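(* It is NP-hard to compute an optimal spiral tree of a point set: the problem whose input is a root $r\in\mathbb{R}^2$, terminals $t_1,\dots,t_n\in\mathbb{R}^2$ and a restricting angle $\alpha<\pi/2$, and whose output is a spiral tree of minimum length for this input, is NP-hard.
   Context: The root $r$ is the origin of polar coordinates. For a point $p$ with polar coordinates $(R,\phi)$ the right spiral $\mathcal{S}^+_p$ is given by $R(t)=Re^{-t}$, $\phi(t)=\phi+\tan(\alpha)\,t$, and the left spiral $\mathcal{S}^-_p$ by the same equations with $\alpha$ replaced by $-\alpha$. A spiral segment is a connected piece of a right or left spiral (possibly including the limit endpoint $r$), directed towards $r$. A spiral tree for root $r$, terminals $t_1,\dots,t_n$ and restricting angle $\alpha$ is a finite tree drawn in the plane, rooted at $r$, whose nodes include $r$ and all terminals and possibly additional (Steiner) nodes, with arcs directed from the terminals towards the root, each arc being a concatenation of (arbitrarily many) spiral segments. Its length is the sum of the lengths of its arcs; an optimal spiral tree is one of minimum length. *)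

theory Defs
  imports "HOL-Analysis.Analysis" "HOL-Computational_Algebra.Polynomial"
begin

section \<open>Deterministic multi-tape Turing machines\<close>

text \<open>
  Tapes are two-way infinite. Symbol 0 is the blank, 1 and 2 are the bits 0 and 1, further
  symbols are at the machine's disposal. The working states are those below \<open>num_states\<close>,
  state 0 is initial, and \<open>num_states\<close> itself is the halting state.
\<close>

datatype move = Move_Left | Stay | Move_Right

record tm =
  num_tapes :: nat
  num_syms :: nat
  num_states :: nat
  delta :: "nat \<Rightarrow> nat list \<Rightarrow> nat \<times> (nat \<times> move) list"

definition wf_tm :: "tm \<Rightarrow> bool" where
  "wf_tm M \<longleftrightarrow> num_tapes M \<ge> 1 \<and> num_syms M \<ge> 3 \<and>
     (\<forall>q < num_states M. \<forall>ss. length ss = num_tapes M \<and> (\<forall>s \<in> set ss. s < num_syms M) \<longrightarrow>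
        fst (delta M q ss) \<le> num_states M \<and>
        length (snd (delta M q ss)) = num_tapes M \<and>
        (\<forall>(s, m) \<in> set (snd (delta M q ss)). s < num_syms M))"

type_synonym tape = "(int \<Rightarrow> nat) \<times> int"
type_synonym config = "nat \<times> tape list"

fun move_offset :: "move \<Rightarrow> int" where
  "move_offset Move_Left = -1"
| "move_offset Stay = 0"
| "move_offset Move_Right = 1"

definition read_tape :: "tape \<Rightarrow> nat" where
  "read_tape tp = fst tp (snd tp)"

definition act_tape :: "nat \<times> move \<Rightarrow> tape \<Rightarrow> tape" where
  "act_tape a tp = ((fst tp)(snd tp := fst a), snd tp + move_offset (snd a))"

definition step :: "tm \<Rightarrow> config \<Rightarrow> config" where
  "step M c =
    (if fst c < num_states M
     then let d = delta M (fst c) (map read_tape (snd c))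
          in (fst d, map2 act_tape (snd d) (snd c))
     else c)"

definition word_contents :: "bool list \<Rightarrow> int \<Rightarrow> nat" where
  "word_contents w i =
    (if 0 \<le> i \<and> i < int (length w) then (if w ! nat i then 2 else 1) else 0)"

definition start_config :: "tm \<Rightarrow> bool list \<Rightarrow> config" where
  "start_config M w =
    (0, (word_contents w, 0) # replicate (num_tapes M - 1) (word_contents [], 0))"

text \<open>The input is given, and the output is expected, on the first tape.\<close>

definition tm_outputs_within :: "tm \<Rightarrow> nat \<Rightarrow> bool list \<Rightarrow> bool list \<Rightarrow> bool" where
  "tm_outputs_within M T x y \<longleftrightarrow>
    (\<exists>t \<le> T. let c = (step M ^^ t) (start_config M x)
             in fst c = num_states M \<and> fst (hd (snd c)) = word_contents y)"


section \<open>Polynomial time, NP and NP-hardness\<close>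

type_synonym language = "bool list set"

definition poly_time :: "(bool list \<Rightarrow> bool list) \<Rightarrow> bool" where
  "poly_time f \<longleftrightarrow>
    (\<exists>M (p :: nat poly). wf_tm M \<and> (\<forall>x. tm_outputs_within M (poly p (length x)) x (f x)))"

definition class_P :: "language set" where
  "class_P = {L. poly_time (\<lambda>x. [x \<in> L])}"

text \<open>An injective pairing: the bits of the first word are doubled, then a mark 01 follows.\<close>

definition pair_words :: "bool list \<Rightarrow> bool list \<Rightarrow> bool list" where
  "pair_words x u = concat (map (\<lambda>b. [b, b]) x) @ [False, True] @ u"

definition class_NP :: "language set" where
  "class_NP = {L. \<exists>V \<in> class_P. \<exists>p :: nat poly. \<forall>x.
     x \<in> L \<longleftrightarrow> (\<exists>u. length u \<le> poly p (length x) \<and> pair_words x u \<in> V)}"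

definition poly_reducible :: "language \<Rightarrow> language \<Rightarrow> bool" where
  "poly_reducible A B \<longleftrightarrow> (\<exists>f. poly_time f \<and> (\<forall>x. x \<in> A \<longleftrightarrow> f x \<in> B))"

definition NP_hard :: "language \<Rightarrow> bool" where
  "NP_hard B \<longleftrightarrow> (\<forall>A \<in> class_NP. poly_reducible A B)"


section \<open>Binary encodings\<close>

text \<open>Binary digits, least significant first.\<close>

fun bits :: "nat \<Rightarrow> bool list" where
  "bits n = (if n = 0 then [] else odd n # bits (n div 2))"

declare bits.simps [simp del]

text \<open>All encodings of data are prefix-free, so that they can be concatenated.\<close>

definition encode_list :: "('a \<Rightarrow> bool list) \<Rightarrow> 'a list \<Rightarrow> bool list" where
  "encode_list e xs = concat (map (\<lambda>x. True # e x) xs) @ [False]"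

definition encode_pair :: "('a \<Rightarrow> bool list) \<Rightarrow> ('b \<Rightarrow> bool list) \<Rightarrow> 'a \<times> 'b \<Rightarrow> bool list" where
  "encode_pair e f z = e (fst z) @ f (snd z)"

definition encode_nat :: "nat \<Rightarrow> bool list" where
  "encode_nat n = encode_list (\<lambda>b. [b]) (bits n)"

definition encode_int :: "int \<Rightarrow> bool list" where
  "encode_int i = (i < 0) # encode_nat (nat \<bar>i\<bar>)"

definition encode_rat :: "rat \<Rightarrow> bool list" where
  "encode_rat q = encode_pair encode_int encode_int (quotient_of q)"


section \<open>Minimisation problems\<close>

text \<open>
  The decision problem of a minimisation problem: given an instance and a rational bound, does
  an optimal solution have cost at most the bound? The minimisation problem is called NP-hard
  if this decision problem is.
\<close>

definition decision_problem ::
  "('i \<Rightarrow> bool list) \<Rightarrow> 'i set \<Rightarrow> ('i \<Rightarrow> 's \<Rightarrow> bool) \<Rightarrow> ('i \<Rightarrow> 's \<Rightarrow> real) \<Rightarrow> language" where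
  "decision_problem enc Inst optimal cost =
    {encode_pair enc encode_rat (I, K) | I K.
       I \<in> Inst \<and> (\<exists>s. optimal I s \<and> cost I s \<le> of_rat K)}"

definition NP_hard_minimisation ::
  "('i \<Rightarrow> bool list) \<Rightarrow> 'i set \<Rightarrow> ('i \<Rightarrow> 's \<Rightarrow> bool) \<Rightarrow> ('i \<Rightarrow> 's \<Rightarrow> real) \<Rightarrow> bool" where
  "NP_hard_minimisation enc Inst feasible cost \<longleftrightarrow>
    NP_hard (decision_problem enc Inst (\<lambda>I. is_arg_min (cost I) (feasible I)) cost)"


section \<open>Spirals and spiral segments\<close>

text \<open>The plane is the type of complex numbers; \<open>rcis R \<phi>\<close> has polar coordinates \<open>(R, \<phi>)\<close>.\<close>

definition right_spiral :: "complex \<Rightarrow> real \<Rightarrow> complex \<Rightarrow> real \<Rightarrow> complex" where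
  "right_spiral r \<alpha> p t = r + rcis (cmod (p - r) * exp (- t)) (Arg (p - r) + tan \<alpha> * t)"

definition left_spiral :: "complex \<Rightarrow> real \<Rightarrow> complex \<Rightarrow> real \<Rightarrow> complex" where
  "left_spiral r \<alpha> = right_spiral r (- \<alpha>)"

datatype side = Right_Side | Left_Side

fun spiral :: "complex \<Rightarrow> real \<Rightarrow> side \<Rightarrow> complex \<Rightarrow> real \<Rightarrow> complex" where
  "spiral r \<alpha> Right_Side = right_spiral r \<alpha>"
| "spiral r \<alpha> Left_Side = left_spiral r \<alpha>"

text \<open>
  \<open>Segment s p (Some T)\<close> follows the spiral of \<open>p\<close> on side \<open>s\<close> for the parameters in \<open>[0, T]\<close>;
  \<open>Segment s p None\<close> follows it all the way into the limit point \<open>r\<close>. Every connected piece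
  of a spiral has this form, since the spiral of a point on a given spiral is a final part of
  the latter.
\<close>

datatype segment = Segment side (seg_start: complex) "real option"

fun valid_segment :: "complex \<Rightarrow> segment \<Rightarrow> bool" where
  "valid_segment r (Segment s p (Some T)) \<longleftrightarrow> p \<noteq> r \<and> T > 0"
| "valid_segment r (Segment s p None) \<longleftrightarrow> p \<noteq> r"

fun seg_end :: "complex \<Rightarrow> real \<Rightarrow> segment \<Rightarrow> complex" where
  "seg_end r \<alpha> (Segment s p (Some T)) = spiral r \<alpha> s p T"
| "seg_end r \<alpha> (Segment s p None) = r"

fun seg_domain :: "segment \<Rightarrow> real set" where
  "seg_domain (Segment s p (Some T)) = {0..T}"
| "seg_domain (Segment s p None) = {0..}"

fun seg_length :: "complex \<Rightarrow> real \<Rightarrow> segment \<Rightarrow> real" where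
  "seg_length r \<alpha> (Segment s p e) =
    integral (seg_domain (Segment s p e)) (\<lambda>t. norm (vector_derivative (spiral r \<alpha> s p) (at t)))"


section \<open>Spiral trees\<close>

fun is_arc :: "complex \<Rightarrow> real \<Rightarrow> complex \<Rightarrow> segment list \<Rightarrow> complex \<Rightarrow> bool" where
  "is_arc r \<alpha> p [] q \<longleftrightarrow> False"
| "is_arc r \<alpha> p [\<sigma>] q \<longleftrightarrow> valid_segment r \<sigma> \<and> seg_start \<sigma> = p \<and> seg_end r \<alpha> \<sigma> = q"
| "is_arc r \<alpha> p (\<sigma> # \<tau> # \<sigma>s) q \<longleftrightarrow>
     valid_segment r \<sigma> \<and> seg_start \<sigma> = p \<and> is_arc r \<alpha> (seg_end r \<alpha> \<sigma>) (\<tau> # \<sigma>s) q"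

definition arc_length :: "complex \<Rightarrow> real \<Rightarrow> segment list \<Rightarrow> real" where
  "arc_length r \<alpha> \<sigma>s = (\<Sum>\<sigma> \<leftarrow> \<sigma>s. seg_length r \<alpha> \<sigma>)"

text \<open>
  Every node other than the root has exactly one outgoing arc, leading to its parent. Arcs are
  allowed to cross or overlap; overlapping parts count with multiplicity.
\<close>

record drawn_tree =
  nodes :: "complex set"
  parent :: "complex \<Rightarrow> complex"
  out_arc :: "complex \<Rightarrow> segment list"

definition spiral_tree :: "complex \<Rightarrow> complex list \<Rightarrow> real \<Rightarrow> drawn_tree \<Rightarrow> bool" where
  "spiral_tree r ts \<alpha> T \<longleftrightarrow>
     finite (nodes T) \<and> r \<in> nodes T \<and> set ts \<subseteq> nodes T \<and>
     (\<forall>v \<in> nodes T - {r}. parent T v \<in> nodes T \<and> is_arc r \<alpha> v (out_arc T v) (parent T v)) \<and>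
     (\<forall>v \<in> nodes T. \<exists>k. (parent T ^^ k) v = r)"

definition tree_length :: "complex \<Rightarrow> real \<Rightarrow> drawn_tree \<Rightarrow> real" where
  "tree_length r \<alpha> T = (\<Sum>v \<in> nodes T - {r}. arc_length r \<alpha> (out_arc T v))"


section \<open>The spiral tree problem\<close>

text \<open>
  Inputs are finitely represented: points have rational Cartesian coordinates, and the restricting
  angle is a rational multiple of \<open>\<pi>\<close>.
\<close>

type_synonym rat_point = "rat \<times> rat"

definition to_plane :: "rat_point \<Rightarrow> complex" where
  "to_plane z = Complex (of_rat (fst z)) (of_rat (snd z))"

record spiral_instance =
  root :: rat_point
  terminals :: "rat_point list"
  angle_coeff :: rat

definition angle :: "spiral_instance \<Rightarrow> real" where
  "angle I = of_rat (angle_coeff I) * pi"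

definition spiral_instances :: "spiral_instance set" where
  "spiral_instances = {I. 0 \<le> angle I \<and> angle I < pi / 2}"

definition encode_point :: "rat_point \<Rightarrow> bool list" where
  "encode_point = encode_pair encode_rat encode_rat"

definition encode_instance :: "spiral_instance \<Rightarrow> bool list" where
  "encode_instance I =
     encode_point (root I) @ encode_list encode_point (terminals I) @ encode_rat (angle_coeff I)"

definition spiral_tree_for :: "spiral_instance \<Rightarrow> drawn_tree \<Rightarrow> bool" where
  "spiral_tree_for I =
     spiral_tree (to_plane (root I)) (map to_plane (terminals I)) (angle I)"

definition spiral_tree_length :: "spiral_instance \<Rightarrow> drawn_tree \<Rightarrow> real" where
  "spiral_tree_length I = tree_length (to_plane (root I)) (angle I)"

end

theory Submission
  imports Defs
begin

text \<open>Around lattice points far from the root, spirals of angle \<open>\<pi> / 4\<close> are nearly parallel to the axes, so that a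
  minimum spiral tree is a minimum rectilinear arborescence up to an error that the bound absorbs. Terminals
  placed on almost all points of a grid leave only few choices to an arborescence: small tiles with ports at their
  right and top sides force an extra point per group of free points, and a port is reached only if the ports on the
  left and below are, in the way of a gate of monotone logic. Grids of such tiles evaluate a formula in
  conjunctive normal form, and the formula describes the accepting computations of a machine, with tape contents
  stored relative to the heads. The reduction is a loop program over registers; its loops run over registers that do
  not change meanwhile, so that its running time is polynomial.\<close>

text \<open>For restricting angle \<pi> / 4 an arc has length sqrt 2 times its loss of radius,
  whatever its shape, so the length of a tree depends only on the positions and parents of its
  nodes. These lengths are irrational in general, but the size of an arborescence is an integer. The
  bound therefore lies halfway between two integers, and the distance of the terminals from the root
  only has to keep the total error below 1 / 2. A distance exponential in the size of the picture is
  affordable since coordinates are written in binary.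

  Optimality enters only by counting: every tile has a least number of extra points, so a set that
  meets the sum of these numbers is tight in each tile and in each group of free cells, and
  tightness makes a tile obey its rule. Apart from choice, the rules are monotone: they say when a
  port may be reached, and signals may get lost. The missing negation comes from forks, which serve
  at most one of two outputs and so guess complementary values. With them signals can cross in the
  plane, and chains of forks and demands carry an implication against the direction of
  growth.\<close>

type_synonym cell = "int \<times> int"

section \<open>Lower bounds for supports by exhaustive search\<close>

definition supported :: "cell set => cell => bool" where
  "supported N c \<longleftrightarrow> (fst c - 1, snd c) \<in> N \<or> (fst c, snd c - 1) \<in> N"

text \<open>A search tree for supports: cells of \<open>D\<close> are in the set and need a support, cells of \<open>Z\<close>
  are not in the set, at most \<open>k\<close> further cells of \<open>G\<close> may be used besides \<open>U\<close>; cells outside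
  of \<open>G\<close> and \<open>Z\<close> are free.\<close>

function refuted :: "cell list => cell list => int => cell list => cell list => bool" where
  "refuted Z G k U [] = (k < 0)"
| "refuted Z G k U ((x, y) # D) =
    (if k < 0 then True else
     let p = (x - 1, y); q = (x, y - 1);
         free = (%p. p \<in> set U \<or> p \<notin> set G & p \<notin> set Z)
     in if free p \<or> free q then refuted Z G k U D
        else (p \<in> set Z \<or> refuted Z G (k - 1) (p # U) (p # D)) &
             (q \<in> set Z \<or> refuted Z G (k - 1) (q # U) (q # D)))"
  by pat_completeness auto
text \<open>A decision lowers the budget; every other step shortens the list of demands.\<close>

termination
  by (relation "inv_image (less_than <*lex*> less_than) (%(Z, G, k, U, D). (nat (k + 1), length D))") auto
declare refuted.simps(2) [simp del]

text \<open>The cells of \<open>U\<close> are distinct members of \<open>N \<inter> set G\<close>,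
  so a negative budget already gives the count. A branch puts a supporting cell into
  \<open>U\<close>: one unit passes from \<open>k\<close> to the length of \<open>U\<close>, and the
  claimed bound does not change.\<close>

lemma refute_sound:
  assumes "refuted Z G k U D"
    and "\<And>c. c \<in> set D ==> supported N c" and "\<And>c. c \<in> N \<inter> set G ==> supported N c"
    and "set Z \<inter> N = {}" and "set U \<subseteq> N \<inter> set G" and "distinct U"
  shows "int (card (N \<inter> set G)) > k + int (length U)"
  using assms
proof (induction Z G k U D rule: refuted.induct)
  case (1 Z G k U)
  have "length U = card (set U)" using 1 by (simp add: distinct_card)
  also have "\<dots> <= card (N \<inter> set G)" using 1 by (intro card_mono) auto
  finally show ?case using 1 by simp
next
  case (2 Z G k U x y D)
  have len: "length U <= card (N \<inter> set G)"
    using 2 by (metis card_mono distinct_card finite_Int List.finite_set)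
  show ?case
  proof (cases "k < 0")
    case True then show ?thesis using len by simp
  next
    case False
    define p where "p = (x - 1, y)"
    define q where "q = (x, y - 1)"
    define free where "free = (%p. p \<in> set U \<or> p \<notin> set G & p \<notin> set Z)"
    have sup: "p \<in> N \<or> q \<in> N" using 2(5)[of "(x,y)"] by (auto simp: supported_def p_def q_def)
    have R: "if free p \<or> free q then refuted Z G k U D
        else (p \<in> set Z \<or> refuted Z G (k - 1) (p # U) (p # D)) &
             (q \<in> set Z \<or> refuted Z G (k - 1) (q # U) (q # D))"
      using 2(4) False by (subst (asm) refuted.simps(2)) (simp only: if_False Let_def p_def q_def free_def)
    show ?thesis
    proof (cases "free p \<or> free q")
      case True
      \<comment> \<open>A free support costs nothing in \<open>G\<close>, so the demand is met
        without a decision.\<close>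
      then show ?thesis using R 2(1)[OF False p_def q_def free_def] 2(5-9) by (simp add: List.member_iff free_def)
    next
      case nf: False
      \<comment> \<open>The same argument for both supports: one unit of the budget is spent on
        \<open>c\<close>, which becomes a demand in turn.\<close>
      have step: "int (card (N \<inter> set G)) > k + int (length U)"
        if c: "c \<in> N" "\<not> free c" and r: "c \<in> set Z \<or> refuted Z G (k - 1) (c # U) (c # D)"
          and IH: "refuted Z G (k - 1) (c # U) (c # D) ==> (\<And>e. e \<in> set (c # D) ==> supported N e) ==> set (c # U) \<subseteq> N \<inter> set G
             ==> distinct (c # U) ==> int (card (N \<inter> set G)) > (k - 1) + int (length (c # U))" for c
      proof -
        have z: "c \<notin> set Z" using c 2(7) by auto
        then have g: "c \<in> set G" "c \<notin> set U" using c by (auto simp: free_def)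
        have "int (card (N \<inter> set G)) > (k - 1) + int (length (c # U))"
          using r z g c 2(5-9) by (intro IH) (auto)
        then show ?thesis by simp
      qed
      have R': "p \<in> set Z \<or> refuted Z G (k - 1) (p # U) (p # D)" "q \<in> set Z \<or> refuted Z G (k - 1) (q # U) (q # D)"
        using R nf by simp_all
      note IHp = 2(2)[OF False p_def q_def free_def nf _ _ 2(6,7)]
      note IHq = 2(3)[OF False p_def q_def free_def nf _ _ 2(6,7)]
      show ?thesis
        using sup
      proof
        assume p: "p \<in> N"
        show ?thesis by (rule step[OF p _ R'(1)]) (use nf IHp in blast)+
      next
        assume q: "q \<in> N"
        show ?thesis by (rule step[OF q _ R'(2)]) (use nf IHq in blast)+
      qed
    qed
  qed
qed

subsection \<open>Tiles\<close>

text \<open>A tile is a picture of \<open>20\<close> rows, bottom row first, of \<open>20\<close> codes: \<open>0\<close> is a terminal, and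
  \<open>g \<ge> 1\<close> is a free cell of group \<open>g\<close>. Column and row \<open>0\<close> belong to the neighbouring tiles, where
  only the cells \<open>left_port\<close> and \<open>bottom_port\<close> need not be terminals.\<close>

fun row_cells :: "int => int => int list => (cell \<times> int) list" where
  "row_cells x y [] = []"
| "row_cells x y (c # cs) = (if c = 0 then row_cells (x + 1) y cs else ((x, y), c) # row_cells (x + 1) y cs)"

fun pic_cells :: "int => int list list => (cell \<times> int) list" where
  "pic_cells y [] = []"
| "pic_cells y (r # rs) = row_cells 1 y r @ pic_cells (y + 1) rs"

definition code_at :: "int list list => cell => int" where
  "code_at P c = P ! nat (snd c - 1) ! nat (fst c - 1)"

definition left_port :: cell where "left_port = (0, 13)"
definition bottom_port :: cell where "bottom_port = (6, 0)"
definition right_port :: cell where "right_port = (20, 13)"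
definition top_port :: cell where "top_port = (6, 20)"

text \<open>Only terminals with two nonterminal neighbours constrain the free cells. The neighbour
  code -1 stands for a port in column or row 0; it belongs to no group of the tile, as groups are
  numbered from 1.\<close>

fun row_demands :: "int => int => int => int list => int list => (cell \<times> int \<times> int) list" where
  "row_demands x y l (b # bs) (c # cs) =
     (if c = 0 & l ~= 0 & b ~= 0 then ((x, y), l, b) # row_demands (x + 1) y c bs cs else row_demands (x + 1) y c bs cs)"
| "row_demands x y l _ _ = []"

fun pic_demands :: "int => int list => int list list => (cell \<times> int \<times> int) list" where
  "pic_demands y p [] = []"
| "pic_demands y p (r # rs) = row_demands 1 y (if y = 13 then -1 else 0) p r @ pic_demands (y + 1) r rs"

definition bottom_row :: "int list" where
  "bottom_row = [0,0,0,0,0,-1,0,0,0,0,0,0,0,0,0,0,0,0,0,0]"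

type_synonym group = "int \<times> cell list \<times> int \<times> cell list"

fun mk_group :: "(cell \<times> int) list => (cell \<times> int \<times> int) list => int \<times> int => group" where
  "mk_group cs ds (g, s) =
    (g, map fst (filter (%(k, c). c = g) cs), s, map fst (filter (%(k, a, b). a = g \<or> b = g) ds))"

fun group_ok :: "group => bool" where
  "group_ok (g, G, s, B) = (g \<ge> 1 & s \<ge> 0 & (s = 0 \<or> refuted [] G (s - 1) [] B))"

fun get_group :: "int => group list => group" where
  "get_group g [] = (0, [], 0, [])"
| "get_group g ((h, d) # gs) = (if g = h then (h, d) else get_group g gs)"

text \<open>Cells of \<open>U\<close> inside the group count as spent and become demands themselves,
  so success means that more than \<open>s\<close> cells of the group are used.\<close>

definition refute_group :: "cell list => cell list => group => bool" where
  "refute_group Z U g = (case g of (_, G, s, B) =>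
     refuted Z G (s - int (length (filter (%c. c \<in> set G) U))) (filter (%c. c \<in> set G) U) (filter (%c. c \<in> set G) U @ B))"

text \<open>A refutation by propagation in a set that is tight in every group: each step decides a
  cell \<open>c\<close>, because the opposite decision would push the group \<open>g\<close> beyond
  its cost. In the end some group admits no tight solution at all.\<close>

fun steps_ok :: "group list => cell list => cell list => (int \<times> cell \<times> bool) list => int => bool" where
  "steps_ok gs Z U [] g = refute_group Z U (get_group g gs)"
| "steps_ok gs Z U ((g, c, b) # st) h =
     (if b then refute_group (c # Z) U (get_group g gs) & c \<notin> set U & steps_ok gs Z (c # U) st h
      else c \<notin> set U & refute_group Z (c # U) (get_group g gs) & steps_ok gs (c # Z) U st h)"

definition in_range :: "cell => bool" where
  "in_range c \<longleftrightarrow> 1 <= fst c & fst c <= 20 & 1 <= snd c & snd c <= 20"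

definition pic_shape :: "int list list => bool" where
  "pic_shape P \<longleftrightarrow> length P = 20 & (\<forall>r \<in> set P. length r = 20)"

definition free_cells :: "int list list => cell set" where
  "free_cells P = {c. in_range c & code_at P c ~= 0}"

definition terminal_cells :: "int list list => cell set" where
  "terminal_cells P = {c. in_range c & code_at P c = 0}"

lemma set_row_cells: "(k, c) \<in> set (row_cells x y r) \<longleftrightarrow> c ~= 0 & snd k = y & x <= fst k & fst k < x + int (length r) & c = r ! nat (fst k - x)"
proof (induction r arbitrary: x)
  case Nil then show ?case by auto
next
  case (Cons a r)
  note IH = Cons[of "x + 1"]
  show ?case
  proof (cases "fst k = x")
    case True
    have "(k, c) \<notin> set (row_cells (x + 1) y r)" using IH True by simp
    then show ?thesis using True by (cases k) auto
  next
    case False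
    show ?thesis
    proof (cases "fst k \<ge> x")
      case True
      then have "nat (fst k - x) = Suc (nat (fst k - (x + 1)))" "x + 1 <= fst k" using False by simp_all
      then show ?thesis using IH True False by (cases k) (simp add: add.assoc)
    next
      case False
      then show ?thesis using IH by (cases k) simp
    qed
  qed
qed

lemma set_pic_cells:
  "(k, c) \<in> set (pic_cells y P) \<longleftrightarrow> c ~= 0 & y <= snd k & snd k < y + int (length P) & 1 <= fst k &
    fst k <= int (length (P ! nat (snd k - y))) & c = P ! nat (snd k - y) ! nat (fst k - 1)"
proof (induction P arbitrary: y)
  case Nil then show ?case by auto
next
  case (Cons a P)
  note IH = Cons[of "y + 1"]
  show ?case
  proof (cases "snd k = y")
    case True
    have "(k, c) \<notin> set (pic_cells (y + 1) P)" using IH True by simp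
    then show ?thesis using True by (auto simp: set_row_cells)
  next
    case False
    have r: "(k, c) \<notin> set (row_cells 1 y a)" using False by (simp add: set_row_cells)
    show ?thesis
    proof (cases "snd k \<ge> y")
      case True
      then have "nat (snd k - y) = Suc (nat (snd k - (y + 1)))" "y + 1 <= snd k" using False by simp_all
      then show ?thesis using IH True r by (simp add: add.assoc)
    next
      case False
      then show ?thesis using IH r by simp
    qed
  qed
qed

lemma pic_cells_iff:
  assumes "pic_shape P"
  shows "(k, c) \<in> set (pic_cells 1 P) \<longleftrightarrow> c ~= 0 & in_range k & c = code_at P k"
proof -
  have "length (P ! nat (snd k - 1)) = 20" if "1 <= snd k" "snd k < 1 + int (length P)"
  proof -
    have "P ! nat (snd k - 1) \<in> set P" using that by (intro nth_mem) auto
    then show ?thesis using assms by (auto simp: pic_shape_def)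
  qed
  then show ?thesis using assms by (auto simp: set_pic_cells in_range_def code_at_def pic_shape_def)
qed

lemma row_demands_sub:
  "(k, d) \<in> set (row_demands x y l p r) ==>
    snd k = y & x <= fst k & fst k < x + int (length r) & r ! nat (fst k - x) = 0"
proof (induction x y l p r rule: row_demands.induct)
  case (1 x y l b bs c cs)
  show ?case
  proof (cases "(k, d) \<in> set (row_demands (x + 1) y c bs cs)")
    case True
    note IH = 1(1,2)
    have h: "snd k = y & x + 1 <= fst k & fst k < x + 1 + int (length cs) & cs ! nat (fst k - (x + 1)) = 0"
      using 1(1)[OF _ True] 1(2)[OF _ True] by blast
    then have "x + 1 <= fst k" by blast
    then have "nat (fst k - x) = Suc (nat (fst k - (x + 1)))" by simp
    then show ?thesis using h by simp
  next
    case False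
    then show ?thesis using 1(3) by (auto split: if_splits)
  qed
qed auto

lemma pic_demands_sub:
  "(k, d) \<in> set (pic_demands y p P) ==> y <= snd k & snd k < y + int (length P) & 1 <= fst k &
    fst k <= int (length (P ! nat (snd k - y))) & P ! nat (snd k - y) ! nat (fst k - 1) = 0"
proof (induction y p P rule: pic_demands.induct)
  case (2 y p r rs)
  show ?case
  proof (cases "(k, d) \<in> set (pic_demands (y + 1) r rs)")
    case True
    note h = 2(1)[OF True]
    then have "y + 1 <= snd k" by blast
    then have "nat (snd k - y) = Suc (nat (snd k - (y + 1)))" by simp
    then show ?thesis using h by simp
  next
    case False
    then have "(k, d) \<in> set (row_demands 1 y (if y = 13 then -1 else 0) p r)" using 2(2) by simp
    from row_demands_sub[OF this] show ?thesis by auto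
  qed
qed auto

lemma pic_demands_iff:
  assumes "pic_shape P" "(k, d) \<in> set (pic_demands 1 p P)"
  shows "in_range k & code_at P k = 0"
proof -
  note h = pic_demands_sub[OF assms(2)]
  then have "P ! nat (snd k - 1) \<in> set P" by (intro nth_mem) auto
  then have "length (P ! nat (snd k - 1)) = 20" using assms by (auto simp: pic_shape_def)
  then show ?thesis using h assms by (auto simp: in_range_def code_at_def pic_shape_def)
qed

section \<open>Soundness of the tile certificates\<close>

definition local_closed :: "cell set => bool" where
  "local_closed M \<longleftrightarrow> (\<forall>c \<in> M. in_range c --> supported M c)"

definition groups_of :: "int list list => (int \<times> int) list => group list" where
  "groups_of P ss = map (mk_group (pic_cells 1 P) (pic_demands 1 bottom_row P)) ss"

lemma group_props:
  assumes "pic_shape P" "(g, G, s, B) \<in> set (groups_of P ss)"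
  shows "set G = {c. in_range c & code_at P c = g & code_at P c ~= 0}" "set B \<subseteq> terminal_cells P" "(g, s) \<in> set ss"
proof -
  obtain g' s' where gs: "(g', s') \<in> set ss" "(g, G, s, B) = mk_group (pic_cells 1 P) (pic_demands 1 bottom_row P) (g', s')"
    using assms(2) by (auto simp: groups_of_def)
  show "(g, s) \<in> set ss" using gs by auto
  have G: "G = map fst (filter (%(k, c). c = g) (pic_cells 1 P))" using gs(2) by simp
  show "set G = {c. in_range c & code_at P c = g & code_at P c ~= 0}"
    unfolding G by (force simp: pic_cells_iff[OF assms(1)])
  have B: "B = map fst (filter (%(k, a, b). a = g \<or> b = g) (pic_demands 1 bottom_row P))" using gs(2) by simp
  show "set B \<subseteq> terminal_cells P"
  proof
    fix k assume "k \<in> set B"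
    then obtain d where "(k, d) \<in> set (pic_demands 1 bottom_row P)" unfolding B by auto
    from pic_demands_iff[OF assms(1) this] show "k \<in> terminal_cells P"
      by (auto simp: terminal_cells_def)
  qed
qed

lemma refute_group_sound:
  assumes P: "pic_shape P" and g: "(g, G, s, B) \<in> set (groups_of P ss)"
    and M: "local_closed M" "terminal_cells P \<subseteq> M"
    and r: "refute_group Z U (g, G, s, B)" and Z: "set Z \<inter> M = {}" and U: "set U \<subseteq> M" "distinct U"
  shows "int (card (M \<inter> set G)) > s"
proof -
  note gp = group_props[OF P g]
  let ?U = "filter (%c. c \<in> set G) U"
  have "int (card (M \<inter> set G)) > (s - int (length ?U)) + int (length ?U)"
  proof (rule refute_sound[where Z = Z and D = "?U @ B"])
    show "refuted Z G (s - int (length ?U)) ?U (?U @ B)" using r by (simp add: refute_group_def)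
    show "supported M c" if "c \<in> set (?U @ B)" for c
    proof -
      have "c \<in> M" "in_range c" using that gp U M by (auto simp: terminal_cells_def)
      then show ?thesis using M by (auto simp: local_closed_def)
    qed
    show "supported M c" if "c \<in> M \<inter> set G" for c
      using that gp M unfolding local_closed_def by auto
  qed (use Z U in auto)
  then show ?thesis by simp
qed

lemma group_lower:
  assumes P: "pic_shape P" and g: "(g, G, s, B) \<in> set (groups_of P ss)"
    and M: "local_closed M" "terminal_cells P \<subseteq> M" and ok: "group_ok (g, G, s, B)"
  shows "int (card (M \<inter> set G)) \<ge> s"
proof (cases "s = 0")
  case False
  note gp = group_props[OF P g]
  have "int (card (M \<inter> set G)) > (s - 1) + int (length ([]::cell list))"
  proof (rule refute_sound[where Z = "[]" and D = B])
    show "refuted [] G (s - 1) [] B" using ok False by simp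
    show "supported M c" if "c \<in> set B" for c
    proof -
      have "c \<in> M" "in_range c" using that gp M by (auto simp: terminal_cells_def)
      then show ?thesis using M by (auto simp: local_closed_def)
    qed
    show "supported M c" if "c \<in> M \<inter> set G" for c
      using that gp M unfolding local_closed_def by auto
  qed auto
  then show ?thesis by simp
qed simp

lemma get_group_in: "get_group g gs \<in> set gs \<or> get_group g gs = (0, [], 0, [])"
  by (induction g gs rule: get_group.induct) auto

text \<open>This is the default of \<open>get_group\<close>: a certificate that names an unknown
  group is rejected.\<close>

lemma refute_group_empty: "\<not> refute_group Z U (0, [], 0, [])"
  by (simp add: refute_group_def)

lemma steps_sound:
  assumes P: "pic_shape P" and M: "local_closed M" "terminal_cells P \<subseteq> M"
    and tight: "\<And>g G s B. (g, G, s, B) \<in> set (groups_of P ss) ==> int (card (M \<inter> set G)) = s"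
    and "steps_ok (groups_of P ss) Z U st h" "set Z \<inter> M = {}" "set U \<subseteq> M" "distinct U"
  shows False
  using assms(5-)
proof (induction st arbitrary: Z U)
  have no: False if "refute_group Z U (get_group g (groups_of P ss))" "set Z \<inter> M = {}" "set U \<subseteq> M" "distinct U" for Z U g
  proof -
    obtain g' G s B where e: "get_group g (groups_of P ss) = (g', G, s, B)" by (cases "get_group g (groups_of P ss)")
    then have i: "(g', G, s, B) \<in> set (groups_of P ss)"
      using get_group_in[of g "groups_of P ss"] that(1) refute_group_empty by auto
    from refute_group_sound[OF P i M that(1)[unfolded e] that(2-4)] tight[OF i] show False by simp
  qed
  {
    case Nil
    then show ?case using no by simp
  next
    case (Cons a st)
    obtain g c b where a: "a = (g, c, b)" by (cases a)
    show ?case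
    proof (cases b)
      case True
      \<comment> \<open>If \<open>c\<close> were absent, the group \<open>g\<close> would exceed its
        cost, against \<open>tight\<close>.\<close>
      have "c \<in> M" using no[of "c # Z" U g] Cons.prems True by (auto simp: a)
      then show ?thesis using Cons.IH[of Z "c # U"] Cons.prems True by (auto simp: a)
    next
      case False
      have "c \<notin> M" using no[of Z "c # U" g] Cons.prems False by (auto simp: a)
      then show ?thesis using Cons.IH[of "c # Z" U] Cons.prems False by (auto simp: a)
    qed
  }
qed

definition groups_ok :: "int list list => (int \<times> int) list => bool" where
  "groups_ok P ss \<longleftrightarrow> distinct (map fst ss) & list_all group_ok (groups_of P ss)"

lemma finite_in_range: "finite {c. in_range c}"
  by (rule finite_subset[of _ "{1..20} \<times> {1..20}"]) (auto simp: in_range_def)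

lemma groups_sum:
  assumes P: "pic_shape P" and d: "distinct (map fst ss)" "\<forall>(g, s) \<in> set ss. g \<ge> 1"
  shows "(\<Sum>(g, s) \<leftarrow> ss. card (M \<inter> {c. in_range c & code_at P c = g & code_at P c ~= 0})) <= card (M \<inter> free_cells P)"
proof -
  have fin: "finite (free_cells P)" by (rule finite_subset[OF _ finite_in_range]) (auto simp: free_cells_def)
  let ?A = "%g. M \<inter> {c. in_range c & code_at P c = g & code_at P c ~= 0}"
  have f2: "finite (?A g)" for g by (rule finite_subset[OF _ finite_in_range]) auto
  have "(\<Sum>(g, s) \<leftarrow> ss. card (?A g)) = (\<Sum>g \<leftarrow> map fst ss. card (?A g))"
    by (induction ss) auto
  also have "\<dots> = (\<Sum>g \<in> set (map fst ss). card (?A g))" using d(1) by (rule sum_list_distinct_conv_sum_set)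
  also have "\<dots> = card (\<Union>g \<in> set (map fst ss). ?A g)"
    by (rule card_UN_disjoint[symmetric]) (use f2 in auto)
  also have "\<dots> <= card (M \<inter> free_cells P)"
    by (rule card_mono) (use fin d(2) in \<open>auto simp: free_cells_def\<close>)
  finally show ?thesis .
qed

text \<open>Groups are disjoint, so their lower bounds add up. If the sum is attained, no single
  group can lie above its bound; this is the tightness that the propagation relies on.\<close>

lemma tile_lower:
  assumes P: "pic_shape P" and ok: "groups_ok P ss" and M: "local_closed M" "terminal_cells P \<subseteq> M"
  shows "(\<Sum>(g, s) \<leftarrow> ss. s) <= int (card (M \<inter> free_cells P))"
    and "int (card (M \<inter> free_cells P)) <= (\<Sum>(g, s) \<leftarrow> ss. s) ==> (g, G, s, B) \<in> set (groups_of P ss) ==>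
      int (card (M \<inter> set G)) = s"
proof -
  let ?A = "%g. M \<inter> {c. in_range c & code_at P c = g & code_at P c ~= 0}"
  have gok: "group_ok x" if "x \<in> set (groups_of P ss)" for x
    using ok that by (auto simp: groups_ok_def list_all_iff)
  have mk: "mk_group (pic_cells 1 P) (pic_demands 1 bottom_row P) gs \<in> set (groups_of P ss)" if "gs \<in> set ss" for gs
    using that by (auto simp: groups_of_def)
  have lo: "s <= int (card (?A g))" "g \<ge> 1" if gs: "(g, s) \<in> set ss" for g s
  proof -
    obtain G B where e: "mk_group (pic_cells 1 P) (pic_demands 1 bottom_row P) (g, s) = (g, G, s, B)" by simp
    note i = mk[OF gs, unfolded e]
    show "s <= int (card (?A g))" using group_lower[OF P i M gok[OF i]] group_props(1)[OF P i] by simp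
    show "g \<ge> 1" using gok[OF i] by simp
  qed
  have le: "(\<Sum>(g, s) \<leftarrow> ss. int (card (?A g))) <= int (card (M \<inter> free_cells P))"
  proof -
    have "(\<Sum>(g, s) \<leftarrow> ss. int (card (?A g))) = int (\<Sum>(g, s) \<leftarrow> ss. card (?A g))" by (induction ss) auto
    then show ?thesis using groups_sum[OF P, of ss M] ok lo(2) by (auto simp: groups_ok_def)
  qed
  show 1: "(\<Sum>(g, s) \<leftarrow> ss. s) <= int (card (M \<inter> free_cells P))"
    by (rule order_trans[OF sum_list_mono le]) (use lo in auto)
  assume eq: "int (card (M \<inter> free_cells P)) <= (\<Sum>(g, s) \<leftarrow> ss. s)" and i: "(g, G, s, B) \<in> set (groups_of P ss)"
  note gp = group_props[OF P i]
  have "int (card (?A g)) = s"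
  proof (rule ccontr)
    assume ne: "int (card (?A g)) ~= s"
    have "(\<Sum>(g, s) \<leftarrow> ss. s) < (\<Sum>(g, s) \<leftarrow> ss. int (card (?A g)))"
    proof -
      obtain xs ys where "ss = xs @ (g, s) # ys" using split_list[OF gp(3)] by blast
      moreover have "(\<Sum>(g, s) \<leftarrow> xs. s) <= (\<Sum>(g, s) \<leftarrow> xs. int (card (?A g)))"
        using lo calculation by (intro sum_list_mono) auto
      moreover have "(\<Sum>(g, s) \<leftarrow> ys. s) <= (\<Sum>(g, s) \<leftarrow> ys. int (card (?A g)))"
        using lo calculation by (intro sum_list_mono) auto
      ultimately show ?thesis using lo(1)[OF gp(3)] ne by auto
    qed
    then show False using le eq by simp
  qed
  then show "int (card (M \<inter> set G)) = s" using gp(1) by simp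
qed

section \<open>Witnesses for the upper bounds\<close>

text \<open>A witness lists the columns of the free cells that are used, row by row.\<close>

fun open_row :: "int => int list => int list => bool list" where
  "open_row x ws [] = []"
| "open_row x [] (c # cs) = (c = 0) # open_row (x + 1) [] cs"
| "open_row x (w # ws) (c # cs) =
    (if c = 0 then True # open_row (x + 1) (w # ws) cs
     else if w = x then True # open_row (x + 1) ws cs else False # open_row (x + 1) (w # ws) cs)"

fun row_closed :: "bool => bool list => bool list => bool" where
  "row_closed l (b # bs) (c # cs) = ((c --> l \<or> b) & row_closed c bs cs)"
| "row_closed l _ _ = True"

text \<open>Only row 13 asks whether the left port is there; the other cells of column 0 are
  terminals of the neighbouring tile or of the frame.\<close>

fun pic_closed :: "bool => int => bool list => bool list list => bool" where
  "pic_closed l y p [] = True"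
| "pic_closed l y p (r # rs) = (row_closed (y = 13 --> l) p r & pic_closed l (y + 1) r rs)"

lemma length_open_row [simp]: "length (open_row x ws r) = length r"
  by (induction x ws r rule: open_row.induct) auto

lemma open_row_terminal: "i < length r ==> r ! i = 0 ==> open_row x ws r ! i"
  by (induction x ws r arbitrary: i rule: open_row.induct) (auto simp: nth_Cons split: nat.splits)

lemma card_index_Cons: "card {i. i < Suc n & R i} = (if R 0 then 1 else 0) + card {i. i < n & R (Suc i)}"
proof -
  have "{i. i < Suc n & R i} = (if R 0 then {0} else {}) \<union> Suc ` {i. i < n & R (Suc i)}"
    by (auto simp: image_iff less_Suc_eq_0_disj)
  moreover have "card (Suc ` {i. i < n & R (Suc i)}) = card {i. i < n & R (Suc i)}"
    by (rule card_image) simp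
  ultimately show ?thesis by auto
qed

lemma card_open_row: "card {i. i < length r & r ! i ~= 0 & open_row x ws r ! i} <= length ws"
proof (induction x ws r rule: open_row.induct)
  case (2 x c cs)
  then show ?case using card_index_Cons[of "length cs" "%i. (c # cs) ! i ~= 0 & open_row x [] (c # cs) ! i"] by simp
next
  case (3 x w ws c cs)
  then show ?case using card_index_Cons[of "length cs" "%i. (c # cs) ! i ~= 0 & open_row x (w # ws) (c # cs) ! i"]
    by (auto split: if_splits)
qed simp

lemma row_closed_nth:
  "row_closed l p r ==> length p = length r ==> i < length r ==> r ! i ==>
    (if i = 0 then l else r ! (i - 1)) \<or> p ! i"
proof (induction l p r arbitrary: i rule: row_closed.induct)
  case (1 l b bs c cs)
  show ?case
  proof (cases i)
    case 0 then show ?thesis using 1 by auto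
  next
    case (Suc j)
    then show ?thesis using 1(1)[of j] 1(2-) by (cases j) auto
  qed
qed auto

lemma pic_closed_nth:
  "pic_closed l y p P ==> length p = 20 ==> \<forall>r \<in> set P. length r = 20 ==> j < length P ==> i < 20 ==> P ! j ! i ==>
    (if i = 0 then (y + int j = 13 --> l) else P ! j ! (i - 1)) \<or> (if j = 0 then p ! i else P ! (j - 1) ! i)"
proof (induction l y p P arbitrary: j rule: pic_closed.induct)
  case (2 l y p r rs)
  show ?case
  proof (cases j)
    case 0 then show ?thesis using 2 row_closed_nth[of "y = 13 --> l" p r i] by auto
  next
    case (Suc k)
    then show ?thesis using 2(1)[of k] 2(2-) by (cases k) (auto simp: algebra_simps)
  qed
qed auto

text \<open>Rows and columns are numbered from 1, lists from 0: the last entry of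
  \<open>Q ! 12\<close> is the right port, and \<open>last Q ! 5\<close> is the top port.\<close>

fun witness_rows_ok :: "int => (bool \<times> bool \<times> bool \<times> bool) => bool list list => bool" where
  "witness_rows_ok S (l, d, r, t) Q =
     (pic_closed l 1 (map (%c. c = 0 \<or> d) bottom_row) Q &
      (r --> last (Q ! 12)) & (t --> last Q ! 5))"

definition witness_ok :: "int list list => int => (bool \<times> bool \<times> bool \<times> bool) \<times> int list list => bool" where
  "witness_ok P S = (%(q, ws). witness_rows_ok S q (map2 (open_row 1) ws P) &
     length ws = 20 & (\<Sum>w \<leftarrow> ws. int (length w)) <= S)"

text \<open>An absent input is put into \<open>Z\<close> and a reached output into \<open>U\<close>.
  The value \<open>True\<close> for an input and \<open>False\<close> for an output assume
  nothing.\<close>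

definition refutation_ok ::
  "int list list => (int \<times> int) list => (bool \<times> bool \<times> bool \<times> bool) \<times> (int \<times> cell \<times> bool) list \<times> int => bool" where
  "refutation_ok P ss = (%((l, d, r, t), st, h).
     steps_ok (groups_of P ss)
       ((if l then [] else [left_port]) @ (if d then [] else [bottom_port]))
       ((if r then [right_port] else []) @ (if t then [top_port] else [])) st h)"

text \<open>On the right and top sides exactly the ports are free cells, so the next tile can rely
  on all other cells of its column and row 0.\<close>

definition pic_ok :: "int list list => bool" where
  "pic_ok P \<longleftrightarrow> pic_shape P &
     map (%r. last r = 0) P = replicate 12 True @ False # replicate 7 True &
     map (%c. c = 0) (last P) = replicate 5 True @ False # replicate 14 True"

lemma tile_upper:
  assumes P: "pic_shape P" and w: "witness_ok P S ((l, d, r, t), ws)"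
  obtains W where "W \<subseteq> free_cells P" "int (card W) <= S" "r --> right_port \<in> W \<union> terminal_cells P" "t --> top_port \<in> W \<union> terminal_cells P"
    "\<And>c. c \<in> W \<union> terminal_cells P ==>
      fst c = 1 & (snd c = 13 --> l) \<or> snd c = 1 & (fst c = 6 --> d) \<or>
      fst c > 1 & (fst c - 1, snd c) \<in> W \<union> terminal_cells P \<or> snd c > 1 & (fst c, snd c - 1) \<in> W \<union> terminal_cells P"
proof
  define Q where "Q = map2 (open_row 1) ws P"
  have lws: "length ws = 20" and lP: "length P = 20" using w P by (auto simp: witness_ok_def pic_shape_def)
  have rP: "length (P ! j) = 20" if "j < 20" for j using P that by (auto simp: pic_shape_def)
  have Q: "length Q = 20" "Q ! j = open_row 1 (ws ! j) (P ! j)" "length (Q ! j) = 20" if "j < 20" for j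
    using that lws lP rP by (auto simp: Q_def)
  have lQ: "length Q = 20" using lws lP by (simp add: Q_def)
  let ?o = "%c. Q ! nat (snd c - 1) ! nat (fst c - 1)"
  let ?W = "{c. in_range c & code_at P c ~= 0 & ?o c}"
  have trm: "?o c" if "in_range c" "code_at P c = 0" for c
  proof -
    have "nat (snd c - 1) < 20" "nat (fst c - 1) < 20" using that by (auto simp: in_range_def)
    then show ?thesis using that Q rP open_row_terminal by (auto simp: code_at_def)
  qed
  then have U: "?W \<union> terminal_cells P = {c. in_range c & ?o c}"
    by (auto simp: terminal_cells_def)
  show "?W \<subseteq> free_cells P" by (auto simp: free_cells_def)
  have ok: "witness_rows_ok S (l, d, r, t) Q" "(\<Sum>w \<leftarrow> ws. int (length w)) <= S"
    using w by (auto simp: witness_ok_def Q_def)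
  let ?R = "%j. {i. i < length (P ! j) & P ! j ! i ~= 0 & open_row 1 (ws ! j) (P ! j) ! i}"
  \<comment> \<open>Count by rows: a row opens at most as many free cells as its witness has
    entries.\<close>
  have "?W \<subseteq> (\<Union>j < 20. (%i. (int i + 1, int j + 1)) ` ?R j)"
  proof
    fix c assume c: "c \<in> ?W"
    define i where "i = nat (fst c - 1)"
    define j where "j = nat (snd c - 1)"
    have ij: "c = (int i + 1, int j + 1)" "i < 20" "j < 20" using c by (auto simp: in_range_def i_def j_def prod_eq_iff)
    then have "i \<in> ?R j" using c Q rP by (simp add: code_at_def)
    then show "c \<in> (\<Union>j < 20. (%i. (int i + 1, int j + 1)) ` ?R j)" using ij by blast
  qed
  then have "card ?W <= card (\<Union>j < 20. (%i. (int i + 1, int j + 1)) ` ?R j)"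
    by (intro card_mono) auto
  also have "\<dots> <= (\<Sum>j < 20. card ((%i. (int i + 1, int j + 1)) ` ?R j))" by (rule card_UN_le) simp
  also have "\<dots> <= (\<Sum>j < 20. length (ws ! j))"
    by (intro sum_mono order_trans[OF card_image_le card_open_row]) simp
  also have "\<dots> = (\<Sum>w \<leftarrow> ws. length w)"
    by (simp add: sum_list_sum_nth lws atLeast0LessThan)
  finally have "int (card ?W) <= int (\<Sum>w \<leftarrow> ws. length w)" by simp
  also have "\<dots> = (\<Sum>w \<leftarrow> ws. int (length w))" by (induction ws) auto
  finally show "int (card ?W) <= S" using ok by simp
  have pr: "in_range right_port" "in_range top_port" by (auto simp: in_range_def right_port_def top_port_def)
  have "last (Q ! 12) = Q ! 12 ! 19" "last Q = Q ! 19"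
    using Q(3)[of 12] lQ by (auto simp: last_conv_nth simp flip: length_0_conv)
  then show "r --> right_port \<in> ?W \<union> terminal_cells P" "t --> top_port \<in> ?W \<union> terminal_cells P"
    unfolding U using ok pr by (auto simp: right_port_def top_port_def)
  fix c assume "c \<in> ?W \<union> terminal_cells P"
  then have c: "in_range c" "?o c" using U by auto
  obtain x y where xy: "c = (x, y)" by (cases c)
  define i where "i = nat (x - 1)"
  define j where "j = nat (y - 1)"
  have ij: "x = int i + 1" "y = int j + 1" "i < 20" "j < 20" using c by (auto simp: in_range_def xy i_def j_def)
  have b: "pic_closed l 1 (map (%c. c = 0 \<or> d) bottom_row) Q" using ok by simp
  let ?V = "?W \<union> terminal_cells P"
  have rQ: "\<forall>r \<in> set Q. length r = 20" using Q lQ by (metis in_set_conv_nth)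
  have "(if i = 0 then (1 + int j = 13 --> l) else Q ! j ! (i - 1)) \<or>
        (if j = 0 then (map (%c. c = 0 \<or> d) bottom_row) ! i else Q ! (j - 1) ! i)"
    by (rule pic_closed_nth[OF b]) (use lQ rQ ij c in \<open>auto simp: bottom_row_def xy\<close>)
  moreover have "x = 1 & (y = 13 --> l) \<or> x > 1 & (x - 1, y) \<in> ?V"
    if h: "if i = 0 then (1 + int j = 13 --> l) else Q ! j ! (i - 1)"
  proof (cases "i = 0")
    case True then show ?thesis using h ij by simp
  next
    case False
    have "nat (x - 1 - 1) = i - 1" using ij by simp
    then show ?thesis unfolding U using h False ij by (simp add: in_range_def)
  qed
  moreover have "y = 1 & (x = 6 --> d) \<or> y > 1 & (x, y - 1) \<in> ?V"
    if h: "if j = 0 then (map (%c. c = 0 \<or> d) bottom_row) ! i else Q ! (j - 1) ! i"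
  proof (cases "j = 0")
    case True
    have "d" if "i = 5" using that h True by (simp add: bottom_row_def)
    then show ?thesis using ij True by auto
  next
    case False
    have "nat (y - 1 - 1) = j - 1" using ij by simp
    then show ?thesis unfolding U using h False ij by (simp add: in_range_def)
  qed
  ultimately show "fst c = 1 & (snd c = 13 --> l) \<or> snd c = 1 & (fst c = 6 --> d) \<or>
      fst c > 1 & (fst c - 1, snd c) \<in> ?V \<or> snd c > 1 & (fst c, snd c - 1) \<in> ?V"
    unfolding xy fst_conv snd_conv by blast
qed

lemma tile_refutation:
  assumes P: "pic_shape P" and ok: "groups_ok P ss" and M: "local_closed M" "terminal_cells P \<subseteq> M"
    and tight: "int (card (M \<inter> free_cells P)) <= (\<Sum>(g, s) \<leftarrow> ss. s)"
    and st: "refutation_ok P ss ((l, d, r, t), st, h)"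
    and io: "left_port \<in> M --> l" "bottom_port \<in> M --> d" "r --> right_port \<in> M" "t --> top_port \<in> M"
  shows False
proof (rule steps_sound[OF P M])
  show "steps_ok (groups_of P ss) ((if l then [] else [left_port]) @ (if d then [] else [bottom_port]))
       ((if r then [right_port] else []) @ (if t then [top_port] else [])) st h"
    using st by (simp add: refutation_ok_def)
  show "int (card (M \<inter> set G)) = s" if "(g, G, s, B) \<in> set (groups_of P ss)" for g G s B
    using tile_lower(2)[OF P ok M tight that] .
  show "set ((if l then [] else [left_port]) @ (if d then [] else [bottom_port])) \<inter> M = {}"
    using io by (cases l; cases d) simp_all
  show "set ((if r then [right_port] else []) @ (if t then [top_port] else [])) \<subseteq> M"
    using io by (cases r; cases t) simp_all
  show "distinct ((if r then [right_port] else []) @ (if t then [top_port] else []))"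
    by (simp add: right_port_def top_port_def)
qed

section \<open>The ten tiles and their rules\<close>

datatype tile = Block | Fork | Bend | Split_Left | Split_Bottom | Or_Right | Or_Top | And_Right | And_Top | Need

text \<open>The codes cut the free cells into groups small enough for exhaustive search. A terminal
  with its two possible supports in different groups passes a decision from one group to the
  other.\<close>

fun pic :: "tile => int list list" where
  "pic Block = [
  [0,0,0,0,0,0,0,0,0,0,0,0,0,0,0,0,0,0,0,0],
  [0,0,0,0,0,0,0,0,0,0,0,0,0,0,0,0,0,0,0,0],
  [0,0,0,0,0,0,0,0,0,0,0,0,0,0,0,0,0,0,0,0],
  [0,0,0,0,0,0,0,0,0,0,0,0,0,0,0,0,0,0,0,0],
  [0,0,0,0,0,0,0,0,0,0,0,0,0,0,0,0,0,0,0,0],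
  [0,0,0,0,0,0,0,0,0,0,0,0,0,0,0,0,0,0,0,0],
  [0,0,0,0,0,0,0,0,0,0,0,0,0,0,0,0,0,0,0,0],
  [0,0,0,0,0,0,0,0,0,0,0,0,0,0,0,0,0,0,0,0],
  [0,0,0,0,0,0,0,0,0,0,0,0,0,0,0,0,0,0,0,0],
  [0,0,0,0,0,0,0,0,0,0,0,0,0,0,0,0,0,0,0,0],
  [0,0,0,0,0,0,0,0,0,0,0,0,0,0,0,0,0,0,0,0],
  [0,0,0,0,0,0,0,0,0,0,0,0,0,0,0,0,0,0,0,0],
  [0,0,0,0,0,0,0,0,0,0,0,0,0,0,0,0,0,0,0,1],
  [0,0,0,0,0,0,0,0,0,0,0,0,0,0,0,0,0,0,0,0],
  [0,0,0,0,0,0,0,0,0,0,0,0,0,0,0,0,0,0,0,0],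
  [0,0,0,0,0,0,0,0,0,0,0,0,0,0,0,0,0,0,0,0],
  [0,0,0,0,0,0,0,0,0,0,0,0,0,0,0,0,0,0,0,0],
  [0,0,0,0,0,0,0,0,0,0,0,0,0,0,0,0,0,0,0,0],
  [0,0,0,0,0,0,0,0,0,0,0,0,0,0,0,0,0,0,0,0],
  [0,0,0,0,0,2,0,0,0,0,0,0,0,0,0,0,0,0,0,0]]"
| "pic Fork = [
  [0,0,0,0,0,0,0,0,0,0,0,0,0,0,0,0,0,0,0,0],
  [0,0,0,0,0,0,0,0,0,0,0,0,0,0,0,0,0,0,0,0],
  [0,0,0,0,0,0,0,0,0,0,0,0,0,0,0,0,0,0,0,0],
  [0,0,0,0,0,0,0,0,0,0,0,0,0,0,0,0,0,0,0,0],
  [0,0,0,0,0,0,0,0,0,0,0,0,0,0,0,0,0,0,0,0],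
  [0,0,0,0,0,0,0,0,0,0,0,0,0,0,0,0,0,0,0,0],
  [0,0,0,0,0,0,0,0,0,0,0,0,0,0,0,0,0,0,0,0],
  [0,0,0,0,0,0,0,0,0,0,0,0,0,0,0,0,0,0,0,0],
  [0,0,0,0,0,0,0,0,0,0,0,0,0,0,0,0,0,3,3,0],
  [0,0,0,0,0,0,0,0,0,0,0,0,0,0,0,0,3,3,3,0],
  [0,0,0,0,0,0,0,0,0,0,0,0,0,0,0,3,3,3,0,0],
  [0,0,0,0,0,0,0,0,0,0,0,0,0,0,2,0,3,0,0,0],
  [0,0,0,0,0,0,0,0,0,0,0,0,2,2,0,4,4,0,0,6],
  [0,0,0,0,0,0,0,0,1,0,0,2,2,0,4,4,0,6,6,0],
  [0,0,0,0,0,1,0,0,0,0,2,2,0,0,4,0,6,6,0,0],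
  [0,0,0,0,0,0,0,0,1,1,0,0,0,5,0,6,6,0,0,0],
  [0,0,0,0,0,0,0,0,1,0,0,0,5,5,5,0,0,0,0,0],
  [0,0,0,0,0,0,0,7,7,0,0,5,5,5,0,0,0,0,0,0],
  [0,0,0,0,0,0,7,7,0,0,0,5,5,0,0,0,0,0,0,0],
  [0,0,0,0,0,7,0,0,0,0,0,0,0,0,0,0,0,0,0,0]]"
| "pic Bend = [
  [0,0,0,0,8,0,10,10,0,0,0,0,0,15,15,0,0,0,0,0],
  [0,0,0,8,0,10,10,10,0,0,0,0,15,15,15,0,0,0,0,0],
  [0,0,9,0,10,10,10,0,0,14,0,15,15,15,0,17,17,0,0,0],
  [0,9,9,9,0,10,0,0,14,14,14,0,15,0,17,17,17,0,0,0],
  [9,9,9,0,11,0,0,14,14,14,0,16,0,17,17,17,0,19,19,0],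
  [9,9,0,11,0,13,13,14,14,0,16,16,16,0,17,0,19,19,19,0],
  [0,0,12,0,13,13,0,0,0,16,16,16,0,18,0,19,19,19,0,0],
  [0,12,12,12,13,0,2,2,0,16,16,0,18,18,18,0,19,0,0,0],
  [12,12,12,0,0,2,2,2,0,0,0,18,18,18,0,20,20,0,0,0],
  [12,12,0,0,2,2,2,0,0,0,0,18,18,0,20,20,0,0,0,0],
  [0,1,1,1,0,2,0,0,0,0,0,0,0,0,20,0,0,0,0,0],
  [1,1,1,0,3,3,3,0,0,0,6,6,0,21,21,21,0,0,0,0],
  [1,1,0,3,3,3,0,0,0,6,6,6,21,21,21,0,0,0,24,24],
  [1,0,0,3,3,0,5,0,6,6,6,0,21,21,0,0,0,24,24,0],
  [0,0,0,3,0,5,5,5,0,6,0,0,21,0,23,23,23,24,0,0],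
  [0,0,4,0,5,5,5,0,7,0,0,22,0,23,23,23,0,0,0,0],
  [0,4,4,4,5,5,0,7,0,0,22,22,22,23,23,0,0,0,0,0],
  [4,4,4,0,0,0,7,7,0,22,22,22,0,23,0,0,0,0,0,0],
  [4,4,0,0,0,7,7,0,0,22,22,0,0,0,0,0,0,0,0,0],
  [0,0,0,0,0,7,0,0,0,0,0,0,0,0,0,0,0,0,0,0]]"
| "pic Split_Left = [
  [0,0,0,0,0,0,0,0,0,0,0,0,0,0,0,0,0,0,0,0],
  [0,0,0,0,0,0,0,0,0,0,0,0,0,0,0,0,0,0,0,0],
  [0,0,0,0,0,0,0,0,0,0,0,0,0,0,0,0,0,0,0,0],
  [0,0,0,0,0,0,0,0,0,0,0,0,0,0,0,0,0,0,0,0],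
  [0,0,0,0,0,0,0,0,0,0,0,0,0,0,0,0,0,0,0,0],
  [0,0,0,0,0,0,0,0,0,0,4,4,0,0,0,0,0,0,0,0],
  [0,0,0,0,0,0,0,0,0,4,4,4,0,0,0,0,0,0,0,0],
  [0,0,0,0,0,0,0,0,4,4,4,0,0,0,0,0,0,0,0,0],
  [0,0,0,0,0,3,3,3,0,4,0,0,0,0,8,8,0,0,0,0],
  [0,0,2,0,3,3,3,0,5,5,0,0,0,8,8,8,0,0,0,0],
  [0,2,2,2,3,3,0,5,5,0,0,0,8,8,8,0,0,0,0,0],
  [2,2,2,0,3,0,0,5,0,0,0,1,0,8,0,0,0,0,12,0],
  [2,2,0,0,0,0,6,0,1,1,1,0,9,9,0,0,0,12,12,12],
  [0,0,0,0,0,6,0,1,1,1,0,9,9,0,11,0,12,12,12,0],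
  [0,0,0,0,7,0,1,1,1,0,0,9,0,11,11,11,12,12,0,0],
  [0,0,0,7,7,7,0,1,0,0,10,0,11,11,11,0,0,0,0,0],
  [0,0,7,7,7,0,13,13,0,10,10,10,11,11,0,0,0,0,0,0],
  [0,0,7,7,0,13,13,13,10,10,10,0,0,0,0,0,0,0,0,0],
  [0,0,0,0,13,13,13,0,10,10,0,0,0,0,0,0,0,0,0,0],
  [0,0,0,0,0,13,0,0,0,0,0,0,0,0,0,0,0,0,0,0]]"
| "pic Split_Bottom = [
  [0,0,0,0,3,3,0,0,0,0,0,0,0,0,0,0,0,0,0,0],
  [0,0,0,3,3,3,0,0,0,0,0,0,0,0,0,0,0,0,0,0],
  [0,0,3,3,3,0,5,5,0,0,0,0,0,0,0,0,0,0,0,0],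
  [0,0,0,3,0,5,5,5,0,0,0,0,0,0,0,0,0,0,0,0],
  [0,0,4,0,5,5,5,0,0,0,0,0,0,0,0,0,0,0,0,0],
  [0,4,4,4,0,5,0,0,0,0,0,0,0,0,0,0,0,0,0,0],
  [4,4,4,0,6,6,0,0,0,0,0,0,0,11,11,0,0,0,0,0],
  [4,4,0,6,6,6,0,0,0,0,0,0,11,11,11,0,0,0,0,0],
  [0,0,6,6,6,0,8,8,0,0,0,11,11,11,0,12,12,0,0,0],
  [0,0,0,6,0,8,8,8,0,10,10,0,11,0,12,12,12,0,0,0],
  [0,0,7,0,8,8,8,0,10,10,0,1,0,12,12,12,0,0,0,0],
  [0,7,7,7,0,8,0,10,10,0,1,1,1,0,12,0,0,0,0,0],
  [7,7,7,0,9,0,10,0,0,1,1,1,0,13,13,0,0,16,16,16],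
  [7,7,0,9,9,9,0,0,0,1,1,0,13,13,0,0,16,16,16,0],
  [0,0,9,9,9,0,0,0,1,0,0,0,13,0,15,15,16,16,0,0],
  [0,0,9,9,0,0,0,1,0,0,0,14,0,15,15,0,16,0,0,0],
  [0,0,0,0,0,0,2,2,0,0,14,14,14,15,0,0,0,0,0,0],
  [0,0,0,0,0,2,2,2,0,14,14,14,0,0,0,0,0,0,0,0],
  [0,0,0,0,2,2,2,0,0,14,14,0,0,0,0,0,0,0,0,0],
  [0,0,0,0,0,2,0,0,0,0,0,0,0,0,0,0,0,0,0,0]]"
| "pic Or_Right = [
  [0,0,0,0,12,12,0,0,15,15,0,0,0,0,0,0,0,0,0,0],
  [0,0,0,12,12,12,0,15,15,15,0,0,0,0,0,0,0,0,0,0],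
  [0,0,12,12,12,0,15,15,15,0,0,0,0,0,3,3,0,0,0,0],
  [0,0,0,12,0,14,0,15,0,0,0,0,0,3,3,3,0,0,0,0],
  [0,0,13,0,14,0,16,16,0,0,0,0,3,3,3,0,0,0,0,0],
  [0,13,13,13,0,16,16,0,0,2,2,2,0,3,0,0,0,0,0,0],
  [13,13,13,0,0,16,0,0,2,2,2,0,4,4,0,0,0,0,0,0],
  [13,13,0,0,1,1,1,1,2,2,0,4,4,0,0,0,0,0,0,0],
  [0,0,0,1,1,1,1,0,2,0,0,4,0,0,0,0,0,0,0,0],
  [0,0,11,1,1,1,0,0,0,0,5,5,5,0,0,0,8,8,0,0],
  [0,11,0,1,1,0,0,0,0,5,5,5,0,0,0,8,8,8,0,0],
  [11,11,0,0,0,0,0,0,0,5,5,0,7,0,8,8,8,0,0,0],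
  [11,0,0,0,0,0,0,0,0,5,0,7,7,7,0,8,0,10,10,10],
  [0,0,0,0,0,0,0,0,6,0,7,7,7,0,9,0,10,10,10,0],
  [0,0,0,0,0,0,0,6,6,6,7,7,0,9,9,9,10,10,0,0],
  [0,0,0,0,0,0,6,6,6,0,0,0,9,9,9,0,10,0,0,0],
  [0,0,0,0,0,0,6,6,0,0,0,0,9,9,0,0,0,0,0,0],
  [0,0,0,0,0,0,0,0,0,0,0,0,0,0,0,0,0,0,0,0],
  [0,0,0,0,0,0,0,0,0,0,0,0,0,0,0,0,0,0,0,0],
  [0,0,0,0,0,17,0,0,0,0,0,0,0,0,0,0,0,0,0,0]]"
| "pic Or_Top = [
  [0,0,0,0,7,7,0,0,10,10,0,0,0,0,0,0,0,0,0,0],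
  [0,0,0,7,7,7,0,10,10,10,0,0,0,0,0,0,0,0,0,0],
  [0,0,7,7,7,0,10,10,10,0,0,0,0,0,0,0,0,0,0,0],
  [0,0,0,7,0,9,0,10,0,0,0,0,0,0,0,0,0,0,0,0],
  [0,0,8,0,9,0,11,11,11,0,0,0,0,0,0,0,0,0,0,0],
  [0,8,8,8,0,11,11,11,0,0,0,0,0,0,0,0,0,0,0,0],
  [8,8,8,0,0,11,11,0,0,0,0,0,0,0,0,0,0,0,0,0],
  [8,8,0,0,0,11,0,0,0,0,0,0,0,0,0,0,0,0,0,0],
  [0,0,0,0,1,1,1,0,0,0,0,0,0,0,0,0,0,0,0,0],
  [0,0,0,1,1,1,1,0,0,0,0,0,0,0,0,0,0,0,0,0],
  [0,12,12,1,1,1,0,0,0,0,0,0,0,0,0,0,0,0,0,0],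
  [12,12,0,1,1,0,3,3,0,0,0,0,0,0,0,0,0,0,0,0],
  [12,0,0,1,0,3,3,3,0,0,0,0,0,0,0,0,0,0,0,13],
  [0,0,2,0,3,3,3,0,5,5,0,0,0,0,0,0,0,0,0,0],
  [0,2,2,2,0,3,0,5,5,5,0,0,0,0,0,0,0,0,0,0],
  [2,2,2,0,4,0,5,5,5,0,0,0,0,0,0,0,0,0,0,0],
  [2,2,0,4,4,4,0,5,0,0,0,0,0,0,0,0,0,0,0,0],
  [0,0,4,4,4,0,6,6,0,0,0,0,0,0,0,0,0,0,0,0],
  [0,0,4,4,0,6,6,0,0,0,0,0,0,0,0,0,0,0,0,0],
  [0,0,0,0,0,6,0,0,0,0,0,0,0,0,0,0,0,0,0,0]]"
| "pic And_Right = [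
  [0,0,0,0,2,2,2,0,5,5,0,0,0,0,0,0,0,0,0,0],
  [0,0,0,2,2,2,0,5,5,5,0,0,0,0,0,0,0,0,0,0],
  [0,0,0,2,2,0,5,5,5,0,0,0,0,0,0,0,0,0,0,0],
  [0,0,0,2,0,4,0,5,0,0,0,0,0,0,0,0,0,0,0,0],
  [0,0,3,0,4,0,6,6,0,0,0,0,0,0,0,0,0,0,0,0],
  [0,3,3,3,0,6,6,0,7,7,0,0,0,0,0,0,0,0,0,0],
  [3,3,3,0,6,0,0,7,7,7,0,0,0,0,0,0,0,0,0,0],
  [3,3,0,1,0,0,7,7,7,0,9,9,0,0,0,0,0,0,0,0],
  [0,0,1,0,1,1,0,7,0,9,9,9,0,0,0,0,0,0,0,0],
  [0,1,1,1,1,0,8,0,9,9,9,0,0,0,0,0,0,0,0,0],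
  [1,1,1,1,0,8,8,8,0,9,0,0,0,0,0,0,0,0,0,0],
  [1,1,0,0,8,8,8,0,10,10,0,0,0,0,13,13,0,0,0,0],
  [0,0,0,0,8,8,0,10,10,10,0,0,0,13,13,13,0,0,0,16],
  [0,0,0,0,0,0,10,10,10,0,12,0,13,13,13,0,0,0,16,0],
  [0,0,0,0,0,0,0,10,0,12,12,12,0,13,0,15,15,15,0,0],
  [0,0,0,0,0,0,11,0,12,12,12,0,14,0,15,15,15,0,0,0],
  [0,0,0,0,0,11,11,11,12,12,0,14,14,14,15,15,0,0,0,0],
  [0,0,0,0,11,11,11,0,0,0,14,14,14,0,15,0,0,0,0,0],
  [0,0,0,0,11,11,0,0,0,0,14,14,0,0,0,0,0,0,0,0],
  [0,0,0,0,0,17,0,0,0,0,0,0,0,0,0,0,0,0,0,0]]"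
| "pic And_Top = [
  [0,0,0,0,7,7,7,0,0,0,10,10,0,0,0,0,0,0,0,0],
  [0,0,0,7,7,7,0,0,0,10,10,10,0,0,0,0,0,0,0,0],
  [0,0,0,7,7,0,9,0,10,10,10,0,0,0,0,0,0,0,0,0],
  [0,0,0,7,0,9,9,9,0,10,0,0,0,0,0,0,0,0,0,0],
  [0,0,8,0,9,9,9,0,11,0,0,0,0,0,0,0,0,0,0,0],
  [0,8,8,8,9,9,0,11,0,0,0,0,0,0,0,0,0,0,0,0],
  [8,8,8,0,0,1,1,0,0,0,0,0,0,0,0,0,0,0,0,0],
  [8,8,0,0,1,1,1,0,0,0,0,0,0,0,0,0,0,0,0,0],
  [0,0,0,1,1,1,0,0,0,0,0,0,0,0,0,0,0,0,0,0],
  [0,0,1,0,1,1,0,0,0,0,0,0,0,0,0,0,0,0,0,0],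
  [0,12,0,1,1,0,3,3,0,0,0,0,0,0,0,0,0,0,0,0],
  [12,0,0,1,0,3,3,3,0,0,0,0,0,0,0,0,0,0,0,0],
  [0,0,2,0,3,3,3,0,5,5,0,0,0,0,0,0,0,0,0,13],
  [0,2,2,2,0,3,0,5,5,5,0,0,0,0,0,0,0,0,0,0],
  [2,2,2,0,4,0,5,5,5,0,0,0,0,0,0,0,0,0,0,0],
  [2,2,0,4,4,4,0,5,0,0,0,0,0,0,0,0,0,0,0,0],
  [0,0,4,4,4,0,6,6,0,0,0,0,0,0,0,0,0,0,0,0],
  [0,0,4,4,0,6,6,6,0,0,0,0,0,0,0,0,0,0,0,0],
  [0,0,0,0,6,6,6,0,0,0,0,0,0,0,0,0,0,0,0,0],
  [0,0,0,0,0,6,0,0,0,0,0,0,0,0,0,0,0,0,0,0]]"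
| "pic Need = [
  [0,0,0,0,4,0,6,6,0,0,0,9,9,0,0,0,0,0,0,0],
  [0,0,0,4,0,6,6,6,0,0,9,9,9,0,0,0,0,0,0,0],
  [0,0,5,0,6,6,6,0,0,9,9,9,0,0,0,0,0,0,0,0],
  [0,5,5,5,0,6,0,8,8,0,9,0,0,0,0,0,0,0,0,0],
  [5,5,5,0,7,0,8,8,0,1,1,0,0,0,0,0,0,0,0,0],
  [5,5,0,7,7,7,8,0,1,1,1,0,0,0,0,0,0,0,0,0],
  [0,0,7,7,7,0,0,1,1,1,1,0,0,0,0,0,0,0,0,0],
  [0,0,7,7,0,3,3,1,1,1,0,0,0,0,0,0,0,0,0,0],
  [0,0,0,0,3,3,0,0,0,0,0,0,0,0,0,0,0,0,0,0],
  [0,0,2,2,3,0,0,0,0,0,0,0,0,0,0,0,0,0,0,0],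
  [0,2,2,0,0,0,0,0,0,0,0,0,0,0,0,0,0,0,0,0],
  [2,2,2,0,0,0,0,0,0,0,0,0,0,0,0,0,0,0,0,0],
  [2,2,0,0,0,0,0,0,0,0,0,0,0,0,0,0,0,0,0,10],
  [0,0,0,0,0,0,0,0,0,0,0,0,0,0,0,0,0,0,0,0],
  [0,0,0,0,0,0,0,0,0,0,0,0,0,0,0,0,0,0,0,0],
  [0,0,0,0,0,0,0,0,0,0,0,0,0,0,0,0,0,0,0,0],
  [0,0,0,0,0,0,0,0,0,0,0,0,0,0,0,0,0,0,0,0],
  [0,0,0,0,0,0,0,0,0,0,0,0,0,0,0,0,0,0,0,0],
  [0,0,0,0,0,0,0,0,0,0,0,0,0,0,0,0,0,0,0,0],
  [0,0,0,0,0,11,0,0,0,0,0,0,0,0,0,0,0,0,0,0]]"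

fun group_costs :: "tile => (int \<times> int) list" where
  "group_costs Block = [(1,0), (2,0)]"
| "group_costs Fork = [(1,1), (2,3), (3,3), (4,2), (5,3), (6,3), (7,2)]"
| "group_costs Bend = [(1,3), (2,3), (3,3), (4,3), (5,3), (6,3), (7,3), (8,1), (9,3), (10,3), (11,1), (12,3), (13,2), (14,3), (15,3), (16,3), (17,3), (18,3), (19,3), (20,2), (21,3), (22,3), (23,3), (24,2)]"
| "group_costs Split_Left = [(1,4), (2,3), (3,3), (4,3), (5,2), (6,1), (7,3), (8,3), (9,2), (10,3), (11,3), (12,3), (13,3)]"
| "group_costs Split_Bottom = [(1,4), (2,3), (3,3), (4,3), (5,3), (6,3), (7,3), (8,3), (9,3), (10,3), (11,3), (12,3), (13,2), (14,3), (15,2), (16,3)]"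
| "group_costs Or_Right = [(1,4), (2,3), (3,3), (4,2), (5,3), (6,3), (7,3), (8,3), (9,3), (10,3), (11,2), (12,3), (13,3), (14,1), (15,3), (16,2), (17,0)]"
| "group_costs Or_Top = [(1,4), (2,3), (3,3), (4,3), (5,3), (6,2), (7,3), (8,3), (9,1), (10,3), (11,3), (12,2), (13,0)]"
| "group_costs And_Right = [(1,5), (2,3), (3,3), (4,1), (5,3), (6,2), (7,3), (8,3), (9,3), (10,3), (11,3), (12,3), (13,3), (14,3), (15,3), (16,1), (17,0)]"
| "group_costs And_Top = [(1,5), (2,3), (3,3), (4,3), (5,3), (6,3), (7,3), (8,3), (9,3), (10,3), (11,1), (12,1), (13,0)]"
| "group_costs Need = [(1,3), (2,3), (3,2), (4,1), (5,3), (6,3), (7,3), (8,2), (9,3), (10,0), (11,0)]"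

fun refutations :: "tile => ((bool \<times> bool \<times> bool \<times> bool) \<times> (int \<times> cell \<times> bool) list \<times> int) list" where
  "refutations Block = [((True, True, True, False), [], 1),
  ((True, True, False, True), [], 2)]"
| "refutations Fork = [((True, True, True, True), [(6,(16,16),False), (7,(9,17),True), (1,(10,16),False), (2,(15,12),False), (3,(17,12),False), (4,(15,15),False)], 5)]"
| "refutations Bend = [((False, True, False, True), [(1,(4,11),False), (2,(6,11),False), (3,(4,15),False), (4,(4,17),False), (5,(8,15),False), (6,(10,15),False)], 7),
  ((True, False, True, False), [(8,(4,2),False), (9,(4,4),False), (10,(6,4),False), (11,(4,6),False), (12,(4,8),False), (13,(7,6),False), (14,(11,4),False), (15,(13,4),False), (16,(13,6),False), (17,(15,6),False), (18,(15,8),False), (19,(17,8),False), (20,(15,11),False), (21,(13,15),False), (22,(13,17),False), (23,(17,15),False)], 24)]"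
| "refutations Split_Left = [((False, True, False, True), [(2,(4,11),False), (3,(8,9),False), (4,(10,9),False), (5,(8,12),False), (6,(6,14),False), (7,(6,16),False), (13,(8,16),True)], 1),
  ((False, True, True, False), [(2,(4,11),False), (3,(8,9),False), (4,(10,9),False), (5,(8,12),False), (6,(6,14),False), (7,(6,16),False), (12,(16,15),True), (1,(12,12),False), (8,(14,12),False), (9,(12,15),False), (10,(12,17),False)], 11)]"
| "refutations Split_Bottom = [((True, False, False, True), [(2,(8,16),True), (3,(4,4),False), (4,(4,6),False), (5,(6,6),False), (6,(4,10),False), (7,(4,12),False), (8,(6,12),False), (9,(6,14),False), (10,(11,10),False), (11,(13,10),False)], 1),
  ((True, False, True, False), [(3,(4,4),False), (4,(4,6),False), (5,(6,6),False), (6,(4,10),False), (7,(4,12),False), (8,(6,12),False), (9,(6,14),False), (10,(11,10),False), (11,(13,10),False), (16,(16,15),True), (1,(13,12),False), (12,(15,12),False), (13,(13,15),False), (14,(13,17),False)], 15)]"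
| "refutations Or_Right = [((False, False, True, False), [(10,(16,15),True), (11,(3,10),False), (12,(4,4),False), (13,(4,6),False), (14,(6,4),False), (15,(8,4),False), (16,(6,7),False), (1,(8,8),False), (2,(12,6),False), (3,(14,6),False), (4,(12,9),False), (5,(10,13),False), (6,(10,15),False), (7,(14,13),False), (8,(16,13),False)], 9),
  ((True, True, False, True), [], 17)]"
| "refutations Or_Top = [((False, False, False, True), [(6,(8,17),True), (7,(4,4),False), (8,(4,6),False), (9,(6,4),False), (10,(8,4),False), (11,(6,8),False), (12,(3,11),False), (1,(4,13),False), (2,(4,15),False), (3,(6,15),False), (4,(6,17),False)], 5),
  ((True, True, True, False), [], 13)]"
| "refutations And_Right = [((False, True, True, False), [(1,(6,9),False), (7,(8,9),False), (8,(8,11),False), (9,(10,11),False), (10,(8,15),False), (11,(8,17),False), (12,(12,15),False), (13,(14,15),False), (14,(14,17),False), (15,(18,15),False)], 16),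
  ((True, False, True, False), [(2,(4,4),False), (3,(4,6),False), (4,(6,4),False), (5,(8,4),False), (6,(5,7),False), (16,(19,14),False), (1,(6,9),False), (7,(8,9),False), (8,(8,11),False), (9,(10,11),False), (10,(8,15),False), (11,(8,17),False), (12,(12,15),False), (13,(14,15),False), (14,(14,17),False)], 15),
  ((True, True, False, True), [], 17)]"
| "refutations And_Top = [((False, True, False, True), [(6,(8,16),True), (12,(2,11),False), (1,(4,12),False), (2,(4,14),False), (3,(6,14),False), (4,(6,16),False)], 5),
  ((True, False, False, True), [(6,(8,16),True), (7,(4,4),False), (8,(4,6),False), (9,(8,4),False), (10,(10,4),False), (11,(8,6),False), (1,(4,12),False), (2,(4,14),False), (3,(6,14),False), (4,(6,16),False)], 5),
  ((True, True, True, False), [], 13)]"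
| "refutations Need = [((False, False, False, False), [(2,(4,10),False), (3,(7,8),False), (4,(4,2),False), (5,(4,4),False), (6,(6,4),False), (7,(6,6),False), (8,(9,4),False), (9,(11,4),False)], 1),
  ((True, True, True, False), [], 10),
  ((True, True, False, True), [], 11)]"

fun witnesses :: "tile => ((bool \<times> bool \<times> bool \<times> bool) \<times> int list list) list" where
  "witnesses Block = [((False, False, False, False), [[],[],[],[],[],[],[],[],[],[],[],[],[],[],[],[],[],[],[],[]])]"
| "witnesses Fork = [((False, False, True, False), [[],[],[],[],[],[],[],[],[19],[19],[],[15,17],[13,17,20],[13,18],[15,18],[10],[15],[],[7,8,12,13],[]]), ((False, False, False, True), [[],[],[],[],[],[],[],[],[],[],[16,17,18],[],[14],[15,16,19],[11,12],[14,16,17],[9,14],[9,14],[],[6]])]"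
| "witnesses Bend = [((False, False, False, False), [[5],[],[3,5,6,7,10,12,13,14],[3,10],[3,5,10,12,14,15,16],[12],[3,5,6,12,14,16,17,18],[3,14],[3,14],[5,6,7,15,16],[3],[3,7,16],[],[1,4,5,9,10,11,13,14,18,19],[6,16],[3,6,7,9,12,16],[3,12],[3,12,14],[6,7],[]]), ((True, False, False, True), [[5],[],[3,5,6,7,12,13,14],[3,9,10],[3,5,10,12,14,15,16],[12],[3,5,6,12,14,16,17,18],[3,8,14],[3,8,14],[15,16],[4,6],[6,12,16],[1,2,6,12],[13,14,18,19],[4,8,10,16],[12,16],[4,5,6,8,12],[8,12,14],[1,2],[6]]), ((False, True, True, False), [[8,15],[4,8,15],[17],[4,6,11,13,17],[19],[1,2,4,7,8,9,13,15,19],[],[4,5,10,11,15,17],[17],[1,2,5,6,7,12,13],[3,15],[3,7,15],[15,20],[1,4,5,7,9,10,11],[7,13,17,18],[3,7,9],[3,13,14,15],[3],[6,7,10,11],[]]), ((True, True, True, True), [[8,15],[4,8,15],[17],[4,6,11,13,17],[19],[1,2,4,7,8,9,13,15,19],[],[4,5,8,10,11,15,17],[8,17],[1,2,12,13],[4,6,15],[6,12,15],[1,2,6,12,15,20],[],[4,8,10,13,17,18],[],[4,5,6,8,13,14,15],[8],[1,2,10,11],[6]])]"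
| "witnesses Split_Left = [((False, False, False, False), [[],[],[],[],[],[],[],[9,10,11],[7],[3,7],[3,8,9,13,14,15],[3,5],[7,11],[12,13,17,18,19],[5,7,8,9],[5,11,13,14,15],[5,11],[11],[5,6,7],[]]), ((True, False, True, True), [[],[],[],[],[],[12],[12],[],[8,10,16],[10,16],[4,5,6],[8,12,14],[1,2,10,14,20],[6,10],[12,16,17,18],[6,8],[8,12,13,14],[3,4,8],[9,10],[6]])]"
| "witnesses Split_Bottom = [((False, False, False, False), [[],[4],[4,5],[],[3,5,6,7],[3],[3],[],[3,4,5,12,13,14],[],[3,5,6,7,9,10,12,14,15,16],[3,12],[3,5,7,12,19],[5,13,14,19],[5,9],[12,14,15,17],[7,12],[7,12],[7],[]]), ((False, True, True, True), [[6],[6],[8],[4,8],[],[4,6],[6,15],[1,2,6,15],[8,17],[4,8,11,13,17],[],[4,6,8,9,13,15],[15,20],[1,2,6,10,11],[13,16,17,18],[3,4,8],[8,13,14],[8],[10,11],[6]])]"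
| "witnesses Or_Right = [((False, False, False, False), [[],[4],[4,5,7,8,9],[],[3,5,7,13,14,15],[3,7,11],[3,11,13],[7,13],[7,9],[13],[2,4,5],[2,10,11,15,16,17],[12,19],[9,12,13,15,19],[9,15],[9,15,17],[],[],[],[]]), ((True, False, True, False), [[],[],[3,4,5,7,8,9,16],[16],[3,5],[3,6,7,12,14],[3,14],[8,9,10],[12],[3,4,5,6,12,18],[12,18],[],[1,10,14,16,20],[],[10,11,12,16,17,18],[],[7,8,13,14],[],[],[]]), ((False, True, True, False), [[6,10],[6,10],[16],[4,6,8,16],[8],[4,12,14],[6,14],[1,2,6,8,9,10],[6,12],[6,12,18],[2,12,18],[2],[10,14,16,20],[],[10,11,12,16,17,18],[],[7,8,13,14],[],[],[]])]"
| "witnesses Or_Top = [((False, False, False, False), [[5],[5],[5,7,8,9],[],[3,5,9],[3],[3,6,7],[],[7],[7],[],[1,2,4,5],[],[3,5,6,7],[3],[3,5,7,8,9],[5],[5],[6,7],[]]), ((True, False, False, True), [[],[4],[4,5,7,8,9],[],[3,5,9],[3],[3,6,7],[],[],[],[3,4,5,6],[8],[1,4,8],[10],[4,6,10],[],[1,2,6,8],[8],[3,4],[6]]), ((False, True, False, True), [[6,10],[6,10],[],[4,6,8],[8],[4,8],[],[1,2,6],[6],[6],[6],[1,2,8],[4,8],[10],[4,6,10],[],[1,2,6,8],[8],[3,4],[6]])]"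
| "witnesses And_Right = [((False, False, False, False), [[7],[],[4,5,7,8,9],[],[3,5],[3,6,7],[3],[4,7,8,9],[5],[5,7,9,10,11],[7],[1,2,7],[8],[8,9,13,14,15,19],[10,17],[7,10,11,13,17],[7,13],[7,13,15],[],[]]), ((True, True, True, False), [[6,10],[6,10],[],[4,6,8],[8],[4,10],[5,10],[1,2,12],[3,6,8,12],[3],[3,4,8,10],[10,16],[5,6,10,16,20],[],[8,12,14,18],[],[8,9,10,14,15,16],[],[5,6,11,12],[]])]"
| "witnesses And_Top = [((False, False, False, False), [[7],[],[4,5,9,10,11],[6,7],[3,7,9],[3],[3,7],[7],[],[3],[4,5],[1],[3,5,6,7],[3],[3,5,7,8,9],[5],[5],[6],[6,7],[]]), ((True, True, False, True), [[6,12],[6,12],[],[4,8,10],[],[4,5,6,8],[],[1,2],[4,5,6],[6],[2,8],[4,8],[10],[4,6,10],[],[1,2,6,8],[8],[3,4,8],[],[6]])]"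
| "witnesses Need = [((True, False, False, False), [[5],[],[3,5,6,7,10,11,12],[3],[3,5,7,8],[5],[5],[7,8,9,10],[],[4,5],[],[],[1,2],[],[],[],[],[],[],[]]), ((False, True, False, False), [[8,13],[4,8,13],[],[4,6,9,11],[11],[1,2,6,7,11],[11],[3,4],[5,6],[],[2,3],[3],[],[],[],[],[],[],[],[]])]"

text \<open>Outputs are only bounded from above, so a signal may always be dropped.
  \<open>Fork\<close> draws on no input and chooses one output at most; \<open>Bend\<close> keeps
  its two signals apart, from left to top and from bottom to right, without a crossing.\<close>

fun rel :: "tile => bool => bool => bool => bool => bool" where
  "rel Block l d r t = (\<not> r & \<not> t)"
| "rel Fork l d r t = (\<not> (r & t))"
| "rel Bend l d r t = ((t --> l) & (r --> d))"
| "rel Split_Left l d r t = ((t --> l) & (r --> l))"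
| "rel Split_Bottom l d r t = ((t --> d) & (r --> d))"
| "rel Or_Right l d r t = ((r --> l \<or> d) & \<not> t)"
| "rel Or_Top l d r t = ((t --> l \<or> d) & \<not> r)"
| "rel And_Right l d r t = ((r --> l & d) & \<not> t)"
| "rel And_Top l d r t = ((t --> l & d) & \<not> r)"
| "rel Need l d r t = ((l \<or> d) & \<not> r & \<not> t)"

definition tile_ok :: "tile => bool" where
  "tile_ok T \<longleftrightarrow> pic_ok (pic T) & groups_ok (pic T) (group_costs T) &
     list_all (refutation_ok (pic T) (group_costs T)) (refutations T) &
     list_all (witness_ok (pic T) (\<Sum>(g, s) \<leftarrow> group_costs T. s)) (witnesses T)"

text \<open>All tables are finite and the checks executable, so evaluation settles each
  tile.\<close>

lemma tile_ok: "tile_ok T"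
proof (cases T)
  case Block show ?thesis unfolding Block by code_simp
next
  case Fork show ?thesis unfolding Fork by code_simp
next
  case Bend show ?thesis unfolding Bend by code_simp
next
  case Split_Left show ?thesis unfolding Split_Left by code_simp
next
  case Split_Bottom show ?thesis unfolding Split_Bottom by code_simp
next
  case Or_Right show ?thesis unfolding Or_Right by code_simp
next
  case Or_Top show ?thesis unfolding Or_Top by code_simp
next
  case And_Right show ?thesis unfolding And_Right by code_simp
next
  case And_Top show ?thesis unfolding And_Top by code_simp
next
  case Need show ?thesis unfolding Need by code_simp
qed



definition base_cost :: "tile => nat" where
  "base_cost T = nat (\<Sum>(g, s) \<leftarrow> group_costs T. s)"

lemma pic_shape: "pic_shape (pic T)"
  using tile_ok[of T] by (simp add: tile_ok_def pic_ok_def)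

lemma base_cost_int: "(\<Sum>(g, s) \<leftarrow> group_costs T. s) = int (base_cost T)"
  unfolding base_cost_def by (cases T) simp_all

lemma tile_cost_ge:
  assumes "local_closed M" "terminal_cells (pic T) \<subseteq> M"
  shows "base_cost T <= card (M \<inter> free_cells (pic T))"
proof -
  have "groups_ok (pic T) (group_costs T)" using tile_ok[of T] by (simp add: tile_ok_def)
  from tile_lower(1)[OF pic_shape this assms] show ?thesis by (simp add: base_cost_int)
qed

text \<open>A refutation survives if inputs are taken away or outputs are added. Hence the list only
  contains violations with as many inputs and as few outputs as possible.\<close>

lemma refutation_exists:
  assumes "\<not> rel T l d r t"
  obtains l' d' r' t' x where "((l', d', r', t'), x) \<in> set (refutations T)"
    "l --> l'" "d --> d'" "r' --> r" "t' --> t"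
proof -
  have "list_ex (%((l', d', r', t'), x). (l --> l') & (d --> d') & (r' --> r) & (t' --> t)) (refutations T)"
    using assms by (cases T) auto
  then show ?thesis using that unfolding list_ex_iff by fast
qed

text \<open>Dually, a witness stays good if more inputs are present or fewer outputs are asked for,
  so the list only contains extreme cases.\<close>

lemma witness_exists:
  assumes "rel T l d r t"
  obtains l' d' r' t' ws where "((l', d', r', t'), ws) \<in> set (witnesses T)"
    "l' --> l" "d' --> d" "r --> r'" "t --> t'"
proof -
  have "list_ex (%((l', d', r', t'), ws). (l' --> l) & (d' --> d) & (r --> r') & (t --> t')) (witnesses T)"
    using assms by (cases T) auto
  then show ?thesis using that unfolding list_ex_iff by fast
qed

lemma tile_rel:
  assumes M: "local_closed M" "terminal_cells (pic T) \<subseteq> M"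
    and c: "card (M \<inter> free_cells (pic T)) <= base_cost T"
  shows "rel T (left_port \<in> M) (bottom_port \<in> M) (right_port \<in> M) (top_port \<in> M)"
proof (rule ccontr)
  assume "\<not> ?thesis"
  from refutation_exists[OF this] obtain l d r t st h where
    r: "((l, d, r, t), st, h) \<in> set (refutations T)"
      "left_port \<in> M --> l" "bottom_port \<in> M --> d" "r --> right_port \<in> M" "t --> top_port \<in> M" by (metis surj_pair)
  have "refutation_ok (pic T) (group_costs T) ((l, d, r, t), st, h)"
    "groups_ok (pic T) (group_costs T)"
    using tile_ok[of T] r(1) by (auto simp: tile_ok_def list_all_iff)
  moreover have "int (card (M \<inter> free_cells (pic T))) <= (\<Sum>(g, s) \<leftarrow> group_costs T. s)"
    using c by (simp add: base_cost_int)
  ultimately show False using tile_refutation[OF pic_shape _ M] r by blast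
qed

lemma tile_witness:
  assumes "rel T l d r t"
  obtains W where "W \<subseteq> free_cells (pic T)" "card W <= base_cost T"
    "r --> right_port \<in> W \<union> terminal_cells (pic T)" "t --> top_port \<in> W \<union> terminal_cells (pic T)"
    "\<And>c. c \<in> W \<union> terminal_cells (pic T) ==>
      fst c = 1 & (snd c = 13 --> l) \<or> snd c = 1 & (fst c = 6 --> d) \<or>
      fst c > 1 & (fst c - 1, snd c) \<in> W \<union> terminal_cells (pic T) \<or>
      snd c > 1 & (fst c, snd c - 1) \<in> W \<union> terminal_cells (pic T)"
proof -
  from witness_exists[OF assms] obtain l' d' r' t' ws where
    w: "((l', d', r', t'), ws) \<in> set (witnesses T)" "l' --> l" "d' --> d" "r --> r'" "t --> t'" by blast
  have wok: "witness_ok (pic T) (int (base_cost T)) ((l', d', r', t'), ws)"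
    using tile_ok[of T] w(1) by (auto simp: tile_ok_def list_all_iff base_cost_int)
  show ?thesis
  proof (rule tile_upper[OF pic_shape wok])
    fix W
    let ?V = "W \<union> terminal_cells (pic T)"
    assume W: "W \<subseteq> free_cells (pic T)" "int (card W) <= int (base_cost T)" "r' --> right_port \<in> ?V" "t' --> top_port \<in> ?V"
      "\<And>c. c \<in> ?V ==>
        fst c = 1 & (snd c = 13 --> l') \<or> snd c = 1 & (fst c = 6 --> d') \<or>
        fst c > 1 & (fst c - 1, snd c) \<in> ?V \<or> snd c > 1 & (fst c, snd c - 1) \<in> ?V"
    show thesis
    proof (rule that[of W])
      show "W \<subseteq> free_cells (pic T)" by (rule W(1))
      show "card W <= base_cost T" using W(2) by simp
      show "r --> right_port \<in> ?V" using W(3) w(4) by blast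
      show "t --> top_port \<in> ?V" using W(4) w(5) by blast
      fix c assume "c \<in> ?V"
      from W(5)[OF this] w(2,3) show "fst c = 1 & (snd c = 13 --> l) \<or> snd c = 1 & (fst c = 6 --> d) \<or>
        fst c > 1 & (fst c - 1, snd c) \<in> ?V \<or> snd c > 1 & (fst c, snd c - 1) \<in> ?V"
        by (elim disjE conjE) simp_all
    qed
  qed
qed

lemma pic_frame:
  assumes "1 <= k" "k <= 20"
  shows "k ~= 13 ==> (20, k) \<in> terminal_cells (pic T)" "k ~= 6 ==> (k, 20) \<in> terminal_cells (pic T)"
proof -
  define P where "P = pic T"
  have ok: "pic_ok P" using tile_ok[of T] by (simp add: tile_ok_def P_def)
  then have l: "length P = 20" and r: "\<And>j. j < 20 ==> length (P ! j) = 20" by (auto simp: pic_ok_def pic_shape_def)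
  define n where "n = nat (k - 1)"
  have n: "n < 20" "k = int n + 1" using assms by (auto simp: n_def)
  have "map (%r. last r = 0) P ! n = (replicate 12 True @ False # replicate 7 True) ! n"
    using ok by (simp add: pic_ok_def)
  then have a: "(last (P ! n) = 0) = (replicate 12 True @ False # replicate 7 True) ! n" using l n by simp
  have len: "P ! n ~= []" "P ~= []" using l r[OF n(1)] by auto
  have "last (P ! n) = P ! n ! 19" using r[OF n(1)] len by (simp add: last_conv_nth)
  with a have a: "(P ! n ! 19 = 0) = (replicate 12 True @ False # replicate 7 True) ! n" by simp
  have ne: "(replicate 12 True @ False # replicate 7 True) ! n" if "n ~= 12"
    using that n(1) by (cases "n < 12") (simp_all add: nth_append nth_Cons')
  show "(20, k) \<in> terminal_cells (pic T)" if "k ~= 13"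
    using a ne that n by (simp add: terminal_cells_def in_range_def code_at_def P_def)
  have "map (%c. c = 0) (last P) ! n = (replicate 5 True @ False # replicate 14 True) ! n"
    using ok by (simp add: pic_ok_def)
  moreover have "last P = P ! 19" using l len by (simp add: last_conv_nth)
  ultimately have b: "(P ! 19 ! n = 0) = (replicate 5 True @ False # replicate 14 True) ! n" using r[of 19] n by simp
  have ne': "(replicate 5 True @ False # replicate 14 True) ! n" if "n ~= 5"
    using that n(1) by (cases "n < 5") (simp_all add: nth_append nth_Cons')
  show "(k, 20) \<in> terminal_cells (pic T)" if "k ~= 6"
    using b ne' that n by (simp add: terminal_cells_def in_range_def code_at_def P_def)
qed

section \<open>Grids of tiles\<close>

text \<open>A finite set of lattice points in which every point but the origin has its left or its
  lower neighbour.\<close>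

definition arborescence :: "cell set => bool" where
  "arborescence N \<longleftrightarrow> finite N &
     (\<forall>c \<in> N. 0 <= fst c & 0 <= snd c & (c = (0, 0) \<or> supported N c))"

text \<open>Tiles have period 20 and own the cells 1 to 20, so the right or top port of a tile is
  the left or bottom port of the next one.\<close>

definition place :: "nat => nat => cell => cell" where
  "place i j c = (20 * int i + fst c, 20 * int j + snd c)"

text \<open>Column and row 0 of the outermost tiles. The frame supports itself down to the origin,
  and all left and bottom ports on it are present.\<close>

definition frame :: "nat => nat => cell set" where
  "frame w h = {(x, y). 0 <= x & x <= 20 * int w & 0 <= y & y <= 20 * int h & (x = 0 \<or> y = 0)}"

definition grid_terminals :: "nat => nat => (nat => nat => tile) => cell set" where
  "grid_terminals w h g = frame w h \<union> (\<Union>i < w. \<Union>j < h. place i j ` terminal_cells (pic (g i j)))"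

definition grid_cost :: "nat => nat => (nat => nat => tile) => nat" where
  "grid_cost w h g = (\<Sum>i < w. \<Sum>j < h. base_cost (g i j))"

definition solves :: "nat => nat => (nat => nat => tile) => (nat => nat => bool) => (nat => nat => bool) => bool" where
  "solves w h g H V \<longleftrightarrow> (\<forall>i < w. \<forall>j < h. rel (g i j) (H i j) (V i j) (H (Suc i) j) (V i (Suc j)))"

lemma place_inj: "place i j c = place i' j' c' ==> in_range c ==> in_range c' ==> i = i' & j = j' & c = c'"
  unfolding place_def in_range_def prod_eq_iff fst_conv snd_conv by presburger

lemma inj_place: "inj (place i j)"
  by (auto simp: place_def inj_on_def prod_eq_iff)

lemma free_range: "free_cells P \<subseteq> {c. in_range c}" and terminal_range: "terminal_cells P \<subseteq> {c. in_range c}"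
  by (auto simp: free_cells_def terminal_cells_def)

lemma finite_frame: "finite (frame w h)"
  by (rule finite_subset[of _ "{0..20 * int w} \<times> {0..20 * int h}"]) (auto simp: frame_def)

lemma finite_grid_terminals: "finite (grid_terminals w h g)"
  unfolding grid_terminals_def
  by (auto intro!: finite_frame finite_imageI finite_subset[OF terminal_range finite_in_range])

lemma frame_not_place: "in_range c ==> place i j c \<notin> frame w h"
  by (auto simp: place_def in_range_def frame_def)

text \<open>Every tile uses at least its base cost, and the bound on \<open>card N\<close> leaves no
  slack beyond the sum of these costs. So each tile is tight and obeys its rule.\<close>

lemma grid_lower:
  assumes N: "arborescence N" "grid_terminals w h g \<subseteq> N"
    and c: "card N <= card (grid_terminals w h g) + grid_cost w h g"
  shows "solves w h g (%i j. place i j left_port \<in> N) (%i j. place i j bottom_port \<in> N)"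
proof -
  define X where "X = grid_terminals w h g"
  define M where "M = (%i j. {c. place i j c \<in> N})"
  define F where "F = (%i j. M i j \<inter> free_cells (pic (g i j)))"
  have fin: "finite N" using N by (simp add: arborescence_def)
  have lc: "local_closed (M i j)" for i j
    unfolding local_closed_def
  proof (intro ballI impI)
    fix c assume c: "c \<in> M i j" "in_range c"
    then have "place i j c ~= (0, 0)" by (auto simp: place_def in_range_def)
    then have "supported N (place i j c)" using c N(1) by (auto simp: arborescence_def M_def)
    then show "supported (M i j) c" by (auto simp: supported_def M_def place_def algebra_simps)
  qed
  have tm: "terminal_cells (pic (g i j)) \<subseteq> M i j" if "i < w" "j < h" for i j
  proof
    fix c assume "c \<in> terminal_cells (pic (g i j))"
    then have "place i j c \<in> grid_terminals w h g" using that unfolding grid_terminals_def by blast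
    then show "c \<in> M i j" using N(2) by (auto simp: M_def)
  qed
  have finF: "finite (F i j)" for i j unfolding F_def
    by (rule finite_subset[OF _ finite_in_range]) (use free_range in auto)
  have lo: "base_cost (g i j) <= card (F i j)" if "i < w" "j < h" for i j
    unfolding F_def using tile_cost_ge[OF lc tm[OF that]] .
  let ?I = "{..<w} \<times> {..<h}"
  let ?U = "\<Union>(i, j) \<in> ?I. place i j ` F i j"
  have disj: "X \<inter> ?U = {}"
  proof -
    have "place i j c \<notin> X" if c: "c \<in> F i j" for i j c
    proof
      have r: "in_range c" "c \<notin> terminal_cells (pic (g i j))" using c by (auto simp: F_def free_cells_def terminal_cells_def)
      assume "place i j c \<in> X"
      then consider "place i j c \<in> frame w h"
        | i' j' c' where "place i j c = place i' j' c'" "c' \<in> terminal_cells (pic (g i' j'))"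
        unfolding X_def grid_terminals_def by blast
      then show False
      proof cases
        case 1 then show False using frame_not_place r(1) by blast
      next
        case (2 i' j' c')
        then have "in_range c'" by (simp add: terminal_cells_def)
        then show False using place_inj[OF 2(1) r(1)] 2(2) r(2) by blast
      qed
    qed
    then show ?thesis by auto
  qed
  have "card ?U = (\<Sum>(i, j) \<in> ?I. card (place i j ` F i j))"
  proof -
    have "card (\<Union>p \<in> ?I. place (fst p) (snd p) ` F (fst p) (snd p)) = (\<Sum>p \<in> ?I. card (place (fst p) (snd p) ` F (fst p) (snd p)))"
    proof (rule card_UN_disjoint)
      show "\<forall>p \<in> ?I. \<forall>q \<in> ?I. p ~= q --> place (fst p) (snd p) ` F (fst p) (snd p) \<inter> place (fst q) (snd q) ` F (fst q) (snd q) = {}"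
      proof (intro ballI impI)
        fix p q :: "nat \<times> nat" assume ne: "p ~= q"
        have r: "in_range c" if "c \<in> F i j" for i j c using that by (simp add: F_def free_cells_def)
        show "place (fst p) (snd p) ` F (fst p) (snd p) \<inter> place (fst q) (snd q) ` F (fst q) (snd q) = {}"
        proof (rule equals0I)
          fix x assume "x \<in> place (fst p) (snd p) ` F (fst p) (snd p) \<inter> place (fst q) (snd q) ` F (fst q) (snd q)"
          then obtain c c' where "place (fst p) (snd p) c = place (fst q) (snd q) c'" "c \<in> F (fst p) (snd p)" "c' \<in> F (fst q) (snd q)" by auto
          then show False using place_inj r ne by (metis prod_eqI)
        qed
      qed
    qed (use finF in auto)
    then show ?thesis by (simp add: case_prod_beta)
  qed
  also have "\<dots> = (\<Sum>(i, j) \<in> ?I. card (F i j))"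
    by (rule sum.cong[OF refl]) (auto intro!: card_image inj_on_subset[OF inj_place])
  finally have cU: "card ?U = (\<Sum>(i, j) \<in> ?I. card (F i j))" .
  have "card X + card ?U = card (X \<union> ?U)"
    using finF disj by (intro card_Un_disjoint[symmetric]) (auto simp: X_def finite_grid_terminals)
  also have "\<dots> <= card N"
    by (intro card_mono fin) (use N(2) in \<open>auto simp: X_def F_def M_def\<close>)
  finally have "(\<Sum>(i, j) \<in> ?I. card (F i j)) <= (\<Sum>(i, j) \<in> ?I. base_cost (g i j))"
    using c cU by (simp add: X_def grid_cost_def sum.cartesian_product)
  then have eq: "card (F i j) <= base_cost (g i j)" if "i < w" "j < h" for i j
  proof -
    assume le: "(\<Sum>(i, j) \<in> ?I. card (F i j)) <= (\<Sum>(i, j) \<in> ?I. base_cost (g i j))"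
    let ?b = "%p. base_cost (g (fst p) (snd p))" and ?F = "%p. card (F (fst p) (snd p))"
    have "sum ?b ?I <= sum ?F ?I" by (rule sum_mono) (auto simp: lo)
    then have "sum ?b ?I = sum ?F ?I" using le by (simp add: case_prod_beta)
    from sum_mono_inv[OF this, of "(i, j)"] show ?thesis using lo that by auto
  qed
  show ?thesis
    unfolding solves_def
  proof (intro allI impI)
    fix i j assume ij: "i < w" "j < h"
    have "rel (g i j) (left_port \<in> M i j) (bottom_port \<in> M i j) (right_port \<in> M i j) (top_port \<in> M i j)"
      by (rule tile_rel[OF lc tm[OF ij]]) (use eq[OF ij] in \<open>simp add: F_def\<close>)
    moreover have "place i j right_port = place (Suc i) j left_port" "place i j top_port = place i (Suc j) bottom_port"
      by (auto simp: place_def left_port_def right_port_def top_port_def bottom_port_def)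
    ultimately show "rel (g i j) (place i j left_port \<in> N) (place i j bottom_port \<in> N) (place (Suc i) j left_port \<in> N) (place i (Suc j) bottom_port \<in> N)"
      by (simp add: M_def)
  qed
qed

lemma grid_upper:
  assumes S: "solves w h g H V"
  shows "\<exists>N. arborescence N & grid_terminals w h g \<subseteq> N & card N <= card (grid_terminals w h g) + grid_cost w h g"
proof -
  define good where "good = (%T l d r t W. W \<subseteq> free_cells (pic T) & card W <= base_cost T &
    (r --> right_port \<in> W \<union> terminal_cells (pic T)) & (t --> top_port \<in> W \<union> terminal_cells (pic T)) &
    (\<forall>c \<in> W \<union> terminal_cells (pic T).
      fst c = 1 & (snd c = 13 --> l) \<or> snd c = 1 & (fst c = 6 --> d) \<or>
      fst c > 1 & (fst c - 1, snd c) \<in> W \<union> terminal_cells (pic T) \<or>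
      snd c > 1 & (fst c, snd c - 1) \<in> W \<union> terminal_cells (pic T)))"
  have "\<exists>W. good T l d r t W" if "rel T l d r t" for T l d r t
  proof (rule tile_witness[OF that])
    fix W
    let ?V = "W \<union> terminal_cells (pic T)"
    assume "W \<subseteq> free_cells (pic T)" "card W <= base_cost T" "r --> right_port \<in> ?V" "t --> top_port \<in> ?V"
      "\<And>c. c \<in> ?V ==>
        fst c = 1 & (snd c = 13 --> l) \<or> snd c = 1 & (fst c = 6 --> d) \<or>
        fst c > 1 & (fst c - 1, snd c) \<in> ?V \<or> snd c > 1 & (fst c, snd c - 1) \<in> ?V"
    then have "good T l d r t W" unfolding good_def by (intro conjI ballI)
    then show ?thesis ..
  qed
  then have "\<forall>i j. \<exists>W. i < w --> j < h --> good (g i j) (H i j) (V i j) (H (Suc i) j) (V i (Suc j)) W"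
    using S by (simp add: solves_def)
  then obtain W where W: "\<And>i j. i < w ==> j < h ==> good (g i j) (H i j) (V i j) (H (Suc i) j) (V i (Suc j)) (W i j)"
    by metis
  define X where "X = grid_terminals w h g"
  define A where "A = (%i j. W i j \<union> terminal_cells (pic (g i j)))"
  let ?I = "{..<w} \<times> {..<h}"
  define N where "N = X \<union> (\<Union>(i, j) \<in> ?I. place i j ` W i j)"
  have AN: "place i j c \<in> N" if "i < w" "j < h" "c \<in> A i j" for i j c
    using that unfolding N_def A_def X_def grid_terminals_def by blast
  have FN: "c \<in> N" if "c \<in> frame w h" for c using that by (simp add: N_def X_def grid_terminals_def)
  have Nc: "c \<in> frame w h \<or> (\<exists>i j c'. i < w & j < h & c' \<in> A i j & c = place i j c')" if "c \<in> N" for c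
    using that unfolding N_def A_def X_def grid_terminals_def by blast
  have Ar: "in_range c" if "c \<in> A i j" "i < w" "j < h" for i j c
    using that W[of i j] free_range terminal_range by (fastforce simp: A_def good_def)
  have fW: "finite (W i j)" if "i < w" "j < h" for i j
    by (rule finite_subset[OF _ finite_in_range]) (use Ar that in \<open>auto simp: A_def\<close>)
  have arb: "arborescence N"
    unfolding arborescence_def
  proof (intro conjI ballI)
    show "finite N" unfolding N_def X_def using finite_grid_terminals fW by auto
    fix c assume c: "c \<in> N"
    consider "c \<in> frame w h" | i j c' where "i < w" "j < h" "c' \<in> A i j" "c = place i j c'"
      using Nc[OF c] by blast
    then have "0 <= fst c & 0 <= snd c & (c = (0, 0) \<or> supported N c)"
    proof cases
      case 1
      have "(fst c - 1, snd c) \<in> N" if "snd c = 0" "fst c ~= 0" using 1 that by (intro FN) (auto simp: frame_def)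
      moreover have "(fst c, snd c - 1) \<in> N" if "fst c = 0" "snd c ~= 0" using 1 that by (intro FN) (auto simp: frame_def)
      moreover have "fst c = 0 \<or> snd c = 0" "0 <= fst c" "0 <= snd c" using 1 by (auto simp: frame_def)
      ultimately show ?thesis by (cases "fst c = 0"; cases "snd c = 0") (simp_all add: supported_def prod_eq_iff)
    next
      case (2 i j c')
      have r: "in_range c'" using Ar 2 by blast
      have g: "fst c' = 1 & (snd c' = 13 --> H i j) \<or> snd c' = 1 & (fst c' = 6 --> V i j) \<or>
        fst c' > 1 & (fst c' - 1, snd c') \<in> A i j \<or> snd c' > 1 & (fst c', snd c' - 1) \<in> A i j"
        using W[OF 2(1,2)] 2(3) by (auto simp: good_def A_def)
      \<comment> \<open>A cell of column 1 leans on column 20 of the tile to its left, or on the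
        frame.\<close>
      have left: "(fst c - 1, snd c) \<in> N" if b: "fst c' = 1" "snd c' = 13 --> H i j"
      proof (cases i)
        case 0
        then have "(fst c - 1, snd c) \<in> frame w h" using 2 r b by (auto simp: place_def frame_def in_range_def)
        then show ?thesis by (rule FN)
      next
        case (Suc i')
        have e: "(fst c - 1, snd c) = place i' j (20, snd c')" using 2 b Suc by (simp add: place_def)
        have "(20, snd c') \<in> A i' j"
        proof (cases "snd c' = 13")
          case True
          then show ?thesis using W[of i' j] 2 b Suc by (simp add: good_def A_def right_port_def)
        next
          case False
          then show ?thesis using pic_frame(1)[of "snd c'"] r by (simp add: A_def in_range_def)
        qed
        then show ?thesis unfolding e using AN 2 Suc by simp
      qed
      have below: "(fst c, snd c - 1) \<in> N" if b: "snd c' = 1" "fst c' = 6 --> V i j"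
      proof (cases j)
        case 0
        then have "(fst c, snd c - 1) \<in> frame w h" using 2 r b by (auto simp: place_def frame_def in_range_def)
        then show ?thesis by (rule FN)
      next
        case (Suc j')
        have e: "(fst c, snd c - 1) = place i j' (fst c', 20)" using 2 b Suc by (simp add: place_def)
        have "(fst c', 20) \<in> A i j'"
        proof (cases "fst c' = 6")
          case True
          then show ?thesis using W[of i j'] 2 b Suc by (simp add: good_def A_def top_port_def)
        next
          case False
          then show ?thesis using pic_frame(2)[of "fst c'"] r by (simp add: A_def in_range_def)
        qed
        then show ?thesis unfolding e using AN 2 Suc by simp
      qed
      have "(fst c - 1, snd c) = place i j (fst c' - 1, snd c')" "(fst c, snd c - 1) = place i j (fst c', snd c' - 1)"
        using 2 by (auto simp: place_def)
      then have "supported N c" using g left below AN[OF 2(1,2)] by (auto simp: supported_def)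
      moreover have "0 <= fst c & 0 <= snd c" using 2 r by (simp add: place_def in_range_def)
      ultimately show ?thesis by simp
    qed
    then show "0 <= fst c" "0 <= snd c" "c = (0, 0) \<or> supported N c" by blast+
  qed
  have "card N <= card X + card (\<Union>(i, j) \<in> ?I. place i j ` W i j)"
    unfolding N_def by (rule card_Un_le)
  also have "card (\<Union>(i, j) \<in> ?I. place i j ` W i j) <= (\<Sum>p \<in> ?I. card (case p of (i, j) => place i j ` W i j))"
    by (rule card_UN_le) simp
  also have "\<dots> <= (\<Sum>(i, j) \<in> ?I. base_cost (g i j))"
  proof (rule sum_mono)
    fix p assume p: "p \<in> ?I"
    obtain i j where ij: "p = (i, j)" by (cases p)
    have "card (place i j ` W i j) <= card (W i j)" by (rule card_image_le) (use fW p ij in auto)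
    then show "card (case p of (i, j) => place i j ` W i j) <= (case p of (i, j) => base_cost (g i j))"
      using W[of i j] p ij by (auto simp: good_def)
  qed
  finally have "card N <= card X + grid_cost w h g"
    by (simp add: grid_cost_def sum.cartesian_product)
  then show ?thesis using arb unfolding X_def N_def by blast
qed

section \<open>Satisfiability as a grid of tiles\<close>

text \<open>The crossing of a horizontal and a vertical signal; with \<open>b\<close> the vertical signal also feeds
  the horizontal one.\<close>

definition macro_tile :: "bool => nat => nat => tile" where
  "macro_tile b x y =
   [[Block, Split_Bottom, Split_Left, Split_Left, Split_Left, Split_Left, Split_Left, Split_Left, Split_Left, Split_Left, Split_Left, Split_Left, Split_Left],
    [Split_Left, Bend, Or_Top, Split_Bottom, And_Top, Fork, Bend, Block, Block, Block, Block, Fork, if b then Or_Right else Split_Left],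
    [Split_Bottom, Split_Left, Split_Left, And_Top, Split_Bottom, And_Top, Or_Top, Block, Block, Block, Fork, Need, Block],
    [Split_Bottom, Fork, And_Right, Or_Top, Fork, Or_Top, Split_Bottom, Block, Block, Fork, Need, Block, Block],
    [Split_Bottom, And_Top, Fork, And_Right, Or_Right, And_Top, Or_Top, Block, Fork, Need, Block, Block, Block],
    [Split_Bottom, Split_Bottom, Or_Top, Or_Right, Fork, Split_Bottom, And_Top, Fork, Need, Block, Block, Block, Block],
    [Split_Bottom, And_Right, Or_Right, Or_Right, Split_Left, And_Right, Bend, Need, Block, Block, Block, Block, Block],
    [Block, Block, Block, Block, Block, Fork, Need, Block, Block, Block, Block, Block, Block],
    [Block, Block, Block, Block, Fork, Need, Block, Block, Block, Block, Block, Block, Block],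
    [Block, Block, Block, Fork, Need, Block, Block, Block, Block, Block, Block, Block, Block],
    [Block, Block, Fork, Need, Block, Block, Block, Block, Block, Block, Block, Block, Block],
    [Block, Fork, Need, Block, Block, Block, Block, Block, Block, Block, Block, Block, Block]] ! y ! x"

text \<open>The signals inside the macro for given inputs \<open>l\<close>, \<open>d\<close>.\<close>

definition macro_h :: "bool => bool => nat => nat => bool" where
  "macro_h l d x y =
   [[False, False, d, d, d, d, d, d, d, d, d, d, d],
    [l, False, False, False, d, False, l, False, False, False, False, False, l],
    [False, l, l, l & d, False, d, False, False, False, False, False, l, False],
    [False, l, l & \<not> d, l & \<not> d, False, l, False, False, False, False, l, False, False],
    [False, l & d, False, l \<or> \<not> d, l, l \<or> d, False, False, False, l, False, False, False],
    [False, False, l & d, False, False, False, l, False, l, False, False, False, False],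
    [False, False, False, d, d, d, d, l, False, False, False, False, False],
    [False, False, False, False, False, False, \<not> d, False, False, False, False, False, False],
    [False, False, False, False, False, \<not> d, False, False, False, False, False, False, False],
    [False, False, False, False, \<not> d, False, False, False, False, False, False, False, False],
    [False, False, False, \<not> d, False, False, False, False, False, False, False, False, False],
    [False, False, \<not> d, False, False, False, False, False, False, False, False, False, False]] ! y ! x"

definition macro_v :: "bool => bool => nat => nat => bool" where
  "macro_v l d x y =
   [[False, d, False, False, False, False, False, False, False, False, False, False, False],
    [False, False, \<not> l & d, d, d, False, False, False, False, False, False, False, d],
    [l, False, \<not> l & d, l & d, d, \<not> l, l, False, False, False, False, \<not> l, False],
    [l, l & d, l, l & d, l & d, \<not> l & d, l, False, False, False, \<not> l, False, False],
    [l & d, \<not> l \<or> d, False, l, \<not> l & d, l \<or> d, l, False, False, \<not> l, False, False, False],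
    [False, l & d, \<not> l & d, False, False, l \<or> d, l, False, \<not> l, False, False, False, False],
    [False, l & d, d, False, True, d, l, \<not> l, False, False, False, False, False],
    [False, False, False, False, False, False, d, False, False, False, False, False, False],
    [False, False, False, False, False, d, False, False, False, False, False, False, False],
    [False, False, False, False, d, False, False, False, False, False, False, False, False],
    [False, False, False, d, False, False, False, False, False, False, False, False, False],
    [False, False, d, False, False, False, False, False, False, False, False, False, False]] ! y ! x"

lemma all_less_13: "(\<forall>x < 13. P x) \<longleftrightarrow> (\<forall>x < 12. P x) & P (12::nat)"
  and all_less_12: "(\<forall>x < 12. P x) \<longleftrightarrow> P 0 & P 1 & P 2 & P 3 & P 4 & P 5 & P 6 & P 7 & P 8 & P 9 & P 10 & P (11::nat)"
  by (simp_all add: numeral_eq_Suc All_less_Suc conj_ac)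

text \<open>Two diagonals of alternating \<open>Fork\<close> and \<open>Need\<close> tiles start at
  the \<open>Bend\<close> in column 6 and row 6. If the last fork serves the exit, it fails the
  adjacent \<open>Need\<close>, which must be served by the preceding fork, and so on back to the
  \<open>Bend\<close>. This brings the exits to the row and column of the entries, so that macros
  fit together. The part to the lower left interchanges the signals with guessed complements, and
  row 0 carries the vertical signal to column 12, where it may join the horizontal one. The claim
  itself is propositional.\<close>

lemma macro_sound:
  assumes "\<forall>x < 13. \<forall>y < 12. rel (macro_tile b x y) (H x y) (V x y) (H (x + 1) y) (V x (y + 1))"
  shows "H 13 1 --> H 0 1 \<or> b & V 1 0" "V 1 12 --> V 1 0"
proof -
  have "\<not> (H 13 1 & \<not> H 0 1 & \<not> (b & V 1 0)) & \<not> (V 1 12 & \<not> V 1 0)"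
    using assms unfolding all_less_13 all_less_12 macro_tile_def
    by (cases b) (simp_all add: numeral_eq_Suc, sat+)
  then show "H 13 1 --> H 0 1 \<or> b & V 1 0" "V 1 12 --> V 1 0" by blast+
qed

lemma macro_complete:
  "\<forall>x < 13. \<forall>y < 12. rel (macro_tile b x y) (macro_h l d x y) (macro_v l d x y)
    (if x = 12 then y = 1 & (l \<or> b & d) else macro_h l d (x + 1) y)
    (if y = 11 then x = 1 & d else macro_v l d x (y + 1))"
  unfolding all_less_13 all_less_12 macro_tile_def macro_h_def macro_v_def
  by (cases b; cases l; cases d) (simp_all add: numeral_eq_Suc)

lemma macro_boundary:
  "\<forall>y < 12. macro_h l d 0 y = (y = 1 & l)" "\<forall>x < 13. macro_v l d x 0 = (x = 1 & d)"
  unfolding all_less_13 all_less_12 macro_h_def macro_v_def by simp_all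

text \<open>In an even column the fork sends its signal either upwards, as the positive literal, or
  along the row to the next column, where it turns upwards as the negative literal.\<close>

definition choice_tile :: "bool => nat => tile" where
  "choice_tile e x = (if e then (if x = 0 then Block else if x = 1 then Fork else Split_Left)
                      else (if x <= 1 then Split_Left else Block))"

text \<open>A matrix with \<open>C\<close> rows and \<open>2 * n\<close> columns, where the columns \<open>2 * v\<close> and \<open>2 * v + 1\<close>
  stand for the literals of the variable \<open>v\<close>.\<close>

definition cnf_sat :: "nat => nat => (nat => nat => bool) => bool" where
  "cnf_sat n C lit \<longleftrightarrow> (\<exists>a. \<forall>c < C. \<exists>m < 2 * n. lit c m & (a (m div 2) = even m))"

text \<open>All ports on the frame are reached, which would act as stray signals; the blocks in
  column and row 0 swallow them. A variable takes 26 = 2 * 13 columns of tiles and a clause 12 rows;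
  the last column demands a signal from each clause.\<close>

definition layout :: "nat => (nat => nat => bool) => nat => nat => tile" where
  "layout n lit i j =
    (if i = 0 \<or> j = 0 then Block
     else if i = Suc (26 * n) then (if j \<ge> 2 & (j - 2) mod 12 = 1 then Need else Block)
     else if j = 1 then choice_tile (even ((i - 1) div 13)) ((i - 1) mod 13)
     else macro_tile (lit ((j - 2) div 12) ((i - 1) div 13)) ((i - 1) mod 13) ((j - 2) mod 12))"

lemma div_mod_macro:
  "x < 13 ==> (13 * m + x) div 13 = (m::nat)" "x < 13 ==> (13 * m + x) mod 13 = (x::nat)"
  "y < 12 ==> (12 * c + y) div 12 = (c::nat)" "y < 12 ==> (12 * c + y) mod 12 = (y::nat)"
  by simp_all

lemma layout_macro:
  assumes "m < 2 * n" "x < 13" "y < 12"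
  shows "layout n lit (13 * m + 1 + x) (12 * c + 2 + y) = macro_tile (lit c m) x y"
proof -
  have "13 * m + 1 + x ~= Suc (26 * n)" using assms by linarith
  moreover have "13 * m + 1 + x - 1 = 13 * m + x" "12 * c + 2 + y - 2 = 12 * c + y" by simp_all
  ultimately show ?thesis unfolding layout_def using div_mod_macro assms by simp
qed

lemma layout_choice:
  assumes "m < 2 * n" "x < 13"
  shows "layout n lit (13 * m + 1 + x) 1 = choice_tile (even m) x"
proof -
  have "13 * m + 1 + x ~= Suc (26 * n)" using assms by linarith
  moreover have "13 * m + 1 + x - 1 = 13 * m + x" by simp
  ultimately show ?thesis unfolding layout_def using div_mod_macro assms by simp
qed

lemma layout_sound:
  assumes S: "solves (26 * n + 2) (12 * C + 2) (layout n lit) H V"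
  shows "cnf_sat n C lit"
proof -
  have R: "rel (layout n lit i j) (H i j) (V i j) (H (i + 1) j) (V i (j + 1))" if "i < 26 * n + 2" "j < 12 * C + 2" for i j
    using S that by (simp add: solves_def)
  define h where "h = (%c m. H (13 * m + 1) (12 * c + 3))"
  define v where "v = (%c m. V (13 * m + 2) (12 * c + 2))"
  have mac: "h c (m + 1) --> h c m \<or> lit c m & v c m" "v (c + 1) m --> v c m" if "c < C" "m < 2 * n" for c m
  proof -
    let ?H = "%x y. H (13 * m + 1 + x) (12 * c + 2 + y)" and ?V = "%x y. V (13 * m + 1 + x) (12 * c + 2 + y)"
    have "\<forall>x < 13. \<forall>y < 12. rel (macro_tile (lit c m) x y) (?H x y) (?V x y) (?H (x + 1) y) (?V x (y + 1))"
    proof (intro allI impI)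
      fix x y :: nat assume xy: "x < 13" "y < 12"
      have "13 * m + 1 + x < 26 * n + 2" "12 * c + 2 + y < 12 * C + 2" using that xy by linarith+
      from R[OF this] show "rel (macro_tile (lit c m) x y) (?H x y) (?V x y) (?H (x + 1) y) (?V x (y + 1))"
        using layout_macro[OF that(2) xy, of lit c] by (simp add: add.assoc)
    qed
    from macro_sound[OF this] show "h c (m + 1) --> h c m \<or> lit c m & v c m" "v (c + 1) m --> v c m"
      unfolding h_def v_def by (simp_all add: algebra_simps numeral_eq_Suc)
  qed
  \<comment> \<open>The signal of a clause starts off behind the block and can only be switched on
    by a literal.\<close>
  have hl: "h c m --> (\<exists>m' < m. lit c m' & v c m')" if "c < C" "m <= 2 * n" for c m
    using that(2)
  proof (induction m)
    case 0
    have "\<not> H 1 (12 * c + 3)" using R[of 0 "12 * c + 3"] that by (simp add: layout_def)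
    then show ?case by (simp add: h_def)
  next
    case (Suc m)
    then show ?case using mac(1)[OF that(1), of m] by (auto simp: less_Suc_eq)
  qed
  have v0: "v c m --> v 0 m" if "c < C" "m < 2 * n" for c m
    using that(1)
  proof (induction c)
    case (Suc c)
    then show ?case using mac(2)[of c m] that by simp
  qed simp
  have hend: "h c (2 * n)" if c: "c < C" for c
  proof -
    have "(12 * c + 1) mod 12 = 1" by simp
    then have l1: "layout n lit (Suc (26 * n)) (12 * c + 3) = Need" by (simp add: layout_def)
    have l0: "layout n lit (Suc (26 * n)) (12 * c + 2) = Block" by (simp add: layout_def)
    have "\<not> V (Suc (26 * n)) (12 * c + 3)" using R[of "Suc (26 * n)" "12 * c + 2"] c l0 by (simp add: add.commute numeral_eq_Suc)
    moreover have "H (Suc (26 * n)) (12 * c + 3) \<or> V (Suc (26 * n)) (12 * c + 3)"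
      using R[of "Suc (26 * n)" "12 * c + 3"] c l1 by simp
    ultimately show ?thesis by (simp add: h_def)
  qed
  \<comment> \<open>Both literals of one variable would draw on both outputs of the same
    fork.\<close>
  have choice: "\<not> (v 0 (2 * k) & v 0 (2 * k + 1))" if k: "k < n" for k
  proof -
    let ?m = "2 * k"
    have m: "?m < 2 * n" "?m + 1 < 2 * n" using k by simp_all
    have r: "rel (choice_tile (even m) x) (H i 1) (V i 1) (H i' 1) (V i 2)"
      if "m < 2 * n" "x < 13" "i = 13 * m + 1 + x" "i' = i + 1" for m x i i'
    proof -
      have "i < 26 * n + 2" using that by linarith
      then show ?thesis using R[of i 1] layout_choice[OF that(1,2), of lit] that(3,4) by (simp add: numeral_2_eq_2)
    qed
    have fork: "\<not> (H (13 * ?m + 3) 1 & V (13 * ?m + 2) 2)"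
      using r[OF m(1), of 1 "13 * ?m + 2" "13 * ?m + 3"] by (simp add: choice_tile_def)
    have run: "x < 12 ==> H (13 * ?m + 3 + x) 1 --> H (13 * ?m + 3) 1" for x
    proof (induction x)
      case (Suc x)
      have "H (13 * ?m + 3 + Suc x) 1 --> H (13 * ?m + 3 + x) 1"
        using r[OF m(1), of "x + 2" "13 * ?m + 3 + x" "13 * ?m + 3 + Suc x"] Suc.prems by (simp add: choice_tile_def)
      then show ?case using Suc by simp
    qed simp
    have "V (13 * (?m + 1) + 2) 2 --> H (13 * (?m + 1) + 2) 1"
      using r[OF m(2), of 1 "13 * (?m + 1) + 2" "13 * (?m + 1) + 3"] by (simp add: choice_tile_def)
    moreover have "H (13 * (?m + 1) + 2) 1 --> H (13 * (?m + 1) + 1) 1"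
      using r[OF m(2), of 0 "13 * (?m + 1) + 1" "13 * (?m + 1) + 2"] by (simp add: choice_tile_def)
    moreover have "H (13 * (?m + 1) + 1) 1 --> H (13 * ?m + 3) 1"
    proof -
      have e: "13 * ?m + 3 + 11 = 13 * (?m + 1) + 1" by simp
      have "H (13 * ?m + 3 + 11) 1 --> H (13 * ?m + 3) 1" by (rule run) simp
      then show ?thesis unfolding e .
    qed
    ultimately show ?thesis using fork by (simp add: v_def numeral_2_eq_2) blast
  qed
  show ?thesis
    unfolding cnf_sat_def
  \<comment> \<open>A variable is true if its positive literal enters the first clause; by
    \<open>choice\<close>, a negative literal that enters there makes it false.\<close>
  proof (intro exI[of _ "%k. v 0 (2 * k)"] allI impI)
    fix c assume c: "c < C"
    obtain m where m: "m < 2 * n" "lit c m" "v c m" using hl[OF c order_refl] hend[OF c] by blast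
    have vm: "v 0 m" using v0[OF c m(1)] m(3) by blast
    have "v 0 (2 * (m div 2)) = even m"
    proof (cases "even m")
      case False
      then have "2 * (m div 2) + 1 = m" "m div 2 < n" using m(1) by (auto elim: oddE)
      then show ?thesis using choice[of "m div 2"] vm False by auto
    qed (use vm in auto)
    then show "\<exists>m < 2 * n. lit c m & (v 0 (2 * (m div 2)) = even m)" using m by blast
  qed
qed

lemma layout_complete:
  assumes "cnf_sat n C lit"
  obtains H V where "solves (26 * n + 2) (12 * C + 2) (layout n lit) H V"
proof -
  obtain a where a: "\<And>c. c < C ==> \<exists>m < 2 * n. lit c m & (a (m div 2) = even m)"
    using assms by (auto simp: cnf_sat_def)
  define L where "L = (%m. a (m div 2) = even (m::nat))"
  define h where "h = (%c m. \<exists>m' < m. lit c m' & L m')"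
  define H where "H = (%i j. if i = 0 \<or> j = 0 \<or> i > Suc (26 * n) then False
    else let m = (i - 1) div 13; x = (i - 1) mod 13 in
      if j = 1 then (if even m then x \<ge> 2 & \<not> L m else x <= 1 & L m)
      else macro_h (h ((j - 2) div 12) m) (L m) x ((j - 2) mod 12))"
  define V where "V = (%i j. if i = 0 \<or> j <= 1 \<or> i = Suc (26 * n) then False
    else macro_v (h ((j - 2) div 12) ((i - 1) div 13)) (L ((i - 1) div 13)) ((i - 1) mod 13) ((j - 2) mod 12))"
  have L2: "L (m + 1) = (\<not> L m)" if "even m" for m using that by (auto simp: L_def)
  have hS: "h c (m + 1) = (h c m \<or> lit c m & L m)" for c m by (auto simp: h_def less_Suc_eq)
  have Hm: "H (13 * m + 1 + x) (12 * c + 2 + y) = macro_h (h c m) (L m) x y" if "x < 13" "y < 12" "13 * m + x <= 26 * n" for m x c y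
  proof -
    have "13 * m + 1 + x - 1 = 13 * m + x" "12 * c + 2 + y - 2 = 12 * c + y" by simp_all
    then show ?thesis unfolding H_def Let_def using div_mod_macro that by simp
  qed
  have H1: "H (13 * m + 1 + x) 1 = (if even m then x \<ge> 2 & \<not> L m else x <= 1 & L m)" if "x < 13" "13 * m + x <= 26 * n" for m x
  proof -
    have "13 * m + 1 + x - 1 = 13 * m + x" by simp
    then show ?thesis unfolding H_def Let_def using div_mod_macro that by simp
  qed
  have Vm: "V (13 * m + 1 + x) (12 * c + 2 + y) = macro_v (h c m) (L m) x y" if "m < 2 * n" "x < 13" "y < 12" for m x c y
  proof -
    have "13 * m + 1 + x - 1 = 13 * m + x" "12 * c + 2 + y - 2 = 12 * c + y" "13 * m + 1 + x ~= Suc (26 * n)" using that by auto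
    then show ?thesis unfolding V_def using div_mod_macro that by simp
  qed
  have "rel (layout n lit i j) (H i j) (V i j) (H (Suc i) j) (V i (Suc j))" if ij: "i < 26 * n + 2" "j < 12 * C + 2" for i j
  proof -
    consider "i = 0" | "j = 0" | "i = Suc (26 * n)" "j > 0"
      | m x where "m < 2 * n" "x < 13" "i = 13 * m + 1 + x" "j = 1"
      | m x c y where "m < 2 * n" "x < 13" "i = 13 * m + 1 + x" "c < C" "y < 12" "j = 12 * c + 2 + y"
    proof -
      have i: "i = 13 * ((i - 1) div 13) + 1 + (i - 1) mod 13" if "i ~= 0" using that by simp
      have j: "j = 12 * ((j - 2) div 12) + 2 + (j - 2) mod 12" if "j \<ge> 2" using that by simp
      have im: "(i - 1) div 13 < 2 * n" if "i ~= 0" "i ~= Suc (26 * n)" using that ij by (simp add: less_mult_imp_div_less)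
      have jc: "(j - 2) div 12 < C" if "j \<ge> 2" using that ij by (simp add: less_mult_imp_div_less)
      consider "i = 0" | "j = 0" | "i = Suc (26 * n)" "j > 0" | "i ~= 0" "i ~= Suc (26 * n)" "j = 1" | "i ~= 0" "i ~= Suc (26 * n)" "j \<ge> 2" by linarith
      then show thesis
      proof cases
        case 4 then show thesis using that(4)[of "(i - 1) div 13" "(i - 1) mod 13"] i im by simp
      next
        case 5 then show thesis using that(5)[of "(i - 1) div 13" "(i - 1) mod 13" "(j - 2) div 12" "(j - 2) mod 12"] i j im jc by simp
      qed (use that in blast)+
    qed
    then show ?thesis
    proof cases
      case 1
      have "\<not> H (13 * 0 + 1 + 0) j"
      proof -
        consider "j = 0" | "j = 1" | c y where "j = 12 * c + 2 + y" "y < 12"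
        proof -
          have "j = 12 * ((j - 2) div 12) + 2 + (j - 2) mod 12" if "j \<ge> 2" using that by simp
          then show thesis using that(1,2) that(3)[of "(j - 2) div 12" "(j - 2) mod 12"] by linarith
        qed
        then show ?thesis
        proof cases
          case 1 then show ?thesis by (simp add: H_def)
        next
          case 2 then show ?thesis using H1[of 0 0] by simp
        next
          case (3 c y) then show ?thesis using Hm[of 0 y 0 c] macro_boundary(1) by (simp add: h_def)
        qed
      qed
      then show ?thesis using 1 by (simp add: layout_def V_def)
    next
      case 2
      then show ?thesis by (simp add: layout_def H_def V_def)
    next
      case 3
      have o: "\<not> H (Suc i) j" "\<not> V i (Suc j)" using 3 by (simp_all add: H_def V_def)
      show ?thesis
      proof (cases "j \<ge> 2 & (j - 2) mod 12 = 1")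
        case True
        define c where "c = (j - 2) div 12"
        have j: "j = 12 * c + 2 + 1"
        proof -
          have "j - 2 = 12 * c + 1" using True unfolding c_def by (metis mult_div_mod_eq)
          then show ?thesis using True by simp
        qed
        then have "c < C" using ij by simp
        then have "h c (2 * n)" using a by (auto simp: h_def L_def)
        moreover have "H (13 * (2 * n) + 1 + 0) (12 * c + 2 + 1) = macro_h (h c (2 * n)) (L (2 * n)) 0 1" by (rule Hm) simp_all
        ultimately have "H i j" using 3 j macro_boundary(1) by simp
        then show ?thesis using 3 True o by (simp add: layout_def)
      next
        case False
        then show ?thesis using 3 o by (auto simp: layout_def)
      qed
    next
      case (4 m x)
      have Hi: "H i 1 = (if even m then x \<ge> 2 & \<not> L m else x <= 1 & L m)" using H1[of x m] 4 by simp
      have Hs: "H (Suc i) 1 = (if x = 12 then even m & \<not> L m else if even m then x \<ge> 1 & \<not> L m else x = 0 & L m)"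
      proof (cases "x = 12")
        case True
        have "H (13 * (m + 1) + 1 + 0) 1 = (if even (m + 1) then 0 \<ge> (2::nat) & \<not> L (m + 1) else L (m + 1))"
          using H1[of 0 "m + 1"] 4 by simp
        then show ?thesis using True 4 L2[of m] by (auto simp: algebra_simps)
      next
        case False
        have "H (13 * m + 1 + (x + 1)) 1 = (if even m then x + 1 \<ge> 2 & \<not> L m else x + 1 <= 1 & L m)"
          using H1[of "x + 1" m] 4 False by simp
        then show ?thesis using False 4 by auto
      qed
      have Vi: "\<not> V i 1" by (simp add: V_def)
      have Vs: "V i 2 = (x = 1 & L m)" using Vm[of m x 0 0] 4 macro_boundary(2) by (simp add: numeral_2_eq_2)
      have "layout n lit i j = choice_tile (even m) x" using layout_choice[OF 4(1,2), of lit] 4 by simp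
      then show ?thesis using Hi Hs Vi Vs 4 by (auto simp: choice_tile_def numeral_2_eq_2 split: if_splits)
    next
      case (5 m x c y)
      have lay: "layout n lit i j = macro_tile (lit c m) x y" using layout_macro[OF 5(1,2,5), of lit c] 5 by simp
      have Hi: "H i j = macro_h (h c m) (L m) x y" using Hm[of x y m c] 5 by simp
      have Vi: "V i j = macro_v (h c m) (L m) x y" using Vm[of m x y c] 5 by simp
      have Hs: "H (Suc i) j = (if x = 12 then y = 1 & (h c m \<or> lit c m & L m) else macro_h (h c m) (L m) (x + 1) y)"
      proof (cases "x = 12")
        case True
        then have "Suc i = 13 * (m + 1) + 1 + 0" using 5 by simp
        moreover have "H (13 * (m + 1) + 1 + 0) (12 * c + 2 + y) = macro_h (h c (m + 1)) (L (m + 1)) 0 y"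
          by (rule Hm) (use 5 in simp_all)
        ultimately show ?thesis using True 5 macro_boundary(1) hS by simp
      next
        case False
        then have "Suc i = 13 * m + 1 + (x + 1)" using 5 by simp
        moreover have "H (13 * m + 1 + (x + 1)) (12 * c + 2 + y) = macro_h (h c m) (L m) (x + 1) y"
          by (rule Hm) (use 5 False in simp_all)
        ultimately show ?thesis using False 5 by simp
      qed
      have Vs: "V i (Suc j) = (if y = 11 then x = 1 & L m else macro_v (h c m) (L m) x (y + 1))"
      proof (cases "y = 11")
        case True
        then have "Suc j = 12 * (c + 1) + 2 + 0" using 5 by simp
        moreover have "V (13 * m + 1 + x) (12 * (c + 1) + 2 + 0) = macro_v (h (c + 1) m) (L m) x 0"
          by (rule Vm) (use 5 in simp_all)
        ultimately show ?thesis using True 5 macro_boundary(2) by simp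
      next
        case False
        then have "Suc j = 12 * c + 2 + (y + 1)" using 5 by simp
        moreover have "V (13 * m + 1 + x) (12 * c + 2 + (y + 1)) = macro_v (h c m) (L m) x (y + 1)"
          by (rule Vm) (use 5 False in simp_all)
        ultimately show ?thesis using False 5 by simp
      qed
      have "rel (macro_tile (lit c m) x y) (macro_h (h c m) (L m) x y) (macro_v (h c m) (L m) x y)
          (if x = 12 then y = 1 & (h c m \<or> lit c m & L m) else macro_h (h c m) (L m) (x + 1) y)
          (if y = 11 then x = 1 & L m else macro_v (h c m) (L m) x (y + 1))"
        using macro_complete 5 by blast
      then show ?thesis unfolding lay Hi Vi Hs Vs .
    qed
  qed
  then show thesis by (intro that[of H V]) (simp add: solves_def)
qed

section \<open>Spiral trees for the restricting angle \<open>\<pi> / 4\<close>\<close>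

text \<open>As \<open>tan (\<pi> / 4) = 1\<close>, the logarithm of the moving point relative to the
  root follows a straight line in this direction.\<close>

definition turn :: "side => complex" where
  "turn s = (case s of Right_Side => -1 + \<i> | Left_Side => -1 - \<i>)"

lemma norm_turn: "norm (turn s) = sqrt 2"
  by (cases s) (simp_all add: turn_def cmod_def)

lemma Re_turn [simp]: "Re (turn s) = -1"
  by (cases s) (simp_all add: turn_def)

lemma spiral_exp: "spiral r (pi / 4) s p t = r + (p - r) * exp (of_real t * turn s)"
proof -
  have t: "tan (- (pi / 4)) = -1" using tan_45 by (simp only: tan_minus)
  have a: "rcis (cmod (p - r) * exp (- t)) (Arg (p - r) + \<theta>) = (p - r) * exp (complex_of_real (- t) + \<i> * of_real \<theta>)" for \<theta>
  proof -
    have "rcis (cmod (p - r) * exp (- t)) (Arg (p - r) + \<theta>) = rcis (cmod (p - r)) (Arg (p - r)) * rcis (exp (- t)) \<theta>"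
      by (simp add: rcis_mult)
    also have "\<dots> = (p - r) * rcis (exp (- t)) \<theta>" by (simp only: rcis_cmod_Arg)
    also have "rcis (exp (- t)) \<theta> = exp (complex_of_real (- t)) * exp (\<i> * of_real \<theta>)"
      by (simp only: rcis_def cis_conv_exp exp_of_real)
    finally show ?thesis by (simp only: exp_add)
  qed
  show ?thesis
  proof (cases s)
    case Right_Side
    have "complex_of_real (- t) + \<i> * of_real t = of_real t * turn s" by (simp add: Right_Side turn_def algebra_simps)
    then show ?thesis using a[of t] by (simp add: Right_Side right_spiral_def tan_45)
  next
    case Left_Side
    have "complex_of_real (- t) + \<i> * of_real (- t) = of_real t * turn s" by (simp add: Left_Side turn_def algebra_simps)
    then show ?thesis using a[of "- t"] by (simp add: Left_Side left_spiral_def right_spiral_def tan_45)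
  qed
qed

lemma norm_spiral: "cmod (spiral r (pi / 4) s p t - r) = cmod (p - r) * exp (- t)"
  by (simp add: spiral_exp norm_mult norm_exp_eq_Re)

lemma norm_spiral_derivative:
  "norm (vector_derivative (spiral r (pi / 4) s p) (at t)) = sqrt 2 * cmod (p - r) * exp (- t)"
proof -
  have "((%t. r + (p - r) * exp (of_real t * turn s)) has_vector_derivative (p - r) * (turn s * exp (of_real t * turn s))) (at t)"
    by (auto intro!: derivative_eq_intros has_vector_derivative_real_field simp: algebra_simps)
  moreover have "spiral r (pi / 4) s p = (%t. r + (p - r) * exp (of_real t * turn s))"
    using spiral_exp by blast
  ultimately show ?thesis
    by (simp add: vector_derivative_at norm_mult norm_exp_eq_Re norm_turn)
qed

text \<open>The speed on the spiral is \<open>sqrt 2\<close> times the rate at which the radius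
  shrinks; this holds up to the limit point as well.\<close>

lemma seg_length_eq:
  assumes "valid_segment r \<sigma>"
  shows "seg_length r (pi / 4) \<sigma> = sqrt 2 * (cmod (seg_start \<sigma> - r) - cmod (seg_end r (pi / 4) \<sigma> - r))"
proof -
  obtain s p e where \<sigma>: "\<sigma> = Segment s p e" by (cases \<sigma>)
  let ?c = "sqrt 2 * cmod (p - r)"
  show ?thesis
  proof (cases e)
    case None
    have "((%t. exp (- 1 * t)) has_integral exp (- 1 * 0) / 1) {0::real..}"
      by (rule has_integral_exp_minus_to_infinity) simp
    then have "((%t. ?c * exp (- t)) has_integral ?c * 1) {0..}"
      by (intro has_integral_mult_right) simp
    then have "integral {0..} (%t. ?c * exp (- t)) = ?c * 1" by (rule integral_unique)
    then show ?thesis using None \<sigma> by (simp only: seg_length.simps seg_domain.simps norm_spiral_derivative segment.sel seg_end.simps) simp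
  next
    case (Some T)
    have T: "T > 0" using assms \<sigma> Some by simp
    have "((%t. ?c * exp (- t)) has_integral (- ?c * exp (- T)) - (- ?c * exp (- 0))) {0..T}"
      by (rule fundamental_theorem_of_calculus)
         (use T in \<open>auto intro!: derivative_eq_intros simp: has_real_derivative_iff_has_vector_derivative[symmetric]\<close>)
    then have "integral {0..T} (%t. ?c * exp (- t)) = (- ?c * exp (- T)) - (- ?c * exp (- 0))" by (rule integral_unique)
    then show ?thesis using Some \<sigma>
      by (simp only: seg_length.simps seg_domain.simps norm_spiral_derivative segment.sel seg_end.simps norm_spiral) (simp add: algebra_simps)
  qed
qed

text \<open>The radii telescope, so only the ends of an arc matter for its length.\<close>

lemma arc_length_eq:
  "is_arc r (pi / 4) p \<sigma>s q ==> arc_length r (pi / 4) \<sigma>s = sqrt 2 * (cmod (p - r) - cmod (q - r))"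
proof (induction r "pi / 4" p \<sigma>s q rule: is_arc.induct)
  case (2 r p \<sigma> q)
  then show ?case using seg_length_eq[of r \<sigma>] by (auto simp: arc_length_def)
next
  case (3 r p \<sigma> \<tau> \<sigma>s q)
  then show ?case using seg_length_eq[of r \<sigma>] by (auto simp: arc_length_def algebra_simps)
qed simp

section \<open>Reachability along spirals\<close>

text \<open>\<open>x\<close> and \<open>y\<close> are twice the parameters spent on left and on
  right spirals. Exponentials commute, so the order of the segments does not matter, and the
  reachable points form a quadrant in logarithmic coordinates.\<close>

definition spiral_reach :: "complex => complex => complex => bool" where
  "spiral_reach r p q \<longleftrightarrow> p ~= r & (\<exists>x y. x \<ge> 0 & y \<ge> 0 &
     q - r = (p - r) * exp (- Complex ((x + y) / 2) ((x - y) / 2)))"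

lemma spiral_reach_trans: "spiral_reach r p q ==> spiral_reach r q q' ==> spiral_reach r p q'"
  unfolding spiral_reach_def
proof (elim conjE exE, intro conjI)
  fix x y x' y'
  assume "p ~= r" "0 <= x" "0 <= y" "q - r = (p - r) * exp (- Complex ((x + y) / 2) ((x - y) / 2))"
    "0 <= x'" "0 <= y'" "q' - r = (q - r) * exp (- Complex ((x' + y') / 2) ((x' - y') / 2))"
  moreover have "- Complex ((x + y) / 2) ((x - y) / 2) + - Complex ((x' + y') / 2) ((x' - y') / 2) =
      - Complex (((x + x') + (y + y')) / 2) (((x + x') - (y + y')) / 2)"
    by (simp add: complex_eq_iff field_simps)
  ultimately show "\<exists>x y. x \<ge> 0 & y \<ge> 0 & q' - r = (p - r) * exp (- Complex ((x + y) / 2) ((x - y) / 2))"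
    by (intro exI[of _ "x + x'"] exI[of _ "y + y'"]) (simp add: mult.assoc flip: exp_add)
qed simp

lemma segment_reach:
  assumes "valid_segment r \<sigma>" "seg_end r (pi / 4) \<sigma> ~= r"
  shows "spiral_reach r (seg_start \<sigma>) (seg_end r (pi / 4) \<sigma>)"
proof -
  obtain s p T where \<sigma>: "\<sigma> = Segment s p (Some T)" "p ~= r" "T > 0"
  proof -
    obtain s p e where "\<sigma> = Segment s p e" by (cases \<sigma>)
    then show thesis using that assms by (cases e) auto
  qed
  show ?thesis
  proof (cases s)
    case Right_Side
    have "of_real T * turn s = - Complex ((0 + 2 * T) / 2) ((0 - 2 * T) / 2)"
      using Right_Side by (simp add: turn_def complex_eq_iff)
    then show ?thesis using \<sigma> unfolding spiral_reach_def
      by (intro conjI exI[of _ 0] exI[of _ "2 * T"]) (simp_all add: spiral_exp)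
  next
    case Left_Side
    have "of_real T * turn s = - Complex ((2 * T + 0) / 2) ((2 * T - 0) / 2)"
      using Left_Side by (simp add: turn_def complex_eq_iff)
    then show ?thesis using \<sigma> unfolding spiral_reach_def
      by (intro conjI exI[of _ "2 * T"] exI[of _ 0]) (simp_all add: spiral_exp)
  qed
qed

lemma is_arc_start: "is_arc r a p \<sigma>s q ==> p ~= r"
  by (induction r a p \<sigma>s q rule: is_arc.induct) (auto elim!: valid_segment.elims)

lemma arc_reach: "is_arc r (pi / 4) p \<sigma>s q ==> q ~= r ==> spiral_reach r p q"
proof (induction r "pi / 4" p \<sigma>s q rule: is_arc.induct)
  case (2 r p \<sigma> q)
  then show ?case using segment_reach[of r \<sigma>] by auto
next
  case (3 r p \<sigma> \<tau> \<sigma>s q)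
  have "seg_end r (pi / 4) \<sigma> ~= r" using 3(2) is_arc_start by (simp only: is_arc.simps) blast
  then show ?case using 3 segment_reach[of r \<sigma>] spiral_reach_trans by auto
qed simp

lemma arc_norm_le: "is_arc r (pi / 4) p \<sigma>s q ==> cmod (q - r) <= cmod (p - r)"
proof (cases "q = r")
  case False
  assume "is_arc r (pi / 4) p \<sigma>s q"
  from arc_reach[OF this False] obtain x y where "x \<ge> 0" "y \<ge> 0"
    "q - r = (p - r) * exp (- Complex ((x + y) / 2) ((x - y) / 2))" by (auto simp: spiral_reach_def)
  then show ?thesis by (simp add: norm_mult norm_exp_eq_Re mult_left_le)
qed simp

lemma arc_to_root: "p ~= r ==> \<exists>\<sigma>s. is_arc r (pi / 4) p \<sigma>s r"
  by (rule exI[of _ "[Segment Right_Side p None]"]) simp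

text \<open>One left segment followed by one right segment suffices. The cases arise because a
  segment must have a positive parameter and an arc at least one segment; the latter is also why
  \<open>q\<close> must differ from \<open>p\<close>.\<close>

lemma reach_arc:
  assumes "spiral_reach r p q" "q ~= p"
  shows "\<exists>\<sigma>s. is_arc r (pi / 4) p \<sigma>s q"
proof -
  obtain x y where xy: "p ~= r" "x \<ge> 0" "y \<ge> 0" and q: "q - r = (p - r) * exp (- Complex ((x + y) / 2) ((x - y) / 2))"
    using assms by (auto simp: spiral_reach_def)
  have L: "of_real (x / 2) * turn Left_Side = - Complex (x / 2) (x / 2)"
    and R: "of_real (y / 2) * turn Right_Side = - Complex (y / 2) (- y / 2)"
    by (simp_all add: turn_def complex_eq_iff)
  let ?m = "spiral r (pi / 4) Left_Side p (x / 2)"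
  have m: "?m - r = (p - r) * exp (- Complex (x / 2) (x / 2))" by (simp only: spiral_exp L) simp
  have mr: "?m ~= r" using m xy by (metis exp_not_eq_zero mult_eq_0_iff right_minus_eq)
  have e: "spiral r (pi / 4) Right_Side ?m (y / 2) = q"
  proof -
    have "- Complex (x / 2) (x / 2) + - Complex (y / 2) (- y / 2) = - Complex ((x + y) / 2) ((x - y) / 2)"
      by (simp add: complex_eq_iff field_simps)
    then have "(?m - r) * exp (- Complex (y / 2) (- y / 2)) = q - r" unfolding m q by (simp add: mult.assoc flip: exp_add)
    then show ?thesis by (simp only: spiral_exp[of r Right_Side] R) (simp add: algebra_simps)
  qed
  have sp0: "spiral r (pi / 4) s p 0 = p" for s p by (simp add: spiral_exp)
  show ?thesis
  proof (cases "x = 0"; cases "y = 0")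
    assume "x = 0" "y = 0"
    then have "q = p" using q by (simp add: zero_complex.code[symmetric])
    then show ?thesis using assms by simp
  next
    assume h: "x = 0" "y ~= 0"
    then have "?m = p" using sp0[of Left_Side] by (simp del: spiral.simps)
    then show ?thesis using e h xy by (intro exI[of _ "[Segment Right_Side p (Some (y / 2))]"]) simp
  next
    assume h: "x ~= 0" "y = 0"
    then have "?m = q" using e sp0[of Right_Side] by (simp del: spiral.simps)
    then show ?thesis using h xy by (intro exI[of _ "[Segment Left_Side p (Some (x / 2))]"]) simp
  next
    assume h: "x ~= 0" "y ~= 0"
    then show ?thesis using e mr xy
      by (intro exI[of _ "[Segment Left_Side p (Some (x / 2)), Segment Right_Side ?m (Some (y / 2))]"]) simp
  qed
qed

lemma tree_length_eq:
  assumes "spiral_tree r ts (pi / 4) T"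
  shows "tree_length r (pi / 4) T = sqrt 2 * (\<Sum>v \<in> nodes T - {r}. cmod (v - r) - cmod (parent T v - r))"
proof -
  have "tree_length r (pi / 4) T = (\<Sum>v \<in> nodes T - {r}. sqrt 2 * (cmod (v - r) - cmod (parent T v - r)))"
    unfolding tree_length_def
    by (rule sum.cong[OF refl]) (use assms arc_length_eq in \<open>auto simp: spiral_tree_def\<close>)
  then show ?thesis by (simp add: sum_distrib_left)
qed

section \<open>Trees from forests\<close>

text \<open>Nodes of a finite forest may be placed at the same point without increasing the length.\<close>

lemma tree_of_forest:
  fixes I :: "'i set" and \<pi> :: "'i => complex" and par :: "'i => 'i option" and dep :: "'i => nat"
  assumes fin: "finite I"
    and par: "\<And>i j. i \<in> I ==> par i = Some j ==> j \<in> I & dep j < dep i & spiral_reach r (\<pi> i) (\<pi> j)"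
    and root: "\<And>i. i \<in> I ==> \<pi> i ~= r"
    and ts: "set ts \<subseteq> insert r (\<pi> ` I)"
  defines "val \<equiv> %i. cmod (\<pi> i - r)"
  shows "\<exists>T. spiral_tree r ts (pi / 4) T & nodes T = insert r (\<pi> ` I) &
    tree_length r (pi / 4) T <= sqrt 2 * (\<Sum>i \<in> I. val i - (case par i of None => 0 | Some j => val j))"
proof -
  \<comment> \<open>Among the indices at one point, one of least depth is kept. Its parent has
    smaller depth and therefore lies at another point, and depths still decrease along the new
    parents.\<close>
  define low where "low = (%q. arg_min dep (%i. i \<in> I & \<pi> i = q))"
  have low: "low q \<in> I & \<pi> (low q) = q" "\<And>i. i \<in> I ==> \<pi> i = q ==> dep (low q) <= dep i" if q: "q \<in> \<pi> ` I" for q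
  proof -
    obtain i where i: "i \<in> I & \<pi> i = q" using q by auto
    show "low q \<in> I & \<pi> (low q) = q" unfolding low_def using arg_min_natI[of "%i. i \<in> I & \<pi> i = q", OF i] by simp
    show "dep (low q) <= dep i" if "i \<in> I" "\<pi> i = q" for i unfolding low_def using arg_min_nat_le[of "%i. i \<in> I & \<pi> i = q" i dep] that by simp
  qed
  define p where "p = (%q. case par (low q) of None => r | Some j => \<pi> j)"
  have p: "p q \<in> insert r (\<pi> ` I) & cmod (p q - r) <= cmod (q - r) & (\<exists>\<sigma>s. is_arc r (pi / 4) q \<sigma>s (p q)) &
      (p q = r \<or> dep (low (p q)) < dep (low q))" if q: "q \<in> \<pi> ` I" for q
  proof (cases "par (low q)")
    case None
    then show ?thesis using arc_to_root[of q r] root low[OF q] by (auto simp: p_def)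
  next
    case (Some j)
    note l = low(1)[OF q]
    note j = par[OF _ Some]
    have pq: "p q = \<pi> j" using Some by (simp add: p_def)
    have "\<pi> j ~= q" using low(2)[OF q, of j] j l by auto
    then have "\<exists>\<sigma>s. is_arc r (pi / 4) q \<sigma>s (\<pi> j)" using reach_arc[of r q "\<pi> j"] j l by auto
    moreover have "dep (low (\<pi> j)) < dep (low q)" using low(2)[of "\<pi> j" j] j l by fastforce
    ultimately show ?thesis using pq j l arc_norm_le by auto
  qed
  define T where "T = \<lparr>nodes = insert r (\<pi> ` I), parent = p, out_arc = (%q. SOME \<sigma>s. is_arc r (pi / 4) q \<sigma>s (p q))\<rparr>"
  have rI: "r \<notin> \<pi> ` I" using root by auto
  have T: "spiral_tree r ts (pi / 4) T"
    unfolding spiral_tree_def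
  proof (intro conjI ballI)
    show "finite (nodes T)" "r \<in> nodes T" "set ts \<subseteq> nodes T" using fin ts by (auto simp: T_def)
    fix v assume v: "v \<in> nodes T - {r}"
    then have v': "v \<in> \<pi> ` I" by (auto simp: T_def)
    show "parent T v \<in> nodes T" using p[OF v'] by (auto simp: T_def)
    show "is_arc r (pi / 4) v (out_arc T v) (parent T v)" using p[OF v'] by (auto simp: T_def intro: someI_ex)
  next
    fix v assume "v \<in> nodes T"
    then show "\<exists>k. (parent T ^^ k) v = r"
    proof (induction "dep (low v)" arbitrary: v rule: less_induct)
      case less
      show ?case
      proof (cases "v = r")
        case True then show ?thesis by (intro exI[of _ 0]) simp
      next
        case False
        then have v: "v \<in> \<pi> ` I" using less.prems by (auto simp: T_def)
        have pv: "parent T v = p v" by (simp add: T_def)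
        show ?thesis
        proof (cases "p v = r")
          case True then show ?thesis by (intro exI[of _ 1]) (simp add: pv)
        next
          case False
          then obtain k where "(parent T ^^ k) (p v) = r"
            using less.hyps[of "p v"] p[OF v] by (auto simp: T_def)
          then show ?thesis by (intro exI[of _ "Suc k"]) (simp add: funpow_swap1 pv del: funpow.simps add: funpow_Suc_right)
        qed
      qed
    qed
  qed
  let ?d = "%i. val i - (case par i of None => 0 | Some j => val j)"
  have d0: "?d i \<ge> 0" if "i \<in> I" for i
  proof (cases "par i")
    case (Some j)
    from par[OF that Some] obtain x y where "x \<ge> 0" "y \<ge> 0"
      "\<pi> j - r = (\<pi> i - r) * exp (- Complex ((x + y) / 2) ((x - y) / 2))" by (auto simp: spiral_reach_def)
    then have "val j <= val i" by (simp add: val_def norm_mult norm_exp_eq_Re mult_left_le)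
    then show ?thesis using Some by simp
  qed (simp add: val_def)
  have "(\<Sum>v \<in> nodes T - {r}. cmod (v - r) - cmod (parent T v - r)) = (\<Sum>v \<in> \<pi> ` I. ?d (low v))"
    by (rule sum.cong) (use rI low in \<open>auto simp: T_def p_def val_def split: option.splits\<close>)
  also have "\<dots> = sum ?d (low ` \<pi> ` I)"
    by (rule sum.reindex_cong[symmetric]) (use low in \<open>auto intro!: inj_on_inverseI[of _ \<pi>]\<close>)
  \<comment> \<open>The indices that were dropped contribute nonnegative terms.\<close>
  also have "\<dots> <= sum ?d I"
    by (rule sum_mono2) (use fin low d0 in auto)
  finally have "tree_length r (pi / 4) T <= sqrt 2 * sum ?d I"
    by (simp add: tree_length_eq[OF T] mult_left_mono)
  then show ?thesis using T by (intro exI[of _ T]) (simp add: T_def)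
qed

section \<open>Lattice points in logarithmic coordinates\<close>

text \<open>Terminals are lattice points close to \<open>(D, D)\<close>, seen from the far away root at the origin. In the
  coordinates of \<open>pt\<close>, which are logarithmic polar coordinates turned by 45 degrees, spirals are
  parallel to the axes, and lattice points nearly form a lattice of mesh width \<open>1 / D\<close>.\<close>

lemma half_diff_le: "a - p <= e ==> b - q <= e ==> (a + b) / 2 - (p + q) / 2 <= (e::real)"
  by (simp add: field_simps)

lemma half_le: "p <= m ==> q <= m ==> 0 <= e ==> ((p - e) + (q - e)) / 2 <= (m::real)"
  by simp

text \<open>The error of an arc is of order \<open>M ^ 2 / D\<close>. In \<open>lower\<close> a tree
  has at most \<open>card X ^ 2\<close> nodes besides the root, in \<open>upper\<close> at most
  \<open>C + 1 + card X\<close>; the last factor covers both counts, and 200 leaves room for the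
  estimates.\<close>

locale far_root =
  fixes D :: real and M :: nat and X :: "cell set" and C :: nat
  assumes X: "finite X" "X ~= {}" "\<And>c. c \<in> X ==> 0 <= fst c & fst c <= int M & 0 <= snd c & snd c <= int M"
    and M1: "M \<ge> 1"
    and D: "D \<ge> 200 * (real M)\<^sup>2 * ((real (card X))\<^sup>2 + real C + 2)"
begin

definition r :: complex where "r = 0"

definition grid_point :: "cell => complex" where
  "grid_point c = Complex (D + of_int (fst c)) (D + of_int (snd c))"

definition pt :: "real => real => complex" where
  "pt x y = r + Complex D D * exp (Complex ((x + y) / 2) ((x - y) / 2))"

text \<open>The lattice point \<open>(D + a, D + b)\<close> divided by \<open>(D, D)\<close> as
  complex numbers is \<open>1 + off c\<close>; its logarithm gives the coordinates for
  \<open>pt\<close>.\<close>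

definition off :: "cell => complex" where
  "off c = Complex ((of_int (fst c) + of_int (snd c)) / (2 * D)) ((of_int (snd c) - of_int (fst c)) / (2 * D))"

text \<open>With this choice of signs \<open>lx\<close> approximates the second coordinate and
  \<open>ly\<close> the first one, both scaled by \<open>1 / D\<close>.\<close>

definition lx :: "cell => real" where "lx c = Re (Ln (1 + off c)) + Im (Ln (1 + off c))"
definition ly :: "cell => real" where "ly c = Re (Ln (1 + off c)) - Im (Ln (1 + off c))"

text \<open>The logarithm of \<open>1 + z\<close> differs from \<open>z\<close> by at most twice the
  square of \<open>cmod z\<close>, and \<open>cmod z\<close> is at most \<open>M / D\<close>. A
  coordinate combines a real and an imaginary part, which doubles the error.\<close>

definition err :: real where "err = 4 * (real M)\<^sup>2 / D\<^sup>2"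

lemma D_bounds: "D > 0" "D \<ge> 400 * (real M)\<^sup>2" "400 * real M <= D" "err \<ge> 0" "err < 1 / (2 * D)" "err <= 1 / 100"
proof -
  have m: "(real M)\<^sup>2 \<ge> real M" "real M \<ge> 1" using M1 by (simp_all add: power2_eq_square)
  have "200 * (real M)\<^sup>2 * 2 <= 200 * (real M)\<^sup>2 * ((real (card X))\<^sup>2 + real C + 2)"
    by (intro mult_left_mono) auto
  then show b: "D \<ge> 400 * (real M)\<^sup>2" using D by simp
  then show "D > 0" "400 * real M <= D" using m by linarith+
  then have D0: "D > 0" by simp
  show "err \<ge> 0" by (simp add: err_def)
  have "4 * (real M)\<^sup>2 * (2 * D) < D\<^sup>2"
  proof -
    have "8 * (real M)\<^sup>2 < D" using b m by linarith
    then have "8 * (real M)\<^sup>2 * D < D * D" using D0 by (intro mult_strict_right_mono)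
    then show ?thesis by (simp add: power2_eq_square)
  qed
  then show e: "err < 1 / (2 * D)" using D0 by (simp add: err_def field_simps)
  have "50 <= D" using b m by linarith
  then have "1 / (2 * D) <= 1 / 100" using D0 by (simp add: field_simps)
  then show "err <= 1 / 100" using e by linarith
qed

lemma r_ne: "pt x y ~= r"
proof -
  have "Complex D D ~= 0" using D_bounds(1) by (simp add: complex_eq_iff)
  then show ?thesis by (simp add: pt_def)
qed

lemma norm_pt: "cmod (pt x y - r) = sqrt 2 * (D * exp ((x + y) / 2))"
proof -
  have "cmod (Complex D D) = sqrt 2 * D" using D_bounds(1) by (simp add: cmod_def real_sqrt_mult flip: mult_2)
  then show ?thesis by (simp add: pt_def norm_mult norm_exp_eq_Re)
qed

lemma pt_reach: "x' <= x ==> y' <= y ==> spiral_reach r (pt x y) (pt x' y')"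
  unfolding spiral_reach_def
proof (intro conjI exI)
  show "pt x' y' - r = (pt x y - r) * exp (- Complex (((x - x') + (y - y')) / 2) (((x - x') - (y - y')) / 2))"
  proof -
    have "Complex ((x' + y') / 2) ((x' - y') / 2) = Complex ((x + y) / 2) ((x - y) / 2) + - Complex (((x - x') + (y - y')) / 2) (((x - x') - (y - y')) / 2)"
      by (simp add: complex_eq_iff field_simps)
    then show ?thesis by (simp only: pt_def exp_add) (simp add: mult.assoc)
  qed
qed (use r_ne in auto)

lemma reach_pt:
  assumes "spiral_reach r (pt x y) q"
  obtains x' y' where "x' <= x" "y' <= y" "q = pt x' y'"
proof -
  obtain a b where ab: "a \<ge> 0" "b \<ge> 0" and q: "q - r = (pt x y - r) * exp (- Complex ((a + b) / 2) ((a - b) / 2))"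
    using assms by (auto simp: spiral_reach_def)
  have "Complex ((x + y) / 2) ((x - y) / 2) + - Complex ((a + b) / 2) ((a - b) / 2) = Complex (((x - a) + (y - b)) / 2) (((x - a) - (y - b)) / 2)"
    by (simp add: complex_eq_iff field_simps)
  then have "q - r = Complex D D * exp (Complex (((x - a) + (y - b)) / 2) (((x - a) - (y - b)) / 2))"
    unfolding q by (simp add: pt_def mult.assoc flip: exp_add)
  then show ?thesis using that[of "x - a" "y - b"] ab by (simp add: pt_def algebra_simps)
qed

text \<open>Spirals wind around the root, so a point determines its coordinates only up to full
  turns, which raise one coordinate and lower the other.\<close>

lemma pt_eqD:
  assumes "pt x y = pt x' y'"
  obtains k :: int where "x - x' = 2 * pi * of_int k" "y' - y = 2 * pi * of_int k"
proof -
  have "Complex D D ~= 0" using D_bounds(1) by (simp add: complex_eq_iff)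
  then have "exp (Complex ((x + y) / 2) ((x - y) / 2)) = exp (Complex ((x' + y') / 2) ((x' - y') / 2))"
    using assms by (simp add: pt_def)
  then obtain n :: int where n: "Complex ((x + y) / 2) ((x - y) / 2) = Complex ((x' + y') / 2) ((x' - y') / 2) + of_int (2 * n) * pi * \<i>"
    by (auto simp: exp_eq)
  have "(x + y) / 2 = (x' + y') / 2" using arg_cong[OF n, of Re] by simp
  moreover have "(x - y) / 2 = (x' - y') / 2 + 2 * of_int n * pi" using arg_cong[OF n, of Im] by simp
  ultimately show ?thesis by (intro that[of n]) (simp_all add: field_simps)
qed

lemma grid_point_pt:
  assumes "c \<in> X"
  shows "pt (lx c) (ly c) = grid_point c" "\<bar>lx c - of_int (snd c) / D\<bar> <= err" "\<bar>ly c - of_int (fst c) / D\<bar> <= err"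
proof -
  obtain a b where c: "c = (a, b)" by (cases c)
  have ab: "0 <= a" "a <= int M" "0 <= b" "b <= int M" using X(3)[OF assms] c by auto
  define x y where "x = real_of_int a" and "y = real_of_int b"
  have xy: "0 <= x" "x <= real M" "0 <= y" "y <= real M" using ab by (auto simp: x_def y_def)
  have D0: "D > 0" by (rule D_bounds)
  have "(cmod (off c))\<^sup>2 = ((x + y) / (2 * D))\<^sup>2 + ((y - x) / (2 * D))\<^sup>2"
    by (simp add: off_def cmod_power2 c x_def y_def)
  also have "\<dots> = (x\<^sup>2 + y\<^sup>2) / (2 * D\<^sup>2)"
    using D0 by (simp add: power_divide field_simps power2_eq_square)
  also have "\<dots> <= ((real M)\<^sup>2 + (real M)\<^sup>2) / (2 * D\<^sup>2)"
    using xy by (intro divide_right_mono add_mono power_mono) auto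
  finally have n2: "(cmod (off c))\<^sup>2 <= (real M / D)\<^sup>2" by (simp add: power_divide)
  then have n1: "cmod (off c) <= real M / D" using D0 by (simp add: abs_le_square_iff[symmetric] power2_le_iff_abs_le)
  also have "\<dots> <= 1 / 2" using D_bounds(3) D0 by (simp add: field_simps)
  finally have half: "cmod (off c) <= 1 / 2" .
  have "cmod (Ln (1 + off c) - off c) <= (cmod (off c))\<^sup>2 / (1 - cmod (off c))"
    using half by (intro Ln_approx_linear) auto
  also have "\<dots> <= (cmod (off c))\<^sup>2 / (1 / 2)" using half by (intro divide_left_mono) auto
  also have "\<dots> <= 2 * (real M / D)\<^sup>2" using n2 by simp
  finally have d: "cmod (Ln (1 + off c) - off c) <= err / 2" by (simp add: err_def power_divide)
  have "\<bar>Re (Ln (1 + off c)) - (x + y) / (2 * D)\<bar> <= err / 2" "\<bar>Im (Ln (1 + off c)) - (y - x) / (2 * D)\<bar> <= err / 2"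
    using abs_Re_le_cmod[of "Ln (1 + off c) - off c"] abs_Im_le_cmod[of "Ln (1 + off c) - off c"] d
    by (simp_all add: off_def c x_def y_def)
  moreover have "(x + y) / (2 * D) + (y - x) / (2 * D) = y / D" "(x + y) / (2 * D) - (y - x) / (2 * D) = x / D"
    using D0 by (simp_all add: field_simps)
  moreover have "real_of_int (snd c) / D = y / D" "real_of_int (fst c) / D = x / D" by (simp_all add: c x_def y_def)
  ultimately show "\<bar>lx c - of_int (snd c) / D\<bar> <= err" "\<bar>ly c - of_int (fst c) / D\<bar> <= err"
    unfolding lx_def ly_def by linarith+
  have "1 + off c ~= 0"
  proof
    assume "1 + off c = 0"
    then have "off c = -1" by (simp add: eq_neg_iff_add_eq_0 add.commute)
    then show False using half by simp
  qed
  moreover have "Complex ((lx c + ly c) / 2) ((lx c - ly c) / 2) = Ln (1 + off c)" by (simp add: lx_def ly_def complex_eq_iff)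
  ultimately have "pt (lx c) (ly c) = r + Complex D D * (1 + off c)" by (simp add: pt_def)
  also have "\<dots> = grid_point c" using D0 by (simp add: complex_eq_iff r_def off_def grid_point_def c field_simps)
  finally show "pt (lx c) (ly c) = grid_point c" .
qed

text \<open>A full turn changes coordinates by more than 6, so these small bounds serve to exclude
  windings.\<close>

lemma coord_bounds: "c \<in> X ==> \<bar>lx c\<bar> <= 1 / 10" "c \<in> X ==> \<bar>ly c\<bar> <= 1 / 10"
proof -
  assume c: "c \<in> X"
  have b: "0 <= of_int k / D & of_int k / D <= 1 / 400" if "0 <= k" "k <= int M" for k :: int
  proof -
    have "real_of_int k <= real M" using that by linarith
    then have "400 * real_of_int k <= D" using D_bounds(3) by linarith
    then show ?thesis using D_bounds(1) that by (simp add: field_simps)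
  qed
  show "\<bar>lx c\<bar> <= 1 / 10" using grid_point_pt(2)[OF c] b[of "snd c"] X(3)[OF c] D_bounds(6) by linarith
  show "\<bar>ly c\<bar> <= 1 / 10" using grid_point_pt(3)[OF c] b[of "fst c"] X(3)[OF c] D_bounds(6) by linarith
qed

text \<open>Twice the error is less than the mesh width \<open>1 / D\<close>, so the order of the
  exact coordinates survives rounding.\<close>

lemma coord_mono:
  assumes "c \<in> X" "c' \<in> X"
  shows "lx c <= lx c' ==> snd c <= snd c'" "ly c <= ly c' ==> fst c <= fst c'"
proof -
  have k: "k <= k'" if "real_of_int k / D <= of_int k' / D + 2 * err" for k k' :: int
  proof -
    have "2 * err * D < 1" using D_bounds(1,5) by (simp add: field_simps)
    moreover have "real_of_int k <= of_int k' + 2 * err * D" using that D_bounds(1) by (simp add: field_simps)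
    ultimately show ?thesis by linarith
  qed
  show "snd c <= snd c'" if "lx c <= lx c'"
    by (rule k) (use grid_point_pt(2)[OF assms(1)] grid_point_pt(2)[OF assms(2)] that in linarith)
  show "fst c <= fst c'" if "ly c <= ly c'"
    by (rule k) (use grid_point_pt(3)[OF assms(1)] grid_point_pt(3)[OF assms(2)] that in linarith)
qed

section \<open>Trees on the grid of crossings\<close>

text \<open>The analogue of the Hanan grid in rectilinear Steiner problems: a left and a right
  spiral through two terminals meet here.\<close>

definition crossings :: "complex set" where
  "crossings = (%(x, y). pt x y) ` (lx ` X \<times> ly ` X)"

lemma crossings: "finite crossings" "card crossings <= (card X)\<^sup>2" "r \<notin> crossings"
proof -
  show "finite crossings" using X by (simp add: crossings_def)
  have "card crossings <= card (lx ` X \<times> ly ` X)" unfolding crossings_def by (rule card_image_le) (use X in auto)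
  also have "\<dots> <= card X * card X" unfolding card_cartesian_product by (intro mult_mono card_image_le X) auto
  finally show "card crossings <= (card X)\<^sup>2" by (simp add: power2_eq_square)
  show "r \<notin> crossings"
  proof
    assume "r \<in> crossings"
    then obtain x y where "r = pt x y" by (auto simp: crossings_def)
    then show False using r_ne[of x y] by simp
  qed
qed


text \<open>Each node moves outwards to the point given by the least coordinates of the terminals
  that it serves. The displacement is saved on every incoming arc and paid once on the outgoing arc;
  nodes without an incoming arc do not move. So the total length cannot grow.\<close>

lemma Hanan_tree:
  assumes T: "spiral_tree r ts (pi / 4) T" and ts: "set ts = grid_point ` X"
  shows "\<exists>T'. spiral_tree r ts (pi / 4) T' & nodes T' \<subseteq> insert r crossings &
    tree_length r (pi / 4) T' <= tree_length r (pi / 4) T"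
proof -
  define V where "V = nodes T"
  \<comment> \<open>The parent of the root is arbitrary in a drawn tree; making the root a fixed
    point gives well-behaved iterates.\<close>
  define p where "p = (%v. if v = r then r else parent T v)"
  have fV: "finite V" "r \<in> V" "grid_point ` X \<subseteq> V" using T ts by (auto simp: spiral_tree_def V_def)
  have arc: "p v \<in> V & is_arc r (pi / 4) v (out_arc T v) (p v)" if "v \<in> V" "v ~= r" for v
    using T that by (auto simp: spiral_tree_def V_def p_def)
  have pV: "p v \<in> V" if "v \<in> V" for v using arc[OF that] fV by (cases "v = r") (auto simp: p_def)
  have pr: "(p ^^ k) r = r" for k by (induction k) (auto simp: p_def)
  have "\<exists>k. (p ^^ k) v = r" if "v \<in> V" for v
  proof -
    have "\<forall>v \<in> nodes T. \<exists>k. (parent T ^^ k) v = r" using T unfolding spiral_tree_def by (elim conjE)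
    from bspec[OF this that[unfolded V_def]] obtain k where k: "(parent T ^^ k) v = r" ..
    have "(p ^^ j) v = (parent T ^^ j) v \<or> (p ^^ j) v = r" for j
      by (induction j) (auto simp: p_def)
    then show ?thesis using k by metis
  qed
  then obtain dep where dep: "\<And>v. v \<in> V ==> (p ^^ dep v) v = r & (\<forall>k. (p ^^ k) v = r --> dep v <= k)"
  proof -
    assume h: "\<And>v. v \<in> V ==> \<exists>k. (p ^^ k) v = r"
      and that: "\<And>dep. (\<And>v. v \<in> V ==> (p ^^ dep v) v = r & (\<forall>k. (p ^^ k) v = r --> dep v <= k)) ==> thesis"
    show thesis by (rule that[of "%v. LEAST k. (p ^^ k) v = r"]) (use h in \<open>auto intro: LeastI_ex Least_le\<close>)
  qed
  have dep_less: "dep (p v) < dep v" if v: "v \<in> V" "v ~= r" for v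
  proof -
    have "dep v ~= 0" using dep[OF v(1)] v(2) by (metis funpow_0)
    then obtain n where n: "dep v = Suc n" by (cases "dep v") auto
    then have "(p ^^ n) (p v) = r" using dep[OF v(1)] by (simp add: funpow_Suc_right del: funpow.simps)
    then show ?thesis using dep[OF pV[OF v(1)]] n by auto
  qed
  define S where "S = (%v. {c \<in> X. \<exists>k. (p ^^ k) (grid_point c) = v})"
  define A where "A = {v \<in> V - {r}. S v ~= {}}"
  have fS: "finite (S v)" "S v \<subseteq> X" for v using X by (auto simp: S_def)
  have Sp: "S v \<subseteq> S (p v)" for v
  proof
    fix c assume "c \<in> S v"
    then obtain k where k: "c \<in> X" "(p ^^ k) (grid_point c) = v" by (auto simp: S_def)
    then have "(p ^^ Suc k) (grid_point c) = p v" by simp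
    then show "c \<in> S (p v)" using k(1) unfolding S_def by blast
  qed
  have reach: "v = grid_point c \<or> spiral_reach r (grid_point c) v" if cv: "c \<in> S v" "v ~= r" for c v
  proof -
    obtain k where "(p ^^ k) (grid_point c) = v" and cX: "c \<in> X" using cv by (auto simp: S_def)
    then show ?thesis using cv(2)
    proof (induction k arbitrary: v)
      case (Suc k)
      define u where "u = (p ^^ k) (grid_point c)"
      have vu: "v = p u" using Suc.prems by (simp add: u_def)
      have ur: "u ~= r" using vu Suc.prems by (auto simp: p_def)
      have uV: "u \<in> V" unfolding u_def using fV(3) cX pV by (induction k) auto
      have "u = grid_point c \<or> spiral_reach r (grid_point c) u" using Suc.IH[of u] cX ur by (simp add: u_def)
      moreover have "spiral_reach r u v" using arc[OF uV ur] arc_reach vu Suc.prems by auto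
      ultimately show ?case using spiral_reach_trans by blast
    qed auto
  qed
  define x where "x = (%v. Min (lx ` S v))"
  define y where "y = (%v. Min (ly ` S v))"
  have xy: "x v \<in> lx ` S v" "y v \<in> ly ` S v" if "S v ~= {}" for v
    using that fS by (auto simp: x_def y_def intro!: Min_in)
  \<comment> \<open>The terminals attaining the two minima may reach \<open>v\<close> with different
    winding numbers. A full turn costs \<open>2 * pi\<close> in one coordinate, far more than
    terminals differ, so it only brings \<open>v\<close> closer to the root.\<close>
  have norm_le: "cmod (v - r) <= cmod (pt (x v) (y v) - r)" if v: "v \<in> A" for v
  proof -
    have v': "v ~= r" "S v ~= {}" using v by (auto simp: A_def)
    obtain c c' where c: "c \<in> S v" "x v = lx c" "c' \<in> S v" "y v = ly c'" using xy[OF v'(2)] by auto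
    have get: "\<exists>a b. a <= lx e & b <= ly e & v = pt a b" if e: "e \<in> S v" for e
    proof -
      have eX: "e \<in> X" using fS(2) e by blast
      from reach[OF e v'(1)] show ?thesis
      proof
        assume "v = grid_point e" then show ?thesis using grid_point_pt(1)[OF eX] by (intro exI[of _ "lx e"] exI[of _ "ly e"]) simp
      next
        assume "spiral_reach r (grid_point e) v"
        then have "spiral_reach r (pt (lx e) (ly e)) v" using grid_point_pt(1)[OF eX] by simp
        from reach_pt[OF this] show ?thesis by blast
      qed
    qed
    obtain a b where ab: "a <= lx c" "b <= ly c" "v = pt a b" using get[OF c(1)] by blast
    obtain a' b' where ab': "a' <= lx c'" "b' <= ly c'" "v = pt a' b'" using get[OF c(3)] by blast
    obtain k :: int where k: "a - a' = 2 * pi * of_int k" "b' - b = 2 * pi * of_int k" using pt_eqD[of a b a' b'] ab ab' by metis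
    have cX: "c \<in> X" "c' \<in> X" using c fS(2) by blast+
    have "a + b <= lx c + ly c'"
    proof -
      consider "k = 0" | "k > 0" | "k < 0" by linarith
      then show ?thesis
      proof cases
        case 1 then show ?thesis using k ab ab' by simp
      next
        case 2
        then have "2 * pi * of_int k \<ge> 0" by simp
        then show ?thesis using k ab ab' by linarith
      next
        case 3
        then have "real_of_int k <= -1" by linarith
        then have "2 * pi * of_int k <= 2 * pi * (-1)" by (intro mult_left_mono) auto
        then have "2 * pi * of_int k <= - 6" using pi_gt3 by linarith
        then show ?thesis using k ab ab' coord_bounds[OF cX(1)] coord_bounds[OF cX(2)] by linarith
      qed
    qed
    then have "D * exp ((a + b) / 2) <= D * exp ((x v + y v) / 2)" using c D_bounds(1) by simp
    then have "sqrt 2 * (D * exp ((a + b) / 2)) <= cmod (pt (x v) (y v) - r)"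
      unfolding norm_pt by (rule mult_left_mono) simp
    moreover have "cmod (v - r) = sqrt 2 * (D * exp ((a + b) / 2))" unfolding ab(3) by (rule norm_pt)
    ultimately show ?thesis by simp
  qed
  \<comment> \<open>Without an incoming arc from \<open>A\<close>, the node serves no terminal
    except the one located at \<open>v\<close> itself.\<close>
  have leaf: "v = pt (x v) (y v)" if v: "v \<in> A" "\<And>u. u \<in> A ==> p u ~= v" for v
  proof -
    have one: "c \<in> S v ==> v = grid_point c" for c
    proof -
      assume c: "c \<in> S v"
      then obtain k where k: "(p ^^ k) (grid_point c) = v" "c \<in> X" by (auto simp: S_def)
      show "v = grid_point c"
      proof (cases k)
        case (Suc j)
        define u where "u = (p ^^ j) (grid_point c)"
        have "p u = v" using k Suc by (simp add: u_def)
        moreover have "u \<in> A"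
        proof -
          have "u \<in> V" unfolding u_def using fV(3) k pV by (induction j) auto
          moreover have "u ~= r" using \<open>p u = v\<close> v(1) by (auto simp: p_def A_def)
          moreover have "c \<in> S u" using k(2) by (auto simp: S_def u_def)
          ultimately show ?thesis by (auto simp: A_def)
        qed
        ultimately show ?thesis using v(2) by blast
      qed (use k in auto)
    qed
    have "S v ~= {}" using v by (auto simp: A_def)
    then obtain c c' where c: "c \<in> S v" "x v = lx c" "c' \<in> S v" "y v = ly c'" using xy[of v] by auto
    have "c = c'" using one[OF c(1)] one[OF c(3)] by (auto simp: grid_point_def prod_eq_iff)
    moreover have "c \<in> X" using c(1) fS(2) by blast
    ultimately show ?thesis using grid_point_pt(1)[of c] one[OF c(1)] c(2,4) by metis
  qed
  define par where "par = (%v. if p v = r then None else Some (p v))"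
  define g where "g = (%v. cmod (pt (x v) (y v) - r))"
  have pA: "p v \<in> A" if "v \<in> A" "p v ~= r" for v using that pV Sp[of v] by (auto simp: A_def)
  have fA: "finite A" using fV by (auto simp: A_def)
  \<comment> \<open>The move cannot raise the coordinates of a terminal and, by
    \<open>norm_le\<close>, cannot lower its radius; so terminals stay in place.\<close>
  have ge: "grid_point c \<in> insert r ((%v. pt (x v) (y v)) ` A)" if c: "c \<in> X" for c
  proof -
    let ?v = "grid_point c"
    have v: "?v = pt (lx c) (ly c)" using grid_point_pt(1)[OF c] by simp
    have cS: "c \<in> S ?v" using c by (auto simp: S_def intro: exI[of _ 0])
    then have vA: "?v \<in> A" using fV(3) c v r_ne[of "lx c" "ly c"] by (auto simp: A_def)
    have le: "x ?v <= lx c" "y ?v <= ly c" using cS fS by (auto simp: x_def y_def intro!: Min_le)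
    have "D * exp ((lx c + ly c) / 2) <= D * exp ((x ?v + y ?v) / 2)"
    proof -
      have "cmod (pt (lx c) (ly c) - r) <= cmod (pt (x ?v) (y ?v) - r)" using norm_le[OF vA] unfolding v[symmetric] .
      then show ?thesis unfolding norm_pt by simp
    qed
    then have "lx c + ly c <= x ?v + y ?v" using D_bounds(1) by simp
    then have "x ?v = lx c" "y ?v = ly c" using le by linarith+
    then have "pt (x ?v) (y ?v) = ?v" using trans[OF arg_cong2[of _ _ _ _ pt] v[symmetric]] by blast
    then have "?v \<in> (%v. pt (x v) (y v)) ` A" by (intro image_eqI[OF _ vA]) (rule sym)
    then show ?thesis by (rule insertI2)
  qed
  obtain T' where T': "spiral_tree r ts (pi / 4) T'" "nodes T' = insert r ((%v. pt (x v) (y v)) ` A)"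
    "tree_length r (pi / 4) T' <= sqrt 2 * (\<Sum>i \<in> A. g i - (case par i of None => 0 | Some j => g j))"
  proof -
    have "\<exists>T'. spiral_tree r ts (pi / 4) T' & nodes T' = insert r ((%v. pt (x v) (y v)) ` A) &
      tree_length r (pi / 4) T' <= sqrt 2 * (\<Sum>i \<in> A. g i - (case par i of None => 0 | Some j => g j))"
      unfolding g_def
    proof (rule tree_of_forest[where dep = dep])
      fix i j assume ij: "i \<in> A" "par i = Some j"
      then have j: "j = p i" "p i ~= r" by (auto simp: par_def split: if_splits)
      have i: "i \<in> V" "i ~= r" "S i ~= {}" using ij by (auto simp: A_def)
      have "x (p i) <= x i" "y (p i) <= y i"
        unfolding x_def y_def using Sp[of i] i fS by (auto intro!: Min_antimono)
      then show "j \<in> A & dep j < dep i & spiral_reach r (pt (x i) (y i)) (pt (x j) (y j))"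
        using pA[OF ij(1)] dep_less[OF i(1,2)] j pt_reach by auto
    qed (use fA r_ne ge ts in auto)
    then show thesis using that by blast
  qed
  define f where "f = (%v. cmod (v - r))"
  define h where "h = (%v. g v - f v)"
  have h0: "h v \<ge> 0" if "v \<in> A" for v using norm_le[OF that] by (simp add: h_def g_def f_def)
  let ?h = "%v. if v \<in> A then h v else 0"
  \<comment> \<open>A node that moves is the parent of some node in \<open>A\<close>, so its
    displacement is covered by an incoming arc.\<close>
  have sub: "{u \<in> A. h u ~= 0} \<subseteq> p ` A"
  proof
    fix u assume u: "u \<in> {u \<in> A. h u ~= 0}"
    show "u \<in> p ` A"
    proof (rule ccontr)
      assume "u \<notin> p ` A"
      then have "u = pt (x u) (y u)" using leaf[of u] u by auto
      then show False using u by (simp add: h_def g_def f_def)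
    qed
  qed
  have "sum h A = sum ?h {u \<in> A. h u ~= 0}" by (rule sum.mono_neutral_cong_right) (use fA in auto)
  also have "\<dots> <= sum ?h (p ` A)" by (rule sum_mono2) (use fA sub h0 in auto)
  also have "\<dots> <= sum (?h \<circ> p) A" by (rule sum_image_le) (use fA h0 in auto)
  finally have hs: "sum h A <= (\<Sum>v \<in> A. ?h (p v))" by (simp add: o_def)
  have "(\<Sum>i \<in> A. g i - (case par i of None => 0 | Some j => g j)) = (\<Sum>i \<in> A. (f i - f (p i)) + (h i - ?h (p i)))"
  proof (rule sum.cong[OF refl])
    fix i assume "i \<in> A"
    then show "g i - (case par i of None => 0 | Some j => g j) = (f i - f (p i)) + (h i - ?h (p i))"
      using pA[of i] by (cases "p i = r") (auto simp: par_def h_def f_def A_def)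
  qed
  also have "\<dots> <= (\<Sum>i \<in> A. f i - f (p i))" using hs by (simp add: sum.distrib sum_subtractf)
  \<comment> \<open>Nodes that serve no terminal are left out; their arcs have nonnegative
    length.\<close>
  also have "\<dots> <= (\<Sum>i \<in> V - {r}. f i - f (p i))"
  proof (rule sum_mono2)
    show "0 <= f b - f (p b)" if "b \<in> V - {r} - A" for b
      using pV[of b] arc_norm_le[of r b "out_arc T b" "p b"] arc[of b] that by (auto simp: f_def)
  qed (use fV in \<open>auto simp: A_def\<close>)
  also have "\<dots> = (\<Sum>v \<in> nodes T - {r}. cmod (v - r) - cmod (parent T v - r))"
    by (rule sum.cong) (auto simp: V_def f_def p_def)
  finally have "tree_length r (pi / 4) T' <= tree_length r (pi / 4) T"
    unfolding tree_length_eq[OF T] by (intro order_trans[OF T'(3)] mult_left_mono) simp_all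
  moreover have "nodes T' \<subseteq> insert r crossings"
  proof -
    have "pt (x v) (y v) \<in> crossings" if "v \<in> A" for v
    proof -
      have "S v ~= {}" using that by (simp add: A_def)
      then have "x v \<in> lx ` X" "y v \<in> ly ` X" using xy[of v] fS(2) by blast+
      then show ?thesis unfolding crossings_def by (intro image_eqI[of _ _ "(x v, y v)"]) simp_all
    qed
    then show ?thesis unfolding T'(2) by blast
  qed
  ultimately show ?thesis using T'(1) by blast
qed


text \<open>The decision problem asks for an optimal tree, so one has to exist. On the finite set of
  crossings a length is determined by the node set and the parents, which leaves finitely many
  values.\<close>

lemma optimal_tree_exists:
  assumes ts: "set ts = grid_point ` X"
  shows "\<exists>T. is_arg_min (tree_length r (pi / 4)) (spiral_tree r ts (pi / 4)) T & nodes T \<subseteq> insert r crossings"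
proof -
  define H where "H = {T. spiral_tree r ts (pi / 4) T & nodes T \<subseteq> insert r crossings}"
  let ?W = "insert r crossings"
  let ?len = "%(U, p). sqrt 2 * (\<Sum>v \<in> U - {r}. cmod (v - r) - cmod (p v - r))"
  let ?cand = "\<Union>U \<in> Pow ?W. {U} \<times> (U \<rightarrow>\<^sub>E ?W)"
  have "tree_length r (pi / 4) ` H \<subseteq> ?len ` ?cand"
  proof
    fix l assume "l \<in> tree_length r (pi / 4) ` H"
    then obtain T where T: "spiral_tree r ts (pi / 4) T" "nodes T \<subseteq> ?W" "l = tree_length r (pi / 4) T" by (auto simp: H_def)
    have "parent T v \<in> nodes T" if "v \<in> nodes T" "v ~= r" for v using T(1) that by (simp add: spiral_tree_def)
    then have "restrict (%v. if v = r then r else parent T v) (nodes T) \<in> nodes T \<rightarrow>\<^sub>E ?W"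
      using T(2) by (auto simp: subset_iff split: if_splits)
    moreover have "l = ?len (nodes T, restrict (%v. if v = r then r else parent T v) (nodes T))"
      unfolding T(3) tree_length_eq[OF T(1)] by (auto intro!: sum.cong)
    ultimately show "l \<in> ?len ` ?cand" using T(2) by blast
  qed
  moreover have "finite ?cand" using crossings(1) by (auto intro!: finite_PiE intro: finite_subset)
  ultimately have fin: "finite (tree_length r (pi / 4) ` H)" by (meson finite_imageI finite_subset)
  have "H ~= {}"
  proof -
    have "\<exists>T. spiral_tree r ts (pi / 4) T & nodes T = insert r (grid_point ` X) & tree_length r (pi / 4) T <=
        sqrt 2 * (\<Sum>i \<in> X. cmod (grid_point i - r) - (case None of None => 0 | Some j => cmod (grid_point j - r)))"
      by (rule tree_of_forest[where dep = "%_. 0"]) (use X(1) grid_point_pt(1) r_ne ts in \<open>auto, metis\<close>)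
    then obtain T where "spiral_tree r ts (pi / 4) T" by blast
    from Hanan_tree[OF this ts] show ?thesis by (auto simp: H_def)
  qed
  then obtain T where T: "T \<in> H" "tree_length r (pi / 4) T = Min (tree_length r (pi / 4) ` H)"
  proof -
    assume "H ~= {}" and that: "\<And>T. T \<in> H ==> tree_length r (pi / 4) T = Min (tree_length r (pi / 4) ` H) ==> thesis"
    then have "Min (tree_length r (pi / 4) ` H) \<in> tree_length r (pi / 4) ` H" using fin by (intro Min_in) auto
    then show thesis using that by (metis imageE)
  qed
  have "tree_length r (pi / 4) T <= tree_length r (pi / 4) T'" if T': "spiral_tree r ts (pi / 4) T'" for T'
  proof -
    obtain T'' where "T'' \<in> H" "tree_length r (pi / 4) T'' <= tree_length r (pi / 4) T'"
      using Hanan_tree[OF T' ts] by (auto simp: H_def)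
    then show ?thesis using T(2) Min_le[OF fin, of "tree_length r (pi / 4) T''"] by fastforce
  qed
  then show ?thesis using T(1) by (intro exI[of _ T]) (auto simp: H_def is_arg_min_linorder)
qed

section \<open>Comparison of spiral trees with arborescences\<close>

lemma exp_le_quadratic: "(s::real) <= 1 ==> exp s <= 1 + s + s\<^sup>2"
proof (cases "s \<ge> 0")
  case False
  assume "s <= 1"
  have "(1 + s + s\<^sup>2) * (1 - s) = 1 - s ^ 3" by (simp add: power2_eq_square power3_eq_cube algebra_simps)
  moreover have "s ^ 3 <= 0" using False by (simp add: power3_eq_cube mult_nonneg_nonpos mult_nonpos_nonpos mult_nonneg_nonpos2)
  ultimately have "(1 + s + s\<^sup>2) * (1 - s) \<ge> 1" by simp
  then have "1 + s + s\<^sup>2 \<ge> 1 / (1 - s)" using False by (simp add: pos_divide_le_eq)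
  moreover have "exp s <= 1 / (1 - s)"
  proof -
    have "1 - s <= exp (- s)" using exp_ge_add_one_self[of "- s"] by simp
    then have "1 / exp (- s) <= 1 / (1 - s)" using False by (intro divide_left_mono) auto
    then show ?thesis by (simp add: exp_minus inverse_eq_divide)
  qed
  ultimately show ?thesis by linarith
qed (use exp_bound in auto)

text \<open>\<open>v\<close> is \<open>sqrt 2\<close> times the radius. To first order it equals
  \<open>2 * D + a + b\<close>, so a unit step of the lattice costs about 1.\<close>

lemma value_bounds:
  assumes "0 <= a" "a <= int M" "0 <= b" "b <= int M" "\<bar>x - of_int b / D\<bar> <= err" "\<bar>y - of_int a / D\<bar> <= err"
  defines "v \<equiv> 2 * (D * exp ((x + y) / 2))"
  shows "2 * D + of_int (a + b) - 8 * (real M)\<^sup>2 / D <= v" "v <= 2 * D + of_int (a + b) + 16 * (real M)\<^sup>2 / D"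
proof -
  have D0: "D > 0" by (rule D_bounds)
  define s where "s = (x + y) / 2"
  define s0 where "s0 = real_of_int (a + b) / (2 * D)"
  have "s0 = (of_int b / D + of_int a / D) / 2" by (simp add: s0_def add_divide_distrib)
  moreover have "\<bar>(x + y) / 2 - (p + q) / 2\<bar> <= e" if "\<bar>x - p\<bar> <= e" "\<bar>y - q\<bar> <= e" for p q e :: real
    using that by (simp add: abs_le_iff field_simps)
  ultimately have ds: "\<bar>s - s0\<bar> <= err" using assms(5,6) unfolding s_def by metis
  have s0M: "0 <= s0" "s0 <= real M / D"
  proof -
    have "real_of_int (a + b) <= 2 * real M" using assms(2,4) by linarith
    then have "real_of_int (a + b) / (2 * D) <= 2 * real M / (2 * D)" using D0 by (intro divide_right_mono) auto
    then show "s0 <= real M / D" by (simp add: s0_def)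
    show "0 <= s0" using assms D0 by (simp add: s0_def)
  qed
  have eD: "2 * D * err = 8 * (real M)\<^sup>2 / D" using D0 by (simp add: err_def power2_eq_square)
  have eM: "err <= real M / D"
  proof -
    have "4 * (real M) <= D" using D_bounds(3) by simp
    then have "4 * real M * real M <= D * real M" by (intro mult_right_mono) auto
    then show ?thesis using D0 by (simp add: err_def power2_eq_square field_simps)
  qed
  have v: "v = 2 * D * exp s" by (simp add: v_def s_def)
  have "2 * D * s0 = of_int (a + b)" using D0 by (simp add: s0_def)
  moreover have "2 * D * (1 + s) <= v" unfolding v using exp_ge_add_one_self[of s] D0 by (intro mult_left_mono) auto
  moreover have "2 * D * s \<ge> 2 * D * (s0 - err)" using ds D0 by (intro mult_left_mono) auto
  ultimately show "2 * D + of_int (a + b) - 8 * (real M)\<^sup>2 / D <= v" using eD by (simp add: algebra_simps)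
  have MD: "real M / D <= 1 / 400" using D_bounds(3) D0 by (simp add: field_simps)
  have s2: "\<bar>s\<bar> <= 2 * (real M / D)" using ds s0M eM by linarith
  then have "s <= 1" using MD by linarith
  then have "exp s <= 1 + s + s\<^sup>2" by (rule exp_le_quadratic)
  moreover have "s\<^sup>2 <= (2 * (real M / D))\<^sup>2" using s2 by (metis abs_le_square_iff abs_of_nonneg abs_ge_zero order_trans)
  ultimately have "exp s <= 1 + (s0 + err) + (2 * (real M / D))\<^sup>2" using ds by linarith
  then have "v <= 2 * D * (1 + (s0 + err) + (2 * (real M / D))\<^sup>2)" unfolding v using D0 by (intro mult_left_mono) auto
  also have "\<dots> = 2 * D + 2 * D * s0 + 2 * D * err + 8 * (real M)\<^sup>2 / D"
    using D0 by (simp add: power2_eq_square field_simps)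
  finally show "v <= 2 * D + of_int (a + b) + 16 * (real M)\<^sup>2 / D"
    using eD \<open>2 * D * s0 = of_int (a + b)\<close> by simp
qed


text \<open>The lattice path that goes left from \<open>c\<close> and then down to \<open>c'\<close>, without \<open>c'\<close>.\<close>

definition lattice_path :: "cell => cell => cell set" where
  "lattice_path c c' = (%i. (i, snd c)) ` {fst c' <.. fst c} \<union> (%j. (fst c', j)) ` {snd c' <.. snd c}"

definition weight :: "cell => int" where "weight c = fst c + snd c"

lemma card_lattice_path:
  assumes "fst c' <= fst c" "snd c' <= snd c"
  shows "int (card (lattice_path c c')) <= weight c - weight c'"
proof -
  have "card (lattice_path c c') <= card ((%i. (i, snd c)) ` {fst c' <.. fst c}) + card ((%j. (fst c', j)) ` {snd c' <.. snd c})"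
    unfolding lattice_path_def by (rule card_Un_le)
  also have "\<dots> <= card {fst c' <.. fst c} + card {snd c' <.. snd c}" by (intro add_mono card_image_le) auto
  finally show ?thesis using assms by (simp add: weight_def)
qed

lemma lattice_path_supported:
  assumes "fst c' <= fst c" "snd c' <= snd c" "d \<in> lattice_path c c'"
  shows "supported (insert c' (lattice_path c c')) d" "fst c' <= fst d" "snd c' <= snd d"
  using assms by (auto simp: lattice_path_def supported_def image_iff prod_eq_iff)

text \<open>Crossings are rounded to lattice points, and each arc is replaced by a lattice path with
  at most as many points as the weight drops, which is the length of the arc up to a small error.
  All errors together stay below 1 / 2; with the slack 1 / 2 of the bound this is still less than
  one further point.\<close>

lemma lower:
  assumes T: "spiral_tree r ts (pi / 4) T" and ts: "set ts = grid_point ` X"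
    and len: "tree_length r (pi / 4) T <= 2 * D + real C + 1 / 2"
  shows "\<exists>N. arborescence N & X \<subseteq> N & card N <= C + 1"
proof -
  obtain T' where T': "spiral_tree r ts (pi / 4) T'" "nodes T' \<subseteq> insert r crossings"
    "tree_length r (pi / 4) T' <= tree_length r (pi / 4) T" using Hanan_tree[OF T ts] by blast
  define Q where "Q = nodes T' - {r}"
  have Q: "Q \<subseteq> crossings" "finite Q" using T'(2) crossings(1) by (auto simp: Q_def intro: finite_subset)
  \<comment> \<open>A crossing may come from several pairs of terminals; one pair is chosen, and
    \<open>uniq\<close> shows that a terminal still gets its own coordinates.\<close>
  define sx where "sx = (%q. SOME c. c \<in> X & (\<exists>c' \<in> X. q = pt (lx c) (ly c')))"
  define sy where "sy = (%q. SOME c'. c' \<in> X & q = pt (lx (sx q)) (ly c'))"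
  have s: "sx q \<in> X" "sy q \<in> X" "q = pt (lx (sx q)) (ly (sy q))" if "q \<in> crossings" for q
  proof -
    have "\<exists>c. c \<in> X & (\<exists>c' \<in> X. q = pt (lx c) (ly c'))" using that by (auto simp: crossings_def)
    from someI_ex[OF this] have a: "sx q \<in> X" "\<exists>c' \<in> X. q = pt (lx (sx q)) (ly c')" by (auto simp: sx_def)
    then have "\<exists>c'. c' \<in> X & q = pt (lx (sx q)) (ly c')" by blast
    from someI_ex[OF this] show "sx q \<in> X" "sy q \<in> X" "q = pt (lx (sx q)) (ly (sy q))" using a by (auto simp: sy_def)
  qed
  have dom: "lx (sx q') <= lx (sx q) & ly (sy q') <= ly (sy q)" if "q \<in> crossings" "q' \<in> crossings" "spiral_reach r q q'" for q q'
  proof -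
    note sq = s[OF that(1)] and sq' = s[OF that(2)]
    have "spiral_reach r (pt (lx (sx q)) (ly (sy q))) q'" using that(3) sq(3) by simp
    then obtain a b where ab: "a <= lx (sx q)" "b <= ly (sy q)" "q' = pt a b" by (rule reach_pt)
    have "pt a b = pt (lx (sx q')) (ly (sy q'))" using ab(3) sq'(3) by simp
    then obtain k :: int where k: "a - lx (sx q') = 2 * pi * of_int k" "ly (sy q') - b = 2 * pi * of_int k" by (rule pt_eqD)
    note cb = coord_bounds(1)[OF sq(1)] coord_bounds(2)[OF sq(2)] coord_bounds(1)[OF sq'(1)] coord_bounds(2)[OF sq'(2)]
    have "k = 0"
    proof (rule ccontr)
      assume "k ~= 0"
      then consider "real_of_int k \<ge> 1" | "real_of_int k <= -1" by linarith
      then show False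
      proof cases
        case 1
        then have "2 * pi * 1 <= 2 * pi * of_int k" by (intro mult_left_mono) auto
        then show False using k(1) ab(1) cb pi_gt3 by linarith
      next
        case 2
        then have "2 * pi * of_int k <= 2 * pi * (-1)" by (intro mult_left_mono) auto
        then show False using k(2) ab(2) cb pi_gt3 by linarith
      qed
    qed
    then show ?thesis using k ab by simp
  qed
  have uniq: "lx (sx (grid_point c)) = lx c & ly (sy (grid_point c)) = ly c" if c: "c \<in> X" for c
  proof -
    have g: "grid_point c = pt (lx c) (ly c)" using grid_point_pt(1)[OF c] by simp
    then have "grid_point c \<in> crossings" using c by (auto simp: crossings_def)
    note sc = s[OF this]
    have "pt (lx c) (ly c) = pt (lx (sx (grid_point c))) (ly (sy (grid_point c)))" using sc(3) g by simp
    then obtain k :: int where k: "lx c - lx (sx (grid_point c)) = 2 * pi * of_int k" "ly (sy (grid_point c)) - ly c = 2 * pi * of_int k" by (rule pt_eqD)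
    have "k = 0"
    proof (rule ccontr)
      assume "k ~= 0"
      then consider "real_of_int k \<ge> 1" | "real_of_int k <= -1" by linarith
      then show False
      proof cases
        case 1
        then have "2 * pi * 1 <= 2 * pi * of_int k" by (intro mult_left_mono) auto
        then show False using k(1) coord_bounds(1)[OF c] coord_bounds(1)[OF sc(1)] pi_gt3 by linarith
      next
        case 2
        then have "2 * pi * of_int k <= 2 * pi * (-1)" by (intro mult_left_mono) auto
        then show False using k(1) coord_bounds(1)[OF c] coord_bounds(1)[OF sc(1)] pi_gt3 by linarith
      qed
    qed
    then show ?thesis using k by simp
  qed
  define \<Lambda> where "\<Lambda> = (%q. if q = r then (0, 0) else (fst (sy q), snd (sx q)))"
  have \<Lambda>t: "\<Lambda> (grid_point c) = c" if c: "c \<in> X" for c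
  proof -
    have g: "grid_point c = pt (lx c) (ly c)" using grid_point_pt(1)[OF c] by simp
    then have "grid_point c \<in> crossings" "grid_point c ~= r" using c r_ne by (auto simp: crossings_def)
    note sc = s[OF this(1)]
    have "snd (sx (grid_point c)) = snd c" "fst (sy (grid_point c)) = fst c"
      using coord_mono[OF sc(1) c] coord_mono[OF c sc(1)] coord_mono[OF sc(2) c] coord_mono[OF c sc(2)] uniq[OF c] by auto
    then show ?thesis using \<open>grid_point c ~= r\<close> by (simp add: \<Lambda>_def prod_eq_iff)
  qed
  have \<Lambda>0: "0 <= fst (\<Lambda> q) & 0 <= snd (\<Lambda> q)" if "q \<in> insert r crossings" for q
    using that s[of q] X(3)[of "sx q"] X(3)[of "sy q"] by (auto simp: \<Lambda>_def)
  have pq: "parent T' q \<in> insert r Q & is_arc r (pi / 4) q (out_arc T' q) (parent T' q)" if "q \<in> Q" for q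
    using T'(1) that by (auto simp: spiral_tree_def Q_def)
  have \<Lambda>p: "fst (\<Lambda> (parent T' q)) <= fst (\<Lambda> q) & snd (\<Lambda> (parent T' q)) <= snd (\<Lambda> q)" if q: "q \<in> Q" for q
  proof (cases "parent T' q = r")
    case True then show ?thesis using \<Lambda>0[of q] q Q by (auto simp: \<Lambda>_def)
  next
    case False
    have pc: "parent T' q \<in> crossings" "q \<in> crossings" "q ~= r" using pq[OF q] False q Q crossings(3) by auto
    have "spiral_reach r q (parent T' q)" using pq[OF q] arc_reach False by blast
    note d = dom[OF pc(2,1) this]
    note s1 = s[OF pc(1)] and s2 = s[OF pc(2)]
    show ?thesis using d coord_mono(2)[OF s1(2) s2(2)] coord_mono(1)[OF s1(1) s2(1)] False pc(3) by (simp add: \<Lambda>_def)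
  qed
  \<comment> \<open>A path omits its lower end, which the path of the parent provides; only the
    origin has to be added.\<close>
  define N where "N = insert (0, 0) (\<Union>q \<in> Q. lattice_path (\<Lambda> q) (\<Lambda> (parent T' q)))"
  have inN: "\<Lambda> q \<in> N" if "q \<in> insert r Q" for q
  proof (cases "q = r")
    case True then show ?thesis by (simp add: \<Lambda>_def N_def)
  next
    case False
    then have "q \<in> nodes T'" using that by (auto simp: Q_def)
    then have "\<exists>k. (parent T' ^^ k) q = r" using T'(1) unfolding spiral_tree_def by (elim conjE) blast
    then obtain k where "(parent T' ^^ k) q = r" ..
    then show ?thesis using that False
    proof (induction k arbitrary: q)
      case (Suc k)
      have q: "q \<in> Q" using Suc.prems by simp
      have "\<Lambda> (parent T' q) \<in> N"
      proof (cases "parent T' q = r")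
        case True then show ?thesis by (simp add: \<Lambda>_def N_def)
      next
        case False
        then show ?thesis using Suc.IH[of "parent T' q"] Suc.prems(1) pq[OF q]
          by (simp add: funpow_Suc_right del: funpow.simps)
      qed
      \<comment> \<open>Different crossings may be rounded to the same lattice point; then the path
        is empty and the parent supplies the point.\<close>
      moreover have "\<Lambda> q = \<Lambda> (parent T' q) \<or> \<Lambda> q \<in> lattice_path (\<Lambda> q) (\<Lambda> (parent T' q))"
        using \<Lambda>p[OF q] by (auto simp: lattice_path_def prod_eq_iff image_iff)
      ultimately show ?case using q by (auto simp: N_def)
    qed simp
  qed
  have fl: "finite (lattice_path c c')" for c c' by (simp add: lattice_path_def)
  have arb: "arborescence N"
    unfolding arborescence_def
  proof (intro conjI ballI)
    show "finite N" using Q fl by (auto simp: N_def)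
    fix c assume c: "c \<in> N"
    have "0 <= fst c & 0 <= snd c & (c = (0, 0) \<or> supported N c)"
    proof (cases "c = (0, 0)")
      case False
      then obtain q where q: "q \<in> Q" "c \<in> lattice_path (\<Lambda> q) (\<Lambda> (parent T' q))" using c by (auto simp: N_def)
      note l = lattice_path_supported[OF _ _ q(2)]
      have "\<Lambda> (parent T' q) \<in> N" using inN pq[OF q(1)] by blast
      then have "insert (\<Lambda> (parent T' q)) (lattice_path (\<Lambda> q) (\<Lambda> (parent T' q))) \<subseteq> N" using q(1) by (auto simp: N_def)
      then have "supported N c" using l(1) \<Lambda>p[OF q(1)] by (auto simp: supported_def)
      moreover have "parent T' q \<in> insert r crossings" using pq[OF q(1)] Q by auto
      ultimately show ?thesis using l(2,3) \<Lambda>p[OF q(1)] \<Lambda>0 by fastforce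
    qed simp
    then show "0 <= fst c" "0 <= snd c" "c = (0, 0) \<or> supported N c" by blast+
  qed
  have XN: "X \<subseteq> N"
  proof
    fix c assume c: "c \<in> X"
    have g: "grid_point c = pt (lx c) (ly c)" using grid_point_pt(1)[OF c] by simp
    have "grid_point c \<in> nodes T'" using T'(1) ts c by (auto simp: spiral_tree_def)
    then have "grid_point c \<in> insert r Q" by (auto simp: Q_def)
    from inN[OF this] show "c \<in> N" using \<Lambda>t[OF c] by simp
  qed
  have "card N <= 1 + card (\<Union>q \<in> Q. lattice_path (\<Lambda> q) (\<Lambda> (parent T' q)))"
    unfolding N_def by (cases "finite (\<Union>q \<in> Q. lattice_path (\<Lambda> q) (\<Lambda> (parent T' q)))") (simp_all add: card_insert_if)
  also have "\<dots> <= 1 + (\<Sum>q \<in> Q. card (lattice_path (\<Lambda> q) (\<Lambda> (parent T' q))))"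
    by (intro add_left_mono card_UN_le Q)
  finally have "int (card N) <= 1 + (\<Sum>q \<in> Q. int (card (lattice_path (\<Lambda> q) (\<Lambda> (parent T' q)))))" by (simp flip: of_nat_sum)
  also have "\<dots> <= 1 + (\<Sum>q \<in> Q. weight (\<Lambda> q) - weight (\<Lambda> (parent T' q)))"
    by (intro add_left_mono sum_mono card_lattice_path) (use \<Lambda>p in auto)
  finally have cN: "real (card N) <= 1 + (\<Sum>q \<in> Q. real_of_int (weight (\<Lambda> q) - weight (\<Lambda> (parent T' q))))"
    by (metis of_int_1 of_int_add of_int_le_iff of_int_of_nat_eq of_int_sum)
  define E where "E = 24 * (real M)\<^sup>2 / D"
  have E8: "8 * (real M)\<^sup>2 / D <= E" "E = 8 * (real M)\<^sup>2 / D + 16 * (real M)\<^sup>2 / D" using D_bounds(1) by (auto simp: E_def field_simps)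
  have vb: "2 * D + weight (\<Lambda> q) - 8 * (real M)\<^sup>2 / D <= sqrt 2 * cmod (q - r)" "sqrt 2 * cmod (q - r) <= 2 * D + weight (\<Lambda> q) + 16 * (real M)\<^sup>2 / D"
    if "q \<in> crossings" for q
  proof -
    note sq = s[OF that]
    have "q ~= r" using that crossings(3) by auto
    moreover have "sqrt 2 * cmod (q - r) = 2 * (D * exp ((lx (sx q) + ly (sy q)) / 2))"
      by (subst sq(3)) (simp add: norm_pt)
    ultimately show "2 * D + weight (\<Lambda> q) - 8 * (real M)\<^sup>2 / D <= sqrt 2 * cmod (q - r)" "sqrt 2 * cmod (q - r) <= 2 * D + weight (\<Lambda> q) + 16 * (real M)\<^sup>2 / D"
      using value_bounds[of "fst (sy q)" "snd (sx q)" "lx (sx q)" "ly (sy q)"] X(3)[OF sq(1)] X(3)[OF sq(2)]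
        grid_point_pt(2)[OF sq(1)] grid_point_pt(3)[OF sq(2)] by (auto simp: weight_def \<Lambda>_def)
  qed
  have term_ge: "sqrt 2 * (cmod (q - r) - cmod (parent T' q - r)) \<ge>
      of_int (weight (\<Lambda> q) - weight (\<Lambda> (parent T' q))) - E + (if parent T' q = r then 2 * D else 0)" if q: "q \<in> Q" for q
  proof (cases "parent T' q = r")
    case True
    then show ?thesis using vb(1)[of q] q Q E8 by (auto simp: weight_def \<Lambda>_def algebra_simps)
  next
    case False
    then have "parent T' q \<in> crossings" using pq[OF q] Q by auto
    then show ?thesis using vb(1)[of q] vb(2)[of "parent T' q"] q Q E8(2) False by (auto simp: algebra_simps)
  qed
  have rootedge: "\<exists>q \<in> Q. parent T' q = r"
  proof -
    obtain c where c: "c \<in> X" using X(2) by blast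
    have "grid_point c ~= r" using grid_point_pt(1)[OF c] r_ne by metis
    moreover have gn: "grid_point c \<in> nodes T'" using T'(1) ts c by (auto simp: spiral_tree_def)
    ultimately have gQ: "grid_point c \<in> Q" by (simp add: Q_def)
    have "\<exists>k. (parent T' ^^ k) (grid_point c) = r" using T'(1) gn unfolding spiral_tree_def by (elim conjE) blast
    then obtain k where "(parent T' ^^ k) (grid_point c) = r" ..
    moreover have "\<exists>q \<in> Q. parent T' q = r" if "(parent T' ^^ k) q = r" "q \<in> Q" for k q
      using that
    proof (induction k arbitrary: q)
      case 0 then show ?case by (simp add: Q_def)
    next
      case (Suc k)
      show ?case
      proof (cases "parent T' q = r")
        case True then show ?thesis using Suc.prems by blast
      next
        case False
        then show ?thesis using Suc.IH[of "parent T' q"] Suc.prems(1) pq[OF Suc.prems(2)]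
          by (simp add: funpow_Suc_right del: funpow.simps)
      qed
    qed
    ultimately show ?thesis using gQ by blast
  qed
  \<comment> \<open>One arc into the root accounts for \<open>2 * D\<close>; any further one only
    makes the tree longer.\<close>
  have "2 * D <= (\<Sum>q \<in> Q. if parent T' q = r then 2 * D else 0)"
  proof -
    obtain q where "q \<in> Q" "parent T' q = r" using rootedge by blast
    then show ?thesis using Q(2) D_bounds(1) member_le_sum[of q Q "%q. if parent T' q = r then 2 * D else 0"] by auto
  qed
  moreover have "(\<Sum>q \<in> Q. of_int (weight (\<Lambda> q) - weight (\<Lambda> (parent T' q))) - E + (if parent T' q = r then 2 * D else 0)) <= tree_length r (pi / 4) T'"
    unfolding tree_length_eq[OF T'(1)] sum_distrib_left Q_def[symmetric] by (rule sum_mono) (rule term_ge)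
  ultimately have "2 * D + (real (card N) - 1) - real (card Q) * E <= 2 * D + real C + 1 / 2"
    using cN len T'(3) by (simp add: sum.distrib sum_subtractf)
  moreover have "real (card Q) * E < 1 / 2"
  proof -
    have "card Q <= (card X)\<^sup>2" using card_mono[OF crossings(1) Q(1)] crossings(2) by simp
    then have cq: "real (card Q) <= (real (card X))\<^sup>2" by (metis of_nat_le_iff of_nat_power)
    have "48 * (real M)\<^sup>2 * real (card Q) < D"
    proof -
      have "(real M)\<^sup>2 \<ge> 1" using M1 by (simp add: one_le_power)
      then have "48 * (real M)\<^sup>2 * real (card Q) <= 200 * (real M)\<^sup>2 * (real (card X))\<^sup>2" using cq by (intro mult_mono) auto
      also have "\<dots> < 200 * (real M)\<^sup>2 * ((real (card X))\<^sup>2 + real C + 2)"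
        using M1 by (intro mult_strict_left_mono) auto
      finally show ?thesis using D by linarith
    qed
    then show ?thesis using D_bounds(1) by (simp add: E_def field_simps)
  qed
  ultimately have "real (card N) < real (C + 2)" by simp
  then have "card N <= C + 1" by linarith
  then show ?thesis using arb XN by blast
qed

text \<open>The lattice is drawn exactly in logarithmic coordinates, shifted by \<open>err\<close>
  towards the root. Neighbours then reach each other along one spiral, and every terminal reaches
  its lattice copy by an arc of negligible length.\<close>

lemma upper:
  assumes N: "arborescence N" "X \<subseteq> N" "card N <= C + 1" and ts: "set ts = grid_point ` X"
  shows "\<exists>T. spiral_tree r ts (pi / 4) T & tree_length r (pi / 4) T <= 2 * D + real C + 1 / 2"
proof -
  have D0: "D > 0" by (rule D_bounds)
  \<comment> \<open>Supports have smaller coordinates, so cutting at \<open>M\<close> keeps all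
    supports of what remains, and the value estimates apply.\<close>
  define N' where "N' = {c \<in> N. fst c <= int M & snd c <= int M}"
  have fN: "finite N'" "X \<subseteq> N'" "card N' <= C + 1"
    using N X(3) card_mono[of N N'] by (auto simp: N'_def arborescence_def)
  have pos: "0 <= fst c & fst c <= int M & 0 <= snd c & snd c <= int M" if "c \<in> N'" for c
    using that N(1) by (auto simp: N'_def arborescence_def)
  define pre where "pre = (%c. if (fst c - 1, snd c) \<in> N' then (fst c - 1, snd c) else (fst c, snd c - 1))"
  have pre: "pre c \<in> N' & fst (pre c) <= fst c & snd (pre c) <= snd c & weight (pre c) = weight c - 1" if "c \<in> N'" "c ~= (0, 0)" for c
  proof -
    have "supported N c" using that N(1) by (auto simp: N'_def arborescence_def)
    then show ?thesis using that by (auto simp: supported_def N'_def pre_def weight_def)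
  qed
  \<comment> \<open>\<open>Inr c\<close> is a terminal and \<open>Inl c\<close> the shifted lattice
    point, which becomes its parent.\<close>
  define I where "I = Inl ` N' \<union> Inr ` X"
  define qx where "qx = (%c::cell. of_int (snd c) / D - err)"
  define qy where "qy = (%c::cell. of_int (fst c) / D - err)"
  define \<pi> where "\<pi> = case_sum (%c. pt (qx c) (qy c)) (%c. pt (lx c) (ly c))"
  define par where "par = case_sum (%c. if c = (0, 0) then None else Some (Inl (pre c) :: cell + cell)) (%c::cell. Some (Inl c))"
  define dep where "dep = case_sum (%c. nat (weight c)) (%c. nat (weight c + 1))"
  have "\<exists>T. spiral_tree r ts (pi / 4) T & nodes T = insert r (\<pi> ` I) &
    tree_length r (pi / 4) T <= sqrt 2 * (\<Sum>i \<in> I. cmod (\<pi> i - r) - (case par i of None => 0 | Some j => cmod (\<pi> j - r)))"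
  proof (rule tree_of_forest[where dep = dep])
    show "finite I" using fN X by (simp add: I_def)
    show "\<pi> i ~= r" if "i \<in> I" for i using that r_ne by (auto simp: I_def \<pi>_def)
    show "set ts \<subseteq> insert r (\<pi> ` I)" using ts grid_point_pt(1) by (force simp: I_def \<pi>_def)
    fix i j assume ij: "i \<in> I" "par i = Some j"
    show "j \<in> I & dep j < dep i & spiral_reach r (\<pi> i) (\<pi> j)"
    proof (cases i)
      case (Inl c)
      then have c: "c \<in> N'" "c ~= (0, 0)" "j = Inl (pre c)" using ij by (auto simp: I_def par_def split: if_splits)
      note p = pre[OF c(1,2)]
      have "weight (pre c) \<ge> 0" using p pos[of "pre c"] by (simp add: weight_def)
      moreover have "qx (pre c) <= qx c" "qy (pre c) <= qy c" using p D0 by (auto simp: qx_def qy_def divide_right_mono)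
      ultimately show ?thesis using p c Inl pt_reach by (auto simp: I_def \<pi>_def dep_def)
    next
      case (Inr c)
      then have c: "c \<in> X" "j = Inl c" using ij by (auto simp: I_def par_def)
      have "weight c \<ge> 0" using X(3)[OF c(1)] by (simp add: weight_def)
      moreover have "qx c <= lx c" "qy c <= ly c" using grid_point_pt(2,3)[OF c(1)] by (auto simp: qx_def qy_def)
      ultimately show ?thesis using c Inr fN pt_reach by (auto simp: I_def \<pi>_def dep_def)
    qed
  qed
  then obtain T where T: "spiral_tree r ts (pi / 4) T"
    "tree_length r (pi / 4) T <= (\<Sum>i \<in> I. sqrt 2 * (cmod (\<pi> i - r) - (case par i of None => 0 | Some j => cmod (\<pi> j - r))))"
    by (auto simp: sum_distrib_left)
  define v where "v = (%x y. 2 * (D * exp ((x + y) / 2)))"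
  have sv: "sqrt 2 * cmod (pt x y - r) = v x y" for x y by (simp add: norm_pt v_def)
  define F where "F = (%i. sqrt 2 * (cmod (\<pi> i - r) - (case par i of None => 0 | Some j => cmod (\<pi> j - r))))"
  have MD: "real M / D <= 1 / 400" using D_bounds(3) D0 by (simp add: field_simps)
  \<comment> \<open>By convexity the tangent at \<open>s\<close> bounds the increment.\<close>
  have expdiff: "exp s - exp s' <= exp s * (s - s')" for s s' :: real
  proof -
    have "exp s' = exp s * exp (s' - s)" by (simp flip: exp_add)
    moreover have "1 + (s' - s) <= exp (s' - s)" using exp_ge_add_one_self[of "s' - s"] by simp
    ultimately have "exp s * (1 + (s' - s)) <= exp s'" by (simp add: mult_left_mono)
    then show ?thesis by (simp add: algebra_simps)
  qed
  \<comment> \<open>A step to a neighbour lowers the exponent by \<open>1 / (2 * D)\<close> and so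
    costs at most \<open>exp s\<close>, which is close to 1; the origin pays the long arc to the
    root.\<close>
  have F0: "F (Inl c) <= (if c = (0, 0) then 2 * D else 1 + 2 * real M / D)" if c: "c \<in> N'" for c
  proof (cases "c = (0, 0)")
    case True
    have "exp (- err) <= 1" using D_bounds(4) by simp
    then have "v (- err) (- err) <= 2 * D" using D0 by (simp add: v_def)
    then show ?thesis using True by (simp add: F_def \<pi>_def par_def sv qx_def qy_def)
  next
    case False
    define s where "s = (qx c + qy c) / 2"
    define s' where "s' = (qx (pre c) + qy (pre c)) / 2"
    have ss: "s - s' = 1 / (2 * D)"
    proof -
      have "s - s' = (of_int (weight c) - of_int (weight (pre c))) / (2 * D)" using D0
        by (simp add: s_def s'_def qx_def qy_def weight_def field_simps)
      then show ?thesis using pre[OF c False] by simp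
    qed
    have "F (Inl c) = 2 * D * (exp s - exp s')"
      using False by (simp add: F_def \<pi>_def par_def sv v_def s_def s'_def right_diff_distrib)
    also have "\<dots> <= 2 * D * (exp s * (s - s'))" using expdiff D0 by (intro mult_left_mono) auto
    also have "\<dots> = exp s" using ss D0 by simp
    also have "\<dots> <= exp (real M / D)"
    proof -
      have "real_of_int (fst c) <= real M" "real_of_int (snd c) <= real M" using pos[OF c] by linarith+
      then have "real_of_int (fst c) / D <= real M / D" "real_of_int (snd c) / D <= real M / D" using D0 by (auto intro: divide_right_mono)
      then have "s <= real M / D" unfolding s_def qx_def qy_def
        by (intro half_le) (use D_bounds(4) in auto)
      then show ?thesis by simp
    qed
    also have "\<dots> <= 1 + real M / D + (real M / D)\<^sup>2" by (rule exp_le_quadratic) (use MD in linarith)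
    also have "\<dots> <= 1 + 2 * real M / D"
    proof -
      have "(real M / D)\<^sup>2 <= real M / D * 1" unfolding power2_eq_square using MD D0 by (intro mult_left_mono) auto
      then show ?thesis by simp
    qed
    finally show ?thesis using False by simp
  qed
  have F1: "F (Inr c) <= 32 * (real M)\<^sup>2 / D" if c: "c \<in> X" for c
  proof -
    define s where "s = (lx c + ly c) / 2"
    define s' where "s' = (qx c + qy c) / 2"
    have "lx c - qx c <= 2 * err" "ly c - qy c <= 2 * err" using grid_point_pt(2,3)[OF c] unfolding qx_def qy_def by linarith+
    then have "s - s' <= 2 * err" unfolding s_def s'_def by (rule half_diff_le)
    moreover have "exp s <= 2"
    proof -
      have "s <= 1 / 10" using coord_bounds[OF c] by (simp add: s_def abs_le_iff)
      then have "exp s <= exp (1 / 10)" by simp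
      also have "\<dots> <= 1 + 1 / 10 + (1 / 10)\<^sup>2" by (rule exp_le_quadratic) simp
      finally show ?thesis by (simp add: power2_eq_square)
    qed
    moreover have "qx c - lx c <= 0" "qy c - ly c <= 0" using grid_point_pt(2,3)[OF c] unfolding qx_def qy_def by linarith+
    then have "0 <= s - s'" using half_diff_le[of "qx c" "lx c" 0 "qy c" "ly c"] unfolding s_def s'_def by linarith
    ultimately have "exp s * (s - s') <= 2 * (2 * err)" by (intro mult_mono) auto
    then have "exp s - exp s' <= 4 * err" using expdiff[of s s'] by linarith
    then have "2 * D * (exp s - exp s') <= 2 * D * (4 * err)" using D0 by (intro mult_left_mono) auto
    moreover have "F (Inr c) = 2 * D * (exp s - exp s')"
      by (simp add: F_def \<pi>_def par_def sv v_def s_def s'_def right_diff_distrib)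
    moreover have "2 * D * (4 * err) = 32 * (real M)\<^sup>2 / D" using D0 by (simp add: err_def power2_eq_square)
    ultimately show ?thesis by simp
  qed
  have "tree_length r (pi / 4) T <= sum F I" using T(2) by (simp add: F_def)
  also have "sum F I = (\<Sum>c \<in> N'. F (Inl c)) + (\<Sum>c \<in> X. F (Inr c))"
    unfolding I_def using fN X by (subst sum.union_disjoint) (auto simp: sum.reindex)
  also have "\<dots> <= (2 * D + real C * (1 + 2 * real M / D)) + real (card X) * (32 * (real M)\<^sup>2 / D)"
  proof (rule add_mono)
    have "(\<Sum>c \<in> N'. F (Inl c)) <= (\<Sum>c \<in> N'. if c = (0, 0) then 2 * D else 1 + 2 * real M / D)" by (rule sum_mono) (rule F0)
    also have "\<dots> <= 2 * D + real C * (1 + 2 * real M / D)"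
    proof (cases "(0, 0) \<in> N'")
      case True
      have "(\<Sum>c \<in> N'. if c = (0, 0) then 2 * D else 1 + 2 * real M / D) = 2 * D + (\<Sum>c \<in> N' - {(0, 0)}. 1 + 2 * real M / D)"
        using fN(1) True by (subst sum.remove[OF _ True]) auto
      moreover have "card (N' - {(0, 0)}) <= C" using fN True by (simp add: card_Diff_singleton)
      ultimately show ?thesis using D0 by (simp add: mult_right_mono)
    next
      case False
      \<comment> \<open>Descending along supports ends in the origin, so only the empty set can lack
        it.\<close>
      have "N' = {}"
      proof (rule ccontr)
        assume "N' ~= {}"
        then obtain c where "c \<in> N'" by blast
        then show False
        proof (induction "nat (weight c)" arbitrary: c rule: less_induct)
          case less
          then have "c ~= (0, 0)" using False by blast
          note p = pre[OF less.prems this]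
          then show ?case using less.hyps[of "pre c"] pos[of "pre c"] pos[OF less.prems] by (auto simp: weight_def)
        qed
      qed
      then show ?thesis using D0 by simp
    qed
    finally show "(\<Sum>c \<in> N'. F (Inl c)) <= 2 * D + real C * (1 + 2 * real M / D)" .
    show "(\<Sum>c \<in> X. F (Inr c)) <= real (card X) * (32 * (real M)\<^sup>2 / D)"
      using sum_bounded_above[of X "%c. F (Inr c)" "32 * (real M)\<^sup>2 / D"] F1 by simp
  qed
  also have "\<dots> <= 2 * D + real C + 1 / 2"
  proof -
    have M1': "real M \<ge> 1" using M1 by simp
    then have MM: "real M <= (real M)\<^sup>2" by (simp add: power2_eq_square)
    have n: "real (card X) <= (real (card X))\<^sup>2"
      by (metis le_square of_nat_le_iff of_nat_mult power2_eq_square)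
    have "4 * (real C * real M) + 64 * (real (card X) * (real M)\<^sup>2) <= 4 * (real C * (real M)\<^sup>2) + 64 * ((real (card X))\<^sup>2 * (real M)\<^sup>2)"
      using MM n by (intro add_mono mult_left_mono mult_right_mono) auto
    also have "\<dots> <= 200 * (real M)\<^sup>2 * ((real (card X))\<^sup>2 + real C + 2)"
      by (simp add: algebra_simps)
    also have "\<dots> <= D" by (rule D)
    finally show ?thesis using D0 by (simp add: field_simps)
  qed
  finally show ?thesis using T(1) by blast
qed

theorem optimal_tree_le_iff:
  assumes ts: "set ts = grid_point ` X"
  shows "(\<exists>T. is_arg_min (tree_length r (pi / 4)) (spiral_tree r ts (pi / 4)) T & tree_length r (pi / 4) T <= 2 * D + real C + 1 / 2)
    \<longleftrightarrow> (\<exists>N. arborescence N & X \<subseteq> N & card N <= C + 1)"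
proof
  assume "\<exists>T. is_arg_min (tree_length r (pi / 4)) (spiral_tree r ts (pi / 4)) T & tree_length r (pi / 4) T <= 2 * D + real C + 1 / 2"
  then show "\<exists>N. arborescence N & X \<subseteq> N & card N <= C + 1" using lower[OF _ ts] by (auto simp: is_arg_min_def)
next
  assume "\<exists>N. arborescence N & X \<subseteq> N & card N <= C + 1"
  then obtain T where T: "spiral_tree r ts (pi / 4) T" "tree_length r (pi / 4) T <= 2 * D + real C + 1 / 2" using upper[OF _ _ _ ts] by blast
  obtain T' where T': "is_arg_min (tree_length r (pi / 4)) (spiral_tree r ts (pi / 4)) T'" using optimal_tree_exists[OF ts] by blast
  then have "tree_length r (pi / 4) T' <= tree_length r (pi / 4) T" using T(1) by (auto simp: is_arg_min_linorder)
  then show "\<exists>T. is_arg_min (tree_length r (pi / 4)) (spiral_tree r ts (pi / 4)) T & tree_length r (pi / 4) T <= 2 * D + real C + 1 / 2"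
    using T' T(2) by fastforce
qed

end

section \<open>Encodings are prefix-free\<close>

definition prefix_free :: "('a => bool list) => bool" where
  "prefix_free e \<longleftrightarrow> (\<forall>x y u v. e x @ u = e y @ v --> x = y & u = v)"

lemma prefix_freeD: "prefix_free e ==> e x @ u = e y @ v ==> x = y & u = v"
  by (auto simp: prefix_free_def)

lemma prefix_free_list:
  assumes "prefix_free e" shows "prefix_free (encode_list e)"
proof -
  have "xs = ys & u = v" if "encode_list e xs @ u = encode_list e ys @ v" for xs ys u v
    using that
  proof (induction xs arbitrary: ys)
    case Nil
    then show ?case by (cases ys) (auto simp: encode_list_def)
  next
    case (Cons x xs)
    show ?case
    proof (cases ys)
      case Nil
      then show ?thesis using Cons.prems by (auto simp: encode_list_def)
    next
      case (Cons y ys')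
      have "e x @ (encode_list e xs @ u) = e y @ (encode_list e ys' @ v)"
        using Cons.prems unfolding Cons by (simp add: encode_list_def)
      from prefix_freeD[OF assms this] have "x = y" "encode_list e xs @ u = encode_list e ys' @ v" by auto
      then show ?thesis using Cons.IH[of ys'] Cons by simp
    qed
  qed
  then show ?thesis unfolding prefix_free_def by blast
qed

lemma prefix_free_pair:
  assumes "prefix_free e" "prefix_free f" shows "prefix_free (encode_pair e f)"
  unfolding prefix_free_def
proof (intro allI impI)
  fix x y u v assume "encode_pair e f x @ u = encode_pair e f y @ v"
  then have "e (fst x) @ (f (snd x) @ u) = e (fst y) @ (f (snd y) @ v)" by (simp add: encode_pair_def)
  from prefix_freeD[OF assms(1) this] have "fst x = fst y" "f (snd x) @ u = f (snd y) @ v" by auto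
  then show "x = y & u = v" using prefix_freeD[OF assms(2)] by (auto simp: prod_eq_iff)
qed

lemma bits_inj: "bits m = bits n ==> m = n"
proof (induction m arbitrary: n rule: less_induct)
  case (less m)
  show ?case
  proof (cases "m = 0 \<or> n = 0")
    case True
    then show ?thesis using less.prems bits.simps[of m] bits.simps[of n] by (auto split: if_splits)
  next
    case False
    then have "odd m = odd n" "bits (m div 2) = bits (n div 2)" using less.prems bits.simps[of m] bits.simps[of n] by auto
    then have "m div 2 = n div 2" "m mod 2 = n mod 2" using less.IH[of "m div 2" "n div 2"] False by (auto simp: mod2_eq_if)
    then show ?thesis by (metis div_mult_mod_eq)
  qed
qed

lemma prefix_free_nat: "prefix_free encode_nat"
proof -
  have "prefix_free (%b. [b])" by (auto simp: prefix_free_def)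
  from prefix_free_list[OF this] show ?thesis unfolding prefix_free_def encode_nat_def using bits_inj by blast
qed

lemma prefix_free_int: "prefix_free encode_int"
  unfolding prefix_free_def
proof (intro allI impI)
  fix x y :: int and u v assume "encode_int x @ u = encode_int y @ v"
  then have "(x < 0) = (y < 0)" "encode_nat (nat \<bar>x\<bar>) @ u = encode_nat (nat \<bar>y\<bar>) @ v" by (auto simp: encode_int_def)
  moreover from this(2) have "nat \<bar>x\<bar> = nat \<bar>y\<bar>" "u = v" using prefix_freeD[OF prefix_free_nat] by blast+
  ultimately show "x = y & u = v" by linarith
qed

lemma prefix_free_rat: "prefix_free encode_rat"
  unfolding prefix_free_def encode_rat_def
  using prefix_freeD[OF prefix_free_pair[OF prefix_free_int prefix_free_int]]
  by (metis quotient_of_inject)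

lemma prefix_free_point: "prefix_free encode_point"
  unfolding encode_point_def by (intro prefix_free_pair prefix_free_rat)

lemma prefix_free_instance: "prefix_free encode_instance"
  unfolding prefix_free_def
proof (intro allI impI)
  fix x y :: spiral_instance and u v assume "encode_instance x @ u = encode_instance y @ v"
  then have 1: "encode_point (root x) @ (encode_list encode_point (terminals x) @ encode_rat (angle_coeff x) @ u) =
    encode_point (root y) @ (encode_list encode_point (terminals y) @ encode_rat (angle_coeff y) @ v)" by (simp add: encode_instance_def)
  have r: "root x = root y" using prefix_freeD[OF prefix_free_point 1] by simp
  from 1 have 2: "encode_list encode_point (terminals x) @ (encode_rat (angle_coeff x) @ u) =
    encode_list encode_point (terminals y) @ (encode_rat (angle_coeff y) @ v)"  using prefix_freeD[OF prefix_free_point 1] by simp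
  have t: "terminals x = terminals y" and 3: "encode_rat (angle_coeff x) @ u = encode_rat (angle_coeff y) @ v"
    using prefix_freeD[OF prefix_free_list[OF prefix_free_point] 2] by auto
  from prefix_freeD[OF prefix_free_rat 3] r t show "x = y & u = v" by simp
qed

text \<open>Unique decoding recovers the instance and the bound from the word.\<close>

lemma decision_problem_iff:
  "encode_pair encode_instance encode_rat (I, K) \<in> decision_problem encode_instance Inst optimal cost \<longleftrightarrow>
    I \<in> Inst & (\<exists>s. optimal I s & cost I s <= of_rat K)"
proof -
  have "(I', K') = (I, K)" if "encode_pair encode_instance encode_rat (I, K) = encode_pair encode_instance encode_rat (I', K')" for I' K'
    using prefix_freeD[OF prefix_free_pair[OF prefix_free_instance prefix_free_rat], of "(I, K)" "[]" "(I', K')" "[]"] that by simp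
  then show ?thesis unfolding decision_problem_def by auto
qed

text \<open>The numeral of \<open>n < 2 ^ w\<close> with exactly \<open>w\<close> digits.\<close>

fun digits :: "nat => nat => bool list" where
  "digits 0 n = []"
| "digits (Suc w) n = odd n # digits w (n div 2)"

text \<open>The nonzero high part protects the leading zeros of \<open>n\<close>; this gives
  numerals of fixed width, which a program can copy from a counter.\<close>

lemma bits_digits: "n < 2 ^ w ==> m > 0 ==> bits (2 ^ w * m + n) = digits w n @ bits m"
proof (induction w arbitrary: n)
  case (Suc w)
  have "bits (2 ^ Suc w * m + n) = odd n # bits ((2 ^ Suc w * m + n) div 2)"
    using Suc.prems by (subst bits.simps) auto
  also have "(2 ^ Suc w * m + n) div 2 = 2 ^ w * m + n div 2" by simp
  finally show ?case using Suc.IH[of "n div 2"] Suc.prems by simp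
qed simp

lemma bits_1: "bits 1 = [True]" "bits 0 = []" "bits 2 = [False, True]" "bits (Suc 0) = [True]"
  by (simp_all add: bits.simps)

section \<open>A structured language for Turing machines\<close>

text \<open>Tests and atomic actions depend on the symbols under the heads. The last two arguments of
  \<open>run c s n s'\<close> give the number of steps and the final tapes.\<close>

datatype com = Act "nat list => (nat \<times> move) list" | Seq com com
  | If "nat list => bool" com com | While "nat list => bool" com

inductive run :: "com => tape list => nat => tape list => bool" where
  Act: "run (Act f) s 1 (map2 act_tape (f (map read_tape s)) s)"
| Seq: "run c s n s' ==> run d s' m s'' ==> run (Seq c d) s (n + m) s''"
| IfT: "b (map read_tape s) ==> run c s n s' ==> run (If b c d) s (Suc n) s'"
| IfF: "\<not> b (map read_tape s) ==> run d s n s' ==> run (If b c d) s (Suc n) s'"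
| WhileF: "\<not> b (map read_tape s) ==> run (While b c) s 1 s"
| WhileT: "b (map read_tape s) ==> run c s n s' ==> run (While b c) s' m s'' ==> run (While b c) s (Suc (n + m)) s''"

fun states :: "com => nat" where
  "states (Act f) = 1"
| "states (Seq c d) = states c + states d"
| "states (If b c d) = Suc (states c + states d)"
| "states (While b c) = Suc (states c)"

definition keep :: "nat list => (nat \<times> move) list" where
  "keep ss = map (%s. (s, Stay)) ss"

text \<open>The code of \<open>c\<close> occupies the states from \<open>off\<close> on and continues in state \<open>e\<close>.\<close>

fun code :: "com => nat => nat => nat => nat list => nat \<times> (nat \<times> move) list" where
  "code (Act f) off e q ss = (e, f ss)"
| "code (Seq c d) off e q ss =
    (if q < off + states c then code c off (off + states c) q ss else code d (off + states c) e q ss)"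
| "code (If b c d) off e q ss =
    (if q = off then (if b ss then Suc off else Suc off + states c, keep ss)
     else if q < Suc off + states c then code c (Suc off) e q ss else code d (Suc off + states c) e q ss)"
| "code (While b c) off e q ss =
    (if q = off then (if b ss then Suc off else e, keep ss) else code c (Suc off) off q ss)"

definition machine :: "nat => nat => com => tm" where
  "machine k g c = \<lparr>num_tapes = k, num_syms = g, num_states = states c, delta = code c 0 (states c)\<rparr>"

fun wf_com :: "nat => nat => com => bool" where
  "wf_com k g (Act f) \<longleftrightarrow> (\<forall>ss. length ss = k & (\<forall>s \<in> set ss. s < g) --> length (f ss) = k & (\<forall>(s, m) \<in> set (f ss). s < g))"
| "wf_com k g (Seq c d) \<longleftrightarrow> wf_com k g c & wf_com k g d"
| "wf_com k g (If b c d) \<longleftrightarrow> wf_com k g c & wf_com k g d"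
| "wf_com k g (While b c) \<longleftrightarrow> wf_com k g c"

lemma states_pos: "states c > 0" by (induction c) auto

lemma code_wf:
  assumes "wf_com k g c" "length ss = k" "\<forall>s \<in> set ss. s < g" "off <= q" "q < off + states c"
  shows "(fst (code c off e q ss) = e \<or> fst (code c off e q ss) < off + states c) &
    length (snd (code c off e q ss)) = k & (\<forall>(s, m) \<in> set (snd (code c off e q ss)). s < g)"
  using assms(1,4,5)
proof (induction c arbitrary: off e)
  case (Act f)
  then show ?case using assms by auto
next
  case (Seq c d)
  show ?case
  proof (cases "q < off + states c")
    case True
    then have "fst (code c off (off + states c) q ss) <= off + states c"
      using Seq.IH(1)[of off "off + states c"] Seq.prems by fastforce
    then have "fst (code c off (off + states c) q ss) < off + (states c + states d)"
      using states_pos[of d] by linarith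
    then show ?thesis using True Seq.IH(1)[of off "off + states c"] Seq.prems by simp
  next
    case False
    then show ?thesis using Seq.IH(2)[of "off + states c" e] Seq.prems by (simp add: add.assoc)
  qed
next
  case (If b c d)
  show ?case
  proof (cases "q = off")
    case True
    then show ?thesis using assms(2,3) states_pos[of c] states_pos[of d] by (auto simp: keep_def)
  next
    case False
    show ?thesis
    proof (cases "q < Suc off + states c")
      case True
      then have "fst (code c (Suc off) e q ss) = e \<or> fst (code c (Suc off) e q ss) < off + states (If b c d)"
        using If.IH(1)[of "Suc off" e] If.prems \<open>q ~= off\<close> by fastforce
      then show ?thesis using True \<open>q ~= off\<close> If.IH(1)[of "Suc off" e] If.prems by simp
    next
      case False
      then show ?thesis using \<open>q ~= off\<close> If.IH(2)[of "Suc off + states c" e] If.prems by (simp add: add.assoc)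
    qed
  qed
next
  case (While b c)
  show ?case
  proof (cases "q = off")
    case True
    then show ?thesis using assms(2,3) states_pos[of c] by (auto simp: keep_def)
  next
    case False
    then have "fst (code c (Suc off) off q ss) < off + states (While b c)"
      using While.IH[of "Suc off" off] While.prems by fastforce
    then show ?thesis using False While.IH[of "Suc off" off] While.prems by simp
  qed
qed

lemma wf_machine: "wf_com k g c ==> k \<ge> 1 ==> g \<ge> 3 ==> wf_tm (machine k g c)"
  unfolding wf_tm_def machine_def using code_wf[of k g c _ 0 _ "states c"] by fastforce

lemma act_keep: "map2 act_tape (keep (map read_tape s)) s = s"
  by (induction s) (auto simp: keep_def act_tape_def read_tape_def)

lemma step_machine:
  "q < states c ==> step (machine k g c) (q, s) =
    (fst (code c 0 (states c) q (map read_tape s)), map2 act_tape (snd (code c 0 (states c) q (map read_tape s))) s)"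
  by (simp add: step_def machine_def Let_def)

text \<open>Control stays inside the code of \<open>c\<close>, wherever that code is placed.\<close>

lemma run_code:
  assumes "run c s n s'"
    and "\<And>q ss. off <= q ==> q < off + states c ==> code C 0 (states C) q ss = code c off e q ss"
    and "off + states c <= states C"
  shows "(step (machine k g C) ^^ n) (off, s) = (e, s')"
  using assms
proof (induction arbitrary: off e rule: run.induct)
  case (Act f s)
  then show ?case by (simp add: step_machine)
next
  case (Seq c s n s' d m s'')
  have "(step (machine k g C) ^^ n) (off, s) = (off + states c, s')" by (rule Seq.IH(1)) (use Seq.prems in auto)
  moreover have "(step (machine k g C) ^^ m) (off + states c, s') = (e, s'')" by (rule Seq.IH(2)) (use Seq.prems in auto)
  ultimately show ?case by (simp add: add.commute[of n] funpow_add)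
next
  case (IfT b s c n s' d)
  have "(step (machine k g C) ^^ n) (Suc off, s) = (e, s')" by (rule IfT.IH) (use IfT.prems in auto)
  moreover have "step (machine k g C) (off, s) = (Suc off, s)"
    using IfT.prems(1)[of off] IfT.prems(2) IfT.hyps by (simp add: step_machine act_keep)
  ultimately show ?case by (simp add: funpow_swap1)
next
  case (IfF b s d n s' c)
  have "(step (machine k g C) ^^ n) (Suc off + states c, s) = (e, s')" by (rule IfF.IH) (use IfF.prems in auto)
  moreover have "step (machine k g C) (off, s) = (Suc off + states c, s)"
    using IfF.prems(1)[of off] IfF.prems(2) IfF.hyps by (simp add: step_machine act_keep)
  ultimately show ?case by (simp add: funpow_swap1)
next
  case (WhileF b s c)
  then show ?case using WhileF.prems(1)[of off] by (simp add: step_machine act_keep)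
next
  case (WhileT b s c n s' m s'')
  have "(step (machine k g C) ^^ n) (Suc off, s) = (off, s')" by (rule WhileT.IH(1)) (use WhileT.prems in auto)
  moreover have "(step (machine k g C) ^^ m) (off, s') = (e, s'')" by (rule WhileT.IH(2)) (use WhileT.prems in auto)
  moreover have "step (machine k g C) (off, s) = (Suc off, s)"
    using WhileT.prems(1)[of off] WhileT.prems(2) WhileT.hyps by (simp add: step_machine act_keep)
  ultimately show ?case by (simp add: add.commute[of n] funpow_add funpow_swap1)
qed

lemma run_outputs:
  assumes "run c (snd (start_config (machine k g c) x)) n s'" "n <= T" "fst (hd s') = word_contents y"
  shows "tm_outputs_within (machine k g c) T x y"
proof -
  have "(step (machine k g c) ^^ n) (0, snd (start_config (machine k g c) x)) = (states c, s')"
    by (rule run_code[OF assms(1), of 0]) auto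
  moreover have "start_config (machine k g c) x = (0, snd (start_config (machine k g c) x))" by (simp add: start_config_def)
  ultimately show ?thesis using assms(2,3) unfolding tm_outputs_within_def by (intro exI[of _ n]) (simp add: machine_def)
qed

section \<open>Programs on registers\<close>

text \<open>A register holds a word, whose first letter is the top; a missing top is read as 0.
  \<open>For r f\<close> runs \<open>f a\<close> for the letters \<open>a\<close> of register \<open>r\<close> from the top down and keeps them.\<close>

datatype prog = Skip | Push nat nat | Pop nat | Case nat "nat => prog" | Then prog prog (infixr ";;" 60) | For nat "nat => prog"

definition top_of :: "nat list => nat" where
  "top_of xs = (case xs of [] => 0 | a # _ => a)"

lemma top_of_simps [simp]: "top_of [] = 0" "top_of (a # xs) = a"
  by (simp_all add: top_of_def)

type_synonym store = "nat => nat list"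

primrec sem :: "prog => store => store" where
  "sem Skip s = s"
| "sem (Push r a) s = s(r := a # s r)"
| "sem (Pop r) s = s(r := tl (s r))"
| "sem (Case r f) s = (%a. sem (f a)) (top_of (s r)) s"
| "sem (p ;; q) s = sem q (sem p s)"
| "sem (For r f) s = fold (%a. sem (f a)) (s r) s"

primrec used :: "prog => nat set" where
  "used Skip = {}"
| "used (Push r a) = {r}"
| "used (Pop r) = {r}"
| "used (Case r f) = insert r (\<Union>a. used (f a))"
| "used (p ;; q) = used p \<union> used q"
| "used (For r f) = insert r (\<Union>a. used (f a))"

primrec written :: "prog => nat set" where
  "written Skip = {}"
| "written (Push r a) = {r}"
| "written (Pop r) = {r}"
| "written (Case r f) = (\<Union>a. written (f a))"
| "written (p ;; q) = written p \<union> written q"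
| "written (For r f) = (\<Union>a. written (f a))"

primrec looped :: "prog => nat set" where
  "looped Skip = {}"
| "looped (Push r a) = {}"
| "looped (Pop r) = {}"
| "looped (Case r f) = (\<Union>a. looped (f a))"
| "looped (p ;; q) = looped p \<union> looped q"
| "looped (For r f) = insert r (\<Union>a. looped (f a))"

text \<open>While a loop runs, the head of its register is inside the word, so the body must not
  touch it. The letter 0 is the blank that marks the ends of a word and is never pushed.\<close>

primrec wf_prog :: "nat => nat => prog => bool" where
  "wf_prog k g Skip \<longleftrightarrow> True"
| "wf_prog k g (Push r a) \<longleftrightarrow> r < k & 0 < a & a < g"
| "wf_prog k g (Pop r) \<longleftrightarrow> r < k"
| "wf_prog k g (Case r f) \<longleftrightarrow> r < k & (\<forall>a. wf_prog k g (f a))"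
| "wf_prog k g (p ;; q) \<longleftrightarrow> wf_prog k g p & wf_prog k g q"
| "wf_prog k g (For r f) \<longleftrightarrow> r < k & (\<forall>a. wf_prog k g (f a) & r \<notin> used (f a))"

text \<open>Inside an outermost loop, the registers looped over must not change. This is what makes the
  running time polynomial.\<close>

primrec tame :: "prog => bool" where
  "tame Skip \<longleftrightarrow> True"
| "tame (Push r a) \<longleftrightarrow> True"
| "tame (Pop r) \<longleftrightarrow> True"
| "tame (Case r f) \<longleftrightarrow> (\<forall>a. tame (f a))"
| "tame (p ;; q) \<longleftrightarrow> tame p & tame q"
| "tame (For r f) \<longleftrightarrow> (\<Union>a. looped (f a)) \<inter> (\<Union>a. written (f a)) = {}"

lemma written_used: "written p \<subseteq> used p" by (induction p) auto

lemma looped_less: "wf_prog k g p ==> looped p \<subseteq> {..<k}" by (induction p) auto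

lemma sem_other: "r \<notin> written p ==> sem p s r = s r"
proof (induction p arbitrary: s)
  case (For x f)
  have "fold (%a. sem (f a)) xs s r = s r" for xs
    using For by (induction xs arbitrary: s) auto
  then show ?case by simp
qed auto

definition letters :: "nat => store => bool" where
  "letters g s \<longleftrightarrow> (\<forall>r. \<forall>a \<in> set (s r). 0 < a & a < g)"

lemma fold_letters:
  "(\<And>a s. letters g s ==> letters g (F a s)) ==> letters g s ==> letters g (fold F xs s)"
  by (induction xs arbitrary: s) auto

lemma sem_letters: "wf_prog k g p ==> letters g s ==> letters g (sem p s)"
proof (induction p arbitrary: s)
  case (Pop r)
  have "set (tl (s r)) \<subseteq> set (s r)" by (cases "s r") auto
  then show ?case using Pop by (auto simp: letters_def)
next
  case (For r f)
  then have "letters g (fold (%a. sem (f a)) (s r) s)" by (intro fold_letters) simp_all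
  then show ?case by simp
next
  case (Push r a)
  then show ?case by (simp add: letters_def)
qed simp_all

lemma top_less: "letters g s ==> 0 < g ==> top_of (s r) < g"
  by (cases "s r") (simp_all add: letters_def, metis list.set_intros(1))

subsection \<open>Running time\<close>

text \<open>The constants cover the compiled code: choosing among \<open>g\<close> letters takes up
  to \<open>g\<close> tests, and each letter of a loop is passed downwards and again on the way
  back.\<close>

primrec cost :: "nat => prog => store => nat" where
  "cost g Skip s = 1"
| "cost g (Push r a) s = 2"
| "cost g (Pop r) s = 1"
| "cost g (Case r f) s = g + 1 + (%a. cost g (f a)) (top_of (s r)) s"
| "cost g (p ;; q) s = cost g p s + cost g q (sem p s)"
| "cost g (For r f) s = 5 + snd (fold (%a (s, n). (sem (f a) s, n + (g + 6 + (%a. cost g (f a)) a s))) (s r) (s, 0))"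

text \<open>Inside a loop the registers looped over keep their lengths, so one \<open>n\<close>
  bounds all of them and nesting only multiplies.\<close>

primrec inner_bound :: "nat => prog => nat => nat" where
  "inner_bound g Skip n = 1"
| "inner_bound g (Push r a) n = 2"
| "inner_bound g (Pop r) n = 1"
| "inner_bound g (Case r f) n = g + 1 + (\<Sum>a<g. (%a. inner_bound g (f a)) a n)"
| "inner_bound g (p ;; q) n = inner_bound g p n + inner_bound g q n"
| "inner_bound g (For r f) n = 5 + n * (g + 6 + (\<Sum>a<g. (%a. inner_bound g (f a)) a n))"

text \<open>The second part of a sequence starts with registers that the first part has lengthened
  by at most its running time.\<close>

primrec bound :: "nat => prog => nat => nat" where
  "bound g Skip n = 1"
| "bound g (Push r a) n = 2"
| "bound g (Pop r) n = 1"
| "bound g (Case r f) n = g + 1 + (\<Sum>a<g. (%a. bound g (f a)) a n)"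
| "bound g (p ;; q) n = bound g p n + bound g q (n + bound g p n)"
| "bound g (For r f) n = 5 + n * (g + 6 + (\<Sum>a<g. inner_bound g (f a) n))"

lemma le_sum: "a < g ==> F a <= (\<Sum>a<g. F a)" for F :: "nat => nat"
  by (rule member_le_sum) auto

lemma loop_cost:
  assumes "\<And>a s. P s ==> a \<in> set xs ==> P (F a s)" "\<And>a s. P s ==> a \<in> set xs ==> c a s <= B" "P s"
  shows "snd (fold (%a (s, n). (F a s, n + c a s)) xs (s, m)) <= m + length xs * B"
  using assms
proof (induction xs arbitrary: s m)
  case (Cons a xs)
  have "snd (fold (%a (s, n). (F a s, n + c a s)) xs (F a s, m + c a s)) <= (m + c a s) + length xs * B"
    by (rule Cons.IH) (use Cons.prems in auto)
  moreover have "c a s <= B" using Cons.prems by auto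
  ultimately show ?case by simp
qed simp

lemma inner_cost:
  assumes "wf_prog k g p" "0 < g" "looped p \<inter> written p = {}" "letters g s" "\<And>r. r \<in> looped p ==> length (s r) <= n"
  shows "cost g p s <= inner_bound g p n"
  using assms
proof (induction p arbitrary: s)
  case (Case r f)
  let ?a = "top_of (s r)"
  have "?a < g" using Case.prems by (auto intro: top_less)
  moreover have "cost g (f ?a) s <= inner_bound g (f ?a) n"
    by (rule Case.IH) (use Case.prems in auto)
  ultimately show ?case using le_sum[of ?a g "%a. inner_bound g (f a) n"] by simp
next
  case (Then p q)
  have "cost g p s <= inner_bound g p n" by (rule Then.IH(1)) (use Then.prems in auto)
  moreover have "cost g q (sem p s) <= inner_bound g q n"
  proof (rule Then.IH(2))
    fix r assume "r \<in> looped q"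
    then have "sem p s r = s r" using Then.prems(3) by (intro sem_other) auto
    then show "length (sem p s r) <= n" using Then.prems(5) \<open>r \<in> looped q\<close> by simp
  qed (use Then.prems in \<open>auto intro: sem_letters\<close>)
  ultimately show ?case by simp
next
  case (For r f)
  let ?B = "g + 6 + (\<Sum>a<g. inner_bound g (f a) n)"
  define P where "P s' \<longleftrightarrow> letters g s' & (\<forall>r \<in> looped (For r f). length (s' r) <= n)" for s'
  have P: "P s" using For.prems by (auto simp: P_def)
  have nw: "r' \<notin> written (f a)" if "r' \<in> looped (For r f)" for r' a using For.prems(3) that by auto
  have "snd (fold (%a (s, n). (sem (f a) s, n + (g + 6 + cost g (f a) s))) (s r) (s, 0)) <= 0 + length (s r) * ?B"
  proof (rule loop_cost[where P = P])
    fix a s' assume s': "P s'" "a \<in> set (s r)"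
    show "P (sem (f a) s')" using s' For.prems nw by (auto simp: P_def sem_other intro: sem_letters)
    have "a < g" using s'(2) For.prems(4) by (auto simp: letters_def)
    have "cost g (f a) s' <= inner_bound g (f a) n"
    proof (rule For.IH)
      show "looped (f a) \<inter> written (f a) = {}" using For.prems(3) unfolding looped.simps written.simps by blast
      show "wf_prog k g (f a)" using For.prems(1) by simp
      show "0 < g" by fact
      show "letters g s'" using s' by (simp add: P_def)
      show "length (s' r) <= n" if "r \<in> looped (f a)" for r using s' that by (auto simp: P_def)
    qed simp
    then show "g + 6 + cost g (f a) s' <= ?B" using le_sum[OF \<open>a < g\<close>, of "%a. inner_bound g (f a) n"] by simp
  qed (rule P)
  moreover have "length (s r) * ?B <= n * ?B" using For.prems(5)[of r] by (intro mult_right_mono) auto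
  ultimately have "snd (fold (%a (s, n). (sem (f a) s, n + (g + 6 + cost g (f a) s))) (s r) (s, 0)) <= n * ?B"
    unfolding add_0 by (rule le_trans)
  then have "5 + snd (fold (%a (s, n). (sem (f a) s, n + (g + 6 + cost g (f a) s))) (s r) (s, 0)) <= 5 + n * ?B"
    by (rule add_left_mono)
  then show ?case by (simp only: cost.simps inner_bound.simps)
qed auto

definition total :: "nat => store => nat" where
  "total k s = (\<Sum>r<k. length (s r))"

lemma total_upd: "r < k ==> total k (s(r := xs)) + length (s r) = total k s + length xs"
  unfolding total_def by (subst (1 2) sum.remove[of _ r]) auto

lemma total_ge: "r < k ==> length (s r) <= total k s"
  unfolding total_def by (rule member_le_sum) auto

lemma total_sem: "wf_prog k g p ==> total k (sem p s) <= total k s + cost g p s"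
proof (induction p arbitrary: s)
  case Skip
  then show ?case by simp
next
  case (Push r a)
  then show ?case using total_upd[of r k s "a # s r"] by (simp add: fun_upd_def)
next
  case (Pop r)
  then show ?case using total_upd[of r k s "tl (s r)"] by (simp add: fun_upd_def)
next
  case (Case r f)
  have "total k (sem (f (top_of (s r))) s) <= total k s + cost g (f (top_of (s r))) s" using Case by auto
  then show ?case by simp
next
  case (Then p q)
  then have "total k (sem p s) <= total k s + cost g p s" "total k (sem q (sem p s)) <= total k (sem p s) + cost g q (sem p s)"
    by auto
  then show ?case by simp
next
  case (For r f)
  have "total k (fold (%a. sem (f a)) xs s') + m <= total k s' + snd (fold (%a (s, n). (sem (f a) s, n + (g + 6 + cost g (f a) s))) xs (s', m))" for xs s' m
  proof (induction xs arbitrary: s' m)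
    case (Cons a xs)
    have "total k (sem (f a) s') <= total k s' + cost g (f a) s'" using For by auto
    then show ?case using Cons[of "sem (f a) s'" "m + (g + 6 + cost g (f a) s')"] by simp
  qed simp
  from this[of "s r" s 0] show ?case by (simp add: split_def)
qed

text \<open>Monotonicity is what makes these functions closed under composition.\<close>

definition poly_bounded :: "(nat => nat) => bool" where
  "poly_bounded f \<longleftrightarrow> mono f & (\<exists>p :: nat poly. \<forall>n. f n <= poly p n)"

lemma poly_nat_mono: "m <= n ==> poly p m <= poly (p :: nat poly) n"
  by (induction p) (auto intro!: add_mono mult_mono)

lemma poly_bounded_const: "poly_bounded (%n. c)"
  unfolding poly_bounded_def by (auto intro!: monoI exI[of _ "[:c:]"])

lemma poly_bounded_id: "poly_bounded (%n. n)"
  unfolding poly_bounded_def by (auto intro!: monoI exI[of _ "[:0, 1:]"])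

lemma poly_bounded_add: assumes "poly_bounded f" "poly_bounded h" shows "poly_bounded (%n. f n + h n)"
proof -
  obtain p q where "\<And>n. f n <= poly p n" "\<And>n. h n <= poly q n" using assms unfolding poly_bounded_def by auto
  then have "\<forall>n. f n + h n <= poly (p + q) n" by (simp add: add_mono)
  moreover have "mono (%n. f n + h n)" using assms unfolding poly_bounded_def mono_def by (simp add: add_mono)
  ultimately show ?thesis unfolding poly_bounded_def by blast
qed

lemma poly_bounded_mult: assumes "poly_bounded f" "poly_bounded h" shows "poly_bounded (%n. f n * h n)"
proof -
  obtain p q where "\<And>n. f n <= poly p n" "\<And>n. h n <= poly q n" using assms unfolding poly_bounded_def by auto
  then have "\<forall>n. f n * h n <= poly (p * q) n" by (simp add: mult_mono)
  moreover have "mono (%n. f n * h n)" using assms unfolding poly_bounded_def mono_def by (simp add: mult_mono)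
  ultimately show ?thesis unfolding poly_bounded_def by blast
qed

lemma poly_bounded_comp: assumes "poly_bounded f" "poly_bounded h" shows "poly_bounded (%n. f (h n))"
proof -
  obtain p q where p: "\<And>n. f n <= poly p n" and q: "\<And>n. h n <= poly q n" using assms unfolding poly_bounded_def by auto
  have "f (h n) <= poly (pcompose p q) n" for n
  proof -
    have "f (h n) <= f (poly q n)" using assms(1) q unfolding poly_bounded_def mono_def by blast
    also have "\<dots> <= poly p (poly q n)" by (rule p)
    finally show ?thesis by (simp add: poly_pcompose)
  qed
  moreover have "mono (%n. f (h n))" using assms unfolding poly_bounded_def mono_def by blast
  ultimately show ?thesis unfolding poly_bounded_def by blast
qed

lemma poly_bounded_sum:
  assumes "\<And>i. i < (m::nat) ==> poly_bounded (f i)" shows "poly_bounded (%n. \<Sum>i<m. f i n)"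
  using assms by (induction m) (auto intro: poly_bounded_add poly_bounded_const)

lemmas poly_bounded_intros = poly_bounded_add poly_bounded_mult poly_bounded_const poly_bounded_id poly_bounded_sum

lemma inner_bound_base:
  "inner_bound g Skip = (%n. 1)" "bound g Skip = (%n. 1)" "inner_bound g (Push r a) = (%n. 2)" "inner_bound g (Pop r) = (%n. 1)"
  "bound g (Push r a) = (%n. 2)" "bound g (Pop r) = (%n. 1)"
  by auto

lemma poly_bounded_inner: "poly_bounded (inner_bound g p)"
proof (induction p)
  case (Case r f)
  have eq: "inner_bound g (Case r f) = (%n. g + 1 + (\<Sum>a<g. inner_bound g (f a) n))" by auto
  show ?case unfolding eq using Case by (intro poly_bounded_intros) blast
next
  case (Then p q)
  have "inner_bound g (p ;; q) = (%n. inner_bound g p n + inner_bound g q n)" by auto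
  then show ?case using Then by (auto intro!: poly_bounded_intros)
next
  case (For r f)
  have "inner_bound g (For r f) = (%n. 5 + n * (g + 6 + (\<Sum>a<g. inner_bound g (f a) n)))" by auto
  then show ?case using For by (auto intro!: poly_bounded_intros)
qed (simp_all add: poly_bounded_const inner_bound_base)

lemma poly_bounded_bound: "poly_bounded (bound g p)"
proof (induction p)
  case (Case r f)
  have eq: "bound g (Case r f) = (%n. g + 1 + (\<Sum>a<g. bound g (f a) n))" by auto
  show ?case unfolding eq using Case by (intro poly_bounded_intros) blast
next
  case (Then p q)
  have "bound g (p ;; q) = (%n. bound g p n + bound g q (n + bound g p n))" by auto
  then show ?case using Then by (auto intro!: poly_bounded_intros poly_bounded_comp[of "bound g q"])
next
  case (For r f)
  have "bound g (For r f) = (%n. 5 + n * (g + 6 + (\<Sum>a<g. inner_bound g (f a) n)))" by auto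
  then show ?case by (auto intro!: poly_bounded_intros poly_bounded_inner)
qed (simp_all add: poly_bounded_const inner_bound_base)

lemma cost_bound:
  assumes "wf_prog k g p" "0 < g" "tame p" "letters g s" "total k s <= n"
  shows "cost g p s <= bound g p n"
  using assms
proof (induction p arbitrary: s n)
  case (Case r f)
  let ?a = "top_of (s r)"
  have "?a < g" using Case.prems by (auto intro: top_less)
  moreover have "cost g (f ?a) s <= bound g (f ?a) n"
    by (rule Case.IH) (use Case.prems in auto)
  ultimately show ?case using le_sum[of ?a g "%a. bound g (f a) n"] by simp
next
  case (Then p q)
  have 1: "cost g p s <= bound g p n" by (rule Then.IH(1)) (use Then.prems in auto)
  moreover have "cost g q (sem p s) <= bound g q (n + bound g p n)"
  proof (rule Then.IH(2))
    have "total k (sem p s) <= total k s + cost g p s" using Then.prems by (intro total_sem) auto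
    then show "total k (sem p s) <= n + bound g p n" using 1 Then.prems(5) by linarith
  qed (use Then.prems in \<open>auto intro: sem_letters\<close>)
  ultimately show ?case by simp
next
  case (For r f)
  have r: "r \<notin> written (f a)" for a using For.prems(1) written_used[of "f a"] by auto
  have "cost g (For r f) s <= inner_bound g (For r f) n"
  proof (rule inner_cost[OF For.prems(1,2) _ For.prems(4)])
    show "looped (For r f) \<inter> written (For r f) = {}" using For.prems(3) r by auto
    fix x assume "x \<in> looped (For r f)"
    then have "x < k" using looped_less[OF For.prems(1)] by blast
    then show "length (s x) <= n" using total_ge[of x k s] For.prems(5) by linarith
  qed
  then show ?case by (simp only: bound.simps inner_bound.simps)
qed auto

subsection \<open>Compilation\<close>

text \<open>The top is the rightmost letter, under the head; the head of an empty register is at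
  position -1, on a blank.\<close>

definition stack :: "nat list => tape" where
  "stack xs = (%i. if 0 <= i & i < int (length xs) then rev xs ! nat i else 0, int (length xs) - 1)"

definition on :: "nat => (nat => nat \<times> move) => com" where
  "on r h = Act (%ss. (keep ss)[r := h (ss ! r)])"

primrec branch :: "nat => nat => (nat => com) => com" where
  "branch r 0 F = Act keep"
| "branch r (Suc a) F = If (%ss. ss ! r = a) (F a) (branch r a F)"

text \<open>From the blank below the word back to its top: onto the first cell, right to the blank
  behind the word, and one step back.\<close>

definition walk :: "nat => com" where
  "walk r = Seq (on r (%a. (a, Move_Right))) (Seq (While (%ss. ss ! r ~= 0) (on r (%a. (a, Move_Right)))) (on r (%a. (a, Move_Left))))"

primrec compile :: "nat => prog => com" where
  "compile g Skip = Act keep"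
| "compile g (Push r a) = Seq (on r (%b. (b, Move_Right))) (on r (%b. (a, Stay)))"
| "compile g (Pop r) = on r (%b. if b = 0 then (0, Stay) else (0, Move_Left))"
| "compile g (Case r f) = branch r g (%a. compile g (f a))"
| "compile g (p ;; q) = Seq (compile g p) (compile g q)"
| "compile g (For r f) = Seq (While (%ss. ss ! r ~= 0)
      (Seq (branch r g (%a. compile g (f a))) (on r (%a. (a, Move_Left))))) (walk r)"

lemma read_stack: "read_tape (stack xs) = top_of xs"
  by (cases xs) (auto simp: stack_def read_tape_def nth_append)

lemma run_on:
  assumes "r < length ts"
  shows "run (on r h) ts 1 (ts[r := act_tape (h (read_tape (ts ! r))) (ts ! r)])"
proof -
  have "map2 act_tape ((keep (map read_tape ts))[r := h (map read_tape ts ! r)]) ts = ts[r := act_tape (h (read_tape (ts ! r))) (ts ! r)]"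
    (is "?l = ?r")
  proof (rule nth_equalityI)
    fix i assume "i < length ?l"
    then have "i < length ts" by simp
    then show "?l ! i = ?r ! i" using assms
      by (cases "i = r") (auto simp: keep_def act_tape_def read_tape_def)
  qed (simp add: keep_def)
  then show ?thesis unfolding on_def using run.Act[of "%ss. (keep ss)[r := h (ss ! r)]" ts] by argo
qed

lemma run_branch:
  assumes "run (F a) ts n ts'" "read_tape (ts ! r) = a" "a < m" "r < length ts"
  shows "\<exists>n'. run (branch r m F) ts n' ts' & n' <= m + n"
  using assms(3)
proof (induction m)
  case (Suc m)
  show ?case
  proof (cases "a = m")
    case True
    have "run (branch r (Suc m) F) ts (Suc n) ts'" unfolding branch.simps
      by (rule run.IfT) (use assms True in auto)
    then show ?thesis by (intro exI[of _ "Suc n"]) auto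
  next
    case False
    then obtain n' where n': "run (branch r m F) ts n' ts'" "n' <= m + n" using Suc by auto
    have "run (branch r (Suc m) F) ts (Suc n') ts'" unfolding branch.simps
      by (rule run.IfF) (use assms False n' in auto)
    then show ?thesis using n' by (intro exI[of _ "Suc n'"]) auto
  qed
qed simp

lemma act_stack_push: "act_tape (a, Stay) (act_tape (read_tape (stack xs), Move_Right) (stack xs)) = stack (a # xs)"
  by (auto simp: act_tape_def stack_def read_tape_def fun_eq_iff nth_append)

lemma act_stack_pop: "xs ~= [] ==> act_tape (0, Move_Left) (stack xs) = stack (tl xs)"
  by (cases xs) (auto simp: act_tape_def stack_def fun_eq_iff nth_append)

text \<open>Restricted to \<open>R\<close> because the register of a running loop is not in the form
  of a stack.\<close>

definition holds :: "nat => nat set => store => tape list => bool" where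
  "holds k R s ts \<longleftrightarrow> length ts = k & (\<forall>r \<in> R. r < k & ts ! r = stack (s r))"

text \<open>The register of a loop after \<open>i\<close> rounds.\<close>

definition slid :: "nat list => nat => tape" where
  "slid xs i = (fst (stack xs), int (length xs) - 1 - int i)"

lemma read_slid: "i <= length xs ==> read_tape (slid xs i) = top_of (drop i xs)"
proof (cases "i < length xs")
  case True
  then have "drop i xs = xs ! i # drop (Suc i) xs" by (simp add: Cons_nth_drop_Suc)
  then show ?thesis using True by (auto simp: slid_def read_tape_def stack_def rev_nth nat_diff_distrib intro!: arg_cong[of _ _ "(!) xs"])
next
  case False
  assume "i <= length xs"
  with False have "i = length xs" by simp
  then show ?thesis by (auto simp: slid_def read_tape_def stack_def)
qed

lemma act_slid: "act_tape (read_tape (slid xs i), Move_Left) (slid xs i) = slid xs (Suc i)"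
  by (auto simp: slid_def act_tape_def read_tape_def)

lemma act_slid_right: "act_tape (read_tape (slid xs (Suc i)), Move_Right) (slid xs (Suc i)) = slid xs i"
  by (auto simp: slid_def act_tape_def read_tape_def)

lemma slid_0: "slid xs 0 = stack xs" by (simp add: slid_def stack_def)

lemma run_walk_while:
  assumes "r < length ts" "ts ! r = slid xs i" "i < length xs" "0 \<notin> set xs"
  shows "run (While (%ss. ss ! r ~= 0) (on r (%a. (a, Move_Right)))) ts (2 * i + 3) (ts[r := (fst (stack xs), int (length xs))])"
  using assms
proof (induction i arbitrary: ts)
  case 0
  have t: "ts ! r = stack xs" using 0 by (simp add: slid_0)
  have "run (While (%ss. ss ! r ~= 0) (on r (%a. (a, Move_Right)))) ts (Suc (1 + 1)) (ts[r := (fst (stack xs), int (length xs))])"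
  proof (rule run.WhileT)
    have "hd xs ~= 0" "top_of xs = hd xs" using 0 by (cases xs; auto)+
    then show "map read_tape ts ! r ~= 0" using 0(1) read_stack[of xs] unfolding t[symmetric] by simp
    have "act_tape (read_tape (ts ! r), Move_Right) (ts ! r) = (fst (stack xs), int (length xs))"
      unfolding t by (auto simp: act_tape_def read_tape_def stack_def)
    then show "run (on r (%a. (a, Move_Right))) ts 1 (ts[r := (fst (stack xs), int (length xs))])"
      using run_on[OF 0(1), of "%a. (a, Move_Right)"] by simp
    show "run (While (%ss. ss ! r ~= 0) (on r (%a. (a, Move_Right)))) (ts[r := (fst (stack xs), int (length xs))]) 1 (ts[r := (fst (stack xs), int (length xs))])"
      by (rule run.WhileF) (use 0 in \<open>simp add: read_tape_def stack_def\<close>)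
  qed
  then show ?case by (simp add: numeral_3_eq_3)
next
  case (Suc i)
  have "run (While (%ss. ss ! r ~= 0) (on r (%a. (a, Move_Right)))) ts (Suc (1 + (2 * i + 3))) ((ts[r := slid xs i])[r := (fst (stack xs), int (length xs))])"
  proof (rule run.WhileT)
    have "xs ! Suc i ~= 0" using Suc.prems by (metis nth_mem)
    then show "map read_tape ts ! r ~= 0" using Suc.prems by (simp add: read_slid flip: Cons_nth_drop_Suc)
    show "run (on r (%a. (a, Move_Right))) ts 1 (ts[r := slid xs i])"
      using run_on[OF Suc.prems(1), of "%a. (a, Move_Right)"] Suc.prems(2) by (simp add: act_slid_right)
    show "run (While (%ss. ss ! r ~= 0) (on r (%a. (a, Move_Right)))) (ts[r := slid xs i]) (2 * i + 3) ((ts[r := slid xs i])[r := (fst (stack xs), int (length xs))])"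
      by (rule Suc.IH) (use Suc.prems in auto)
  qed
  then show ?case by simp
qed

lemma run_walk:
  assumes "r < length ts" "ts ! r = slid xs (length xs)" "0 \<notin> set xs"
  shows "run (walk r) ts (2 * length xs + 3) (ts[r := stack xs])"
proof -
  let ?end = "(fst (stack xs), int (length xs))"
  have last: "run (on r (%a. (a, Move_Left))) (ts[r := ?end]) 1 (ts[r := stack xs])"
  proof -
    have "act_tape (read_tape ?end, Move_Left) ?end = stack xs" by (auto simp: act_tape_def read_tape_def stack_def)
    then show ?thesis using run_on[of r "ts[r := ?end]" "%a. (a, Move_Left)"] assms(1) by simp
  qed
  have first: "run (on r (%a. (a, Move_Right))) ts 1 (ts[r := (fst (stack xs), 0)])"
    using run_on[OF assms(1), of "%a. (a, Move_Right)"] assms(2)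
    by (simp add: act_tape_def read_tape_def slid_def)
  have "run (While (%ss. ss ! r ~= 0) (on r (%a. (a, Move_Right)))) (ts[r := (fst (stack xs), 0)]) (2 * length xs + 1) (ts[r := ?end])"
  proof (cases "xs = []")
    case True
    have "run (While (%ss. ss ! r ~= 0) (on r (%a. (a, Move_Right)))) (ts[r := (fst (stack xs), 0)]) 1 (ts[r := (fst (stack xs), 0)])"
      by (rule run.WhileF) (use True assms in \<open>simp add: read_tape_def stack_def\<close>)
    then show ?thesis using True by simp
  next
    case False
    then obtain m where m: "length xs = Suc m" by (cases xs) auto
    have "run (While (%ss. ss ! r ~= 0) (on r (%a. (a, Move_Right)))) (ts[r := (fst (stack xs), 0)]) (2 * m + 3) ((ts[r := (fst (stack xs), 0)])[r := ?end])"
      by (rule run_walk_while) (use assms m in \<open>auto simp: slid_def\<close>)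
    moreover have "2 * length xs + 1 = 2 * m + 3" using m by simp
    ultimately show ?thesis by (simp only: list_update_overwrite)
  qed
  then have "run (walk r) ts (1 + ((2 * length xs + 1) + 1)) (ts[r := stack xs])"
    unfolding walk_def by (intro run.Seq[OF first] run.Seq[OF _ last])
  then show ?thesis by (simp add: numeral_3_eq_3)
qed

text \<open>The set \<open>R\<close> varies in the induction: the body of a loop runs with the
  register of the loop taken out of \<open>R\<close>, and the last conjunct guarantees that the head
  in that register is still where the loop left it.\<close>

lemma run_compile:
  assumes "wf_prog k g p" "used p \<subseteq> R" "holds k R s ts" "letters g s" "0 < g"
  shows "\<exists>n ts'. run (compile g p) ts n ts' & n <= cost g p s & holds k R (sem p s) ts' & (\<forall>r. r \<notin> R --> ts' ! r = ts ! r)"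
  using assms
proof (induction p arbitrary: s ts R)
  case Skip
  have "run (Act keep) ts 1 (map2 act_tape (keep (map read_tape ts)) ts)" by (rule run.Act)
  then have "run (compile g Skip) ts 1 ts" unfolding compile.simps act_keep .
  then show ?case using Skip by (intro exI[of _ 1] exI[of _ ts]) simp
next
  case (Push r a)
  have r: "r < length ts" "ts ! r = stack (s r)" "r \<in> R" using Push by (auto simp: holds_def)
  let ?t = "act_tape (read_tape (ts ! r), Move_Right) (ts ! r)"
  have "run (compile g (Push r a)) ts (1 + 1) ((ts[r := ?t])[r := act_tape (a, Stay) ((ts[r := ?t]) ! r)])"
    unfolding compile.simps by (rule run.Seq[OF run_on[OF r(1)]]) (use run_on[of r "ts[r := ?t]" "%b. (a, Stay)"] r in simp)
  then have "run (compile g (Push r a)) ts 2 (ts[r := stack (a # s r)])"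
    using r act_stack_push[of a "s r"] by (simp add: numeral_2_eq_2)
  moreover have "holds k R (sem (Push r a) s) (ts[r := stack (a # s r)])"
    using Push.prems(3) by (auto simp: holds_def nth_list_update)
  moreover have "ts[r := stack (a # s r)] ! x = ts ! x" if "x \<notin> R" for x using that r(3) by (cases "x = r") auto
  ultimately show ?case by (intro exI[of _ 2] exI[of _ "ts[r := stack (a # s r)]"]) (simp add: fun_upd_def)
next
  case (Pop r)
  have r: "r < length ts" "ts ! r = stack (s r)" "r \<in> R" using Pop by (auto simp: holds_def)
  have "act_tape (if read_tape (ts ! r) = 0 then (0, Stay) else (0, Move_Left)) (ts ! r) = stack (tl (s r))"
  proof (cases "s r")
    case Nil
    then show ?thesis unfolding r(2) by (simp add: read_stack act_tape_def) (simp add: stack_def fun_eq_iff)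
  next
    case (Cons b xs)
    then have "b ~= 0" using Pop.prems(4) unfolding letters_def by (metis list.set_intros(1) not_gr_zero)
    then show ?thesis unfolding r(2) using act_stack_pop[of "s r"] Cons by (simp add: read_stack)
  qed
  then have "run (compile g (Pop r)) ts 1 (ts[r := stack (tl (s r))])"
    using run_on[OF r(1), of "%b. if b = 0 then (0, Stay) else (0, Move_Left)"] by simp
  moreover have "holds k R (sem (Pop r) s) (ts[r := stack (tl (s r))])"
    using Pop.prems(3) by (auto simp: holds_def nth_list_update)
  moreover have "ts[r := stack (tl (s r))] ! x = ts ! x" if "x \<notin> R" for x using that r(3) by (cases "x = r") auto
  ultimately show ?case by (intro exI[of _ 1] exI[of _ "ts[r := stack (tl (s r))]"]) (simp add: fun_upd_def)
next
  case (Case r f)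
  let ?a = "top_of (s r)"
  have r: "r < length ts" "ts ! r = stack (s r)" using Case.prems by (auto simp: holds_def)
  have "\<exists>n ts'. run (compile g (f ?a)) ts n ts' & n <= cost g (f ?a) s & holds k R (sem (f ?a) s) ts' & (\<forall>r. r \<notin> R --> ts' ! r = ts ! r)"
    by (rule Case.IH) (use Case.prems in auto)
  then obtain n ts' where n: "run (compile g (f ?a)) ts n ts'" "n <= cost g (f ?a) s" "holds k R (sem (f ?a) s) ts'" "\<forall>r. r \<notin> R --> ts' ! r = ts ! r"
    by blast
  obtain n' where "run (branch r g (%a. compile g (f a))) ts n' ts'" "n' <= g + n"
    using run_branch[of "%a. compile g (f a)" ?a ts n ts' r g] n(1) r top_less[OF Case.prems(4,5)] by (auto simp: read_stack)
  then show ?case using n by (intro exI[of _ n'] exI[of _ ts']) auto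
next
  case (Then p q)
  have "\<exists>n ts'. run (compile g p) ts n ts' & n <= cost g p s & holds k R (sem p s) ts' & (\<forall>r. r \<notin> R --> ts' ! r = ts ! r)"
    by (rule Then.IH(1)) (use Then.prems in auto)
  then obtain n ts' where n: "run (compile g p) ts n ts'" "n <= cost g p s" "holds k R (sem p s) ts'" "\<forall>r. r \<notin> R --> ts' ! r = ts ! r" by blast
  have "\<exists>n ts''. run (compile g q) ts' n ts'' & n <= cost g q (sem p s) & holds k R (sem q (sem p s)) ts'' & (\<forall>r. r \<notin> R --> ts'' ! r = ts' ! r)"
    by (rule Then.IH(2)) (use Then.prems n in \<open>auto intro: sem_letters\<close>)
  then obtain m ts'' where m: "run (compile g q) ts' m ts''" "m <= cost g q (sem p s)" "holds k R (sem q (sem p s)) ts''" "\<forall>r. r \<notin> R --> ts'' ! r = ts' ! r" by blast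
  have "run (compile g (p ;; q)) ts (n + m) ts''" unfolding compile.simps by (rule run.Seq[OF n(1) m(1)])
  then show ?case using n m by (intro exI[of _ "n + m"] exI[of _ ts'']) auto
next
  case (For r f)
  let ?xs = "s r"
  let ?G = "%a (s, n). (sem (f a) s, n + (g + 6 + cost g (f a) s))"
  let ?loop = "While (%ss. ss ! r ~= 0) (Seq (branch r g (%a. compile g (f a))) (on r (%a. (a, Move_Left))))"
  have r: "r < length ts" "ts ! r = stack ?xs" "r \<in> R" "r < k" using For.prems by (auto simp: holds_def)
  have nz: "0 \<notin> set ?xs" and lt: "\<forall>a \<in> set ?xs. a < g" using For.prems(4) by (auto simp: letters_def)
  \<comment> \<open>The term \<open>2 * (length ?xs - i)\<close> reserves two steps per remaining
    letter for the walk back; \<open>m\<close> is the cost of the earlier rounds.\<close>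
  have loop: "\<exists>n ts'. run ?loop ts0 n ts' & n + m + 2 * (length ?xs - i) <= 1 + snd (fold ?G (drop i ?xs) (s0, m)) &
      holds k (R - {r}) (fold (%a. sem (f a)) (drop i ?xs) s0) ts' & (\<forall>x. x \<notin> R --> ts' ! x = ts0 ! x) & ts' ! r = slid ?xs (length ?xs)"
    if "i <= length ?xs" "holds k (R - {r}) s0 ts0" "ts0 ! r = slid ?xs i" "letters g s0" for i s0 ts0 m
    using that
  proof (induction "length ?xs - i" arbitrary: i s0 ts0 m)
    case 0
    then have i: "i = length ?xs" by simp
    have "run ?loop ts0 1 ts0"
      by (rule run.WhileF) (use 0 r i in \<open>simp add: holds_def read_slid\<close>)
    then show ?case using 0 i by (intro exI[of _ 1] exI[of _ ts0]) auto
  next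
    case (Suc l)
    then have i: "i < length ?xs" by simp
    define a where "a = ?xs ! i"
    have dr: "drop i ?xs = a # drop (Suc i) ?xs" unfolding a_def using i by (simp add: Cons_nth_drop_Suc)
    have a: "a < g" "a ~= 0" using nz lt i nth_mem[OF i] unfolding a_def by metis+
    have len: "length ts0 = k" using Suc.prems by (simp add: holds_def)
    have rd: "read_tape (ts0 ! r) = a" using Suc.prems i dr by (simp add: read_slid)
    have "\<exists>n ts'. run (compile g (f a)) ts0 n ts' & n <= cost g (f a) s0 & holds k (R - {r}) (sem (f a) s0) ts' & (\<forall>x. x \<notin> R - {r} --> ts' ! x = ts0 ! x)"
      by (rule For.IH) (use For.prems Suc.prems in auto)
    then obtain n1 ts1 where n1: "run (compile g (f a)) ts0 n1 ts1" "n1 <= cost g (f a) s0" "holds k (R - {r}) (sem (f a) s0) ts1" "\<forall>x. x \<notin> R - {r} --> ts1 ! x = ts0 ! x"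
      by blast
    obtain n2 where n2: "run (branch r g (%a. compile g (f a))) ts0 n2 ts1" "n2 <= g + n1"
      using run_branch[of "%a. compile g (f a)" a ts0 n1 ts1 r g] n1(1) rd a len r by auto
    have len1: "length ts1 = k" using n1(3) by (simp add: holds_def)
    have tr: "ts1 ! r = slid ?xs i" using n1(4) Suc.prems by auto
    have mv: "run (on r (%a. (a, Move_Left))) ts1 1 (ts1[r := slid ?xs (Suc i)])"
      using run_on[of r ts1 "%a. (a, Move_Left)"] tr len1 r by (simp add: act_slid)
    have "\<exists>n ts'. run ?loop (ts1[r := slid ?xs (Suc i)]) n ts' &
      n + (m + (g + 6 + cost g (f a) s0)) + 2 * (length ?xs - Suc i) <= 1 + snd (fold ?G (drop (Suc i) ?xs) (sem (f a) s0, m + (g + 6 + cost g (f a) s0))) &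
      holds k (R - {r}) (fold (%a. sem (f a)) (drop (Suc i) ?xs) (sem (f a) s0)) ts' &
      (\<forall>x. x \<notin> R --> ts' ! x = ts1[r := slid ?xs (Suc i)] ! x) & ts' ! r = slid ?xs (length ?xs)"
    proof (rule Suc.hyps(1))
      show "holds k (R - {r}) (sem (f a) s0) (ts1[r := slid ?xs (Suc i)])" using n1(3) by (auto simp: holds_def)
      show "ts1[r := slid ?xs (Suc i)] ! r = slid ?xs (Suc i)" using len1 r by simp
      show "letters g (sem (f a) s0)" using For.prems Suc.prems by (auto intro: sem_letters)
    qed (use Suc.hyps i in auto)
    then obtain n3 ts' where n3: "run ?loop (ts1[r := slid ?xs (Suc i)]) n3 ts'"
      "n3 + (m + (g + 6 + cost g (f a) s0)) + 2 * (length ?xs - Suc i) <= 1 + snd (fold ?G (drop (Suc i) ?xs) (sem (f a) s0, m + (g + 6 + cost g (f a) s0)))"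
      "holds k (R - {r}) (fold (%a. sem (f a)) (drop (Suc i) ?xs) (sem (f a) s0)) ts'"
      "\<forall>x. x \<notin> R --> ts' ! x = ts1[r := slid ?xs (Suc i)] ! x" "ts' ! r = slid ?xs (length ?xs)" by blast
    have "run ?loop ts0 (Suc ((n2 + 1) + n3)) ts'"
      by (rule run.WhileT[OF _ run.Seq[OF n2(1) mv] n3(1)]) (use rd a len r in simp)
    moreover have "Suc ((n2 + 1) + n3) + m + 2 * (length ?xs - i) <= 1 + snd (fold ?G (drop i ?xs) (s0, m))"
      using n3(2) n2(2) n1(2) i by (simp add: dr)
    moreover have "ts' ! x = ts0 ! x" if "x \<notin> R" for x
    proof -
      have "x ~= r" using that r by auto
      then show ?thesis using n3(4) n1(4) that by simp
    qed
    ultimately show ?case using n3 dr by (intro exI[of _ "Suc ((n2 + 1) + n3)"] exI[of _ ts']) simp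
  qed
  have "\<exists>n ts'. run ?loop ts n ts' & n + 0 + 2 * (length ?xs - 0) <= 1 + snd (fold ?G (drop 0 ?xs) (s, 0)) &
      holds k (R - {r}) (fold (%a. sem (f a)) (drop 0 ?xs) s) ts' & (\<forall>x. x \<notin> R --> ts' ! x = ts ! x) & ts' ! r = slid ?xs (length ?xs)"
    by (rule loop) (use For.prems r in \<open>auto simp: holds_def slid_0\<close>)
  then obtain n ts' where n: "run ?loop ts n ts'" "n + 2 * length ?xs <= 1 + snd (fold ?G ?xs (s, 0))"
      "holds k (R - {r}) (fold (%a. sem (f a)) ?xs s) ts'" "\<forall>x. x \<notin> R --> ts' ! x = ts ! x" "ts' ! r = slid ?xs (length ?xs)"
    by auto
  have len': "length ts' = k" using n(3) by (simp add: holds_def)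
  have "run (compile g (For r f)) ts (n + (2 * length ?xs + 3)) (ts'[r := stack ?xs])"
    unfolding compile.simps by (rule run.Seq[OF n(1) run_walk]) (use n(5) len' r nz in auto)
  moreover have "sem (For r f) s r = s r" using For.prems(1) written_used by (intro sem_other) auto
  then have "holds k R (sem (For r f) s) (ts'[r := stack ?xs])"
    using n(3) r by (auto simp: holds_def nth_list_update)
  moreover have "ts'[r := stack ?xs] ! x = ts ! x" if "x \<notin> R" for x
    using n(4) that r(3) by (cases "x = r") auto
  moreover have "n + (2 * length ?xs + 3) <= cost g (For r f) s" using n(2) by (simp add: split_def)
  ultimately show ?case by blast
qed

lemma wf_on: "(\<And>a. a < g ==> fst (h a) < g) ==> r < k ==> wf_com k g (on r h)"
proof -
  assume h: "\<And>a. a < g ==> fst (h a) < g" and r: "r < k"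
  have "length ((keep ss)[r := h (ss ! r)]) = k & (\<forall>(s, m) \<in> set ((keep ss)[r := h (ss ! r)]). s < g)"
    if "length ss = k" "\<forall>s \<in> set ss. s < g" for ss
  proof -
    have "set ((keep ss)[r := h (ss ! r)]) \<subseteq> insert (h (ss ! r)) (set (keep ss))" by (rule set_update_subset_insert)
    moreover have "fst (h (ss ! r)) < g" using h that r by simp
    moreover have "\<forall>(s, m) \<in> set (keep ss). s < g" using that(2) by (simp add: keep_def)
    ultimately have "\<forall>(s, m) \<in> set ((keep ss)[r := h (ss ! r)]). s < g"
      by (intro ballI) (auto simp: split_def)
    then show ?thesis using that(1) by (simp add: keep_def)
  qed
  then show ?thesis unfolding on_def wf_com.simps by blast
qed

lemma wf_branch: "(\<And>a. wf_com k g (F a)) ==> wf_com k g (branch r m F)"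
  by (induction m) (auto simp: keep_def)

lemma wf_compile: "wf_prog k g p ==> wf_com k g (compile g p)"
  by (induction p) (auto simp: walk_def keep_def intro!: wf_on wf_branch)

definition input_store :: "bool list => store" where
  "input_store x = (%r. if r = 0 then rev (map (%b. if b then 2 else 1) x) else [])"

text \<open>A fresh tape has its head at 0, but an empty register expects it at -1, so all heads
  step left; then the head of the input walks to the last letter.\<close>

definition start_up :: com where
  "start_up = Seq (Act (%ss. map (%s. (s, Move_Left)) ss)) (walk 0)"

lemma stack_word: "fst (stack (rev (map (%b. if b then 2 else 1) y))) = word_contents y"
  by (auto simp: stack_def word_contents_def fun_eq_iff)

lemma run_start_up:
  assumes "k \<ge> 1"
  shows "\<exists>ts. run start_up ((word_contents x, 0) # replicate (k - 1) (word_contents [], 0)) (2 * length x + 4) ts & holds k {..<k} (input_store x) ts"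
proof -
  let ?w = "rev (map (%b. if b then 2 else 1 :: nat) x)"
  let ?ts0 = "(word_contents x, 0) # replicate (k - 1) (word_contents [], 0)"
  let ?ts1 = "(word_contents x, - 1) # replicate (k - 1) (stack [])"
  have e: "stack [] = (word_contents [], - 1)" by (auto simp: stack_def word_contents_def fun_eq_iff)
  have "map2 act_tape (map (%s. (s, Move_Left)) (map read_tape ts)) ts = map (%t. (fst t, snd t - 1)) ts" for ts
    by (induction ts) (auto simp: act_tape_def read_tape_def)
  from this[of ?ts0] have "map2 act_tape (map (%s. (s, Move_Left)) (map read_tape ?ts0)) ?ts0 = ?ts1"
    by (simp only: e) simp
  then have "run (Act (%ss. map (%s. (s, Move_Left)) ss)) ?ts0 1 ?ts1"
    using run.Act[of "%ss. map (%s. (s, Move_Left)) ss" ?ts0] by (simp only:)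
  moreover have "run (walk 0) ?ts1 (2 * length ?w + 3) (?ts1[0 := stack ?w])"
    by (rule run_walk) (auto simp: slid_def stack_word)
  ultimately have "run start_up ?ts0 (1 + (2 * length ?w + 3)) (?ts1[0 := stack ?w])"
    unfolding start_up_def by (rule run.Seq)
  moreover have "holds k {..<k} (input_store x) (?ts1[0 := stack ?w])"
    using assms by (auto simp: holds_def input_store_def nth_Cons')
  ultimately show ?thesis by (intro exI[of _ "?ts1[0 := stack ?w]"]) (simp add: add.commute)
qed

text \<open>Words appear reversed because the top of a register is the right end of its
  tape.\<close>

theorem poly_time_prog:
  assumes wf: "wf_prog k g p" and tame: "tame p" and k: "k \<ge> 1" and g: "g \<ge> 3"
    and p: "\<And>x. sem p (input_store x) 0 = rev (map (%b. if b then 2 else 1) (f x))"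
  shows "poly_time f"
proof -
  let ?c = "Seq start_up (compile g p)"
  have used: "used p \<subseteq> {..<k}" using wf by (induction p) auto
  have "wf_com k g start_up" unfolding start_up_def walk_def using k by (auto intro!: wf_on)
  then have "wf_tm (machine k g ?c)" using wf_compile[OF wf] k g by (intro wf_machine) auto
  moreover have "poly_bounded (%n. 2 * n + 4 + bound g p n)"
    by (intro poly_bounded_intros poly_bounded_bound)
  then obtain P where P: "\<And>n. 2 * n + 4 + bound g p n <= poly P n" unfolding poly_bounded_def by blast
  moreover have "tm_outputs_within (machine k g ?c) (poly P (length x)) x (f x)" for x
  proof -
    obtain ts where ts: "run start_up ((word_contents x, 0) # replicate (k - 1) (word_contents [], 0)) (2 * length x + 4) ts" "holds k {..<k} (input_store x) ts"
      using run_start_up[OF k] by blast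
    have l: "letters g (input_store x)" using g by (auto simp: letters_def input_store_def)
    obtain n ts' where n: "run (compile g p) ts n ts'" "n <= cost g p (input_store x)" "holds k {..<k} (sem p (input_store x)) ts'"
      using run_compile[OF wf used ts(2) l] g by auto
    have "total k (input_store x) <= length x"
      using k by (simp add: total_def input_store_def sum.If_cases if_distrib[of length] sum.delta cong: if_cong)
    then have "cost g p (input_store x) <= bound g p (length x)" using wf tame l g by (intro cost_bound) auto
    then have "2 * length x + 4 + n <= poly P (length x)" using n(2) P[of "length x"] by linarith
    moreover have "ts' ! 0 = stack (rev (map (%b. if b then 2 else 1) (f x)))" "length ts' = k"
      using n(3) k p[of x] by (auto simp: holds_def)
    then have "fst (hd ts') = word_contents (f x)" using k by (cases ts') (auto simp: stack_word)
    moreover have "run ?c (snd (start_config (machine k g ?c) x)) (2 * length x + 4 + n) ts'"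
      using run.Seq[OF ts(1) n(1)] by (simp add: start_config_def machine_def)
    ultimately show ?thesis by (intro run_outputs)
  qed
  ultimately show ?thesis unfolding poly_time_def by blast
qed

subsection \<open>Program fragments\<close>

definition push_all :: "nat => nat list => prog" where
  "push_all r xs = foldr (%a p. Push r a ;; p) xs Skip"

lemma sem_push_all [simp]: "sem (push_all r xs) s = s(r := rev xs @ s r)"
  by (induction xs arbitrary: s) (auto simp: push_all_def fun_upd_def)

lemma push_all_regs [simp]: "used (push_all r xs) \<subseteq> {r}" "written (push_all r xs) \<subseteq> {r}" "looped (push_all r xs) = {}" "tame (push_all r xs)"
  by (induction xs) (auto simp: push_all_def)

lemma push_all_used: "x \<in> used (push_all r xs) ==> x = r" "x \<in> written (push_all r xs) ==> x = r"
  using push_all_regs by blast+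

lemma push_all_wf [simp]: "wf_prog k g (push_all r xs) \<longleftrightarrow> xs = [] \<or> r < k & (\<forall>a \<in> set xs. 0 < a & a < g)"
  by (induction xs) (auto simp: push_all_def)

text \<open>Programs have to handle every number as a letter; only the letters up to 15 matter.\<close>

definition ltr :: "nat => nat" where
  "ltr a = (if 0 < a & a < 16 then a else 1)"

lemma ltr [simp]: "0 < ltr a" "ltr a < 16" "0 < a ==> a < 16 ==> ltr a = a"
  by (auto simp: ltr_def)

lemma sem_upd: "r \<notin> used p ==> sem p (s(r := v)) = (sem p s)(r := v)"
proof (induction p arbitrary: s)
  case (For x f)
  have "fold (%a. sem (f a)) xs (s(r := v)) = (fold (%a. sem (f a)) xs s)(r := v)" for xs
    using For by (induction xs arbitrary: s) auto
  moreover have "(s(r := v)) x = s x" using For.prems by simp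
  ultimately show ?case by (simp only: sem.simps)
qed (auto simp: fun_upd_twist)

lemma fold_upd:
  assumes "\<And>x. a \<notin> used (p x)"
  shows "fold (%x. sem (p x)) ys (t(a := v)) = (fold (%x. sem (p x)) ys t)(a := v)"
proof (induction ys arbitrary: t)
  case (Cons y ys)
  show ?case unfolding fold_simps sem_upd[OF assms] by (rule Cons)
qed simp

text \<open>A loop cannot change its own register, so a word to be consumed is popped under the
  clock of another register \<open>r\<close>, which has to be long enough. Surplus rounds see the
  letter 0 and do nothing.\<close>

definition pop_loop :: "nat => nat => (nat => prog) => prog" where
  "pop_loop r a p = For r (%_. Case a (%x. if x = 0 then Skip else Pop a ;; p x))"

lemma sem_pop_loop:
  assumes "length (s a) <= length (s r)" "0 \<notin> set (s a)" "\<And>x. a \<notin> used (p x)"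
  shows "sem (pop_loop r a p) s = (fold (%x. sem (p x)) (s a) s)(a := [])"
proof -
  have main: "fold (%_ s. sem (if top_of (s a) = 0 then Skip else Pop a ;; p (top_of (s a))) s) ws s = (fold (%x. sem (p x)) (s a) s)(a := [])"
    if "length (s a) <= length ws" "0 \<notin> set (s a)" for ws :: "nat list" and s
    using that
  proof (induction ws arbitrary: s)
    case Nil
    then show ?case by (simp add: fun_upd_idem)
  next
    case (Cons w ws)
    show ?case
    proof (cases "s a")
      case Nil
      then show ?thesis using Cons.IH[of s] by simp
    next
      case (Cons x xs)
      define s1 where "s1 = sem (p x) (s(a := xs))"
      have s1: "s1 = (sem (p x) s)(a := xs)" unfolding s1_def by (rule sem_upd) (rule assms)
      have a: "s1 a = xs" by (simp add: s1)
      have "fold (%_ s. sem (if top_of (s a) = 0 then Skip else Pop a ;; p (top_of (s a))) s) (w # ws) s =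
        fold (%_ s. sem (if top_of (s a) = 0 then Skip else Pop a ;; p (top_of (s a))) s) ws s1"
        using Cons \<open>0 \<notin> set (s a)\<close> by (simp add: s1_def)
      also have "\<dots> = (fold (%x. sem (p x)) xs s1)(a := [])"
        using Cons.IH[of s1] Cons Cons.prems unfolding a by auto
      also have "fold (%x. sem (p x)) xs s1 = (fold (%x. sem (p x)) xs (sem (p x) s))(a := xs)"
        unfolding s1 by (rule fold_upd) (rule assms)
      finally show ?thesis unfolding Cons fold_simps fun_upd_upd .
    qed
  qed
  have eq: "sem (Case a (%x. if x = 0 then Skip else Pop a ;; p x)) =
    (%s. sem (if top_of (s a) = 0 then Skip else Pop a ;; p (top_of (s a))) s)" by (rule ext) (simp only: sem.simps)
  show ?thesis unfolding pop_loop_def sem.simps(6) eq by (rule main[of s "s r", OF assms(1,2)])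
qed

definition move_all :: "nat => nat => nat => prog" where
  "move_all r a b = pop_loop r a (%x. Push b (ltr x))"

lemma sem_move_all:
  assumes "length (s a) <= length (s r)" "set (s a) \<subseteq> {0<..<16}" "a ~= b"
  shows "sem (move_all r a b) s = s(a := [], b := rev (s a) @ s b)"
proof -
  have "fold (%x. sem (Push b (ltr x))) xs s = s(b := rev xs @ s b)" if "set xs \<subseteq> {0<..<16}" for xs s
    using that by (induction xs arbitrary: s) (auto simp: fun_upd_def)
  from this[OF assms(2)] show ?thesis unfolding move_all_def using assms
    by (subst sem_pop_loop) (auto simp: fun_upd_twist)
qed

subsection \<open>Binary counters\<close>

abbreviation bit_letter :: "bool => nat" where
  "bit_letter b \<equiv> (if b then 2 else 1)"

definition binary :: "nat => nat => nat list" where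
  "binary w n = map bit_letter (digits w n)"

lemma binary_simps [simp]: "binary 0 n = []" "binary (Suc w) n = bit_letter (odd n) # binary w (n div 2)"
  by (simp_all add: binary_def)

lemma length_binary [simp]: "length (binary w n) = w"
  by (induction w arbitrary: n) auto

lemma length_digits [simp]: "length (digits w n) = w"
  by (induction w arbitrary: n) auto

lemma set_binary: "set (binary w n) \<subseteq> {1, 2}"
  by (auto simp: binary_def)

lemma binary_zero: "binary w 0 = replicate w 1"
  by (induction w) auto

text \<open>Register 2 contains a word of the length of the numerals, 6 is a buffer and 7 holds the carry.\<close>

definition add_step :: "nat => prog" where
  "add_step b = Case 7 (%f. if f = 1 then (if b = 2 then Push 6 1 else Push 6 2 ;; Pop 7) else Push 6 (if b = 2 then 2 else 1))"

definition inc :: "nat => prog" where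
  "inc c = Push 7 1 ;; pop_loop 2 c add_step ;; move_all 2 6 c ;; Pop 7"

lemma sem_add_step:
  "sem (add_step (bit_letter b)) (s(6 := t, 7 := (if f then [1] else []))) =
    s(6 := bit_letter (b ~= f) # t, 7 := (if f & b then [1] else []))"
  by (cases b; cases f) (auto simp: add_step_def fun_eq_iff)

lemma add_step_fold:
  "fold (%x. sem (add_step x)) (binary w n) (s(6 := t, 7 := (if f then [1] else []))) =
    s(6 := rev (binary w (n + (if f then 1 else 0))) @ t, 7 := (if f & (\<forall>b \<in> set (digits w n). b) then [1] else []))"
proof (induction w arbitrary: n t f)
  case (Suc w)
  have "fold (%x. sem (add_step x)) (binary (Suc w) n) (s(6 := t, 7 := (if f then [1] else []))) =
    fold (%x. sem (add_step x)) (binary w (n div 2)) (s(6 := bit_letter (odd n ~= f) # t, 7 := (if f & odd n then [1] else [])))"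
    unfolding binary_simps fold_simps sem_add_step ..
  also have "\<dots> = s(6 := rev (binary w (n div 2 + (if f & odd n then 1 else 0))) @ bit_letter (odd n ~= f) # t,
      7 := (if (f & odd n) & (\<forall>b \<in> set (digits w (n div 2)). b) then [1] else []))" by (rule Suc)
  also have "n div 2 + (if f & odd n then 1 else 0) = (n + (if f then 1 else 0)) div 2"
    by (cases "odd n") (auto elim!: oddE evenE)
  also have "rev (binary w ((n + (if f then 1 else 0)) div 2)) @ bit_letter (odd n ~= f) # t = rev (binary (Suc w) (n + (if f then 1 else 0))) @ t"
    by simp
  also have "((f & odd n) & (\<forall>b \<in> set (digits w (n div 2)). b)) = (f & (\<forall>b \<in> set (digits (Suc w) n). b))" by simp
  finally show ?case .
qed simp

text \<open>\<open>binary w n\<close> depends on \<open>n\<close> modulo \<open>2 ^ w\<close> only,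
  so an overflow is harmless; a carry that is left over is removed by the last
  \<open>Pop\<close>.\<close>

lemma sem_inc:
  assumes c: "c \<notin> {2, 6, 7}" and s: "s c = binary w n" "length (s 2) = w" "s 6 = []" "s 7 = []"
  shows "sem (inc c) s = s(c := binary w (Suc n))"
proof -
  have nz: "0 \<notin> set (binary w k)" "set (rev (binary w k)) \<subseteq> {0<..<16}" for k using set_binary[of w k] by auto
  have u: "c \<notin> used (add_step x)" for x using c by (auto simp: add_step_def)
  define f :: "nat list" where "f = (if True & (\<forall>b \<in> set (digits w n). b) then [1] else [])"
  define X where "X = s(6 := [], 7 := (if True then [1] else []))"
  define Y where "Y = (s(6 := rev (binary w (Suc n)), 7 := f))(c := [])"
  have X: "X c = binary w n" "length (X 2) = w" using c s by (auto simp: X_def)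
  have Y: "Y 6 = rev (binary w (Suc n))" "length (Y 2) = w" "Y c = []" using c s by (auto simp: Y_def)
  have 0: "sem (Push 7 1) s = X" using s(3,4) unfolding X_def by (simp add: fun_eq_iff)
  have "sem (pop_loop 2 c add_step) X = (fold (%x. sem (add_step x)) (X c) X)(c := [])"
    by (rule sem_pop_loop) (simp_all add: X nz u)
  also have "\<dots> = Y" unfolding X(1) unfolding X_def add_step_fold f_def[symmetric] Y_def by simp
  finally have 1: "sem (pop_loop 2 c add_step) X = Y" .
  have 2: "sem (move_all 2 6 c) Y = Y(6 := [], c := rev (Y 6) @ Y c)"
    by (rule sem_move_all) (use c nz in \<open>simp_all add: Y\<close>)
  have tl: "tl f = []" by (simp add: f_def)
  have "Y(6 := [], c := rev (Y 6) @ Y c, 7 := []) = s(c := binary w (Suc n))"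
    unfolding Y rev_rev_ident append_Nil2 using s(3,4) c unfolding Y_def by (auto simp: fun_eq_iff)
  moreover have "(Y(6 := [], c := rev (Y 6) @ Y c)) 7 = f" using c by (simp add: Y_def)
  ultimately show ?thesis unfolding inc_def sem.simps(5) 0 1 2 by (simp only: sem.simps(3) tl)
qed

subsection \<open>Writing the instance\<close>

text \<open>\<open>encode_list\<close> for single bits, without the end mark.\<close>

definition pairs_of :: "bool list => bool list" where
  "pairs_of bs = concat (map (%b. [True, b]) bs)"

definition write_bits :: "nat => prog" where
  "write_bits c = pop_loop 2 c (%b. Push 0 2 ;; Push 0 (ltr b) ;; Push 6 (ltr b)) ;; move_all 2 6 c"

lemma sem_write_bits:
  assumes c: "c \<notin> {0, 2, 6}" and s: "s c = binary w n" "length (s 2) = w" "s 6 = []"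
  shows "sem (write_bits c) s = s(0 := rev (map bit_letter (pairs_of (digits w n))) @ s 0)"
proof -
  have nz: "0 \<notin> set (binary w k)" "set (rev (binary w k)) \<subseteq> {0<..<16}" for k using set_binary[of w k] by auto
  have f: "fold (%b. sem (Push 0 2 ;; Push 0 (ltr b) ;; Push 6 (ltr b))) (map bit_letter bs) s =
    s(0 := rev (map bit_letter (pairs_of bs)) @ s 0, 6 := rev (map bit_letter bs) @ s 6)" for bs s
    by (induction bs arbitrary: s) (auto simp: pairs_of_def fun_eq_iff)
  define Y where "Y = (s(0 := rev (map bit_letter (pairs_of (digits w n))) @ s 0, 6 := rev (binary w n)))(c := [])"
  have Y: "Y 6 = rev (binary w n)" "length (Y 2) = w" "Y c = []" using c s by (auto simp: Y_def)
  have "sem (pop_loop 2 c (%b. Push 0 2 ;; Push 0 (ltr b) ;; Push 6 (ltr b))) s =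
    (fold (%b. sem (Push 0 2 ;; Push 0 (ltr b) ;; Push 6 (ltr b))) (s c) s)(c := [])"
    by (rule sem_pop_loop) (use c s nz in simp_all)
  also have "\<dots> = Y" unfolding s(1) unfolding binary_def f s(3) Y_def by simp
  finally have 1: "sem (pop_loop 2 c (%b. Push 0 2 ;; Push 0 (ltr b) ;; Push 6 (ltr b))) s = Y" .
  have 2: "sem (move_all 2 6 c) Y = Y(6 := [], c := rev (Y 6) @ Y c)"
    by (rule sem_move_all) (use c nz in \<open>simp_all add: Y\<close>)
  show ?thesis unfolding write_bits_def sem.simps(5) 1 2 Y rev_rev_ident append_Nil2
    using c s(1,3) unfolding Y_def by (auto simp: fun_eq_iff)
qed

text \<open>The encoding of the rational \<open>2 ^ w + n\<close>: the sign, \<open>w\<close>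
  digits, the leading digit 1 with the end mark, and the denominator 1.\<close>

definition coord_word :: "nat => nat => bool list" where
  "coord_word w n = [False] @ pairs_of (digits w n) @ [True, True, False, False, True, True, False]"

text \<open>The first bit is the continuation mark in the list of terminals.\<close>

definition point_word :: "nat => nat \<times> nat => bool list" where
  "point_word w p = [True] @ coord_word w (fst p) @ coord_word w (snd p)"

definition write_coord :: "nat => prog" where
  "write_coord c = Push 0 1 ;; write_bits c ;; push_all 0 [2, 2, 1, 1, 2, 2, 1]"

lemma sem_write_coord:
  assumes c: "c \<notin> {0, 2, 6}" and s: "s c = binary w n" "length (s 2) = w" "s 6 = []"
  shows "sem (write_coord c) s = s(0 := rev (map bit_letter (coord_word w n)) @ s 0)"
  using c s sem_write_bits[of c "s(0 := 1 # s 0)" w n]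
  by (simp add: write_coord_def coord_word_def fun_upd_def[of s 0 "1 # s 0", symmetric])

definition write_point :: prog where
  "write_point = Push 0 2 ;; write_coord 3 ;; write_coord 4"

definition clear :: "nat => prog" where
  "clear c = For 2 (%_. Pop c)"

lemma sem_clear: "c ~= 2 ==> length (s c) <= length (s 2) ==> sem (clear c) s = s(c := [])"
proof -
  have "fold (%_. sem (Pop c)) ws s = s(c := drop (length ws) (s c))" for ws :: "nat list" and s
    by (induction ws arbitrary: s) (auto simp: drop_Suc fun_eq_iff)
  from this[of "s 2" s] show "c ~= 2 ==> length (s c) <= length (s 2) ==> ?thesis" by (simp add: clear_def)
qed

definition fill :: "nat => prog" where
  "fill c = For 2 (%_. Push c 1)"

lemma sem_fill: "c ~= 2 ==> s c = [] ==> sem (fill c) s = s(c := binary (length (s 2)) 0)"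
proof -
  have "fold (%_. sem (Push c 1)) ws s = s(c := replicate (length ws) 1 @ s c)" for ws :: "nat list" and s
    by (induction ws arbitrary: s) (auto simp: fun_eq_iff replicate_app_Cons_same)
  from this[of "s 2" s] show "c ~= 2 ==> s c = [] ==> ?thesis" by (simp add: fill_def binary_zero)
qed

section \<open>Scanning a picture\<close>

text \<open>A picture is a word of pixels, 2 for a terminal and 1 for another point; 3 ends a line, 4 raises
  the bound, and 5 is a terminal that does not count.\<close>

type_synonym scan = "(nat \<times> nat) list \<times> nat \<times> nat \<times> nat"

definition scan_step :: "nat => scan => scan" where
  "scan_step a = (%(ps, x, y, c).
     if a = 1 then (ps, Suc x, y, c)
     else if a = 2 then (ps @ [(x, y)], Suc x, y, Suc c)
     else if a = 5 then (ps @ [(x, y)], Suc x, y, c)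
     else if a = 3 then (ps, 0, Suc y, c)
     else if a = 4 then (ps, x, y, Suc c) else (ps, x, y, c))"

definition draw_step :: "nat => prog" where
  "draw_step a =
     (if a = 1 then inc 3
      else if a = 2 then write_point ;; inc 3 ;; inc 5
      else if a = 5 then write_point ;; inc 3
      else if a = 3 then inc 4 ;; clear 3 ;; fill 3
      else if a = 4 then inc 5 else Skip)"

text \<open>Registers 3 and 4 hold the position, 5 the bound, and 0 the output so far; 6 and 7 are
  idle between two letters.\<close>

definition drawn :: "store => bool list => scan => store" where
  "drawn s h = (%(ps, x, y, c). let w = length (s 2) in
     s(0 := rev (map bit_letter (h @ concat (map (point_word w) ps))), 3 := binary w x, 4 := binary w y, 5 := binary w c, 6 := [], 7 := []))"

lemma sem_draw_step: "sem (draw_step a) (drawn s h z) = drawn s h (scan_step a z)"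
proof -
  obtain ps x y c where z: "z = (ps, x, y, c)" by (cases z) auto
  define w where "w = length (s 2)"
  define D where "D = (%ps x y c. s(0 := rev (map bit_letter (h @ concat (map (point_word w) ps))), 3 := binary w x, 4 := binary w y, 5 := binary w c, 6 := [], 7 := []))"
  have D: "drawn s h (ps, x, y, c) = D ps x y c" for ps x y c by (simp add: drawn_def D_def w_def Let_def)
  have i3: "sem (inc 3) (D ps x y c) = D ps (Suc x) y c" for ps x y c
    by (subst sem_inc[where w = w and n = x]) (auto simp: D_def w_def fun_eq_iff)
  have i4: "sem (inc 4) (D ps x y c) = D ps x (Suc y) c" for ps x y c
    by (subst sem_inc[where w = w and n = y]) (auto simp: D_def w_def fun_eq_iff)
  have i5: "sem (inc 5) (D ps x y c) = D ps x y (Suc c)" for ps x y c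
    by (subst sem_inc[where w = w and n = c]) (auto simp: D_def w_def fun_eq_iff)
  have z3: "sem (fill 3) (sem (clear 3) (D ps x y c)) = D ps 0 y c" for ps x y c
    by (subst sem_clear) (auto simp: D_def w_def fun_eq_iff sem_fill)
  define S where "S = (%out x y c. s(0 := out, 3 := binary w x, 4 := binary w y, 5 := binary w c, 6 := [], 7 := []))"
  have DS: "D ps x y c = S (rev (map bit_letter (h @ concat (map (point_word w) ps)))) x y c" for ps x y c by (simp only: D_def S_def)
  have S: "S out x y c 0 = out" "S out x y c 3 = binary w x" "S out x y c 4 = binary w y" "length (S out x y c 2) = w" "S out x y c 6 = []"
     "(S out x y c)(0 := out') = S out' x y c" for out out' x y c
    by (simp_all add: S_def w_def fun_eq_iff)
  have p: "sem (Push 0 2) (S out x y c) = S (2 # out) x y c" for out x y c unfolding sem.simps S ..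
  have c3: "sem (write_coord 3) (S out x y c) = S (rev (map bit_letter (coord_word w x)) @ out) x y c" for out x y c
    by (subst sem_write_coord[where w = w and n = x]) (simp_all add: S)
  have c4: "sem (write_coord 4) (S out x y c) = S (rev (map bit_letter (coord_word w y)) @ out) x y c" for out x y c
    by (subst sem_write_coord[where w = w and n = y]) (simp_all add: S)
  have wp: "sem write_point (D ps x y c) = D (ps @ [(x, y)]) x y c" for ps x y c
    unfolding write_point_def sem.simps(5) DS p c3 c4 by (simp add: point_word_def)
  show ?thesis unfolding z D draw_step_def scan_step_def by (simp add: i3 i4 i5 z3 wp D)
qed

text \<open>\<open>encode_point (0, 0)\<close>, the root.\<close>

definition header :: "bool list" where
  "header = [False, False, False, True, True, False, False, False, False, True, True, False]"

text \<open>The end of the list of terminals, the angle coefficient \<open>1 / 4\<close>, and the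
  beginning of the bound: its sign and its lowest digit 1.\<close>

definition footer :: "bool list" where
  "footer = [False, False, True, True, False, False, True, False, True, False, True, True, False, False, True, True]"

definition write_instance :: prog where
  "write_instance = fill 3 ;; fill 4 ;; fill 5 ;; push_all 0 (map bit_letter header) ;; For 1 draw_step ;;
     push_all 0 (map bit_letter footer) ;; write_bits 5 ;; push_all 0 [2, 1, 2, 2, 1, 1, 2, 1, 2, 2, 1]"

text \<open>The bound is \<open>(2 ^ (w + 2) + 2 * c + 1) / 2\<close>. After the lowest digit come
  the \<open>w\<close> digits of \<open>c\<close>, then 0 and the leading 1, and the denominator
  2.\<close>

definition instance_word :: "nat => (nat \<times> nat) list => nat => bool list" where
  "instance_word w ps c = header @ concat (map (point_word w) ps) @ footer @ pairs_of (digits w c) @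
     [True, False, True, True, False, False, True, False, True, True, False]"

lemma sem_write_instance:
  assumes "\<And>r. r \<in> {0, 3, 4, 5, 6, 7} ==> s r = []" and z: "fold scan_step (s 1) ([], 0, 0, 0) = (ps, x, y, c)"
  shows "sem write_instance s 0 = rev (map bit_letter (instance_word (length (s 2)) ps c))"
proof -
  let ?w = "length (s 2)"
  have "sem (push_all 0 (map bit_letter header)) (sem (fill 5) (sem (fill 4) (sem (fill 3) s))) = drawn s header ([], 0, 0, 0)"
    using assms(1) by (simp add: sem_fill drawn_def fun_eq_iff Let_def)
  moreover have "fold (%a. sem (draw_step a)) bs (drawn s header z) = drawn s header (fold scan_step bs z)" for bs z
    by (induction bs arbitrary: z) (auto simp: sem_draw_step)
  moreover have "drawn s header ([], 0, 0, 0) 1 = s 1" by (simp add: drawn_def Let_def)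
  ultimately have 1: "sem (For 1 draw_step) (sem (push_all 0 (map bit_letter header)) (sem (fill 5) (sem (fill 4) (sem (fill 3) s)))) = drawn s header (ps, x, y, c)"
    using z by (simp del: sem_push_all)
  define t where "t = drawn s header (ps, x, y, c)"
  have "sem (write_bits 5) (sem (push_all 0 (map bit_letter footer)) t) =
    (sem (push_all 0 (map bit_letter footer)) t)(0 := rev (map bit_letter (pairs_of (digits ?w c))) @ sem (push_all 0 (map bit_letter footer)) t 0)"
    by (rule sem_write_bits) (auto simp: t_def drawn_def Let_def)
  then have "sem write_instance s 0 = rev [2, 1, 2, 2, 1, 1, 2, 1, 2, 2, 1] @ rev (map bit_letter (pairs_of (digits ?w c))) @ rev (map bit_letter footer) @ t 0"
    unfolding write_instance_def by (simp only: sem.simps(5) 1 flip: t_def) simp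
  then show ?thesis by (simp add: t_def drawn_def Let_def instance_word_def)
qed

section \<open>Pictures of grids\<close>

text \<open>The base cost raises the bound once per tile, in its lowest line.\<close>

definition tile_line :: "tile => nat => nat list" where
  "tile_line T k = map (%c. if c = 0 then 2 else 1) (pic T ! k) @ (if k = 0 then replicate (base_cost T) 4 else [])"

definition grid_line :: "nat => (nat => tile) => nat => nat list" where
  "grid_line w r k = 2 # concat (map (%i. tile_line (r i) k) [0..<w]) @ [3]"

definition strip :: "nat => (nat => tile) => nat list" where
  "strip w r = concat (map (grid_line w r) [0..<20])"

text \<open>The origin is the terminal that does not count, since the bound \<open>C\<close> admits
  arborescences with \<open>C + 1\<close> points.\<close>

definition grid_picture :: "nat => nat => (nat => nat => tile) => nat list" where
  "grid_picture w h g = 5 # replicate (20 * w) 2 @ [3] @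
     concat (map (%j. strip w (%i. g i j)) [0..<h])"

lemma scan_cost: "(scan_step 4 ^^ n) (ps, x, y, c) = (ps, x, y, c + n)"
  by (induction n arbitrary: c) (simp_all add: scan_step_def)

definition line_points :: "int list => nat => nat => (nat \<times> nat) list" where
  "line_points cs x y = map (%i. (x + i, y)) (filter (%i. cs ! i = 0) [0..<length cs])"

lemma line_points_Cons: "line_points (b # cs) x y = (if b = 0 then [(x, y)] else []) @ line_points cs (Suc x) y"
proof -
  have "[0..<length (b # cs)] = 0 # map Suc [0..<length cs]" by (simp only: length_Cons upt_conv_Cons map_Suc_upt zero_less_Suc)
  then show ?thesis by (simp add: line_points_def filter_map o_def)
qed

lemma scan_line:
  "fold scan_step (map (%c. if c = 0 then 2 else 1) cs) (ps, x, y, c) =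
    (ps @ line_points cs x y, x + length cs, y, c + length (line_points cs x y))"
proof (induction cs arbitrary: ps x c)
  case Nil
  then show ?case by (simp add: line_points_def)
next
  case (Cons b cs)
  show ?case
  proof (cases "b = 0")
    case True
    then show ?thesis using Cons[of "ps @ [(x, y)]" "Suc x" "Suc c"] by (simp add: scan_step_def line_points_Cons)
  next
    case False
    then show ?thesis using Cons[of ps "Suc x" c] by (simp add: scan_step_def line_points_Cons)
  qed
qed

definition tile_points :: "tile => nat => nat => nat => (nat \<times> nat) list" where
  "tile_points T k i y = line_points (pic T ! k) (20 * i + 1) y"

lemma pic_line: "k < 20 ==> length (pic T ! k) = 20"
  using pic_shape[of T] by (simp add: pic_shape_def)

lemma scan_tile:
  assumes "k < 20"
  shows "fold scan_step (tile_line T k) (ps, 20 * i + 1, y, c) =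
    (ps @ tile_points T k i y, 20 * Suc i + 1, y, c + length (tile_points T k i y) + (if k = 0 then base_cost T else 0))"
  using pic_line[OF assms, of T] unfolding tile_line_def fold_append comp_apply scan_line tile_points_def
  by (simp add: scan_cost)

lemma scan_grid_line:
  assumes "k < 20"
  shows "fold scan_step (grid_line w r k) (ps, 0, y, c) =
    (ps @ (0, y) # concat (map (%i. tile_points (r i) k i y) [0..<w]), 0, Suc y,
     c + Suc (length (concat (map (%i. tile_points (r i) k i y) [0..<w]))) + (if k = 0 then \<Sum>i<w. base_cost (r i) else 0))"
proof -
  have "fold scan_step (concat (map (%i. tile_line (r i) k) [0..<n])) (ps, 1, y, c) =
    (ps @ concat (map (%i. tile_points (r i) k i y) [0..<n]), 20 * n + 1, y,
     c + length (concat (map (%i. tile_points (r i) k i y) [0..<n])) + (if k = 0 then \<Sum>i<n. base_cost (r i) else 0))" for n ps c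
  proof (induction n)
    case (Suc n)
    show ?case unfolding upt_Suc_append[OF le0] map_append concat_append fold_append comp_apply Suc
      using scan_tile[OF assms, of "r n" _ n] by simp
  qed simp
  from this[of w "ps @ [(0, y)]" "Suc c"] show ?thesis by (simp add: grid_line_def scan_step_def)
qed

definition row_points :: "nat => (nat => tile) => nat => nat => (nat \<times> nat) list" where
  "row_points w r y k = (0, y + k) # concat (map (%i. tile_points (r i) k i (y + k)) [0..<w])"

definition strip_points :: "nat => (nat => tile) => nat => (nat \<times> nat) list" where
  "strip_points w r y = concat (map (row_points w r y) [0..<20])"

definition grid_points :: "nat => nat => (nat => nat => tile) => (nat \<times> nat) list" where
  "grid_points w h g = map (%x. (x, 0)) [0..<Suc (20 * w)] @
     concat (map (%j. strip_points w (%i. g i j) (20 * j + 1)) [0..<h])"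

lemma scan_strip:
  "fold scan_step (strip w r) (ps, 0, y, c) =
    (ps @ strip_points w r y, 0, y + 20, c + length (strip_points w r y) + (\<Sum>i<w. base_cost (r i)))"
proof -
  have "fold scan_step (concat (map (grid_line w r) [0..<n])) (ps, 0, y, c) =
    (ps @ concat (map (row_points w r y) [0..<n]), 0, y + n,
     c + length (concat (map (row_points w r y) [0..<n])) + (if n = 0 then 0 else \<Sum>i<w. base_cost (r i)))"
    if "n <= 20" for n
    using that
  proof (induction n)
    case (Suc n)
    have gl: "fold scan_step (grid_line w r n) (ps', 0, y + n, c') =
      (ps' @ row_points w r y n, 0, y + Suc n, c' + length (row_points w r y n) + (if n = 0 then \<Sum>i<w. base_cost (r i) else 0))" for ps' c'
      using scan_grid_line[of n w r ps' "y + n" c'] Suc.prems by (simp add: row_points_def)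
    have IH: "fold scan_step (concat (map (grid_line w r) [0..<n])) (ps, 0, y, c) =
      (ps @ concat (map (row_points w r y) [0..<n]), 0, y + n,
       c + length (concat (map (row_points w r y) [0..<n])) + (if n = 0 then 0 else \<Sum>i<w. base_cost (r i)))"
      by (rule Suc.IH) (use Suc.prems in simp)
    show ?case unfolding upt_Suc_append[OF le0] map_append concat_append list.map concat.simps append_Nil2 fold_append comp_apply IH gl by simp
  qed simp
  from this[of 20] show ?thesis by (simp add: strip_def strip_points_def)
qed

lemma scan_grid:
  "fold scan_step (grid_picture w h g) ([], 0, 0, 0) =
    (grid_points w h g, 0, 20 * h + 1, length (grid_points w h g) + grid_cost w h g - 1)"
proof -
  have base: "(scan_step 2 ^^ n) (ps, x, 0, c) = (ps @ map (%x. (x, 0)) [x..<x + n], x + n, 0, c + n)" for n ps x c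
    by (induction n) (simp_all add: scan_step_def)
  let ?f = "map (%x. (x, 0::nat)) [0..<Suc (20 * w)]"
  have "fold scan_step (concat (map (%j. strip w (%i. g i j)) [0..<n])) (ps, 0, 1, c) =
    (ps @ concat (map (%j. strip_points w (%i. g i j) (20 * j + 1)) [0..<n]), 0, 20 * n + 1,
     c + length (concat (map (%j. strip_points w (%i. g i j) (20 * j + 1)) [0..<n])) + (\<Sum>j<n. \<Sum>i<w. base_cost (g i j)))" for n ps c
  proof (induction n)
    case (Suc n)
    show ?case unfolding upt_Suc_append[OF le0] map_append concat_append list.map concat.simps append_Nil2 fold_append comp_apply Suc scan_strip by simp
  qed simp
  note rows = this[of h ?f "20 * w"]
  have f: "?f = (0, 0) # map (%x. (x, 0)) [1..<1 + 20 * w]" by (simp add: upt_conv_Cons del: upt_Suc)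
  have "fold scan_step (5 # replicate (20 * w) 2 @ [3]) ([], 0, 0, 0) = (?f, 0, 1, 20 * w)"
    unfolding f using base[of "20 * w" "[(0, 0)]" 1 0] by (simp add: scan_step_def)
  moreover have "grid_picture w h g = (5 # replicate (20 * w) 2 @ [3]) @ concat (map (%j. strip w (%i. g i j)) [0..<h])"
    by (simp add: grid_picture_def)
  ultimately show ?thesis using rows
    by (simp add: grid_points_def grid_cost_def sum.swap[of _ "{..<h}"] del: upt_Suc)
qed

definition to_cell :: "nat \<times> nat => cell" where
  "to_cell p = (int (fst p), int (snd p))"

lemma inj_to_cell: "inj_on to_cell A"
  by (auto simp: inj_on_def to_cell_def prod_eq_iff)

lemma tile_points_cells:
  assumes "k < 20"
  shows "to_cell ` set (tile_points T k i (20 * j + 1 + k)) = place i j ` {c \<in> terminal_cells (pic T). snd c = int k + 1}"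
proof (intro equalityI subsetI)
  fix q assume "q \<in> to_cell ` set (tile_points T k i (20 * j + 1 + k))"
  then obtain a where a: "a < 20" "pic T ! k ! a = 0" "q = (int (20 * i + 1 + a), int (20 * j + 1 + k))"
    using pic_line[OF assms, of T] by (auto simp: tile_points_def line_points_def to_cell_def)
  then have "(int a + 1, int k + 1) \<in> terminal_cells (pic T)" "q = place i j (int a + 1, int k + 1)"
    using assms by (auto simp: terminal_cells_def in_range_def code_at_def place_def)
  then show "q \<in> place i j ` {c \<in> terminal_cells (pic T). snd c = int k + 1}" by force
next
  fix q assume "q \<in> place i j ` {c \<in> terminal_cells (pic T). snd c = int k + 1}"
  then obtain u where u: "1 <= u" "u <= 20" "pic T ! k ! nat (u - 1) = 0" "q = place i j (u, int k + 1)"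
    by (auto simp: terminal_cells_def in_range_def code_at_def)
  then have "(20 * i + 1 + nat (u - 1), 20 * j + 1 + k) \<in> set (tile_points T k i (20 * j + 1 + k))" "q = to_cell (20 * i + 1 + nat (u - 1), 20 * j + 1 + k)"
    using pic_line[OF assms, of T] by (auto simp: tile_points_def line_points_def place_def to_cell_def image_iff intro!: bexI[of _ "nat (u - 1)"])
  then show "q \<in> to_cell ` set (tile_points T k i (20 * j + 1 + k))" by blast
qed

lemma grid_points_cells: "to_cell ` set (grid_points w h g) = grid_terminals w h g"
proof -
  have f: "to_cell ` ((%x. (x, 0)) ` {0..<Suc (20 * w)} \<union> (\<Union>j<h. \<Union>k<20. {(0, 20 * j + 1 + k)})) = frame w h"
  proof (intro equalityI subsetI)
    fix c assume "c \<in> frame w h"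
    then obtain x y where c: "c = (x, y)" "0 <= x" "x <= 20 * int w" "0 <= y" "y <= 20 * int h" "x = 0 \<or> y = 0" by (auto simp: frame_def)
    show "c \<in> to_cell ` ((%x. (x, 0)) ` {0..<Suc (20 * w)} \<union> (\<Union>j<h. \<Union>k<20. {(0, 20 * j + 1 + k)}))"
    proof (cases "y = 0")
      case True
      then have "c = to_cell (nat x, 0)" "nat x < Suc (20 * w)" using c by (auto simp: to_cell_def)
      then show ?thesis by (auto simp del: upt_Suc)
    next
      case False
      define n where "n = nat (y - 1)"
      have "c = to_cell (0, 20 * (n div 20) + 1 + n mod 20)" "n div 20 < h" "n mod 20 < 20"
        using c False by (auto simp: to_cell_def n_def)
      then show ?thesis by blast
    qed
  qed (auto simp: frame_def to_cell_def)
  have t: "(\<Union>k<20. {c \<in> terminal_cells P. snd c = int k + 1}) = terminal_cells P" for P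
  proof (intro equalityI subsetI)
    fix c assume c: "c \<in> terminal_cells P"
    then have "nat (snd c - 1) < 20" "snd c = int (nat (snd c - 1)) + 1" by (auto simp: terminal_cells_def in_range_def)
    then show "c \<in> (\<Union>k<20. {c \<in> terminal_cells P. snd c = int k + 1})" using c by blast
  qed auto
  have "to_cell ` set (grid_points w h g) = frame w h \<union> (\<Union>j<h. \<Union>k<20. \<Union>i<w. to_cell ` set (tile_points (g i j) k i (20 * j + 1 + k)))"
  proof -
    have "set (grid_points w h g) = (%x. (x, 0)) ` {0..<Suc (20 * w)} \<union>
      (\<Union>j<h. \<Union>k<20. insert (0, 20 * j + 1 + k) (\<Union>i<w. set (tile_points (g i j) k i (20 * j + 1 + k))))"
      by (simp add: grid_points_def strip_points_def row_points_def atLeast0LessThan del: upt_Suc)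
    moreover have "to_cell ` (F \<union> (\<Union>j<h. \<Union>k<20. insert (p j k) (\<Union>i<w. t i j k))) =
      to_cell ` (F \<union> (\<Union>j<h. \<Union>k<20. {p j k})) \<union> (\<Union>j<h. \<Union>k<20. \<Union>i<w. to_cell ` t i j k)" for F p and t :: "nat => nat => nat => (nat \<times> nat) set"
      by blast
    ultimately show ?thesis unfolding f[symmetric] by simp
  qed
  also have "(\<Union>j<h. \<Union>k<20. \<Union>i<w. to_cell ` set (tile_points (g i j) k i (20 * j + 1 + k))) =
    (\<Union>j<h. \<Union>k<20. \<Union>i<w. place i j ` {c \<in> terminal_cells (pic (g i j)). snd c = int k + 1})"
    by (intro SUP_cong refl tile_points_cells) simp
  also have "\<dots> = (\<Union>i<w. \<Union>j<h. place i j ` (\<Union>k<20. {c \<in> terminal_cells (pic (g i j)). snd c = int k + 1}))"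
    unfolding image_UN by blast
  finally show ?thesis unfolding t grid_terminals_def .
qed

text \<open>The counter counts occurrences in a list, while the bound concerns the number of
  points.\<close>

lemma distinct_grid_points: "distinct (grid_points w h g)"
proof -
  have y: "snd p = y + k" if "p \<in> set (row_points w r y k)" for p r y k
    using that by (auto simp: row_points_def tile_points_def line_points_def)
  have row: "distinct (row_points w r z k)" if "k < 20" for r z k
  proof -
    have "distinct (concat (map (%i. tile_points (r i) k i y) [0..<n])) & (\<forall>p \<in> set (concat (map (%i. tile_points (r i) k i y) [0..<n])). 0 < fst p & fst p <= 20 * n)" for n y
    proof (induction n)
      case (Suc n)
      have "distinct (tile_points (r n) k n y)" by (auto simp: tile_points_def line_points_def distinct_map inj_on_def)
      moreover have "\<forall>p \<in> set (tile_points (r n) k n y). 20 * n < fst p & fst p <= 20 * Suc n"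
        using pic_line[OF that] by (auto simp: tile_points_def line_points_def)
      ultimately show ?case using Suc by fastforce
    qed simp
    from this[of "z + k" w] show ?thesis unfolding row_points_def by fastforce
  qed
  have rows: "distinct (concat (map (row_points w r z) [0..<n])) & (\<forall>p \<in> set (concat (map (row_points w r z) [0..<n])). z <= snd p & snd p < z + n)"
    if "n <= 20" for r z n
    using that
  proof (induction n)
    case (Suc n)
    have "distinct (row_points w r z n)" by (rule row) (use Suc.prems in simp)
    moreover have "\<forall>p \<in> set (row_points w r z n). snd p = z + n" using y by blast
    ultimately show ?case using Suc by fastforce
  qed simp
  have "distinct (concat (map (%j. strip_points w (%i. g i j) (20 * j + 1)) [0..<n])) &
     (\<forall>p \<in> set (concat (map (%j. strip_points w (%i. g i j) (20 * j + 1)) [0..<n])). 0 < snd p & snd p <= 20 * n)" for n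
  proof (induction n)
    case (Suc n)
    define A where "A = strip_points w (%i. g i n) (20 * n + 1)"
    define B where "B = concat (map (%j. strip_points w (%i. g i j) (20 * j + 1)) [0..<n])"
    have "distinct A & (\<forall>p \<in> set A. 20 * n + 1 <= snd p & snd p < 20 * n + 1 + 20)" using rows[of 20 "%i. g i n" "20 * n + 1"] by (simp add: A_def strip_points_def)
    moreover have "distinct B & (\<forall>p \<in> set B. 0 < snd p & snd p <= 20 * n)" unfolding B_def by (rule Suc)
    ultimately have "distinct (B @ A) & (\<forall>p \<in> set (B @ A). 0 < snd p & snd p <= 20 * Suc n)" by fastforce
    then show ?case unfolding A_def B_def upt_Suc_append[OF le0] map_append concat_append list.map concat.simps append_Nil2 .
  qed simp
  note this[of h]
  moreover define B where "B = concat (map (%j. strip_points w (%i. g i j) (20 * j + 1)) [0..<h])"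
  ultimately have B: "distinct B" "\<And>p. p \<in> set B ==> snd p ~= 0" by auto
  have "set (map (%x. (x, 0)) [0..<Suc (20 * w)]) \<inter> set B = {}" using B(2) by (force simp del: upt_Suc)
  moreover have "distinct (map (%x. (x, 0::nat)) [0..<Suc (20 * w)])" by (simp add: distinct_map inj_on_def del: upt_Suc)
  ultimately show ?thesis using B(1) unfolding grid_points_def B_def[symmetric] by (simp only: distinct_append)
qed

section \<open>Computations as satisfying assignments\<close>

text \<open>\<open>Doing q ss\<close> names the transition under way. It is repeated in every cell
  of a row, so that each cell can shift its contents without looking at the heads.\<close>

datatype var = Sym nat nat | Doing nat "nat list" | State nat

text \<open>A literal names a cell relative to a base cell, a variable of that cell, and a sign. The
  places 1, 2, 3 are the left neighbour, the cell itself and the right neighbour, and 4, 5, 6 are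
  the same cells one step later.\<close>

type_synonym literal = "nat \<times> var \<times> bool"

definition shift :: "nat => int" where
  "shift k = (if k = 1 \<or> k = 4 then -1 else if k = 3 \<or> k = 6 then 1 else 0)"

definition delay :: "nat => nat" where
  "delay k = (if k \<ge> 4 then 1 else 0)"

definition holds_at :: "(nat => int => var => bool) => nat => int => literal list => bool" where
  "holds_at F t d cl \<longleftrightarrow> (\<exists>(k, v, b) \<in> set cl. F (t + delay k) (d + shift k) v = b)"

text \<open>Contents are relative to the head: when it moves left, they move right.\<close>

fun target :: "move => nat" where
  "target Move_Left = 6" | "target Stay = 5" | "target Move_Right = 4"

lemma target [simp]: "shift (target m) = - move_offset m" "delay (target m) = 1" "1 <= target m" "target m <= 6"
  by (cases m; simp add: shift_def delay_def)+

lemma places [simp]: "shift 1 = -1" "shift (Suc 0) = -1" "shift 2 = 0" "shift 3 = 1" "shift 5 = 0" "delay 1 = 0" "delay (Suc 0) = 0" "delay 2 = 0" "delay 3 = 0" "delay 5 = 1"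
  by (simp_all add: shift_def delay_def)

text \<open>Contents are stored relative to the heads, so that one step only involves neighbouring cells.
  The last tape marks the origin of tape 0 and moves along with it.\<close>

locale tableau =
  fixes K g m :: nat and nxt :: "nat => nat list => nat \<times> (nat \<times> move) list"
  assumes K: "K \<ge> 2" and g: "g \<ge> 3"
    and nxt: "q <= m ==> length ss = K ==> set ss \<subseteq> {..<g} ==>
      fst (nxt q ss) <= m & length (snd (nxt q ss)) = K & fst ` set (snd (nxt q ss)) \<subseteq> {..<g} &
      snd (nxt q ss) ! (K - 1) = (ss ! (K - 1), snd (snd (nxt q ss) ! 0))"
begin

definition actions :: "(nat \<times> nat list) list" where
  "actions = List.product [0..<Suc m] (List.n_lists K [0..<g])"

lemma set_actions: "(q, ss) \<in> set actions \<longleftrightarrow> q <= m & length ss = K & set ss \<subseteq> {..<g}"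
  by (auto simp: actions_def set_n_lists)

definition vars :: "var list" where
  "vars = [Sym j s. j \<leftarrow> [0..<K], s \<leftarrow> [0..<g]] @ map (%(q, ss). Doing q ss) actions @ map State [0..<Suc m]"

definition act :: "nat => nat list => nat => nat \<times> move" where
  "act q ss j = snd (nxt q ss) ! j"

definition spread :: "nat \<times> nat list => literal list list" where
  "spread a = (case a of (q, ss) =>
     [[(2, Doing q ss, False), (1, Doing q ss, True)], [(2, Doing q ss, False), (3, Doing q ss, True)]])"

definition copy :: "nat \<times> nat list => literal list list" where
  "copy a = (case a of (q, ss) => [[(2, Doing q ss, False), (2, Sym j s, False), (target (snd (act q ss j)), Sym j s, True)].
     j \<leftarrow> [0..<K], s \<leftarrow> [0..<g]])"

definition update :: "nat \<times> nat list => literal list list" where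
  "update a = (case a of (q, ss) => [[(2, Doing q ss, False), (target (snd (act q ss j)), Sym j (fst (act q ss j)), True)].
     j \<leftarrow> [0..<K]])"

definition fire :: "nat \<times> nat list => literal list list" where
  "fire a = (case a of (q, ss) =>
     [[(2, State q, False), (2, Doing q ss, True)] @ map (%j. (2, Sym j (ss ! j), False)) [0..<K],
      [(2, Doing q ss, False), (5, State (fst (nxt q ss)), True)]])"

definition mid :: "literal list list" where
  "mid = concat (map (%a. spread a @ copy a) actions)"

definition center :: "literal list list" where
  "center = concat (map (%a. spread a @ update a @ fire a) actions)"

lemma in_center: "a \<in> set actions ==> cl \<in> set (spread a) \<or> cl \<in> set (update a) \<or> cl \<in> set (fire a) ==> cl \<in> set center"
  unfolding center_def set_concat set_map by auto

lemma in_mid: "a \<in> set actions ==> cl \<in> set (spread a) \<or> cl \<in> set (copy a) ==> cl \<in> set mid"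
  unfolding mid_def set_concat set_map by auto

lemma in_update: "j < K ==> [(2, Doing q ss, False), (target (snd (act q ss j)), Sym j (fst (act q ss j)), True)] \<in> set (update (q, ss))"
  by (auto simp: update_def)

lemma in_copy: "j < K ==> s < g ==>
  [(2, Doing q ss, False), (2, Sym j s, False), (target (snd (act q ss j)), Sym j s, True)] \<in> set (copy (q, ss))"
  unfolding copy_def by (auto intro!: bexI[of _ j] image_eqI[of _ _ s])

text \<open>The last tape has symbol 1 only at the origin of tape 0; there every symbol except 2,
  the bit of an accepting output, is forbidden.\<close>

definition final :: "literal list list" where
  "final = map (%s. [(2, Sym (K - 1) 1, False), (2, Sym 0 s, False)]) (filter (%s. s ~= 2) [0..<g])"

definition blank_others :: "literal list list" where
  "blank_others = map (%j. [(2, Sym j 0, True)]) [1..<K]"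

definition centre_others :: "literal list list" where
  "centre_others = [(2, Sym (K - 1) 1, True)] # [(2, State 0, True)] # map (%j. [(2, Sym j 0, True)]) [1..<K - 1]"

text \<open>A certificate cell holds a blank or a bit, and blanks extend to the right, so the
  certificate has no gaps.\<close>

definition guess :: "literal list list" where
  "guess = [[(2, Sym 0 0, True), (2, Sym 0 1, True), (2, Sym 0 2, True)], [(2, Sym 0 0, False), (3, Sym 0 0, True)]]"

text \<open>Contradictory symbols in one cell are not excluded: the true facts of the computation
  are forced, and they alone can violate the final clauses. Category 1 has no clauses and serves
  idle bases.\<close>

definition clauses :: "nat => literal list list" where
  "clauses c =
    (if c = 2 then mid
     else if c = 3 then center
     else if c = 4 then final
     else if c = 5 then [(2, Sym 0 0, True)] # blank_others @ mid
     else if c = 6 then [(2, Sym 0 1, True)] # blank_others @ mid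
     else if c = 7 then [(2, Sym 0 2, True)] # blank_others @ mid
     else if c = 8 then [(2, Sym 0 1, True)] # centre_others @ center
     else if c = 9 then [(2, Sym 0 2, True)] # centre_others @ center
     else if c = 10 then guess @ blank_others @ mid
     else [])"

definition category :: "bool list => nat => nat => nat => int => nat" where
  "category w P T t d =
    (if t = 0 then
       (if d < 0 then 5
        else if d = 0 then (if hd w then 9 else 8)
        else if d < int (length w) then (if w ! nat d then 7 else 6)
        else if d < int (length w + P) then 10 else 5)
     else if t < T then (if d = 0 then 3 else 2) else 4)"

section \<open>Computations seen from the heads\<close>

definition advance :: "config => config" where
  "advance c = (let d = nxt (fst c) (map read_tape (snd c)) in (fst d, map2 act_tape (snd d) (snd c)))"

definition start :: "bool list => config" where
  "start z = (0, (word_contents z, 0) # replicate (K - 2) (%_. 0, 0) @ [(%i. if i = 0 then 1 else 0, 0)])"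

definition conf :: "bool list => nat => config" where
  "conf z t = (advance ^^ t) (start z)"

abbreviation "reads c \<equiv> map read_tape (snd c)"

definition view :: "config => nat => int => nat" where
  "view c j d = fst (snd c ! j) (snd (snd c ! j) + d)"

definition valid :: "config => bool" where
  "valid c \<longleftrightarrow> fst c <= m & length (snd c) = K & (\<forall>j < K. \<forall>i. fst (snd c ! j) i < g) &
     fst (snd c ! (K - 1)) = (%i. if i = 0 then 1 else 0) & snd (snd c ! (K - 1)) = snd (snd c ! 0)"

lemma start_valid: "valid (start z)"
  using K g by (auto simp: valid_def start_def nth_Cons' nth_append word_contents_def)

lemma reads_props: assumes "valid c" shows "length (reads c) = K" "set (reads c) \<subseteq> {..<g}" "\<And>j. j < K ==> reads c ! j = view c j 0"
proof -
  show "length (reads c) = K" using assms by (simp add: valid_def)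
  show r: "reads c ! j = view c j 0" if "j < K" for j using assms that by (simp add: valid_def read_tape_def view_def)
  show "set (reads c) \<subseteq> {..<g}"
  proof
    fix x assume "x \<in> set (reads c)"
    then obtain j where j: "j < length (snd c)" "x = reads c ! j" by (auto simp: in_set_conv_nth)
    then have "j < K" using assms by (simp add: valid_def)
    then show "x \<in> {..<g}" using r[of j] j assms by (simp add: valid_def view_def)
  qed
qed

lemma valid_nxt:
  assumes "valid c"
  shows "fst (nxt (fst c) (reads c)) <= m" "length (snd (nxt (fst c) (reads c))) = K"
    "\<And>j. j < K ==> fst (act (fst c) (reads c) j) < g"
    "act (fst c) (reads c) (K - 1) = (view c (K - 1) 0, snd (act (fst c) (reads c) 0))"
proof -
  have "fst c <= m" using assms by (simp add: valid_def)
  note n = nxt[OF this reads_props(1,2)[OF assms]]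
  show "fst (nxt (fst c) (reads c)) <= m" and l: "length (snd (nxt (fst c) (reads c))) = K" using n by blast+
  show "fst (act (fst c) (reads c) j) < g" if "j < K" for j
  proof -
    have "act (fst c) (reads c) j \<in> set (snd (nxt (fst c) (reads c)))" unfolding act_def using that l by (intro nth_mem) simp
    then show ?thesis using n by blast
  qed
  show "act (fst c) (reads c) (K - 1) = (view c (K - 1) 0, snd (act (fst c) (reads c) 0))"
    using n reads_props(3)[OF assms, of "K - 1"] K unfolding act_def by simp
qed

lemma advance_tape:
  assumes "valid c" "j < K"
  shows "snd (advance c) ! j = act_tape (act (fst c) (reads c) j) (snd c ! j)"
  using assms valid_nxt(2)[OF assms(1)] by (simp add: advance_def Let_def act_def valid_def)

lemma advance_view:
  assumes "valid c" "j < K"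
  shows "view (advance c) j (d - move_offset (snd (act (fst c) (reads c) j))) =
    (if d = 0 then fst (act (fst c) (reads c) j) else view c j d)"
  unfolding view_def advance_tape[OF assms] by (simp add: act_tape_def)

lemma advance_valid: assumes c: "valid c" shows "valid (advance c)"
  unfolding valid_def
proof (intro conjI allI impI)
  show "fst (advance c) <= m" using valid_nxt(1)[OF c] by (simp add: advance_def Let_def)
  show "length (snd (advance c)) = K" using valid_nxt(2)[OF c] c by (simp add: advance_def Let_def valid_def)
  show "fst (snd (advance c) ! j) i < g" if "j < K" for j i
    using valid_nxt(3)[OF c that] c that unfolding advance_tape[OF c that] by (simp add: act_tape_def valid_def)
  have K': "K - 1 < K" "0 < K" using K by auto
  note a = valid_nxt(4)[OF c]
  show "fst (snd (advance c) ! (K - 1)) = (%i. if i = 0 then 1 else 0)"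
    unfolding advance_tape[OF c K'(1)] a using c by (auto simp: act_tape_def valid_def view_def fun_eq_iff)
  show "snd (snd (advance c) ! (K - 1)) = snd (snd (advance c) ! 0)"
    unfolding advance_tape[OF c K'(1)] advance_tape[OF c K'(2)] a using c by (simp add: act_tape_def valid_def)
qed

lemma conf_valid: "valid (conf z t)"
  unfolding conf_def by (induction t) (auto intro: start_valid advance_valid)

lemma conf_Suc: "conf z (Suc t) = advance (conf z t)" by (simp add: conf_def)

lemma conf_fst: "fst (conf z (Suc t)) = fst (nxt (fst (conf z t)) (reads (conf z t)))"
  by (simp add: conf_Suc advance_def Let_def)

lemma conf_action: "(fst (conf z t), reads (conf z t)) \<in> set actions"
  using conf_valid[of z t] reads_props[OF conf_valid[of z t]] by (simp add: set_actions valid_def)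

lemma head_bound: "\<bar>snd (snd (conf z t) ! 0)\<bar> <= int t"
proof (induction t)
  case 0
  then show ?case by (simp add: conf_def start_def)
next
  case (Suc t)
  have "0 < K" using K by simp
  then show ?case using Suc unfolding conf_Suc advance_tape[OF conf_valid \<open>0 < K\<close>]
    by (cases "snd (act (fst (conf z t)) (reads (conf z t)) 0)") (auto simp: act_tape_def)
qed

definition fact :: "bool list => nat => int => var => bool" where
  "fact z t d v = (case v of Sym j s => view (conf z t) j d = s
     | Doing q ss => fst (conf z t) = q & reads (conf z t) = ss
     | State q => fst (conf z t) = q)"

lemma fact_copy: assumes "cl \<in> set (copy a)" "d ~= 0" shows "holds_at (fact z) t d cl"
proof -
  obtain q ss where a: "a = (q, ss)" by (cases a)
  obtain j s where cl: "cl = [(2, Doing q ss, False), (2, Sym j s, False), (target (snd (act q ss j)), Sym j s, True)]" "j < K"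
    using assms by (auto simp: copy_def a)
  show ?thesis unfolding cl holds_at_def using advance_view[OF conf_valid[of z t] cl(2), of d] assms(2)
    by (auto simp: fact_def conf_Suc)
qed

lemma fact_update: assumes "cl \<in> set (update a)" shows "holds_at (fact z) t 0 cl"
proof -
  obtain q ss where a: "a = (q, ss)" by (cases a)
  obtain j where cl: "cl = [(2, Doing q ss, False), (target (snd (act q ss j)), Sym j (fst (act q ss j)), True)]" "j < K"
    using assms by (auto simp: update_def a)
  show ?thesis unfolding cl holds_at_def using advance_view[OF conf_valid[of z t] cl(2), of 0]
    by (auto simp: fact_def conf_Suc)
qed

lemma fact_spread: "cl \<in> set (spread a) ==> holds_at (fact z) t d cl"
  by (cases a) (auto simp: spread_def holds_at_def fact_def)

lemma fact_fire: assumes a: "a \<in> set actions" and cl: "cl \<in> set (fire a)" shows "holds_at (fact z) t 0 cl"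
proof -
  obtain q ss where q: "a = (q, ss)" by (cases a)
  have l: "length ss = K" using a by (simp add: q set_actions)
  consider "cl = [(2, State q, False), (2, Doing q ss, True)] @ map (%j. (2, Sym j (ss ! j), False)) [0..<K]"
    | "cl = [(2, Doing q ss, False), (5, State (fst (nxt q ss)), True)]" using cl by (auto simp: fire_def q)
  then show ?thesis
  proof cases
    case 1
    show ?thesis
    proof (rule ccontr)
      assume n: "\<not> ?thesis"
      then have "fst (conf z t) = q" "reads (conf z t) ~= ss" by (auto simp: 1 holds_at_def fact_def)
      moreover have "view (conf z t) j 0 = ss ! j" if "j < K" for j
        using n that by (auto simp: 1 holds_at_def fact_def image_iff)
      then have "reads (conf z t) = ss"
        using reads_props(1,3)[OF conf_valid[of z t]] l by (intro nth_equalityI) auto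
      ultimately show False by simp
    qed
  next
    case 2
    then show ?thesis by (auto simp: holds_at_def fact_def conf_fst)
  qed
qed

lemma fact_mid: "cl \<in> set mid ==> d ~= 0 ==> holds_at (fact z) t d cl"
  using fact_spread fact_copy by (auto simp: mid_def)

lemma fact_center: "cl \<in> set center ==> holds_at (fact z) t 0 cl"
  using fact_spread fact_update fact_fire unfolding center_def by fastforce

lemma start_view: "j < K ==> view (conf z 0) j d =
   (if j = 0 then word_contents z d else if j = K - 1 then (if d = 0 then 1 else 0) else 0)"
  using K by (auto simp: conf_def start_def view_def nth_Cons' nth_append)

text \<open>The easy direction: the facts of an accepting computation satisfy the clauses of every
  cell up to time \<open>T\<close>, at any distance from the heads.\<close>

lemma facts_hold:
  assumes w: "w ~= []" and u: "length u <= P" and acc: "fst (snd (conf (w @ u) T) ! 0) 0 = 2"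
    and T: "T > 0" "t <= T" and cl: "cl \<in> set (clauses (category w P T t d))"
  shows "holds_at (fact (w @ u)) t d cl"
proof (cases "t = 0")
  case False
  show ?thesis
  proof (cases "t < T")
    case True
    then show ?thesis using cl False fact_mid fact_center by (auto simp: category_def clauses_def split: if_splits)
  next
    case nT: False
    then have t: "t = T" using T by simp
    obtain s where s: "cl = [(2, Sym (K - 1) 1, False), (2, Sym 0 s, False)]" "s ~= 2"
      using cl False nT by (auto simp: category_def clauses_def final_def)
    have "view (conf (w @ u) T) 0 d = 2" if "view (conf (w @ u) T) (K - 1) d = 1"
    proof -
      let ?c = "conf (w @ u) T"
      have o: "fst (snd ?c ! (K - 1)) = (%i. if i = 0 then 1 else 0)" "snd (snd ?c ! (K - 1)) = snd (snd ?c ! 0)"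
        using conf_valid[of "w @ u" T] by (simp_all add: valid_def)
      have "snd (snd ?c ! 0) + d = 0" using that unfolding view_def o by presburger
      then show ?thesis using acc by (simp add: view_def)
    qed
    then show ?thesis using s by (auto simp: holds_at_def fact_def t)
  qed
next
  case True
  have unit: "holds_at (fact (w @ u)) 0 d [(2, Sym j s, True)]" if "view (conf (w @ u) 0) j d = s" for j s
    using that by (simp add: holds_at_def fact_def)
  have state: "holds_at (fact (w @ u)) 0 d [(2, State 0, True)]" by (simp add: holds_at_def fact_def conf_def start_def)
  have others: "holds_at (fact (w @ u)) 0 d cl" if bo: "cl \<in> set blank_others" and nd: "d ~= 0" for cl
  proof -
    obtain j where j: "cl = [(2, Sym j 0, True)]" "1 <= j" "j < K" using bo by (auto simp: blank_others_def)
    have "view (conf (w @ u) 0) j d = 0" using start_view[OF j(3), of "w @ u" d] j(2) nd by (cases "j = K - 1") simp_all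
    then show ?thesis unfolding j by (rule unit)
  qed
  have centre: "holds_at (fact (w @ u)) 0 d cl" if co: "cl \<in> set centre_others" and d0: "d = 0" for cl
  proof -
    consider "cl = [(2, Sym (K - 1) 1, True)]" | "cl = [(2, State 0, True)]" | j where "cl = [(2, Sym j 0, True)]" "1 <= j" "j < K - 1"
      using co by (auto simp: centre_others_def)
    then show ?thesis
    proof cases
      case 1
      have "view (conf (w @ u) 0) (K - 1) d = 1" using start_view[of "K - 1" "w @ u" d] K d0 by simp
      then show ?thesis unfolding 1 by (rule unit)
    next
      case (3 j)
      have "view (conf (w @ u) 0) j d = 0" using start_view[of j "w @ u" d] 3 by simp
      then show ?thesis unfolding 3 by (rule unit)
    qed (use state in simp)
  qed
  have K0: "0 < K" using K by simp
  note v0 = start_view[OF K0, of "w @ u"]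
  have cases: "(d < 0 \<or> d \<ge> int (length w + P)) & category w P T t d = 5 \<or>
     d = 0 & category w P T t d = (if hd w then 9 else 8) \<or>
     0 < d & d < int (length w) & category w P T t d = (if w ! nat d then 7 else 6) \<or>
     int (length w) <= d & d < int (length w + P) & category w P T t d = 10"
    using True w by (auto simp: category_def)
  have wc: "word_contents (w @ u) d = (if 0 <= d & d < int (length w) then (if w ! nat d then 2 else 1)
     else if 0 <= d & d < int (length w + length u) then (if u ! (nat d - length w) then 2 else 1) else 0)"
    by (auto simp: word_contents_def nth_append)
  have wl: "length w > 0" using w by simp
  from cases show ?thesis
  proof (elim disjE conjE)
    assume d: "d < 0" "category w P T t d = 5"
    then have "cl = [(2, Sym 0 0, True)] \<or> cl \<in> set blank_others \<or> cl \<in> set mid" using cl by (auto simp: clauses_def)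
    then show ?thesis using others fact_mid[of cl d] unit[of 0 0] d v0 True wc by auto
  next
    assume d: "d \<ge> int (length w + P)" "category w P T t d = 5"
    then have "cl = [(2, Sym 0 0, True)] \<or> cl \<in> set blank_others \<or> cl \<in> set mid" using cl by (auto simp: clauses_def)
    then show ?thesis using others fact_mid[of cl d] unit[of 0 0] d v0 True wc u wl by auto
  next
    assume d: "d = 0" "category w P T t d = (if hd w then 9 else 8)"
    then have "cl = [(2, Sym 0 (if hd w then 2 else 1), True)] \<or> cl \<in> set centre_others \<or> cl \<in> set center"
      using cl by (auto simp: clauses_def)
    then show ?thesis using centre fact_center[of cl] unit[of 0 "if hd w then 2 else 1"] d v0[of d] True wc wl
      by (auto simp: hd_conv_nth[OF w])
  next
    assume d: "0 < d" "d < int (length w)" "category w P T t d = (if w ! nat d then 7 else 6)"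
    then have "cl = [(2, Sym 0 (if w ! nat d then 2 else 1), True)] \<or> cl \<in> set blank_others \<or> cl \<in> set mid"
      using cl by (auto simp: clauses_def)
    then show ?thesis using others fact_mid[of cl d] unit[of 0 "if w ! nat d then 2 else 1"] d v0[of d] True wc by auto
  next
    assume d: "int (length w) <= d" "d < int (length w + P)" "category w P T t d = 10"
    then have "cl = [(2, Sym 0 0, True), (2, Sym 0 1, True), (2, Sym 0 2, True)] \<or> cl = [(2, Sym 0 0, False), (3, Sym 0 0, True)] \<or>
       cl \<in> set blank_others \<or> cl \<in> set mid" using cl by (auto simp: clauses_def guess_def)
    moreover have "holds_at (fact (w @ u)) 0 d [(2, Sym 0 0, True), (2, Sym 0 1, True), (2, Sym 0 2, True)]"
      using v0[of d] wc by (auto simp: holds_at_def fact_def)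
    moreover have "holds_at (fact (w @ u)) 0 d [(2, Sym 0 0, False), (3, Sym 0 0, True)]"
      using v0[of d] v0[of "d + 1"] d by (auto simp: holds_at_def fact_def word_contents_def)
    ultimately show ?thesis using others fact_mid[of cl d] d True wl by auto
  qed
qed

text \<open>By induction on time, all facts of the computation on the certificate read off from row
  0 are true within distance \<open>U - t\<close> of the heads, as each step loses one cell on
  either side. At time \<open>T\<close> the origin is at most \<open>T\<close> away from the head,
  hence \<open>U \<ge> 2 * T\<close>.\<close>

lemma assignment_accepts:
  assumes w: "w ~= []" and T: "T > 0" and U: "U \<ge> 2 * T" and R: "R \<ge> length w + P + U"
    and F: "\<And>t d cl. t <= T ==> - int U <= d ==> d <= int R ==> cl \<in> set (clauses (category w P T t d)) ==> holds_at F t d cl"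
  obtains u where "length u <= P" "fst (snd (conf (w @ u) T) ! 0) 0 = 2"
proof -
  have wl: "length w > 0" using w by simp
  have K0: "0 < K" using K by simp
  \<comment> \<open>The certificate ends before the first cell that may be blank; its last possible
    end is \<open>P\<close>.\<close>
  define n where "n = (LEAST i. i = P \<or> F 0 (int (length w + i)) (Sym 0 0))"
  have n: "n = P \<or> F 0 (int (length w + n)) (Sym 0 0)" unfolding n_def by (rule LeastI[of _ P]) simp
  have nP: "n <= P" unfolding n_def by (rule Least_le) simp
  have nl: "\<not> F 0 (int (length w + i)) (Sym 0 0)" if "i < n" for i using not_less_Least[OF that[unfolded n_def]] by simp
  define u where "u = map (%i. F 0 (int (length w + i)) (Sym 0 2)) [0..<n]"
  have ul: "length u = n" by (simp add: u_def)
  have cert: "F 0 (int (length w + i)) (Sym 0 0) \<or> F 0 (int (length w + i)) (Sym 0 1) \<or> F 0 (int (length w + i)) (Sym 0 2)"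
    "F 0 (int (length w + i)) (Sym 0 0) --> F 0 (int (length w + Suc i)) (Sym 0 0)" if "i < P" for i
  proof -
    have "\<not> int (length w + i) < 0" "int (length w + i) ~= 0" "\<not> int (length w + i) < int (length w)" "int (length w + i) < int (length w + P)"
      using that wl by linarith+
    then have c: "category w P T 0 (int (length w + i)) = 10" unfolding category_def by (simp only: if_False if_True refl)
    have "holds_at F 0 (int (length w + i)) cl" if "cl \<in> set guess" for cl
    proof (rule F)
      show "cl \<in> set (clauses (category w P T 0 (int (length w + i))))" unfolding c using that by (simp add: clauses_def)
      show "- int U <= int (length w + i)" "int (length w + i) <= int R" using \<open>i < P\<close> R by linarith+
    qed simp
    then have "holds_at F 0 (int (length w + i)) [(2, Sym 0 0, True), (2, Sym 0 1, True), (2, Sym 0 2, True)]"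
       "holds_at F 0 (int (length w + i)) [(2, Sym 0 0, False), (3, Sym 0 0, True)]" by (simp_all add: guess_def)
    then show "F 0 (int (length w + i)) (Sym 0 0) \<or> F 0 (int (length w + i)) (Sym 0 1) \<or> F 0 (int (length w + i)) (Sym 0 2)"
      "F 0 (int (length w + i)) (Sym 0 0) --> F 0 (int (length w + Suc i)) (Sym 0 0)"
      by (auto simp: holds_at_def add.commute add.left_commute)
  qed
  have after: "F 0 (int (length w + (n + k))) (Sym 0 0)" if "n + k < P" for k
    using that
  proof (induction k)
    case 0
    then show ?case using n by simp
  next
    case (Suc k)
    then show ?case using cert(2)[of "n + k"] by simp
  qed
  have init: "holds_at F 0 d cl" if "cl \<in> set (clauses (category w P T 0 d))" "\<bar>d\<bar> <= int U" for d cl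
    by (rule F) (use that R in auto)
  have unit: "F 0 d v" if "holds_at F 0 d [(2, v, True)]" for d v using that by (simp add: holds_at_def)
  have row0: "F 0 d (Sym j (view (conf (w @ u) 0) j d))" if j: "j < K" and d: "\<bar>d\<bar> <= int U" for j d
  proof (cases "j = 0")
    case False
    show ?thesis
    proof (cases "d = 0")
      case True
      have "set centre_others \<subseteq> set (clauses (category w P T 0 d))" using True by (auto simp: category_def clauses_def)
      moreover have "[(2, Sym (K - 1) 1, True)] \<in> set centre_others" "1 <= j ==> j < K - 1 ==> [(2, Sym j 0, True)] \<in> set centre_others"
        by (simp_all add: centre_others_def)
      ultimately have "F 0 d (Sym (K - 1) 1)" "1 <= j ==> j < K - 1 ==> F 0 d (Sym j 0)"
        using unit init d by blast+
      then show ?thesis using start_view[OF j, of "w @ u" d] False j True by (cases "j = K - 1") auto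
    next
      case nd: False
      have "set blank_others \<subseteq> set (clauses (category w P T 0 d))" using nd by (auto simp: category_def clauses_def)
      moreover have "[(2, Sym j 0, True)] \<in> set blank_others" using False j by (simp add: blank_others_def)
      ultimately have "F 0 d (Sym j 0)" using unit init d by blast
      then show ?thesis using start_view[OF j, of "w @ u" d] False nd by (cases "j = K - 1") simp_all
    qed
  next
    case True
    have v: "view (conf (w @ u) 0) j d = word_contents (w @ u) d" using start_view[OF j] True by simp
    consider "d < 0 \<or> d \<ge> int (length w + P)" | "d = 0" | "0 < d" "d < int (length w)" | "int (length w) <= d" "d < int (length w + P)"
      by linarith
    then show ?thesis
    proof cases
      case 1
      then have "d < 0 \<or> \<not> d < 0 & d ~= 0 & \<not> d < int (length w) & \<not> d < int (length w + P)" using wl by linarith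
      then have "category w P T 0 d = 5" unfolding category_def by (elim disjE conjE) (simp_all only: if_True if_False refl)
      then have "F 0 d (Sym 0 0)" by (intro unit init d) (simp add: clauses_def)
      moreover have "word_contents (w @ u) d = 0" using 1 ul nP by (auto simp: word_contents_def)
      ultimately show ?thesis using v True by simp
    next
      case 2
      then have "category w P T 0 d = (if hd w then 9 else 8)" by (simp add: category_def)
      then have "F 0 d (Sym 0 (if hd w then 2 else 1))" by (intro unit init d) (simp add: clauses_def)
      moreover have "word_contents (w @ u) d = (if hd w then 2 else 1)" 
      proof -
        obtain b w' where "w = b # w'" using w by (cases w) auto
        then show ?thesis using 2 by (simp add: word_contents_def)
      qed
      ultimately show ?thesis using v True by simp
    next
      case 3
      then have "category w P T 0 d = (if w ! nat d then 7 else 6)" by (simp add: category_def)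
      then have "F 0 d (Sym 0 (if w ! nat d then 2 else 1))" by (intro unit init d) (simp add: clauses_def)
      moreover have "word_contents (w @ u) d = (if w ! nat d then 2 else 1)"
        using 3 by (simp add: word_contents_def nth_append nat_less_iff)
      ultimately show ?thesis using v True by simp
    next
      case 4
      define i where "i = nat d - length w"
      have i: "d = int (length w + i)" "i < P" using 4 by (auto simp: i_def)
      show ?thesis
      proof (cases "i < n")
        case True
        then have "word_contents (w @ u) d = (if F 0 d (Sym 0 2) then 2 else 1)"
          using ul by (simp add: i word_contents_def nth_append u_def nat_int_add)
        moreover have "F 0 d (Sym 0 1) \<or> F 0 d (Sym 0 2)" using cert(1)[OF i(2)] nl[OF True] i by simp
        ultimately show ?thesis using v \<open>j = 0\<close> by auto
      next
        case False
        then have "word_contents (w @ u) d = 0" using ul by (simp add: i word_contents_def)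
        moreover have "F 0 d (Sym 0 0)" using after[of "i - n"] False i by simp
        ultimately show ?thesis using v \<open>j = 0\<close> by simp
      qed
    qed
  qed
  have state0: "F 0 0 (State 0)"
  proof -
    have "set centre_others \<subseteq> set (clauses (category w P T 0 0))" by (auto simp: category_def clauses_def)
    moreover have "[(2, State 0, True)] \<in> set centre_others" by (simp add: centre_others_def)
    ultimately show ?thesis using unit init[of _ 0] by (metis abs_zero of_nat_0_le_iff subsetD)
  qed
  have inv: "F t 0 (State (fst (conf (w @ u) t))) & (\<forall>j < K. \<forall>d. \<bar>d\<bar> <= int U - int t --> F t d (Sym j (view (conf (w @ u) t) j d)))" if "t <= T" for t
    using that
  proof (induction t)
    case 0
    then show ?case using state0 row0 by (simp add: conf_def[of _ 0] start_def[of "w @ u"])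
  next
    case (Suc t)
    let ?c = "conf (w @ u) t"
    define q ss where "q = fst ?c" and "ss = reads ?c"
    have a: "(q, ss) \<in> set actions" unfolding q_def ss_def by (rule conf_action)
    have sl: "length ss = K" "set ss \<subseteq> {..<g}" using a by (simp_all add: set_actions)
    have IH: "F t 0 (State q)" "\<And>j d. j < K ==> \<bar>d\<bar> <= int U - int t ==> F t d (Sym j (view ?c j d))"
      using Suc by (auto simp: q_def)
    have tT: "t < T" using Suc by simp
    have cl0: "holds_at F t 0 cl" if "cl \<in> set center" for cl
      by (rule F) (use that tT R in \<open>auto simp: clauses_def category_def\<close>)
    have cld: "holds_at F t d cl" if "cl \<in> set mid" "\<bar>d\<bar> <= int U" "d ~= 0" for cl d
      by (rule F) (use that tT R in \<open>auto simp: clauses_def category_def\<close>)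
    have sp: "holds_at F t d cl" if "cl \<in> set (spread (q, ss))" "\<bar>d\<bar> <= int U" for cl d
      using cl0[of cl] cld[of cl d] that a by (cases "d = 0") (auto simp: center_def mid_def)
    have do0: "F t 0 (Doing q ss)"
    proof -
      have "holds_at F t 0 ([(2, State q, False), (2, Doing q ss, True)] @ map (%j. (2, Sym j (ss ! j), False)) [0..<K])"
        by (rule cl0[OF in_center[OF a]]) (simp add: fire_def)
      moreover have "F t 0 (Sym j (ss ! j))" if "j < K" for j
        using IH(2)[OF that, of 0] reads_props(3)[OF conf_valid that] tT U by (simp add: ss_def)
      ultimately show ?thesis using IH(1) by (auto simp: holds_at_def)
    qed
    have up: "F t (int k) (Doing q ss) & F t (- int k) (Doing q ss)" if "k <= U" for k
      using that
    proof (induction k)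
      case (Suc k)
      have "holds_at F t (int k) [(2, Doing q ss, False), (3, Doing q ss, True)]"
        "holds_at F t (- int k) [(2, Doing q ss, False), (1, Doing q ss, True)]"
        by (rule sp; use Suc in \<open>simp add: spread_def\<close>)+
      then show ?case using Suc by (simp add: holds_at_def add.commute)
    qed (use do0 in simp)
    have doing: "F t d (Doing q ss)" if "\<bar>d\<bar> <= int U" for d
      using up[of "nat \<bar>d\<bar>"] that by (cases "d \<ge> 0") auto
    have "F (Suc t) 0 (State (fst (conf (w @ u) (Suc t))))"
    proof -
      have "holds_at F t 0 [(2, Doing q ss, False), (5, State (fst (nxt q ss)), True)]"
        by (rule cl0[OF in_center[OF a]]) (simp add: fire_def)
      then show ?thesis using do0 by (simp add: holds_at_def conf_fst q_def ss_def)
    qed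
    moreover have "F (Suc t) d (Sym j (view (conf (w @ u) (Suc t)) j d))" if j: "j < K" and d: "\<bar>d\<bar> <= int U - int (Suc t)" for j d
    proof -
      \<comment> \<open>The cell in which the contents were before head \<open>j\<close>
        moved.\<close>
      define e where "e = d + move_offset (snd (act q ss j))"
      have "\<bar>move_offset (snd (act q ss j))\<bar> <= 1" by (cases "snd (act q ss j)") auto
      then have e: "\<bar>e\<bar> <= int U - int t" using d by (simp add: e_def)
      have view: "view (conf (w @ u) (Suc t)) j d = (if e = 0 then fst (act q ss j) else view ?c j e)"
      proof -
        have d': "e - move_offset (snd (act q ss j)) = d" by (simp add: e_def)
        show ?thesis using advance_view[OF conf_valid[of "w @ u" t] j, of e] unfolding conf_Suc q_def[symmetric] ss_def[symmetric] d' .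
      qed
      show ?thesis
      proof (cases "e = 0")
        case True
        have "holds_at F t 0 [(2, Doing q ss, False), (target (snd (act q ss j)), Sym j (fst (act q ss j)), True)]"
          by (rule cl0[OF in_center[OF a]]) (use in_update[OF j] in blast)
        moreover have "d = - move_offset (snd (act q ss j))" using True unfolding e_def by linarith
        ultimately show ?thesis using do0 True view by (simp add: holds_at_def)
      next
        case False
        have "view ?c j e < g" using conf_valid[of "w @ u" t] j by (simp add: valid_def view_def)
        then have "holds_at F t e [(2, Doing q ss, False), (2, Sym j (view ?c j e), False), (target (snd (act q ss j)), Sym j (view ?c j e), True)]"
          using cld[OF in_mid[OF a disjI2[OF in_copy[OF j]]], of _ e] e False by simp
        moreover have "e + - move_offset (snd (act q ss j)) = d" unfolding e_def by linarith
        ultimately show ?thesis using doing[of e] IH(2)[OF j e] e False view by (simp add: holds_at_def)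
      qed
    qed
    ultimately show ?case by blast
  qed
  \<comment> \<open>The origin as seen from the head of tape 0.\<close>
  define d where "d = - snd (snd (conf (w @ u) T) ! 0)"
  have d: "\<bar>d\<bar> <= int U - int T" using head_bound[of "w @ u" T] U by (simp add: d_def)
  have K1: "K - 1 < K" using K by simp
  define s where "s = view (conf (w @ u) T) 0 d"
  have s: "s = fst (snd (conf (w @ u) T) ! 0) 0" by (simp add: s_def view_def d_def)
  have sg: "s < g" using conf_valid[of "w @ u" T] K0 by (simp add: s valid_def)
  have "view (conf (w @ u) T) (K - 1) d = 1" using conf_valid[of "w @ u" T] by (simp add: valid_def view_def d_def)
  moreover have "F T d (Sym j (view (conf (w @ u) T) j d))" if "j < K" for j using inv[of T] d that by blast
  ultimately have fs: "F T d (Sym (K - 1) 1)" "F T d (Sym 0 s)" using K0 K1 unfolding s_def by metis+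
  have "s = 2"
  proof (rule ccontr)
    assume "s ~= 2"
    have "holds_at F T d [(2, Sym (K - 1) 1, False), (2, Sym 0 s, False)]"
      by (rule F) (use T d R sg \<open>s ~= 2\<close> in \<open>auto simp: category_def clauses_def final_def\<close>)
    then show False using fs by (simp add: holds_at_def)
  qed
  then show ?thesis using that[of u] ul nP s by simp
qed

end

section \<open>Drawing the picture of a formula\<close>

definition sequence :: "prog list => prog" where
  "sequence ps = foldr (;;) ps Skip"

lemma sem_sequence: "sem (sequence ps) s = fold sem ps s"
  by (induction ps arbitrary: s) (simp_all add: sequence_def)

text \<open>Register 15 is at least as long as the word of tokens in register 11, which has one letter per
  cell; 13 receives the picture, 12 is a buffer.\<close>

definition draw_line :: "nat list => nat list => (nat => nat list) => prog" where
  "draw_line l r F = push_all 13 l ;; pop_loop 15 11 (%t. push_all 13 (F t) ;; Push 12 (ltr t)) ;; push_all 13 r ;; move_all 15 12 11"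

text \<open>The last token is at the bottom of its register and out of reach, hence the detour
  through the buffer.\<close>

definition slide :: prog where
  "slide = move_all 15 11 12 ;; Pop 12 ;; move_all 15 12 11 ;; Push 11 1"

definition board :: "store => nat list => nat list => store" where
  "board s z out = s(11 := z, 12 := [], 13 := rev out)"

lemma board [simp]: "board s z out 11 = z" "board s z out 12 = []" "board s z out 13 = rev out" "board s z out 15 = s 15"
  "(board s z out)(13 := rev out') = board s z out'" "(board s z out)(11 := z') = board s z' out"
  by (simp_all add: board_def fun_eq_iff)

definition tokens_ok :: "store => nat list => bool" where
  "tokens_ok s z \<longleftrightarrow> length z <= length (s 15) & set z \<subseteq> {0<..<16}"

lemma sem_draw_line:
  assumes z: "tokens_ok s z"
  shows "sem (draw_line l r F) (board s z out) = board s z (out @ l @ concat (map F z) @ r)"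
proof -
  have z0: "0 \<notin> set z" using z by (auto simp: tokens_ok_def)
  have p: "sem (push_all 13 xs) (board s z out) = board s z (out @ xs)" for xs z out by (simp add: board_def fun_eq_iff)
  have f: "fold (%t. sem (push_all 13 (F t) ;; Push 12 (ltr t))) ys t =
    t(13 := rev (concat (map F ys)) @ t 13, 12 := rev ys @ t 12)" if "set ys \<subseteq> {0<..<16}" for ys t
    using that by (induction ys arbitrary: t) (auto simp: fun_eq_iff)
  define Y where "Y = (%out. s(11 := [], 12 := rev z, 13 := rev out))"
  have "sem (pop_loop 15 11 (%t. push_all 13 (F t) ;; Push 12 (ltr t))) (board s z out) =
    (fold (%t. sem (push_all 13 (F t) ;; Push 12 (ltr t))) (board s z out 11) (board s z out))(11 := [])" for out
    by (rule sem_pop_loop) (use z z0 in \<open>auto simp: tokens_ok_def dest: push_all_used\<close>)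
  then have l: "sem (pop_loop 15 11 (%t. push_all 13 (F t) ;; Push 12 (ltr t))) (board s z out) = Y (out @ concat (map F z))" for out
    using z by (simp add: f tokens_ok_def) (simp add: Y_def board_def fun_eq_iff)
  have q: "sem (push_all 13 xs) (Y out) = Y (out @ xs)" for xs out by (simp add: Y_def fun_eq_iff)
  have "sem (move_all 15 12 11) (Y out) = (Y out)(12 := [], 11 := rev (Y out 12) @ Y out 11)" for out
    by (rule sem_move_all) (use z in \<open>auto simp: tokens_ok_def Y_def\<close>)
  then have m: "sem (move_all 15 12 11) (Y out) = board s z out" for out by (simp add: Y_def board_def fun_eq_iff)
  show ?thesis unfolding draw_line_def sem.simps(5) p l q m by simp
qed

lemma sem_slide:
  assumes z: "tokens_ok s z" "z ~= []"
  shows "sem slide (board s z out) = board s (1 # butlast z) out"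
proof -
  have b: "tokens_ok s (butlast z)" using z by (auto simp: tokens_ok_def dest: in_set_butlastD)
  define Y where "Y = (%v. s(11 := [], 12 := rev v, 13 := rev out))"
  have "sem (move_all 15 11 12) (board s z out) = (board s z out)(11 := [], 12 := rev (board s z out 11) @ board s z out 12)"
    by (rule sem_move_all) (use z in \<open>auto simp: tokens_ok_def\<close>)
  then have 1: "sem (move_all 15 11 12) (board s z out) = Y z" by (simp add: Y_def board_def fun_eq_iff)
  have 2: "sem (Pop 12) (Y z) = Y (butlast z)" using z(2) by (cases z rule: rev_cases) (simp_all add: Y_def fun_eq_iff)
  have "sem (move_all 15 12 11) (Y v) = (Y v)(12 := [], 11 := rev (Y v 12) @ Y v 11)" if "tokens_ok s v" for v
    by (rule sem_move_all) (use that in \<open>auto simp: tokens_ok_def Y_def\<close>)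
  then have 3: "sem (move_all 15 12 11) (Y (butlast z)) = board s (butlast z) out" using b by (simp add: Y_def board_def fun_eq_iff)
  have 4: "sem (Push 11 1) (board s (butlast z) out) = board s (1 # butlast z) out" by (simp add: board_def fun_eq_iff)
  show ?thesis unfolding slide_def sem.simps(5) 1 2 3 4 ..
qed

text \<open>A strip of tiles: one block, then \<open>m\<close> tiles for each cell, depending on its token, then the
  tile \<open>e\<close>.\<close>

definition strip_line :: "nat => tile => (nat => nat => tile) => nat list => nat => nat list" where
  "strip_line m e c z k = (2 # tile_line Block k) @ concat (map (%t. concat (map (%i. tile_line (c t i) k) [0..<m])) z) @ tile_line e k @ [3]"

definition draw_strip :: "nat => tile => (nat => nat => tile) => prog" where
  "draw_strip m e c = sequence (map (%k. draw_line (2 # tile_line Block k) (tile_line e k @ [3])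
     (%t. concat (map (%i. tile_line (c t i) k) [0..<m]))) [0..<20])"

lemma fold_board_map:
  assumes "\<And>x out. sem (f x) (board s z out) = board s z (out @ W x)"
  shows "sem (sequence (map f xs)) (board s z out) = board s z (out @ concat (map W xs))"
  unfolding sem_sequence using assms by (induction xs arbitrary: out) simp_all

lemma sem_draw_strip:
  assumes "tokens_ok s z"
  shows "sem (draw_strip m e c) (board s z out) = board s z (out @ concat (map (strip_line m e c z) [0..<20]))"
  unfolding draw_strip_def by (rule fold_board_map) (simp add: sem_draw_line[OF assms] strip_line_def)

lemma upt_blocks: "concat (map (%q. map (%i. m * q + i) [0..<m]) [0..<n]) = [0..<m * n]"
proof (induction n)
  case (Suc n)
  have "map (%i. m * n + i) [0..<m] = [m * n..<m * n + m]" by (rule nth_equalityI) auto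
  then show ?case using Suc upt_add_eq_append[of 0 "m * n" m] by (simp add: add.commute)
qed simp

lemma upt_frame: "[0..<n + 2] = 0 # map Suc [0..<n] @ [Suc n]"
  by (rule nth_equalityI) (auto simp: nth_Cons' nth_append)

lemma upt_two: "[0..<n + 2] = 0 # 1 # map ((+) 2) [0..<n]"
  by (rule nth_equalityI) (auto simp: nth_Cons' simp del: upt_Suc)

lemma concat_map_concat: "concat (map f (concat (map g xs))) = concat (map (%x. concat (map f (g x))) xs)"
  by (induction xs) simp_all

lemma strip_cells:
  assumes "r 0 = Block" "r (Suc (m * length z)) = e" "\<And>q i. q < length z ==> i < m ==> r (Suc (m * q + i)) = c (z ! q) i"
  shows "concat (map (strip_line m e c z) [0..<20]) = strip (m * length z + 2) r"
proof -
  have "grid_line (m * length z + 2) r k = strip_line m e c z k" for k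
  proof -
    have "[0..<m * length z + 2] = 0 # map Suc [0..<m * length z] @ [Suc (m * length z)]"
      by (rule upt_frame)
    moreover have "concat (map (%i. tile_line (r (Suc i)) k) [0..<m * length z]) =
      concat (map (%t. concat (map (%i. tile_line (c t i) k) [0..<m])) z)"
    proof -
      have "concat (map (%i. tile_line (r (Suc i)) k) [0..<m * length z]) =
        concat (map (%q. concat (map (%i. tile_line (r (Suc (m * q + i))) k) [0..<m])) [0..<length z])"
        unfolding upt_blocks[symmetric] by (simp add: concat_map_concat o_def)
      also have "\<dots> = concat (map (%q. concat (map (%i. tile_line (c (z ! q) i) k) [0..<m])) [0..<length z])"
        by (intro arg_cong[of _ _ concat] map_cong refl) (simp add: assms(3))
      also have "\<dots> = concat (map (%t. concat (map (%i. tile_line (c t i) k) [0..<m])) (map ((!) z) [0..<length z]))"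
        by (simp add: o_def)
      finally show ?thesis by (simp add: map_nth)
    qed
    ultimately show ?thesis by (simp add: grid_line_def strip_line_def assms o_def)
  qed
  then show ?thesis by (simp add: strip_def cong: map_cong)
qed

text \<open>A pair in \<open>cl\<close> consists of a token and the number of a literal within the
  cell that carries the token.\<close>

definition draw_clause :: "nat => (nat \<times> nat) list => prog" where
  "draw_clause b cl = sequence (map (%y. draw_strip (26 * b) (if y = 1 then Need else Block)
     (%t i. macro_tile ((t, i div 13) \<in> set cl) (i mod 13) y)) [0..<12])"

definition clause_rows :: "nat => nat list => (nat \<times> nat) list => nat list" where
  "clause_rows b z cl = concat (map (%y. concat (map (strip_line (26 * b) (if y = 1 then Need else Block)
     (%t i. macro_tile ((t, i div 13) \<in> set cl) (i mod 13) y) z) [0..<20])) [0..<12])"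

lemma sem_draw_clause:
  assumes "tokens_ok s z"
  shows "sem (draw_clause b cl) (board s z out) = board s z (out @ clause_rows b z cl)"
  unfolding draw_clause_def clause_rows_def by (rule fold_board_map) (rule sem_draw_strip[OF assms])

fun slid_rows :: "nat => (nat => (nat \<times> nat) list list) => nat list => nat list => nat list" where
  "slid_rows b cls z [] = []"
| "slid_rows b cls z (c # cs) = concat (map (clause_rows b z) (cls c)) @ slid_rows b cls (1 # butlast z) cs"

text \<open>The bottom line has 520 = 20 * 26 points for each variable of a cell, and 40 for the two
  outer columns of tiles.\<close>

definition draw_picture :: "nat => (nat => (nat \<times> nat) list list) => prog" where
  "draw_picture b cls = Push 13 5 ;; For 15 (%_. push_all 13 (replicate (520 * b) 2)) ;; push_all 13 (replicate 40 2 @ [3]) ;;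
     draw_strip (26 * b) Block (%_ _. Block) ;; draw_strip (26 * b) Block (%_ i. choice_tile (even (i div 13)) (i mod 13)) ;;
     For 10 (%c. sequence (map (draw_clause b) (cls c)) ;; slide)"

definition picture_word :: "nat => (nat => (nat \<times> nat) list list) => nat list => nat list => nat list" where
  "picture_word b cls z cs = (5 # replicate (520 * b * length z) 2 @ replicate 40 2 @ [3]) @
     concat (map (strip_line (26 * b) Block (%_ _. Block) z) [0..<20]) @
     concat (map (strip_line (26 * b) Block (%_ i. choice_tile (even (i div 13)) (i mod 13)) z) [0..<20]) @
     slid_rows b cls z cs"

lemma sem_draw_picture:
  assumes z: "length (s 11) = length (s 15)" "set (s 11) \<subseteq> {0<..<16}" "s 11 ~= []" and s: "s 12 = []" "s 13 = []"
  shows "sem (draw_picture b cls) s 13 = rev (picture_word b cls (s 11) (s 10))"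
    "\<And>r. r \<notin> {11, 12, 13} ==> sem (draw_picture b cls) s r = s r"
proof -
  define z where "z = s 11"
  have s0: "s = board s z []" using s by (simp add: board_def z_def fun_eq_iff)
  have p: "sem (push_all 13 xs) (board s z out) = board s z (out @ xs)" for xs z out by (simp add: board_def fun_eq_iff)
  have ok: "tokens_ok s z" using z by (simp add: tokens_ok_def z_def)
  have p1: "sem (Push 13 5) (board s z out) = board s z (out @ [5])" for out by (simp add: board_def fun_eq_iff)
  have f: "fold (%_. sem (push_all 13 (replicate (520 * b) 2))) ws (board s z out) = board s z (out @ replicate (520 * b * length ws) 2)" for ws :: "nat list" and out
  proof (induction ws arbitrary: out)
    case (Cons w ws)
    then show ?case by (simp add: p replicate_add del: sem_push_all)
  qed simp
  have f15: "sem (For 15 (%_. push_all 13 (replicate (520 * b) 2))) (board s z out) = board s z (out @ replicate (520 * b * length z) 2)" for out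
    using f[of "s 15" out] z(1) by (simp add: z_def)
  have cs: "\<exists>z'. fold (%c. sem (sequence (map (draw_clause b) (cls c)) ;; slide)) cs (board s z out) = board s z' (out @ slid_rows b cls z cs)"
    if "tokens_ok s z" "z ~= []" for cs z out
    using that
  proof (induction cs arbitrary: z out)
    case (Cons c cs)
    have 1: "sem (sequence (map (draw_clause b) (cls c))) (board s z out) = board s z (out @ concat (map (clause_rows b z) (cls c)))"
      by (rule fold_board_map) (rule sem_draw_clause[OF Cons.prems(1)])
    have "tokens_ok s (1 # butlast z)" using Cons.prems by (cases z rule: rev_cases) (auto simp: tokens_ok_def)
    from Cons.IH[OF this, of "out @ concat (map (clause_rows b z) (cls c))"]
    show ?case by (simp add: 1 sem_slide[OF Cons.prems])
  qed auto
  have b10: "board s z out 10 = s 10" for out by (simp add: board_def)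
  obtain z' where "sem (draw_picture b cls) s = board s z' (picture_word b cls z (s 10))"
  proof -
    let ?out = "[] @ [5] @ replicate (520 * b * length z) 2 @ (replicate 40 2 @ [3]) @
     concat (map (strip_line (26 * b) Block (%_ _. Block) z) [0..<20]) @
     concat (map (strip_line (26 * b) Block (%_ i. choice_tile (even (i div 13)) (i mod 13)) z) [0..<20])"
    obtain z' where z': "fold (%c. sem (sequence (map (draw_clause b) (cls c)) ;; slide)) (s 10) (board s z ?out) = board s z' (?out @ slid_rows b cls z (s 10))"
      using cs[OF ok, of "s 10" ?out] assms(3) unfolding z_def by blast
    have "sem (draw_picture b cls) (board s z []) = board s z' (?out @ slid_rows b cls z (s 10))"
      unfolding draw_picture_def sem.simps(5) p1 f15 p sem_draw_strip[OF ok] sem.simps(6)[of 10] b10 append_assoc z'[unfolded append_assoc] ..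
    then show ?thesis using that[of z'] s0 by (simp add: picture_word_def)
  qed
  then show "sem (draw_picture b cls) s 13 = rev (picture_word b cls (s 11) (s 10))"
    "\<And>r. r \<notin> {11, 12, 13} ==> sem (draw_picture b cls) s r = s r" by (simp_all add: z_def board_def)
qed

section \<open>Sliding token words\<close>

text \<open>Token words slide by one cell for each base; \<open>lits\<close> lists the clauses with their bases.\<close>

definition slid_tokens :: "nat list => nat => nat list" where
  "slid_tokens z p = ((%z. 1 # butlast z) ^^ p) z"

lemma length_slid: "z ~= [] ==> length (slid_tokens z p) = length z & slid_tokens z p ~= []"
  unfolding slid_tokens_def by (induction p) (auto simp: length_greater_0_conv[symmetric] simp del: length_greater_0_conv)

lemma nth_slid: "z ~= [] ==> q < length z ==> slid_tokens z p ! q = (if q < p then 1 else z ! (q - p))"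
proof (induction p arbitrary: q)
  case 0
  then show ?case by (simp add: slid_tokens_def)
next
  case (Suc p)
  have l: "length (slid_tokens z p) = length z" using length_slid Suc.prems(1) by blast
  have e: "slid_tokens z (Suc p) = 1 # butlast (slid_tokens z p)" by (simp add: slid_tokens_def)
  show ?case
  proof (cases q)
    case (Suc q')
    then have "slid_tokens z (Suc p) ! q = slid_tokens z p ! q'" using Suc.prems l by (simp add: e nth_butlast)
    then show ?thesis using Suc.IH[of q'] Suc.prems Suc by simp
  qed (simp add: e)
qed

definition based_clauses :: "(nat => (nat \<times> nat) list list) => nat list => (nat \<times> (nat \<times> nat) list) list" where
  "based_clauses cls cs = concat (map (%p. map (Pair p) (cls (cs ! p))) [0..<length cs])"

lemma slid_rows_based:
  "slid_rows b cls (slid_tokens z p) cs =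
    concat (map (%(q, cl). clause_rows b (slid_tokens z (p + q)) cl) (based_clauses cls cs))"
proof (induction cs arbitrary: p)
  case Nil
  then show ?case by (simp add: based_clauses_def)
next
  case (Cons c cs)
  have "based_clauses cls (c # cs) = map (Pair 0) (cls c) @ map (%(q, cl). (Suc q, cl)) (based_clauses cls cs)"
  proof -
    have "[0..<length (c # cs)] = 0 # map Suc [0..<length cs]" by (simp only: length_Cons upt_conv_Cons map_Suc_upt zero_less_Suc)
    then show ?thesis by (simp add: based_clauses_def map_concat o_def)
  qed
  moreover have "1 # butlast (slid_tokens z p) = slid_tokens z (Suc p)" by (simp add: slid_tokens_def)
  ultimately show ?case using Cons[of "Suc p"] by (simp add: o_def split_def)
qed

definition lit_of :: "nat => nat list => (nat \<times> (nat \<times> nat) list) list => nat => nat => bool" where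
  "lit_of b z ls c m = (case ls ! c of (p, cl) => (slid_tokens z p ! (m div (2 * b)), m mod (2 * b)) \<in> set cl)"

text \<open>Connects the streamed drawing, which sees one token word at a time, with the tiles that
  \<open>layout\<close> assigns to the whole formula.\<close>

lemma picture_layout:
  fixes cls :: "nat => (nat \<times> nat) list list" and cs :: "nat list"
  assumes z: "z ~= []" and b: "b > 0"
  defines "ls \<equiv> based_clauses cls cs"
  shows "picture_word b cls z cs = grid_picture (26 * (length z * b) + 2) (12 * length ls + 2) (layout (length z * b) (lit_of b z ls))"
proof -
  let ?n = "length z * b"
  let ?g = "layout ?n (lit_of b z ls)"
  let ?w = "26 * ?n + 2"
  have w: "?w = 26 * b * length z + 2" by simp
  have last: "Suc (26 * b * length z) = Suc (26 * ?n)" by simp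
  have cell: "Suc (26 * b * q + i) ~= Suc (26 * ?n)" if "q < length z" "i < 26 * b" for q i
  proof -
    have "26 * b * q + i < 26 * b * Suc q" using that by simp
    also have "\<dots> <= 26 * b * length z" using that by (intro mult_le_mono) auto
    finally have "26 * b * q + i < 26 * b * length z" .
    moreover have "26 * b * length z = 26 * (length z * b)" by simp
    ultimately show ?thesis by linarith
  qed
  have dm: "(26 * b * q + i) div 13 = 2 * b * q + i div 13" "(26 * b * q + i) mod 13 = i mod 13" for q i
  proof -
    have e: "26 * b * q + i = i + 13 * (2 * b * q)" by simp
    show "(26 * b * q + i) div 13 = 2 * b * q + i div 13" unfolding e by (subst div_mult_self2) simp_all
    show "(26 * b * q + i) mod 13 = i mod 13" unfolding e by (subst mod_mult_self2) simp
  qed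
  have s0: "concat (map (strip_line (26 * b) Block (%_ _. Block) z) [0..<20]) = strip ?w (%i. ?g i 0)"
    unfolding w by (rule strip_cells) (simp_all add: layout_def)
  have s1: "concat (map (strip_line (26 * b) Block (%_ i. choice_tile (even (i div 13)) (i mod 13)) z) [0..<20]) = strip ?w (%i. ?g i 1)"
    unfolding w
  proof (rule strip_cells)
    fix q i assume "q < length z" "i < 26 * b"
    then show "?g (Suc (26 * b * q + i)) 1 = choice_tile (even (i div 13)) (i mod 13)"
      using cell[of q i] by (simp only: layout_def dm diff_Suc_1) simp
  qed (simp_all add: layout_def)
  have s2: "concat (map (strip_line (26 * b) (if y = 1 then Need else Block)
     (%t i. macro_tile ((t, i div 13) \<in> set cl) (i mod 13) y) (slid_tokens z p)) [0..<20]) = strip ?w (%i. ?g i (2 + (12 * c + y)))"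
    if c: "c < length ls" "ls ! c = (p, cl)" and y: "y < 12" for c p cl y
  proof -
    have lz: "length (slid_tokens z p) = length z" using length_slid[OF z] by blast
    have yy: "(2 + (12 * c + y) - 2) mod 12 = y" "(2 + (12 * c + y) - 2) div 12 = c" using y by simp_all
    have "concat (map (strip_line (26 * b) (if y = 1 then Need else Block)
       (%t i. macro_tile ((t, i div 13) \<in> set cl) (i mod 13) y) (slid_tokens z p)) [0..<20]) =
       strip (26 * b * length (slid_tokens z p) + 2) (%i. ?g i (2 + (12 * c + y)))"
    proof (rule strip_cells)
      show "?g (Suc (26 * b * length (slid_tokens z p))) (2 + (12 * c + y)) = (if y = 1 then Need else Block)"
        unfolding lz layout_def yy by simp
      fix q i assume qi: "q < length (slid_tokens z p)" "i < 26 * b"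
      have "i div 13 < 2 * b" using qi by (simp add: less_mult_imp_div_less)
      then have "(2 * b * q + i div 13) div (2 * b) = q" "(2 * b * q + i div 13) mod (2 * b) = i div 13" using b by simp_all
      then show "?g (Suc (26 * b * q + i)) (2 + (12 * c + y)) = macro_tile ((slid_tokens z p ! q, i div 13) \<in> set cl) (i mod 13) y"
        using cell[of q i] qi lz c(2) by (simp only: layout_def yy dm diff_Suc_1 lit_of_def) simp
    qed (simp add: layout_def)
    then show ?thesis unfolding w lz .
  qed
  have rows: "clause_rows b (slid_tokens z p) cl = concat (map (%y. strip ?w (%i. ?g i (2 + (12 * c + y)))) [0..<12])"
    if "c < length ls" "ls ! c = (p, cl)" for c p cl
    unfolding clause_rows_def by (intro arg_cong[of _ _ concat] map_cong refl s2 that) simp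
  have "slid_rows b cls z cs = concat (map (%(q, cl). clause_rows b (slid_tokens z q) cl) ls)"
    using slid_rows_based[of b cls z 0 cs] by (simp add: slid_tokens_def ls_def)
  also have "\<dots> = concat (map (%c. case ls ! c of (q, cl) => clause_rows b (slid_tokens z q) cl) [0..<length ls])"
  proof -
    have "map f ls = map (%c. f (ls ! c)) [0..<length ls]" for f :: "_ => nat list" by (rule nth_equalityI) auto
    then show ?thesis by (simp only:)
  qed
  also have "\<dots> = concat (map (%c. concat (map (%y. strip ?w (%i. ?g i (2 + (12 * c + y)))) [0..<12])) [0..<length ls])"
  proof (intro arg_cong[of _ _ concat] map_cong refl)
    fix c assume "c \<in> set [0..<length ls]"
    then have c: "c < length ls" by simp
    obtain p cl where pc: "ls ! c = (p, cl)" by (cases "ls ! c")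
    show "(case ls ! c of (q, cl) => clause_rows b (slid_tokens z q) cl) = concat (map (%y. strip ?w (%i. ?g i (2 + (12 * c + y)))) [0..<12])"
      unfolding pc prod.case by (rule rows[OF c pc])
  qed
  also have "\<dots> = concat (map (%j. strip ?w (%i. ?g i (2 + j))) [0..<12 * length ls])"
    unfolding upt_blocks[symmetric] by (simp add: concat_map_concat o_def)
  finally have s3: "slid_rows b cls z cs = concat (map (%j. strip ?w (%i. ?g i (2 + j))) [0..<12 * length ls])" .
  have "[0..<12 * length ls + 2] = 0 # 1 # map ((+) 2) [0..<12 * length ls]" by (rule upt_two)
  then have "grid_picture ?w (12 * length ls + 2) ?g = 5 # replicate (20 * ?w) 2 @ [3] @ strip ?w (%i. ?g i 0) @ strip ?w (%i. ?g i 1) @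
      concat (map (%j. strip ?w (%i. ?g i (2 + j))) [0..<12 * length ls])"
    by (simp only: grid_picture_def list.map concat.simps map_map o_def append_Cons append_assoc)
  moreover have "replicate (20 * ?w) (2::nat) = replicate (520 * b * length z) 2 @ replicate 40 2"
  proof -
    have "20 * ?w = 520 * b * length z + 40" by simp
    then show ?thesis by (simp only: replicate_add)
  qed
  ultimately show ?thesis unfolding picture_word_def s0 s1 s3 by (simp only: append_assoc append_Cons)
qed

section \<open>The formula of a machine\<close>

context tableau
begin

abbreviation "width \<equiv> length vars"

definition index :: "var => nat" where
  "index v = (SOME i. i < width & vars ! i = v)"

lemma index: "v \<in> set vars ==> index v < width & vars ! index v = v"
  unfolding index_def by (rule someI_ex) (auto simp: in_set_conv_nth)

lemma set_vars: "set vars = {Sym j s | j s. j < K & s < g} \<union> {Doing q ss | q ss. (q, ss) \<in> set actions} \<union> {State q | q. q <= m}"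
proof -
  have 1: "set [Sym j s. j \<leftarrow> [0..<K], s \<leftarrow> [0..<g]] = {Sym j s | j s. j < K & s < g}" by auto
  have 2: "set (map (%(q, ss). Doing q ss) actions) = {Doing q ss | q ss. (q, ss) \<in> set actions}" by force
  have 3: "set (map State [0..<Suc m]) = {State q | q. q <= m}" by (auto simp: less_Suc_eq_le simp del: upt_Suc)
  show ?thesis unfolding vars_def set_append 1 2 3 Un_assoc ..
qed

lemma width_pos: "width > 0"
proof -
  have "State 0 \<in> set vars" unfolding set_vars by blast
  then show ?thesis by (rule length_pos_if_in_set)
qed

definition lits_ok :: "literal list list => bool" where
  "lits_ok cls \<longleftrightarrow> (\<forall>cl \<in> set cls. \<forall>(k, v, b) \<in> set cl. 1 <= k & k <= 6 & v \<in> set vars)"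

lemma lits_ok_append: "lits_ok (xs @ ys) \<longleftrightarrow> lits_ok xs & lits_ok ys" "lits_ok (cl # xs) \<longleftrightarrow> lits_ok [cl] & lits_ok xs"
  by (auto simp: lits_ok_def)

lemma actions_ok:
  assumes "(q, ss) \<in> set actions"
  shows "fst (nxt q ss) <= m" "j < K ==> fst (act q ss j) < g" "j < K ==> ss ! j < g" "q <= m" "length ss = K"
proof -
  have a: "q <= m" "length ss = K" "set ss \<subseteq> {..<g}" using assms by (simp_all add: set_actions)
  note n = nxt[OF a]
  show "fst (nxt q ss) <= m" "q <= m" "length ss = K" using n a by auto
  show "fst (act q ss j) < g" if "j < K"
  proof -
    have "act q ss j \<in> set (snd (nxt q ss))" unfolding act_def using n that by (intro nth_mem) simp
    then show ?thesis using n by blast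
  qed
  show "ss ! j < g" if "j < K"
  proof -
    have "ss ! j \<in> set ss" using a that by (intro nth_mem) simp
    then show ?thesis using a by blast
  qed
qed

lemma target_pos: "Suc 0 <= target mv"
  by (cases mv) simp_all

lemma lits_ok_action:
  assumes "a \<in> set actions"
  shows "lits_ok (spread a)" "lits_ok (copy a)" "lits_ok (update a)" "lits_ok (fire a)"
proof -
  obtain q ss where a: "a = (q, ss)" by (cases a)
  note ok = actions_ok[OF assms[unfolded a]]
  show "lits_ok (spread a)" "lits_ok (copy a)" "lits_ok (update a)" "lits_ok (fire a)"
    using ok assms by (auto simp: a lits_ok_def spread_def copy_def update_def fire_def set_vars target_pos)
qed

lemma lits_ok_concat: "(\<And>a. a \<in> set xs ==> lits_ok (f a)) ==> lits_ok (concat (map f xs))"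
  by (auto simp: lits_ok_def)

lemma lits_ok_parts: "lits_ok mid" "lits_ok center" "lits_ok final" "lits_ok blank_others" "lits_ok centre_others" "lits_ok guess"
  "s < g ==> lits_ok [[(2, Sym 0 s, True)]]"
proof -
  show "lits_ok mid" unfolding mid_def by (rule lits_ok_concat) (simp add: lits_ok_append(1) lits_ok_action)
  show "lits_ok center" unfolding center_def by (rule lits_ok_concat) (simp add: lits_ok_append(1) lits_ok_action)
qed (use K g in \<open>auto simp: lits_ok_def final_def blank_others_def centre_others_def guess_def set_vars\<close>)

lemma lits_ok_clauses: "lits_ok (clauses c)"
proof -
  have e: "lits_ok []" by (simp add: lits_ok_def)
  have s: "lits_ok [[(2, Sym 0 0, True)]]" "lits_ok [[(2, Sym 0 1, True)]]" "lits_ok [[(2, Sym 0 2, True)]]" using lits_ok_parts(7) g by simp_all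
  note c = lits_ok_append(2)[of _ "blank_others @ mid"] lits_ok_append(2)[of _ "centre_others @ center"]
  show ?thesis unfolding clauses_def using e s lits_ok_parts by (simp add: c lits_ok_append(1))
qed

text \<open>Tokens are places raised by one, since the letter 1 stands for all other cells; even numbers are
  positive literals.\<close>

definition coded :: "nat => (nat \<times> nat) list list" where
  "coded c = map (map (%(k, v, b). (Suc k, 2 * index v + (if b then 0 else 1)))) (clauses c)"

text \<open>Cells are numbered row by row, \<open>L\<close> to a row. The place 1 is the left
  neighbour and gets offset 0, so the base cell itself has offset 1.\<close>

definition offset :: "nat => nat => nat" where
  "offset L k = [0, 0, 1, 2, L, L + 1, L + 2] ! k"

text \<open>One token for each place, those of the next row at distance \<open>L\<close>. The
  \<open>N\<close> idle letters at the end leave room for the \<open>N\<close> bases.\<close>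

definition tokens :: "nat => nat => nat list" where
  "tokens L N = [2, 3, 4] @ replicate (L - 3) 1 @ [5, 6, 7] @ replicate N 1"

lemma token:
  assumes "L \<ge> 3" "p < N" "1 <= k" "k <= 6" "q < length (tokens L N)"
  shows "slid_tokens (tokens L N) p ! q = Suc k \<longleftrightarrow> q = p + offset L k"
proof -
  have z: "tokens L N ~= []" by (simp add: tokens_def)
  have k: "k \<in> {1, 2, 3, 4, 5, 6}" using assms by auto
  have t: "tokens L N ! 0 = 2" "tokens L N ! 1 = 3" "tokens L N ! 2 = 4" "\<And>i. 3 <= i ==> i < L ==> tokens L N ! i = 1"
    "tokens L N ! L = 5" "tokens L N ! (L + 1) = 6" "tokens L N ! (L + 2) = 7"
    "\<And>i. L + 3 <= i ==> i < length (tokens L N) ==> tokens L N ! i = 1"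
  proof -
    have e: "tokens L N = [2, 3, 4] @ (replicate (L - 3) 1 @ ([5, 6, 7] @ replicate N 1))" by (simp add: tokens_def)
    show "tokens L N ! 0 = 2" "tokens L N ! 1 = 3" "tokens L N ! 2 = 4" by (simp_all add: e)
    have n: "tokens L N ! (3 + (L - 3) + j) = ([5, 6, 7] @ replicate N 1) ! j" for j
      unfolding e using nth_append_length_plus[of "[2, 3, 4 :: nat] @ replicate (L - 3) 1" "[5, 6, 7] @ replicate N 1" j] by simp
    have l: "3 + (L - 3) = L" using assms(1) by simp
    show "tokens L N ! L = 5" "tokens L N ! (L + 1) = 6" "tokens L N ! (L + 2) = 7"
      using n[of 0] n[of 1] n[of 2] unfolding l by simp_all
    show "tokens L N ! i = 1" if "3 <= i" "i < L" for i
    proof -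
      have "tokens L N ! (length [2, 3, 4::nat] + (i - 3)) = (replicate (L - 3) 1 @ ([5, 6, 7] @ replicate N 1)) ! (i - 3)"
        unfolding e by (rule nth_append_length_plus)
      moreover have "length [2, 3, 4::nat] + (i - 3) = i" "i - 3 < L - 3" using that by simp_all
      ultimately show ?thesis by (simp add: nth_append)
    qed
    show "tokens L N ! i = 1" if "L + 3 <= i" "i < length (tokens L N)" for i
    proof -
      have "i - L - 3 < N" using that assms(1) by (simp add: e)
      moreover have "i = L + (3 + (i - L - 3))" using that by simp
      ultimately show ?thesis using n[of "3 + (i - L - 3)"] unfolding l by (metis One_nat_def add.commute length_Cons list.size(3) nth_append_length_plus nth_replicate numeral_3_eq_3 plus_1_eq_Suc)
    qed
  qed
  show ?thesis
  proof (cases "q < p")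
    case True
    then show ?thesis using nth_slid[OF z assms(5), of p] assms(3) by simp
  next
    case False
    define i where "i = q - p"
    have i: "i < length (tokens L N)" "q = p + i" using False assms(5) by (auto simp: i_def)
    have s: "slid_tokens (tokens L N) p ! q = tokens L N ! i" using nth_slid[OF z assms(5), of p] False by (simp add: i_def)
    have off: "offset L 1 = 0" "offset L 2 = 1" "offset L 3 = 2" "offset L 4 = L" "offset L 5 = L + 1" "offset L 6 = L + 2"
      by (simp_all add: offset_def)
    have "tokens L N ! i = Suc k \<longleftrightarrow> i = offset L k"
    proof -
      consider "i = 0" | "i = 1" | "i = 2" | "3 <= i" "i < L" | "i = L" | "i = L + 1" | "i = L + 2" | "i \<ge> L + 3" by linarith
      then obtain v where v: "tokens L N ! i = v" "v = 2 & i = 0 \<or> v = 3 & i = 1 \<or> v = 4 & i = 2 \<or> v = 1 & 3 <= i & i < L \<or>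
         v = 5 & i = L \<or> v = 6 & i = L + 1 \<or> v = 7 & i = L + 2 \<or> v = 1 & i \<ge> L + 3"
        by cases (use t i in auto)
      have "k = 1 \<or> k = 2 \<or> k = 3 \<or> k = 4 \<or> k = 5 \<or> k = 6" using k by blast
      then show ?thesis unfolding v(1) using v(2) assms(1) by (elim disjE) (simp_all only: off, linarith+)
    qed
    then show ?thesis unfolding s using i(2) by simp
  qed
qed

lemma ball_cong2: "(\<And>p c. p < (n::nat) ==> c \<in> S p ==> A p c = B p c) ==> (\<forall>p < n. \<forall>c \<in> S p. A p c) = (\<forall>p < n. \<forall>c \<in> S p. B p c)"
  by blast

lemma div_mod_block: "i < (n::nat) ==> (x * n + i) div n = x & (x * n + i) mod n = i"
  by simp

text \<open>A column number contains the cell, the index of the variable within it, and the sign in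
  its lowest bit. Undoing these divisions turns the matrix into clauses attached to bases.\<close>

lemma cnf_cells:
  assumes L: "L \<ge> 3" and N: "length cs = N"
  defines "ls \<equiv> based_clauses coded cs" and "z \<equiv> tokens L N"
  shows "cnf_sat (length z * width) (length ls) (lit_of width z ls) \<longleftrightarrow>
    (\<exists>a :: nat => bool. \<forall>p < N. \<forall>cl \<in> set (clauses (cs ! p)). \<exists>(k, v, b) \<in> set cl. a ((p + offset L k) * width + index v) = b)"
proof -
  let ?w = width
  have z: "z ~= []" "length z = N + L + 3" using L by (simp_all add: z_def tokens_def)
  have one: "(\<exists>m < 2 * (length z * ?w). (slid_tokens z p ! (m div (2 * ?w)), m mod (2 * ?w)) \<in> set (map (%(k, v, b). (Suc k, 2 * index v + (if b then 0 else 1))) cl) & a (m div 2) = even m)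
     \<longleftrightarrow> (\<exists>(k, v, b) \<in> set cl. a ((p + offset L k) * ?w + index v) = b)" (is "?l \<longleftrightarrow> ?r")
    if p: "p < N" and cl: "cl \<in> set (clauses c)" for p c cl and a :: "nat => bool"
  proof
    assume ?l
    then obtain m' k v b where m': "m' < 2 * (length z * ?w)" "(k, v, b) \<in> set cl" "slid_tokens z p ! (m' div (2 * ?w)) = Suc k"
      "m' mod (2 * ?w) = 2 * index v + (if b then 0 else 1)" "a (m' div 2) = even m'" by auto
    define q where "q = m' div (2 * ?w)"
    have kv: "1 <= k" "k <= 6" using lits_ok_clauses[of c] cl m'(2) unfolding lits_ok_def by blast+
    have q: "q < length z" unfolding q_def using m'(1) width_pos by (simp add: less_mult_imp_div_less mult.commute mult.left_commute)
    have "q = p + offset L k" using token[OF L p kv] q m'(3) unfolding q_def z_def by blast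
    moreover have me: "m' = 2 * (q * ?w) + (2 * index v + (if b then 0 else 1))"
      unfolding q_def using m'(4) mult_div_mod_eq[of "2 * ?w" m'] by (simp add: mult.assoc mult.commute)
    then have "m' div 2 = q * ?w + index v" "even m' = b" by auto
    ultimately show ?r using m'(2,5) by auto
  next
    assume ?r
    then obtain k v b where kvb: "(k, v, b) \<in> set cl" "a ((p + offset L k) * ?w + index v) = b" by auto
    have kv: "1 <= k" "k <= 6" "v \<in> set vars" using lits_ok_clauses[of c] cl kvb(1) unfolding lits_ok_def by blast+
    define q where "q = p + offset L k"
    have "k \<in> {1, 2, 3, 4, 5, 6}" using kv by auto
    then have "offset L k <= L + 2" using L by (auto simp: offset_def)
    then have q: "q < length z" using p by (simp add: q_def z)
    define m' where "m' = 2 * ?w * q + (2 * index v + (if b then 0 else 1))"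
    have i: "2 * index v + (if b then 0 else 1) < 2 * ?w" using index[OF kv(3)] by auto
    have d: "m' div (2 * ?w) = q" "m' mod (2 * ?w) = 2 * index v + (if b then 0 else 1)"
      unfolding m'_def using i by (simp_all only: div_mult_self4 mod_mult_self4 div_less mod_less)
    have "m' < 2 * ?w * Suc q" unfolding m'_def using i by simp
    also have "\<dots> <= 2 * ?w * length z" using q by (intro mult_le_mono) auto
    finally have "m' < 2 * (length z * ?w)" by (simp add: mult.commute mult.left_commute)
    moreover have "slid_tokens z p ! q = Suc k" using token[OF L p kv(1,2)] q unfolding q_def z_def by blast
    moreover have "m' div 2 = q * ?w + index v" "even m' = b" unfolding m'_def by (auto simp: mult.assoc mult.commute)
    moreover have "(Suc k, 2 * index v + (if b then 0 else 1)) \<in> set (map (%(k, v, b). (Suc k, 2 * index v + (if b then 0 else 1))) cl)"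
      using kvb(1) by force
    ultimately show ?l using d kvb(2) unfolding q_def by (intro exI[of _ m']) simp
  qed
  have ls: "set ls = {(p, map (%(k, v, b). (Suc k, 2 * index v + (if b then 0 else 1))) cl) | p cl. p < N & cl \<in> set (clauses (cs ! p))}"
    unfolding ls_def based_clauses_def coded_def using N by auto
  have lo: "lit_of ?w z ls c m \<longleftrightarrow> (slid_tokens z (fst (ls ! c)) ! (m div (2 * ?w)), m mod (2 * ?w)) \<in> set (snd (ls ! c))" for c m
    by (simp add: lit_of_def split_def)
  define Q where "Q = (%(a :: nat => bool) x. \<exists>m < 2 * (length z * ?w). (slid_tokens z (fst x) ! (m div (2 * ?w)), m mod (2 * ?w)) \<in> set (snd x) & a (m div 2) = even m)"
  have "(\<forall>c < length ls. \<exists>m < 2 * (length z * ?w). lit_of ?w z ls c m & a (m div 2) = even m) \<longleftrightarrow>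
    (\<forall>p < N. \<forall>cl \<in> set (clauses (cs ! p)). \<exists>(k, v, b) \<in> set cl. a ((p + offset L k) * ?w + index v) = b)" for a
  proof -
    have "(\<forall>c < length ls. \<exists>m < 2 * (length z * ?w). lit_of ?w z ls c m & a (m div 2) = even m) \<longleftrightarrow> (\<forall>x \<in> set ls. Q a x)"
      unfolding lo Q_def all_set_conv_all_nth ..
    also have "\<dots> \<longleftrightarrow> (\<forall>p < N. \<forall>cl \<in> set (clauses (cs ! p)). Q a (p, map (%(k, v, b). (Suc k, 2 * index v + (if b then 0 else 1))) cl))"
      unfolding ls by blast
    also have "\<dots> \<longleftrightarrow> (\<forall>p < N. \<forall>cl \<in> set (clauses (cs ! p)). \<exists>(k, v, b) \<in> set cl. a ((p + offset L k) * ?w + index v) = b)"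
      by (rule ball_cong2) (unfold Q_def fst_conv snd_conv, rule one)
    finally show ?thesis .
  qed
  then show ?thesis unfolding cnf_sat_def by simp
qed

text \<open>Row \<open>t\<close> of the computation, for a window of radius \<open>U\<close> around the heads on the left; the two
  last bases of a row are idle.\<close>

definition row :: "bool list => nat => nat => nat => nat => nat list" where
  "row w P U T t = map (%i. category w P T t (int i - int U)) [0..<2 * U + length w + P + 1] @ [1, 1]"

text \<open>The clauses of a row touch one more cell on either side than there are bases. With the
  two idle bases the row length \<open>L\<close> is the number of these cells, so that neighbouring
  rows do not share cells.\<close>

lemma formula_correct:
  fixes P :: nat
  assumes w: "w ~= []" and T: "T > 0" and U: "U \<ge> 2 * T"
  defines "L \<equiv> 2 * U + length w + P + 3"
  defines "cs \<equiv> concat (map (row w P U T) [0..<Suc T])"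
  defines "ls \<equiv> based_clauses coded cs" and "z \<equiv> tokens L (length cs)"
  shows "cnf_sat (length z * width) (length ls) (lit_of width z ls) \<longleftrightarrow>
    (\<exists>u. length u <= P & fst (snd (conf (w @ u) T) ! 0) 0 = 2)"
proof -
  have rl: "length (row w P U T t) = L" for t by (simp add: row_def L_def)
  have L3: "L \<ge> 3" by (simp add: L_def)
  have len: "length (concat (map (row w P U T) [0..<n])) = L * n" for n by (induction n) (simp_all add: rl)
  have nth: "concat (map (row w P U T) [0..<n]) ! (t * L + d) = row w P U T t ! d" if "t < n" "d < L" for t d n
    using that(1)
  proof (induction n)
    case (Suc n)
    show ?case
    proof (cases "t < n")
      case True
      have "t * L + d < Suc t * L" using that by simp
      also have "\<dots> <= n * L" using True by (intro mult_le_mono) auto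
      finally show ?thesis using Suc True by (simp add: nth_append len mult.commute)
    next
      case False
      then have "t = n" using Suc by simp
      then show ?thesis by (simp add: nth_append len mult.commute)
    qed
  qed simp
  have N: "length cs = Suc T * L" unfolding cs_def len by simp
  have rowd: "row w P U T t ! d = (if d < 2 * U + length w + P + 1 then category w P T t (int d - int U) else 1)" if "d < L" for t d
    using that by (cases "d < 2 * U + length w + P + 1") (auto simp: row_def nth_append L_def nth_Cons' simp del: upt_Suc)
  have idle: "clauses 1 = []" by (simp add: clauses_def)
  note eq = cnf_cells[OF L3 refl, of cs, folded ls_def z_def]
  have off: "(t * L + d) + offset L k = (t + delay k) * L + nat (int d - int U + shift k + int U + 1)" if "1 <= k" "k <= 6" for t d k
  proof -
    have "k \<in> {1, 2, 3, 4, 5, 6}" using that by auto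
    then show ?thesis by (auto simp: offset_def delay_def shift_def nat_add_distrib)
  qed
  show ?thesis unfolding eq
  proof
    assume "\<exists>a. \<forall>p < length cs. \<forall>cl \<in> set (clauses (cs ! p)). \<exists>(k, v, b) \<in> set cl. a ((p + offset L k) * width + index v) = b"
    then obtain a where a: "\<And>p cl. p < length cs ==> cl \<in> set (clauses (cs ! p)) ==> \<exists>(k, v, b) \<in> set cl. a ((p + offset L k) * width + index v) = b"
      by blast
    \<comment> \<open>Cell 0 of a row is the left neighbour of the first base, whence the summand
      1.\<close>
    define F where "F = (%t d v. a ((t * L + nat (d + int U + 1)) * width + index v))"
    obtain u where "length u <= P" "fst (snd (conf (w @ u) T) ! 0) 0 = 2"
    proof (rule assignment_accepts[OF w T U, of P "length w + P + U" F])
      fix t d cl assume t: "t <= T" and d: "- int U <= d" "d <= int (length w + P + U)" and cl: "cl \<in> set (clauses (category w P T t d))"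
      define e where "e = nat (d + int U)"
      have e: "d = int e - int U" "e < 2 * U + length w + P + 1" using d by (auto simp: e_def)
      have eL: "e < L" using e by (simp add: L_def)
      have "t * L + e < Suc t * L" using eL by simp
      also have "\<dots> <= Suc T * L" using t by (intro mult_le_mono) auto
      finally have p: "t * L + e < length cs" by (simp add: N)
      have "cs ! (t * L + e) = category w P T t d" unfolding cs_def using nth[of t "Suc T" e] t eL rowd[OF eL, of t] e by simp
      then obtain k v b where kvb: "(k, v, b) \<in> set cl" "a ((t * L + e + offset L k) * width + index v) = b"
        using a[OF p, of cl] cl by auto
      have "1 <= k" "k <= 6" using lits_ok_clauses cl kvb(1) unfolding lits_ok_def by blast+
      from off[OF this, of t e] kvb show "holds_at F t d cl" unfolding holds_at_def F_def e(1) by force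
    qed simp
    then show "\<exists>u. length u <= P & fst (snd (conf (w @ u) T) ! 0) 0 = 2" by blast
  next
    assume "\<exists>u. length u <= P & fst (snd (conf (w @ u) T) ! 0) 0 = 2"
    then obtain u where u: "length u <= P" "fst (snd (conf (w @ u) T) ! 0) 0 = 2" by blast
    define a where "a = (%i. fact (w @ u) (i div width div L) (int (i div width mod L) - int U - 1) (vars ! (i mod width)))"
    have L0: "L > 0" by (simp add: L_def)
    have a: "a ((t * L + e) * width + index v) = fact (w @ u) t (int e - int U - 1) v" if "e < L" "v \<in> set vars" for t e v
    proof -
      have "((t * L + e) * width + index v) div width = t * L + e" "((t * L + e) * width + index v) mod width = index v"
        using div_mod_block[of "index v" width "t * L + e"] index[OF that(2)] by blast+
      moreover have "(t * L + e) div L = t" "(t * L + e) mod L = e" using that(1) by simp_all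
      ultimately show ?thesis using index[OF that(2)] by (simp add: a_def)
    qed
    show "\<exists>a. \<forall>p < length cs. \<forall>cl \<in> set (clauses (cs ! p)). \<exists>(k, v, b) \<in> set cl. a ((p + offset L k) * width + index v) = b"
    proof (intro exI[of _ a] allI impI ballI)
      fix p cl assume p: "p < length cs" and cl: "cl \<in> set (clauses (cs ! p))"
      define t e where "t = p div L" and "e = p mod L"
      have pe: "p = t * L + e" "e < L" using L0 by (simp_all add: t_def e_def)
      have "t < Suc T" unfolding t_def using p L0 by (simp add: N less_mult_imp_div_less)
      then have csp: "cs ! p = row w P U T t ! e" unfolding cs_def pe(1) using nth pe(2) by blast
      then have eb: "e < 2 * U + length w + P + 1" and cat: "cs ! p = category w P T t (int e - int U)"
        using rowd[OF pe(2), of t] cl idle by (auto split: if_splits)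
      obtain k v b where kvb: "(k, v, b) \<in> set cl" "fact (w @ u) (t + delay k) (int e - int U + shift k) v = b"
        using facts_hold[OF w u T, of t cl "int e - int U"] cl \<open>t < Suc T\<close> unfolding cat holds_at_def by auto
      have kv: "1 <= k" "k <= 6" "v \<in> set vars" using lits_ok_clauses cl kvb(1) unfolding lits_ok_def by blast+
      define e' where "e' = nat (int e - int U + shift k + int U + 1)"
      have "- 1 <= shift k" "shift k <= 1" by (auto simp: shift_def)
      then have e': "e' < L" "int e' - int U - 1 = int e - int U + shift k" using eb by (auto simp: e'_def L_def)
      have "p + offset L k = (t + delay k) * L + e'" using off[OF kv(1,2), of t e] by (simp add: pe(1) e'_def)
      then have "a ((p + offset L k) * width + index v) = b" using a[OF e'(1) kv(3), of "t + delay k"] kvb(2) e'(2) by simp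
      then show "\<exists>(k, v, b) \<in> set cl. a ((p + offset L k) * width + index v) = b" by (intro bexI[OF _ kvb(1)]) simp
    qed
  qed
qed

end

section \<open>Writing the formula\<close>

fun horner :: "nat list => nat => nat" where
  "horner [] n = 0"
| "horner (a # as) n = a + n * horner as n"

lemma horner_poly: "\<exists>as. \<forall>n. poly p n = horner as n" for p :: "nat poly"
proof (induction p)
  case (pCons a p)
  then obtain as where "\<forall>n. poly p n = horner as n" by blast
  then show ?case by (intro exI[of _ "a # as"]) simp
qed (auto intro: exI[of _ "[]"])

text \<open>Register 8 holds the input word; its length is the argument of the polynomial, whose value is
  written in unary to register \<open>r\<close>. The registers after \<open>r\<close> hold the intermediate values.\<close>

fun horner_prog :: "nat => nat list => prog" where
  "horner_prog r [] = Skip"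
| "horner_prog r (a # as) = horner_prog (Suc r) as ;; For 8 (%_. For (Suc r) (%_. push_all r [1])) ;; push_all r (replicate a 1)"

definition repeat :: "nat => nat list => nat list" where
  "repeat n xs = concat (replicate n xs)"

lemma repeat [simp]: "repeat 0 xs = []" "repeat (Suc n) xs = xs @ repeat n xs"
  by (simp_all add: repeat_def)

lemma repeat_single: "repeat n [a] = replicate n a" "repeat n [a, a] = replicate (2 * n) a"
  by (induction n) simp_all

lemma sem_For_push: "q ~= r ==> sem (For r (%_. push_all q xs)) s = s(q := rev (repeat (length (s r)) xs) @ s q)"
proof -
  have "fold (%_. sem (push_all q xs)) ws s = s(q := rev (repeat (length ws) xs) @ s q)" for ws :: "nat list" and s
  proof (induction ws arbitrary: s)
    case (Cons w ws)
    have one: "sem (push_all q xs) s = s(q := rev xs @ s q)" by simp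
    show ?case unfolding fold_simps one Cons by (simp add: fun_eq_iff)
  qed simp
  from this[of "s r" s] show ?thesis by simp
qed

lemma sem_horner:
  assumes "r > 8" "\<And>x. x \<ge> r ==> s x = []"
  shows "sem (horner_prog r as) s r = replicate (horner as (length (s 8))) 1 &
    (\<forall>x. x < r \<or> x > r + length as --> sem (horner_prog r as) s x = s x)"
  using assms
proof (induction as arbitrary: r)
  case (Cons a as)
  let ?t = "sem (horner_prog (Suc r) as) s"
  have t: "?t (Suc r) = replicate (horner as (length (s 8))) 1" "\<And>x. x < Suc r \<or> x > Suc r + length as ==> ?t x = s x"
    using Cons.IH[of "Suc r"] Cons.prems by auto
  have l: "fold (%_. sem (For (Suc r) (%_. push_all r [1]))) ws t = t(r := replicate (length ws * length (t (Suc r))) 1 @ t r)" for ws :: "nat list" and t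
  proof (induction ws arbitrary: t)
    case (Cons w ws)
    have one: "sem (For (Suc r) (%_. push_all r [1])) t = t(r := replicate (length (t (Suc r))) 1 @ t r)"
      by (subst sem_For_push) (simp_all add: repeat_single)
    have "replicate (length ws * n) 1 @ replicate n 1 @ y = replicate (length (w # ws) * n) 1 @ y" for n and y :: "nat list"
      by (simp add: add.commute flip: append_assoc replicate_add)
    then show ?case unfolding fold_simps one Cons by (simp add: fun_eq_iff)
  qed simp
  have t8: "?t 8 = s 8" "?t r = []" using t(2)[of 8] t(2)[of r] Cons.prems by auto
  have "sem (horner_prog r (a # as)) s = ?t(r := replicate a 1 @ replicate (length (s 8) * horner as (length (s 8))) 1)"
    unfolding horner_prog.simps sem.simps(5) sem.simps(6)[of 8] l t(1) t8 by (simp add: fun_eq_iff)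
  then show ?case using t(2) by (simp add: replicate_add)
qed auto

text \<open>The input is in register 8, 16 and \<open>rt\<close> contain the length of the certificate and the number
  of steps, \<open>ru\<close> the radius. Register 9 receives the categories of all bases.\<close>

definition write_bit :: "nat => prog" where
  "write_bit a = Case 14 (%f. if f = 1 then push_all 9 [if a = 2 then 9 else 8] ;; Pop 14 else push_all 9 [if a = 2 then 7 else 6])"

text \<open>The doubled bits and the mark 01 spell \<open>pair_words x []\<close>. Register 14 flags
  its first bit, which lies under the head and needs another category.\<close>

definition first_row :: "nat => prog" where
  "first_row ru = For ru (%_. push_all 9 [5]) ;; Push 14 1 ;; For 8 (%a. write_bit a ;; push_all 9 [if a = 2 then 7 else 6]) ;;
     write_bit 1 ;; push_all 9 [7] ;; For 16 (%_. push_all 9 [10]) ;; For ru (%_. push_all 9 [5]) ;; push_all 9 [5, 1, 1]"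

definition later_row :: "nat => nat => nat => prog" where
  "later_row ru a b = For ru (%_. push_all 9 [a]) ;; push_all 9 [b] ;; For 8 (%_. push_all 9 [a, a]) ;; push_all 9 [a] ;;
     For 16 (%_. push_all 9 [a]) ;; For ru (%_. push_all 9 [a]) ;; push_all 9 [a, 1, 1]"

definition first_word :: "bool list => nat => nat => nat list" where
  "first_word w P U = replicate U 5 @ (if hd w then 9 else 8) # map (%b. if b then 7 else 6) (tl w) @ replicate P 10 @ replicate U 5 @ [5, 1, 1]"

definition later_word :: "nat => nat => nat => nat => nat => nat list" where
  "later_word n P U a b = replicate U a @ [b] @ replicate (2 * n) a @ [a] @ replicate P a @ replicate U a @ [a, 1, 1]"

definition rows_store :: "store => nat list => store" where
  "rows_store s out = s(9 := rev out, 14 := [])"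

lemma rows_push: "sem (push_all 9 xs) (rows_store s out) = rows_store s (out @ xs)"
  by (simp add: rows_store_def fun_eq_iff)

lemma rows_For: "r \<notin> {9, 14} ==> sem (For r (%_. push_all 9 xs)) (rows_store s out) = rows_store s (out @ repeat (length (s r)) xs)"
  by (subst sem_For_push) (simp_all add: rows_store_def fun_eq_iff)

lemma sem_later_row:
  assumes "ru > 16"
  shows "sem (later_row ru a b) (rows_store s out) = rows_store s (out @ later_word (length (s 8)) (length (s 16)) (length (s ru)) a b)"
  using assms by (simp add: later_row_def rows_push rows_For later_word_def repeat_single del: sem_push_all sem.simps(6))

lemma sem_first_row:
  assumes "ru > 16" and x: "s 8 = map bit_letter x"
  shows "sem (first_row ru) (rows_store s out) = rows_store s (out @ first_word (pair_words x []) (length (s 16)) (length (s ru)))"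
proof -
  let ?c = "%b. if b then 7 else (6::nat)"
  define R where "R = (%out. (rows_store s out)(14 := [1]))"
  have p: "sem (Push 14 1) (rows_store s out) = R out" for out by (simp add: R_def rows_store_def fun_eq_iff)
  have wf: "sem (write_bit (bit_letter b)) (R out) = rows_store s (out @ [if b then 9 else 8])" for b out
    by (simp add: write_bit_def R_def rows_store_def fun_eq_iff)
  have w: "sem (write_bit (bit_letter b)) (rows_store s out) = rows_store s (out @ [?c b])" for b out
    by (simp add: write_bit_def rows_store_def fun_eq_iff)
  have w1: "write_bit 1 = write_bit (bit_letter False)" by simp
  have q: "push_all 9 [if bit_letter b = 2 then 7 else 6] = push_all 9 [?c b]" for b by simp
  have loop: "fold (%a. sem (write_bit a ;; push_all 9 [if a = 2 then 7 else 6])) (map bit_letter x) (rows_store s out) =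
    rows_store s (out @ map ?c (concat (map (%b. [b, b]) x)))" for x out
  proof (induction x arbitrary: out)
    case (Cons b x)
    have step: "sem (write_bit (bit_letter b) ;; push_all 9 [if bit_letter b = 2 then 7 else 6]) (rows_store s out) = rows_store s ((out @ [?c b]) @ [?c b])"
      by (simp only: sem.simps(5) w q rows_push)
    show ?case unfolding list.map fold_simps step Cons by simp
  qed simp
  have s8: "R out 8 = map bit_letter x" "rows_store s out 8 = map bit_letter x" for out using x by (simp_all add: R_def rows_store_def)
  have "sem (write_bit 1) (sem (For 8 (%a. write_bit a ;; push_all 9 [if a = 2 then 7 else 6])) (R out)) =
    rows_store s (out @ (if hd (pair_words x []) then 9 else 8) # map ?c (tl (concat (map (%b. [b, b]) x) @ [False])))" for out
  proof (cases x)
    case Nil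
    \<comment> \<open>For empty input the first bit of the word is the first bit of the
      mark.\<close>
    have "sem (write_bit 1) (R out) = rows_store s (out @ [8])" using wf[of False out] by simp
    then show ?thesis unfolding sem.simps(6) s8 unfolding Nil by (simp add: pair_words_def)
  next
    case (Cons b y)
    have step: "sem (write_bit (bit_letter b) ;; push_all 9 [if bit_letter b = 2 then 7 else 6]) (R out) = rows_store s ((out @ [if b then 9 else 8]) @ [?c b])"
      by (simp only: sem.simps(5) wf q rows_push)
    show ?thesis unfolding sem.simps(6) s8 unfolding Cons list.map fold_simps step loop w1 w
      by (simp add: pair_words_def)
  qed
  note main = this
  have f: "sem (For ru (%_. push_all 9 xs)) (rows_store s out) = rows_store s (out @ repeat (length (s ru)) xs)"
    "sem (For 16 (%_. push_all 9 xs)) (rows_store s out) = rows_store s (out @ repeat (length (s 16)) xs)" for xs out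
    by (rule rows_For; use assms(1) in simp)+
  have tl: "tl (y @ [False, True]) = tl (y @ [False]) @ [True]" for y by (cases y) simp_all
  show ?thesis unfolding first_row_def sem.simps(5) f p main rows_push
    by (simp add: tl first_word_def repeat_single pair_words_def)
qed

definition all_rows :: "nat => nat => prog" where
  "all_rows rt ru = first_row ru ;; For rt (%_. later_row ru 2 3) ;; later_row ru 4 4"

lemma sem_all_rows:
  assumes "ru > 16" "rt > 16" and x: "s 8 = map bit_letter x" and s: "s 9 = []" "s 14 = []"
  shows "sem (all_rows rt ru) s = rows_store s (first_word (pair_words x []) (length (s 16)) (length (s ru)) @
    repeat (length (s rt)) (later_word (length x) (length (s 16)) (length (s ru)) 2 3) @
    later_word (length x) (length (s 16)) (length (s ru)) 4 4)"
proof -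
  have s0: "s = rows_store s []" using s by (simp add: rows_store_def fun_eq_iff)
  have l: "fold (%_. sem (later_row ru 2 3)) ws (rows_store s out) =
    rows_store s (out @ repeat (length ws) (later_word (length (s 8)) (length (s 16)) (length (s ru)) 2 3))" for ws :: "nat list" and out
    by (induction ws arbitrary: out) (simp_all add: sem_later_row[OF assms(1)])
  have srt: "rows_store s out rt = s rt" for out using assms(2) by (simp add: rows_store_def)
  have "sem (all_rows rt ru) (rows_store s []) = rows_store s ([] @ first_word (pair_words x []) (length (s 16)) (length (s ru)) @
    repeat (length (s rt)) (later_word (length (s 8)) (length (s 16)) (length (s ru)) 2 3) @
    later_word (length (s 8)) (length (s 16)) (length (s ru)) 4 4)"
    unfolding all_rows_def sem.simps(5) sem_first_row[of ru s x, OF assms(1) x] sem.simps(6) srt l sem_later_row[OF assms(1)] append_assoc ..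
  then show ?thesis using x by (simp flip: s0)
qed

section \<open>The reduction as a program\<close>

text \<open>\<open>rt\<close> and \<open>ru\<close> lie behind the scratch registers of the two
  polynomials. The numerals get 14 digits for each letter of the picture, the width that
  \<open>far_enough\<close> asks for.\<close>

definition reduction_prog :: "nat list => nat list => nat => (nat => (nat \<times> nat) list list) => prog" where
  "reduction_prog asP asT b cls = (let rt = 17 + length asP; ru = rt + length asT + 1 in
     For 0 (%a. Push 8 (ltr a)) ;; For 8 (%_. Pop 0) ;;
     horner_prog 16 asP ;; horner_prog rt asT ;;
     For rt (%_. push_all ru [1, 1]) ;; push_all ru [1, 1] ;;
     all_rows rt ru ;;
     For 9 (%a. Push 10 (ltr a)) ;;
     For 9 (%_. push_all 11 [1]) ;; push_all 11 [7, 6, 5] ;; For ru (%_. push_all 11 [1, 1]) ;; For 8 (%_. push_all 11 [1, 1]) ;;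
     For 16 (%_. push_all 11 [1]) ;; push_all 11 [1, 1, 4, 3, 2] ;;
     For 11 (%_. push_all 15 [1]) ;;
     draw_picture b cls ;;
     For 13 (%a. Push 1 (ltr a)) ;; For 13 (%_. push_all 2 (replicate 14 1)) ;;
     write_instance)"

lemma sem_copy: "q ~= r ==> set (s r) \<subseteq> {0<..<16} ==> sem (For r (%a. Push q (ltr a))) s = s(q := rev (s r) @ s q)"
proof -
  have "fold (%a. sem (Push q (ltr a))) ws s = s(q := rev ws @ s q)" if "set ws \<subseteq> {0<..<16}" for ws s
    using that by (induction ws arbitrary: s) (auto simp: fun_eq_iff)
  from this[of "s r" s] show "q ~= r ==> set (s r) \<subseteq> {0<..<16} ==> ?thesis" by simp
qed

lemma sem_pops: "sem (For r (%_. Pop q)) s = s(q := drop (length (s r)) (s q))"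
proof -
  have "fold (%_. sem (Pop q)) ws s = s(q := drop (length ws) (s q))" for ws :: "nat list" and s
    by (induction ws arbitrary: s) (auto simp: drop_Suc fun_eq_iff)
  then show ?thesis by simp
qed

lemma set_tile_line: "set (tile_line T k) \<subseteq> {1, 2, 4}"
  by (auto simp: tile_line_def)

lemma set_concat_map: "(\<And>x. set (f x) \<subseteq> A) ==> set (concat (map f xs)) \<subseteq> A"
  by auto

lemma set_strip_line: "set (strip_line m e c z k) \<subseteq> {0<..<16}"
proof -
  have t: "set (tile_line T k) \<subseteq> {0<..<16}" for T by (rule order_trans[OF set_tile_line]) auto
  have "set (concat (map (%t. concat (map (%i. tile_line (c t i) k) [0..<m])) z)) \<subseteq> {0<..<16}"
    by (intro set_concat_map t)
  then show ?thesis unfolding strip_line_def set_append using t by simp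
qed

lemma set_slid_rows: "set (slid_rows b cls z cs) \<subseteq> {0<..<16}"
proof (induction b cls z cs rule: slid_rows.induct)
  case (2 b cls z c cs)
  have "set (concat (map (clause_rows b z) (cls c))) \<subseteq> {0<..<16}"
    unfolding clause_rows_def by (intro set_concat_map set_strip_line)
  then show ?case using 2 unfolding slid_rows.simps set_append by blast
qed simp

lemma set_picture: "set (picture_word b cls z cs) \<subseteq> {0<..<16}"
proof -
  have "set (concat (map (strip_line (26 * b) e c z) [0..<20])) \<subseteq> {0<..<16}" for e c by (intro set_concat_map set_strip_line)
  moreover have "set (5 # replicate (520 * b * length z) 2 @ replicate 40 2 @ [3]) \<subseteq> {0<..<16::nat}" by auto
  ultimately show ?thesis unfolding picture_word_def set_append using set_slid_rows by (intro Un_least) blast+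
qed

definition category_word :: "bool list => nat => nat => nat => nat list" where
  "category_word x P T U = first_word (pair_words x []) P U @ repeat T (later_word (length x) P U 2 3) @ later_word (length x) P U 4 4"

lemma set_category_word: "set (category_word x P T U) \<subseteq> {0<..<16}"
proof -
  have "set (repeat n xs) \<subseteq> set xs" for n and xs :: "nat list" by (induction n) auto
  then have "set (repeat T (later_word (length x) P U 2 3)) \<subseteq> set (later_word (length x) P U 2 3)" .
  moreover have "set (later_word (length x) P U 2 3) \<subseteq> {0<..<16}" "set (later_word (length x) P U 4 4) \<subseteq> {0<..<16}" "set (first_word (pair_words x []) P U) \<subseteq> {0<..<16}"
    by (auto simp: later_word_def first_word_def)
  ultimately show ?thesis unfolding category_word_def set_append by blast
qed

lemma sem_reduction:
  fixes x :: "bool list" and asP asT :: "nat list" and b :: nat and cls :: "nat => (nat \<times> nat) list list"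
  defines "P \<equiv> horner asP (length x)" and "T \<equiv> horner asT (length x)"
  defines "U \<equiv> 2 * T + 2"
  defines "cs \<equiv> category_word x P T U"
  defines "z \<equiv> [2, 3, 4] @ replicate (2 * U + (2 * length x + 2) + P) 1 @ [5, 6, 7] @ replicate (length cs) 1"
  defines "bs \<equiv> picture_word b cls z cs"
  assumes sc: "fold scan_step bs ([], 0, 0, 0) = (ps, px, py, c)"
  shows "sem (reduction_prog asP asT b cls) (input_store x) 0 = rev (map bit_letter (instance_word (14 * length bs) ps c))"
proof -
  define rt where "rt = 17 + length asP"
  define ru where "ru = rt + length asT + 1"
  have rr: "rt > 16" "ru > rt" "ru > 16" by (simp_all add: rt_def ru_def)
  define s1 where "s1 = sem (For 0 (%a. Push 8 (ltr a))) (input_store x)"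
  have s1: "s1 = (input_store x)(8 := map bit_letter x)"
    unfolding s1_def by (subst sem_copy) (auto simp: input_store_def rev_map)
  define s2 where "s2 = sem (For 8 (%_. Pop 0)) s1"
  have s2: "s2 r = (if r = 8 then map bit_letter x else [])" for r
    unfolding s2_def sem_pops by (simp add: s1 input_store_def)
  define s3 where "s3 = sem (horner_prog 16 asP) s2"
  have s3: "s3 16 = replicate P 1" "s3 8 = map bit_letter x" "r < 16 \<or> r \<ge> rt ==> r ~= 8 ==> s3 r = []" for r
    using sem_horner[of 16 s2 asP] by (auto simp: s3_def s2 P_def rt_def)
  define s4 where "s4 = sem (horner_prog rt asT) s3"
  have h4: "s4 rt = replicate (horner asT (length (s3 8))) 1 & (\<forall>r. r < rt \<or> r > rt + length asT --> s4 r = s3 r)"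
    unfolding s4_def by (rule sem_horner) (use rr s3 in auto)
  then have s4: "s4 rt = replicate T 1" "s4 16 = replicate P 1" "s4 8 = map bit_letter x" "r < 16 ==> r ~= 8 ==> s4 r = []" "s4 ru = []" for r
    using rr s3 by (auto simp: T_def ru_def)
  define s6 where "s6 = sem (push_all ru [1, 1]) (sem (For rt (%_. push_all ru [1, 1])) s4)"
  have s6: "s6 = s4(ru := replicate U 1)"
  proof -
    have "sem (For rt (%_. push_all ru [1, 1])) s4 = s4(ru := rev (repeat (length (s4 rt)) [1, 1]) @ s4 ru)"
      by (rule sem_For_push) (use rr in simp)
    moreover have "replicate (2 * T) (1::nat) @ [] = replicate (2 * T) 1" "[1, 1] @ replicate (2 * T) 1 = replicate U (1::nat)"
      by (simp_all add: U_def)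
    ultimately show ?thesis unfolding s6_def by (simp add: s4 repeat_single fun_eq_iff)
  qed
  define s7 where "s7 = sem (all_rows rt ru) s6"
  have s7: "s7 = s6(9 := rev cs, 14 := [])"
  proof -
    have "s6 8 = map bit_letter x" "s6 9 = []" "s6 14 = []" "length (s6 16) = P" "length (s6 ru) = U" "length (s6 rt) = T"
      using rr s4 by (auto simp: s6)
    then show ?thesis unfolding s7_def
      by (subst sem_all_rows[of ru rt s6 x]) (use rr in \<open>simp_all add: rows_store_def cs_def category_word_def\<close>)
  qed
  have v7: "s7 8 = map bit_letter x" "s7 9 = rev cs" "length (s7 16) = P" "length (s7 ru) = U" "r < 16 ==> r \<notin> {8, 9} ==> s7 r = []" for r
    using rr s4 by (auto simp: s7 s6)
  define s8 where "s8 = sem (For 9 (%a. Push 10 (ltr a))) s7"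
  have s8: "s8 = s7(10 := cs)"
  proof -
    have "set (s7 9) \<subseteq> {0<..<16}" using set_category_word by (simp add: v7 cs_def)
    then show ?thesis unfolding s8_def by (subst sem_copy) (simp_all add: v7)
  qed
  define K where "K = (%t. s8(11 := t))"
  have p: "sem (push_all 11 xs) (K t) = K (rev xs @ t)" for xs t by (simp add: K_def fun_eq_iff)
  have f: "r ~= 11 ==> sem (For r (%_. push_all 11 xs)) (K t) = K (rev (repeat (length (s8 r)) xs) @ t)" for r xs t
    by (subst sem_For_push) (simp_all add: K_def fun_eq_iff)
  have ln: "length (s8 9) = length cs" "length (s8 ru) = U" "length (s8 8) = length x" "length (s8 16) = P"
    using v7 rr by (auto simp: s8)
  define s9 where "s9 = sem (push_all 11 [1, 1, 4, 3, 2]) (sem (For 16 (%_. push_all 11 [1])) (sem (For 8 (%_. push_all 11 [1, 1]))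
     (sem (For ru (%_. push_all 11 [1, 1])) (sem (push_all 11 [7, 6, 5]) (sem (For 9 (%_. push_all 11 [1])) s8)))))"
  have s9: "s9 = K z"
  proof -
    have k: "s8 = K []" using v7(5)[of 11] by (simp add: K_def s8 fun_eq_iff)
    have ne: "9 ~= (11::nat)" "ru ~= 11" "8 ~= (11::nat)" "16 ~= (11::nat)" using rr by auto
    have "s9 = K (rev [1, 1, 4, 3, 2] @ rev (repeat P [1]) @ rev (repeat (length x) [1, 1]) @ rev (repeat U [1, 1]) @ rev [7, 6, 5] @ rev (repeat (length cs) [1]) @ [])"
      unfolding s9_def k unfolding f[OF ne(1)] f[OF ne(2)] f[OF ne(3)] f[OF ne(4)] p ln ..
    also have "rev [1, 1, 4, 3, 2] @ rev (repeat P [1]) @ rev (repeat (length x) [1, 1]) @ rev (repeat U [1, 1]) @ rev [7, 6, 5] @ rev (repeat (length cs) [1]) @ [] =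
      [2, 3, 4] @ (replicate 2 1 @ replicate P 1 @ replicate (2 * length x) 1 @ replicate (2 * U) 1) @ [5, 6, 7] @ replicate (length cs) 1"
      by (simp add: repeat_single numeral_2_eq_2)
    also have "replicate 2 1 @ replicate P 1 @ replicate (2 * length x) 1 @ replicate (2 * U) 1 = replicate (2 * U + (2 * length x + 2) + P) (1::nat)"
      by (simp flip: replicate_add add: add.commute add.left_commute)
    finally show ?thesis unfolding z_def .
  qed
  define s10 where "s10 = sem (For 11 (%_. push_all 15 [1])) s9"
  have s10: "s10 = (K z)(15 := replicate (length z) 1)"
    unfolding s10_def s9 by (subst sem_For_push) (use v7(5)[of 15] in \<open>simp_all add: K_def s8 repeat_single\<close>)
  have v10: "s10 11 = z" "s10 15 = replicate (length z) 1" "s10 12 = []" "s10 13 = []" "s10 10 = cs" "r < 8 ==> s10 r = []" for r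
    using v7(5) by (simp_all add: s10 K_def s8)
  have zl: "set z \<subseteq> {0<..<16}" "z ~= []" by (auto simp: z_def)
  define s11 where "s11 = sem (draw_picture b cls) s10"
  have "s11 13 = rev (picture_word b cls (s10 11) (s10 10))" "\<And>r. r \<notin> {11, 12, 13} ==> s11 r = s10 r"
    unfolding s11_def by (rule sem_draw_picture; use v10 zl in simp)+
  then have s11: "s11 13 = rev bs" "r < 8 ==> s11 r = []" for r using v10 by (auto simp: bs_def)
  define s12 where "s12 = sem (For 13 (%a. Push 1 (ltr a))) s11"
  have "set (s11 13) \<subseteq> {0<..<16}" using set_picture by (simp add: s11 bs_def)
  then have s12: "s12 = s11(1 := bs)" unfolding s12_def by (subst sem_copy) (simp_all add: s11)
  define s13 where "s13 = sem (For 13 (%_. push_all 2 (replicate 14 1))) s12"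
  have "length (repeat n xs) = n * length xs" for n and xs :: "nat list" by (induction n) simp_all
  then have s13: "s13 1 = bs" "length (s13 2) = 14 * length bs" "r \<in> {0, 3, 4, 5, 6, 7} ==> s13 r = []" for r
    unfolding s13_def by (auto simp: sem_For_push s12 s11 simp del: sem.simps sem_push_all)
  have "sem write_instance s13 0 = rev (map bit_letter (instance_word (length (s13 2)) ps c))"
    by (rule sem_write_instance) (use s13 sc in auto)
  moreover have "sem (reduction_prog asP asT b cls) (input_store x) = sem write_instance s13"
    unfolding reduction_prog_def Let_def sem.simps(5) rt_def[symmetric] ru_def[symmetric]
      s1_def[symmetric] s2_def[symmetric] s3_def[symmetric] s4_def[symmetric] s6_def[symmetric] s7_def[symmetric] s8_def[symmetric]
      s9_def[symmetric] s10_def[symmetric] s11_def[symmetric] s12_def[symmetric] s13_def[symmetric] ..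
  ultimately show ?thesis by (simp add: s13)
qed

subsection \<open>The program is well formed\<close>

text \<open>\<open>W\<close> contains the registers written to and \<open>R\<close> those looped over.\<close>

definition shape :: "nat => nat set => nat set => prog => bool" where
  "shape k W R p \<longleftrightarrow> wf_prog k 16 p & used p \<subseteq> W \<union> R & written p \<subseteq> W & looped p \<subseteq> R"

lemma shape_Skip: "shape k W R Skip" by (simp add: shape_def)
lemma shape_Push: "r \<in> W ==> r < k ==> 0 < a ==> a < 16 ==> shape k W R (Push r a)" by (simp add: shape_def)
lemma shape_Pop: "r \<in> W ==> r < k ==> shape k W R (Pop r)" by (simp add: shape_def)
lemma shape_Then: "shape k W R p ==> shape k W R q ==> shape k W R (p ;; q)" by (simp add: shape_def)
lemma shape_Case: "r \<in> W ==> r < k ==> (\<And>a. shape k W R (f a)) ==> shape k W R (Case r f)"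
  unfolding shape_def by auto
lemma shape_For: "r \<in> R ==> r < k ==> r \<notin> W ==> r \<notin> R' ==> R' \<subseteq> R ==> (\<And>a. shape k W R' (f a)) ==> shape k W R (For r f)"
  unfolding shape_def by fastforce
lemma shape_if: "(c ==> shape k W R p) ==> (\<not> c ==> shape k W R q) ==> shape k W R (if c then p else q)" by simp
lemma shape_push_all: "r \<in> W ==> r < k ==> set xs \<subseteq> {0<..<16} ==> shape k W R (push_all r xs)"
  by (induction xs) (auto simp: shape_def push_all_def)
lemma shape_sequence: "(\<And>p. p \<in> set ps ==> shape k W R p) ==> shape k W R (sequence ps)"
  by (induction ps) (auto simp: shape_def sequence_def)
lemma shape_mono: "shape k W R p ==> W \<subseteq> W' ==> R \<subseteq> R' ==> shape k W' R' p" by (auto simp: shape_def)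

lemma shape_pop_loop:
  assumes "r \<in> R" "r < k" "a \<in> W" "a < k" "r \<notin> W" "\<And>x. shape k W {} (p x)"
  shows "shape k W R (pop_loop r a p)"
  unfolding pop_loop_def
  by (rule shape_For[where R' = "{}"]) (use assms in \<open>auto intro!: shape_Case shape_if shape_Skip shape_Then shape_Pop\<close>)

lemma shape_move_all: "r \<in> R ==> r < k ==> a \<in> W ==> a < k ==> b \<in> W ==> b < k ==> r \<notin> W ==> shape k W R (move_all r a b)"
  unfolding move_all_def by (rule shape_pop_loop) (auto intro!: shape_Push)

definition poly_prog :: "nat => prog => bool" where
  "poly_prog k p \<longleftrightarrow> wf_prog k 16 p & tame p"

text \<open>Tameness restricts single outermost loops only, so a register written by one part may be
  looped over by the next.\<close>

lemma poly_prog_Then: "poly_prog k p ==> poly_prog k q ==> poly_prog k (p ;; q)"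
  by (simp add: poly_prog_def)

lemma tame_shape: "written p \<subseteq> W ==> looped p \<subseteq> R ==> W \<inter> R = {} ==> tame p"
proof (induction p)
  case (For r f)
  have "(\<Union>a. looped (f a)) \<subseteq> R" "(\<Union>a. written (f a)) \<subseteq> W" using For.prems unfolding written.simps looped.simps by blast+
  then show ?case using For.prems(3) unfolding tame.simps by blast
next
  case (Case r f)
  have "written (f a) \<subseteq> W" "looped (f a) \<subseteq> R" for a
    using Case.prems(1,2) unfolding written.simps looped.simps by blast+
  then show ?case using Case.IH Case.prems(3) by simp
qed auto

lemma poly_prog_shape: "shape k W R p ==> W \<inter> R = {} ==> poly_prog k p"
  unfolding shape_def poly_prog_def using tame_shape by blast

lemma letters_concat: "(\<And>x. set (f x) \<subseteq> {0<..<16}) ==> set (concat (map f xs)) \<subseteq> {0<..<16::nat}"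
  by (rule set_concat_map)

lemma set_tile_line': "set (tile_line T k) \<subseteq> {0<..<16}"
  by (rule order_trans[OF set_tile_line]) auto

lemma shape_draw_line:
  assumes "k > 16" "set l \<subseteq> {0<..<16}" "set r \<subseteq> {0<..<16}" "\<And>t. set (F t) \<subseteq> {0<..<16}"
  shows "shape k {11, 12, 13} {15} (draw_line l r F)"
  unfolding draw_line_def
  by (intro shape_Then shape_push_all shape_pop_loop shape_move_all shape_Push) (use assms in auto)

lemma shape_draw_strip: "k > 16 ==> shape k {11, 12, 13} {15} (draw_strip m e c)"
proof -
  assume k: "k > 16"
  have "shape k {11, 12, 13} {15} (draw_line (2 # tile_line Block i) (tile_line e i @ [3]) (%t. concat (map (%j. tile_line (c t j) i) [0..<m])))" for i
    by (rule shape_draw_line[OF k]) (use set_tile_line' in \<open>auto intro!: letters_concat simp del: set_concat\<close>)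
  then show ?thesis unfolding draw_strip_def by (intro shape_sequence) auto
qed

lemma poly_prog_draw_picture:
  assumes k: "k > 16" shows "poly_prog k (draw_picture b cls)"
proof -
  have clause: "shape k {11, 12, 13} {15} (draw_clause b cl)" for cl
    unfolding draw_clause_def by (rule shape_sequence) (use shape_draw_strip[OF k] in auto)
  have slide: "shape k {11, 12, 13} {15} slide"
    unfolding slide_def by (intro shape_Then shape_move_all shape_Pop shape_Push) (use k in auto)
  have "shape k {11, 12, 13} {15, 10} (draw_picture b cls)"
    unfolding draw_picture_def
  proof (intro shape_Then)
    show "shape k {11, 12, 13} {15, 10} (For 15 (%_. push_all 13 (replicate (520 * b) 2)))"
      by (rule shape_For[where R' = "{}"]) (use k in \<open>auto intro!: shape_push_all\<close>)
    show "shape k {11, 12, 13} {15, 10} (For 10 (%c. sequence (map (draw_clause b) (cls c)) ;; slide))"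
      by (rule shape_For[where R' = "{15}"]) (use k clause slide in \<open>auto intro!: shape_Then shape_sequence\<close>)
  qed (use k shape_mono[OF shape_draw_strip[OF k]] in \<open>auto intro!: shape_push_all shape_Push\<close>)
  then show ?thesis by (rule poly_prog_shape) simp
qed

lemma poly_prog_write_instance:
  assumes k: "k > 16" shows "poly_prog k write_instance"
proof -
  let ?W = "{0, 3, 4, 5, 6, 7}"
  have fill: "shape k ?W {2} (fill c)" "shape k ?W {2} (clear c)" if "c \<in> ?W" for c
    unfolding fill_def clear_def by (rule shape_For[where R' = "{}"]; use that k in \<open>auto intro!: shape_Push shape_Pop\<close>)+
  have inc: "shape k ?W {2} (inc c)" if "c \<in> ?W" for c
    unfolding inc_def add_step_def
    by (intro shape_Then shape_Push shape_Pop shape_pop_loop shape_move_all shape_Case shape_if) (use that k in auto)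
  have bits: "shape k ?W {2} (write_bits c)" if "c \<in> ?W" for c
    unfolding write_bits_def by (intro shape_Then shape_Push shape_pop_loop shape_move_all) (use that k in auto)
  have coord: "shape k ?W {2} (write_coord c)" if "c \<in> ?W" for c
    unfolding write_coord_def by (intro shape_Then shape_Push shape_push_all bits) (use that k in auto)
  have point: "shape k ?W {2} write_point"
    unfolding write_point_def by (intro shape_Then shape_Push coord) (use k in auto)
  have draw: "shape k ?W {2} (draw_step a)" for a
    unfolding draw_step_def by (intro shape_if shape_Then point inc fill shape_Skip) auto
  have "shape k ?W {2, 1} (For 1 draw_step)"
    by (rule shape_For[where R' = "{2}"]) (use k draw in auto)
  moreover have "set (map bit_letter bs) \<subseteq> {0<..<16}" for bs by auto
  ultimately have "shape k ?W {2, 1} write_instance"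
    unfolding write_instance_def using k
    by (intro shape_Then shape_push_all shape_mono[OF fill(1)] shape_mono[OF bits]) auto
  then show ?thesis by (rule poly_prog_shape) simp
qed

lemma poly_prog_horner: "r > 8 ==> r + length as < k ==> poly_prog k (horner_prog r as)"
proof (induction as arbitrary: r)
  case (Cons a as)
  have "shape k {r} {8, Suc r} (For 8 (%_. For (Suc r) (%_. push_all r [1])))"
    by (rule shape_For[where R' = "{Suc r}"])
      (use Cons.prems in \<open>auto intro!: shape_push_all shape_For[where R' = "{}"]\<close>)
  then have "poly_prog k (For 8 (%_. For (Suc r) (%_. push_all r [1])))" by (rule poly_prog_shape) (use Cons.prems in auto)
  moreover have "poly_prog k (push_all r (replicate a 1))"
    by (rule poly_prog_shape[where W = "{r}" and R = "{}"]) (use Cons.prems in \<open>auto intro!: shape_push_all\<close>)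
  moreover have "poly_prog k (horner_prog (Suc r) as)" by (rule Cons.IH) (use Cons.prems in auto)
  ultimately show ?case by (simp add: poly_prog_Then)
qed (simp add: poly_prog_def)

lemma poly_prog_all_rows:
  assumes "rt > 16" "ru > rt" "ru < k" shows "poly_prog k (all_rows rt ru)"
proof -
  have n: "shape k {9, 14} {8, 16, ru} (For r (%_. push_all 9 xs))" if "r \<in> {8, 16, ru}" "set xs \<subseteq> {0<..<16}" for r xs
    by (rule shape_For[where R' = "{}"]) (use that assms in \<open>auto intro!: shape_push_all\<close>)
  have later: "shape k {9, 14} {8, 16, ru} (later_row ru a b)" if "0 < a" "a < 16" "0 < b" "b < 16" for a b
    unfolding later_row_def by (intro shape_Then n shape_push_all) (use that assms in auto)
  have bit: "shape k {9, 14} R (write_bit a)" for a R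
    unfolding write_bit_def by (intro shape_Case shape_if shape_Then shape_push_all shape_Pop) (use assms in auto)
  have "shape k {9, 14} {8, 16, ru} (For 8 (%a. write_bit a ;; push_all 9 [if a = 2 then 7 else 6]))"
    by (rule shape_For[where R' = "{}"]) (use assms bit in \<open>auto intro!: shape_Then shape_push_all\<close>)
  then have first: "shape k {9, 14} {8, 16, ru} (first_row ru)"
    unfolding first_row_def using assms by (intro shape_Then n shape_push_all shape_Push bit) auto
  have "shape k {9, 14} {8, 16, ru, rt} (For rt (%_. later_row ru 2 3))"
    by (rule shape_For[where R' = "{8, 16, ru}"]) (use assms later in auto)
  then have "shape k {9, 14} {8, 16, ru, rt} (all_rows rt ru)"
    unfolding all_rows_def by (intro shape_Then shape_mono[OF first] shape_mono[OF later]) auto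
  then show ?thesis by (rule poly_prog_shape) (use assms in auto)
qed

lemma poly_prog_reduction: "\<exists>k \<ge> 1. poly_prog k (reduction_prog asP asT b cls)"
proof -
  define rt where "rt = 17 + length asP"
  define ru where "ru = rt + length asT + 1"
  define k where "k = ru + 1"
  have r: "rt > 16" "ru > rt" "ru < k" "k > 16" by (simp_all add: rt_def ru_def k_def)
  have F: "poly_prog k (For r f)" if "r < k" "r ~= q" "\<And>a. shape k {q} {} (f a)" for r q f
    by (rule poly_prog_shape[where W = "{q}" and R = "{r}"]) (use that in \<open>auto intro!: shape_For[where R' = "{}"]\<close>)
  have FP: "poly_prog k (For r (%_. push_all q xs))" if "r < k" "q < k" "r ~= q" "set xs \<subseteq> {0<..<16}" for r q xs
    by (rule F) (use that in \<open>auto intro!: shape_push_all\<close>)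
  have P: "poly_prog k (push_all q xs)" if "q < k" "set xs \<subseteq> {0<..<16}" for q xs
    by (rule poly_prog_shape[where W = "{q}" and R = "{}"]) (use that in \<open>auto intro!: shape_push_all\<close>)
  have C: "poly_prog k (For r (%a. Push q (ltr a)))" if "r < k" "q < k" "r ~= q" for r q
    by (rule F) (use that in \<open>auto intro!: shape_Push\<close>)
  have "poly_prog k (For 8 (%_. Pop 0))" by (rule F[where q = 0]) (use r in \<open>auto intro!: shape_Pop\<close>)
  then have "poly_prog k (reduction_prog asP asT b cls)"
    unfolding reduction_prog_def Let_def rt_def[symmetric] ru_def[symmetric]
    by (intro poly_prog_Then C FP P poly_prog_horner poly_prog_all_rows[OF r(1,2,3)] poly_prog_draw_picture[OF r(4)] poly_prog_write_instance[OF r(4)])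
      (use r in \<open>auto simp: rt_def ru_def k_def\<close>)
  then show ?thesis using r by (intro exI[of _ k]) auto
qed

section \<open>Machines with an origin mark\<close>

text \<open>The additional tape keeps its symbols and copies the moves of the first tape. The
  halting state idles, so the result can be inspected at a fixed time.\<close>

definition marked :: "tm => nat => nat list => nat \<times> (nat \<times> move) list" where
  "marked M q ss = (if q < num_states M
     then let d = delta M q (butlast ss) in (fst d, snd d @ [(last ss, snd (hd (snd d)))])
     else (q, map (%s. (s, Stay)) ss))"

lemma marked_tableau:
  assumes "wf_tm M"
  shows "tableau (num_tapes M + 1) (num_syms M) (num_states M) (marked M)"
proof
  show "2 <= num_tapes M + 1" "3 <= num_syms M" using assms by (auto simp: wf_tm_def)
  fix q ss assume q: "q <= num_states M" and l: "length ss = num_tapes M + 1" and s: "set ss \<subseteq> {..<num_syms M}"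
  have ne: "ss ~= []" using l by auto
  have la: "ss ! (num_tapes M + 1 - 1) = last ss" using l ne by (simp add: last_conv_nth)
  show "fst (marked M q ss) <= num_states M & length (snd (marked M q ss)) = num_tapes M + 1 &
      fst ` set (snd (marked M q ss)) \<subseteq> {..<num_syms M} &
      snd (marked M q ss) ! (num_tapes M + 1 - 1) = (ss ! (num_tapes M + 1 - 1), snd (snd (marked M q ss) ! 0))"
  proof (cases "q < num_states M")
    case True
    define d where "d = delta M q (butlast ss)"
    have b: "length (butlast ss) = num_tapes M" "\<forall>s \<in> set (butlast ss). s < num_syms M" using l s by (auto dest: in_set_butlastD)
    then have d: "fst d <= num_states M" "length (snd d) = num_tapes M" "\<forall>(s, m) \<in> set (snd d). s < num_syms M"
      using assms True unfolding wf_tm_def d_def by blast+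
    have t: "num_tapes M \<ge> 1" using assms by (simp add: wf_tm_def)
    have ls: "last ss < num_syms M" using s last_in_set[OF ne] by blast
    have e: "marked M q ss = (fst d, snd d @ [(last ss, snd (hd (snd d)))])" using True by (simp add: marked_def d_def Let_def)
    have "snd d ~= []" using d(2) t by auto
    then have h: "(snd d @ [(last ss, snd (hd (snd d)))]) ! 0 = hd (snd d)" by (cases "snd d") auto
    show ?thesis unfolding e fst_conv snd_conv la h using d ls by (auto simp: nth_append)
  next
    case False
    then show ?thesis using q l s la by (auto simp: marked_def)
  qed
qed

context
  fixes M :: tm
  assumes M: "wf_tm M"
begin

interpretation tb: tableau "num_tapes M + 1" "num_syms M" "num_states M" "marked M"
  by (rule marked_tableau[OF M])

definition running :: "bool list => nat => config" where
  "running z t = (step M ^^ t) (start_config M z)"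

lemma marked_conf: "\<exists>o1. tb.conf z t = (fst (running z t), snd (running z t) @ [o1]) & length (snd (running z t)) = num_tapes M"
proof (induction t)
  case 0
  have "num_tapes M \<ge> 1" using M by (simp add: wf_tm_def)
  moreover have "word_contents [] = (%_. 0)" by (auto simp: word_contents_def)
  moreover have "num_tapes M + 1 - 2 = num_tapes M - 1" by simp
  then have "tb.conf z 0 = (0, (word_contents z, 0) # replicate (num_tapes M - 1) (%_. 0, 0) @ [(%i. if i = 0 then 1 else 0, 0)])"
    unfolding tb.conf_def tb.start_def by (simp only: funpow.simps id_apply)
  ultimately show ?case
    by (intro exI[of _ "(%i. if i = 0 then 1 else 0, 0)"]) (simp only: running_def start_config_def funpow.simps id_apply, simp)
next
  case (Suc t)
  then obtain o' where IH: "tb.conf z t = (fst (running z t), snd (running z t) @ [o'])" "length (snd (running z t)) = num_tapes M" by blast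
  let ?c = "running z t"
  have r: "running z (Suc t) = step M ?c" by (simp add: running_def)
  have c: "tb.conf z (Suc t) = tb.advance (fst ?c, snd ?c @ [o'])" unfolding tb.conf_Suc IH(1) ..
  show ?case
  proof (cases "fst ?c < num_states M")
    case True
    define d where "d = delta M (fst ?c) (map read_tape (snd ?c))"
    have m: "marked M (fst ?c) (map read_tape (snd ?c @ [o'])) = (fst d, snd d @ [(read_tape o', snd (hd (snd d)))])"
      using True by (simp add: marked_def d_def Let_def)
    have "length (snd (marked M (fst ?c) (map read_tape (snd ?c @ [o'])))) = num_tapes M + 1"
      using tb.valid_nxt(2)[OF tb.conf_valid[of z t]] IH by simp
    then have ld: "length (snd d) = num_tapes M" unfolding m by simp
    have "step M ?c = (fst d, map2 act_tape (snd d) (snd ?c))" using True by (simp add: step_def d_def Let_def)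
    then show ?thesis unfolding c r tb.advance_def Let_def fst_conv snd_conv m using ld IH(2) by simp
  next
    case False
    have m: "marked M (fst ?c) (map read_tape (snd ?c @ [o'])) = (fst ?c, map (%s. (s, Stay)) (map read_tape (snd ?c @ [o'])))"
      using False by (simp add: marked_def)
    have k: "map2 act_tape (map (%s. (s, Stay)) (map read_tape ts)) ts = ts" for ts
      by (induction ts) (auto simp: act_tape_def read_tape_def)
    have "step M ?c = ?c" using False by (simp add: step_def)
    then show ?thesis unfolding c r tb.advance_def Let_def fst_conv snd_conv m k using IH(2) by simp
  qed
qed

lemma marked_accepts:
  assumes "tm_outputs_within M T0 z [b]" "T0 <= T"
  shows "fst (snd (tb.conf z T) ! 0) 0 = 2 \<longleftrightarrow> b"
proof -
  obtain t where t: "t <= T0" "fst (running z t) = num_states M" "fst (hd (snd (running z t))) = word_contents [b]"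
    using assms(1) unfolding tm_outputs_within_def running_def Let_def by blast
  have "running z (t + k) = running z t" for k
  proof (induction k)
    case (Suc k)
    have "running z (t + Suc k) = step M (running z (t + k))" by (simp add: running_def)
    then show ?case using Suc t(2) by (simp add: step_def)
  qed simp
  from this[of "T - t"] have r: "running z T = running z t" using t(1) assms(2) by simp
  obtain o' where c: "tb.conf z T = (fst (running z T), snd (running z T) @ [o'])" "length (snd (running z T)) = num_tapes M"
    using marked_conf by blast
  have "num_tapes M \<ge> 1" using M by (simp add: wf_tm_def)
  then have "snd (tb.conf z T) ! 0 = hd (snd (running z t))" using c r by (cases "snd (running z t)") auto
  then show ?thesis using t(3) by (simp add: word_contents_def)
qed

end

section \<open>The encoded instance\<close>

text \<open>The distance is a power of two above all offsets, so a coordinate is a counter with a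
  leading digit 1.\<close>

definition far_instance :: "nat => (nat \<times> nat) list => spiral_instance" where
  "far_instance w ps = \<lparr>root = (0, 0), terminals = map (%(x, y). (of_nat (2 ^ w + x), of_nat (2 ^ w + y))) ps, angle_coeff = 1 / 4\<rparr>"

text \<open>This is \<open>2 * D + c + 1 / 2\<close> for \<open>D = 2 ^ w\<close>.\<close>

definition far_bound :: "nat => nat => rat" where
  "far_bound w c = of_nat (2 ^ (w + 2) + 2 * c + 1) / 2"

lemma encode_nat_pairs: "encode_nat n = pairs_of (bits n) @ [False]"
  by (simp add: encode_nat_def encode_list_def pairs_of_def)

lemma encode_rat_of_nat: "encode_rat (of_nat n) = False # encode_nat n @ [False, True, True, False]"
proof -
  have "quotient_of (of_nat n) = (int n, 1)" using quotient_of_int[of "int n"] by simp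
  then show ?thesis by (simp add: encode_rat_def encode_pair_def encode_int_def encode_nat_pairs pairs_of_def bits_1)
qed

lemma encode_coord: "x < 2 ^ w ==> encode_rat (of_nat (2 ^ w + x)) = coord_word w x"
  using bits_digits[of x w 1] unfolding encode_rat_of_nat encode_nat_pairs
  by (simp add: coord_word_def pairs_of_def bits_1)

lemma encode_far:
  assumes "\<And>x y. (x, y) \<in> set ps ==> x < 2 ^ w & y < 2 ^ w" "c < 2 ^ w"
  shows "encode_pair encode_instance encode_rat (far_instance w ps, far_bound w c) = instance_word w ps c"
proof -
  have "encode_list encode_point (map (%(x, y). (of_nat (2 ^ w + x), of_nat (2 ^ w + y))) ps) = concat (map (point_word w) ps) @ [False]"
    using assms(1)
  proof (induction ps)
    case (Cons p ps)
    obtain x y where p: "p = (x, y)" by (cases p)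
    have e1: "encode_point (of_nat (2 ^ w + x), of_nat (2 ^ w + y)) = coord_word w x @ coord_word w y"
      unfolding encode_point_def encode_pair_def fst_conv snd_conv using Cons.prems[of x y] p by (simp only: encode_coord list.set_intros)
    have e2: "encode_list encode_point (map (%(x, y). (of_nat (2 ^ w + x), of_nat (2 ^ w + y))) ps) = concat (map (point_word w) ps) @ [False]"
      by (rule Cons.IH) (use Cons.prems in auto)
    have e3: "encode_list encode_point (map (%(x, y). (of_nat (2 ^ w + x), of_nat (2 ^ w + y))) (p # ps)) =
      True # encode_point (of_nat (2 ^ w + x), of_nat (2 ^ w + y)) @ encode_list encode_point (map (%(x, y). (of_nat (2 ^ w + x), of_nat (2 ^ w + y))) ps)"
      by (simp add: encode_list_def p)
    have pw: "point_word w p = True # coord_word w x @ coord_word w y" by (simp add: point_word_def p)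
    show ?case unfolding e3 e1 e2 by (simp add: pw)
  qed (simp add: encode_list_def)
  moreover have "encode_point (0, 0) = header"
    using encode_rat_of_nat[of 0] by (simp add: encode_point_def encode_pair_def header_def encode_nat_pairs bits_1 pairs_of_def)
  moreover have "encode_rat (1 / 4) @ [False, True, True] = tl footer"
  proof -
    have "(1 / 4 :: rat) = Fract 1 4" by (simp add: Fract_of_int_quotient)
    then have "quotient_of (1 / 4) = (1, 4)" by (simp only: quotient_of_Fract) (simp add: Rat.normalize_def)
    moreover have "bits 4 = [False, False, True]" by (simp add: bits.simps)
    ultimately show ?thesis by (simp add: encode_rat_def encode_pair_def encode_int_def encode_nat_pairs bits_1 pairs_of_def footer_def)
  qed
  moreover have "encode_rat (far_bound w c) = [False, True, True] @ pairs_of (digits w c) @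
     [True, False, True, True, False, False, True, False, True, True, False]"
  proof -
    define n where "n = 2 ^ (w + 2) + 2 * c + (1::nat)"
    have o: "odd n" by (simp add: n_def)
    have "far_bound w c = Fract (int n) 2" by (simp add: far_bound_def n_def Fract_of_int_quotient)
    moreover have "gcd (int n) 2 = 1" using o by (simp add: coprime_iff_gcd_eq_1[symmetric])
    ultimately have q: "quotient_of (far_bound w c) = (int n, 2)" by (simp add: quotient_of_Fract Rat.normalize_def Let_def)
    have n2: "n div 2 = 2 ^ w * 2 + c" by (simp add: n_def)
    have "bits n = odd n # bits (n div 2)" using o by (subst bits.simps) (auto simp: odd_pos)
    also have "\<dots> = True # digits w c @ [False, True]" using o bits_digits[OF assms(2), of 2] unfolding n2 by (simp add: bits_1)
    finally show ?thesis by (simp add: encode_rat_def encode_pair_def q encode_int_def encode_nat_pairs bits_1 pairs_of_def)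
  qed
  moreover have "footer = False # tl footer" by (simp add: footer_def)
  ultimately show ?thesis
    unfolding encode_pair_def encode_instance_def far_instance_def instance_word_def fst_conv snd_conv
    by (simp del: of_nat_add)
qed

section \<open>Optimal trees of a picture\<close>

lemma scan_bounds:
  assumes "fold scan_step bs (ps, x, y, c) = (ps', x', y', c')" "\<And>p. p \<in> set ps ==> fst p <= N & snd p <= N"
    "x + length bs <= N" "y + length bs <= N"
  shows "length ps' <= length ps + length bs & c' <= c + length bs & (\<forall>p \<in> set ps'. fst p <= N & snd p <= N)"
  using assms
proof (induction bs arbitrary: ps x y c)
  case (Cons b bs)
  obtain ps1 x1 y1 c1 where s: "scan_step b (ps, x, y, c) = (ps1, x1, y1, c1)" by (metis prod_cases4)
  have 1: "length ps1 <= Suc (length ps)" "c1 <= Suc c" "x1 <= Suc x" "y1 <= Suc y" "\<And>p. p \<in> set ps1 ==> fst p <= N & snd p <= N"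
    using s Cons.prems(2-4) by (auto simp: scan_step_def split: if_splits)
  have "length ps' <= length ps1 + length bs & c' <= c1 + length bs & (\<forall>p \<in> set ps'. fst p <= N & snd p <= N)"
    by (rule Cons.IH[of ps1 x1 y1 c1]) (use Cons.prems 1 s in auto)
  then show ?case using 1 by auto
qed auto

text \<open>The exponent 14 is 10 + 4: the constant 800 is below \<open>2 ^ 10\<close>, and the four
  factors \<open>n\<close> are each below \<open>2 ^ n\<close>.\<close>

lemma far_enough: "n \<ge> 1 ==> 200 * n\<^sup>2 * (n\<^sup>2 + n + 2) <= (2::nat) ^ (14 * n)"
proof -
  assume n: "n \<ge> 1"
  have "n <= n * n" "1 <= n * n" using n by simp_all
  then have "n\<^sup>2 + n + 2 <= 4 * n\<^sup>2" unfolding power2_eq_square by linarith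
  then have "200 * n\<^sup>2 * (n\<^sup>2 + n + 2) <= 200 * n\<^sup>2 * (4 * n\<^sup>2)" by (rule mult_le_mono2)
  also have "\<dots> = 800 * n ^ 4" by (simp add: power2_eq_square power4_eq_xxxx)
  also have "\<dots> <= 2 ^ (10 * n) * (2 ^ n) ^ 4"
  proof (intro mult_le_mono power_mono)
    have "(800::nat) <= 2 ^ 10" by simp
    also have "\<dots> <= 2 ^ (10 * n)" using n by (intro power_increasing) auto
    finally show "(800::nat) <= 2 ^ (10 * n)" .
    show "n <= 2 ^ n" by (simp add: less_imp_le)
  qed simp
  also have "\<dots> = 2 ^ (14 * n)" by (simp flip: power_mult power_add)
  finally show ?thesis .
qed

text \<open>The length of the picture bounds the coordinates, the number of terminals and the bound
  alike, so it can take the place of all parameters in the requirement on \<open>D\<close>.\<close>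

lemma grid_decision:
  fixes w h :: nat and g :: "nat => nat => tile"
  defines "bs \<equiv> grid_picture w h g"
  assumes sc: "fold scan_step bs ([], 0, 0, 0) = (ps, x, y, c)"
  shows "(\<exists>T. is_arg_min (spiral_tree_length (far_instance (14 * length bs) ps)) (spiral_tree_for (far_instance (14 * length bs) ps)) T &
      spiral_tree_length (far_instance (14 * length bs) ps) T <= of_rat (far_bound (14 * length bs) c)) \<longleftrightarrow>
    (\<exists>H V. solves w h g H V)"
    "\<And>x y. (x, y) \<in> set ps ==> x < 2 ^ (14 * length bs) & y < 2 ^ (14 * length bs)" "c < 2 ^ (14 * length bs)"
proof -
  define n where "n = length bs"
  define X where "X = grid_terminals w h g"
  have n1: "n \<ge> 1" by (simp add: n_def bs_def grid_picture_def)
  have z: "ps = grid_points w h g" "c = length ps + grid_cost w h g - 1" using sc unfolding bs_def scan_grid by auto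
  have bd: "length ps <= n" "c <= n" "\<And>p. p \<in> set ps ==> fst p <= n & snd p <= n"
    using scan_bounds[OF sc, of n] by (auto simp: n_def)
  have pX: "to_cell ` set ps = X" unfolding z(1) X_def by (rule grid_points_cells)
  have cX: "card X = length ps"
    using card_image[OF inj_to_cell, of "set ps"] distinct_card[OF distinct_grid_points, of w h g] pX z(1) by simp
  have ne: "ps ~= []" unfolding z(1) grid_points_def by (simp del: upt_Suc)
  define D :: real where "D = 2 ^ (14 * n)"
  have D: "200 * (real n)\<^sup>2 * ((real (card X))\<^sup>2 + real c + 2) <= D"
  proof -
    have "200 * (real n)\<^sup>2 * ((real (card X))\<^sup>2 + real c + 2) <= 200 * (real n)\<^sup>2 * ((real n)\<^sup>2 + real n + 2)"
      using bd cX by (intro mult_left_mono add_mono power_mono) auto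
    also have "\<dots> = real (200 * n\<^sup>2 * (n\<^sup>2 + n + 2))" by (simp only: of_nat_mult of_nat_add of_nat_power of_nat_numeral)
    also have "\<dots> <= real (2 ^ (14 * n))" using far_enough[OF n1] by (rule of_nat_mono)
    finally show ?thesis by (simp add: D_def)
  qed
  interpret far_root D n X c
  proof
    show "finite X" "X ~= {}" using pX ne by (auto simp flip: pX)
    show "0 <= fst d & fst d <= int n & 0 <= snd d & snd d <= int n" if "d \<in> X" for d
      using that bd(3) by (auto simp: to_cell_def simp flip: pX)
  qed (use n1 D in auto)
  let ?I = "far_instance (14 * n) ps"
  have ts: "set (map to_plane (terminals ?I)) = grid_point ` X"
  proof -
    have "to_plane (of_nat (2 ^ (14 * n) + fst p), of_nat (2 ^ (14 * n) + snd p)) = grid_point (to_cell p)" for p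
      unfolding to_plane_def fst_conv snd_conv of_rat_of_nat_eq grid_point_def to_cell_def by (simp add: D_def)
    then show ?thesis by (simp add: far_instance_def split_def image_image flip: pX del: of_nat_add)
  qed
  have rt: "to_plane (root ?I) = r" by (simp add: far_instance_def to_plane_def r_def complex_eq_iff)
  have an: "angle ?I = pi / 4" by (simp add: far_instance_def angle_def of_rat_divide)
  have k: "of_rat (far_bound (14 * n) c) = 2 * D + real c + 1 / 2"
    by (simp add: far_bound_def of_rat_divide of_rat_add of_rat_mult of_rat_power D_def field_simps power_add)
  have "(\<exists>T. is_arg_min (spiral_tree_length ?I) (spiral_tree_for ?I) T & spiral_tree_length ?I T <= of_rat (far_bound (14 * n) c)) \<longleftrightarrow>
    (\<exists>N. arborescence N & X \<subseteq> N & card N <= c + 1)"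
    unfolding spiral_tree_length_def spiral_tree_for_def rt an k by (rule optimal_tree_le_iff[OF ts])
  \<comment> \<open>The origin is the one terminal that was not counted.\<close>
  also have "c + 1 = card X + grid_cost w h g" using z(2) ne by (cases ps) (simp_all add: cX)
  also have "(\<exists>N. arborescence N & X \<subseteq> N & card N <= card X + grid_cost w h g) \<longleftrightarrow> (\<exists>H V. solves w h g H V)"
    unfolding X_def using grid_lower grid_upper by blast
  finally show "(\<exists>T. is_arg_min (spiral_tree_length (far_instance (14 * length bs) ps)) (spiral_tree_for (far_instance (14 * length bs) ps)) T &
      spiral_tree_length (far_instance (14 * length bs) ps) T <= of_rat (far_bound (14 * length bs) c)) \<longleftrightarrow> (\<exists>H V. solves w h g H V)"
    unfolding n_def .
  have "n < 2 ^ n" by simp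
  also have "(2::nat) ^ n <= 2 ^ (14 * n)" by (intro power_increasing) auto
  finally have lt: "n < 2 ^ (14 * n)" .
  show "c < 2 ^ (14 * length bs)" using bd(2) lt by (simp add: n_def)
  show "x < 2 ^ (14 * length bs) & y < 2 ^ (14 * length bs)" if "(x, y) \<in> set ps" for x y
    using bd(3)[OF that] lt by (auto simp: n_def)
qed

section \<open>Correctness of the reduction\<close>

lemma length_pair_words: "length (pair_words x u) = 2 * length x + 2 + length u"
  by (induction x) (simp_all add: pair_words_def)

context tableau
begin

text \<open>The first and the last row are special, so \<open>T' + 1\<close> steps leave
  \<open>T'\<close> equal rows for the loop; the shift also makes \<open>T\<close> positive.\<close>

lemma category_word_rows:
  fixes x :: "bool list" and P T' :: nat
  defines "T \<equiv> T' + 1" and "U \<equiv> 2 * T' + 2" and "w \<equiv> pair_words x []"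
  shows "category_word x P T' U = concat (map (row w P U T) [0..<Suc T])"
proof -
  have lw: "length w = 2 * length x + 2" by (simp add: w_def length_pair_words)
  have len1: "length (first_word w P U) = 2 * U + length w + P + 3" using lw by (simp add: first_word_def)
  have len2: "length (later_word (length x) P U a b) = 2 * U + length w + P + 3" for a b using lw by (simp add: later_word_def)
  have lr: "length (row w P U T t) = 2 * U + length w + P + 3" for t by (simp add: row_def)
  have w0: "w ~= []" using lw by auto
  have first: "row w P U T 0 = first_word w P U"
  proof (rule nth_equalityI)
    show "length (row w P U T 0) = length (first_word w P U)" by (simp add: lr len1)
    fix i assume "i < length (row w P U T 0)"
    then have i: "i < 2 * U + length w + P + 3" by (simp add: lr)
    have tl: "tl w ! j = w ! Suc j" if "Suc j < length w" for j using that by (simp add: nth_tl)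
    have lt: "length (tl w) = length w - 1" by simp
    show "row w P U T 0 ! i = first_word w P U ! i"
    proof (cases "i < 2 * U + length w + P + 1")
      case True
      have r: "row w P U T 0 ! i = category w P T 0 (int i - int U)" using True by (simp add: row_def nth_append del: upt_Suc)
      consider "i < U" | "i = U" | "U < i" "i < U + length w" | "U + length w <= i" "i < U + length w + P" | "U + length w + P <= i" by linarith
      then show ?thesis
      proof cases
        case 1
        then show ?thesis unfolding r by (simp add: category_def first_word_def nth_append)
      next
        case 2
        then show ?thesis unfolding r by (simp add: category_def first_word_def nth_append)
      next
        case 3
        define j where "j = i - U - 1"
        have j: "i = U + Suc j" "j < length (tl w)" using 3 lt by (auto simp: j_def)
        have "first_word w P U ! i = (if tl w ! j then 7 else 6)" using j by (simp add: first_word_def nth_append)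
        moreover have "category w P T 0 (int i - int U) = (if w ! Suc j then 7 else 6)"
        proof -
          have e: "int i - int U = int (Suc j)" "Suc j < length w" using j lt by auto
          show ?thesis unfolding e(1) category_def nat_int using e(2) by simp
        qed
        moreover have "tl w ! j = w ! Suc j" using j lt by (intro tl) simp
        ultimately show ?thesis unfolding r by simp
      next
        case 4
        define j where "j = i - U - length w"
        have j: "i = U + Suc (length (tl w) + j)" "j < P" using 4 unfolding j_def lt lw by simp_all
        have "first_word w P U ! i = 10" using j by (simp add: first_word_def nth_append)
        moreover have "category w P T 0 (int i - int U) = 10"
        proof -
          have "\<not> int i - int U < 0" "int i - int U ~= 0" "\<not> int i - int U < int (length w)" "int i - int U < int (length w + P)" using 4 lw by linarith+
          then show ?thesis unfolding category_def by (simp only: if_True if_False refl)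
        qed
        ultimately show ?thesis unfolding r by simp
      next
        case 5
        define j where "j = i - U - length w - P"
        have j: "i = U + Suc (length (tl w) + (P + j))" "j < U + 1" using 5 True unfolding j_def lt lw by simp_all
        have "first_word w P U ! i = 5" using j by (cases "j < U") (simp_all add: first_word_def nth_append)
        moreover have "category w P T 0 (int i - int U) = 5"
        proof -
          have "\<not> int i - int U < 0" "int i - int U ~= 0" "\<not> int i - int U < int (length w)" "\<not> int i - int U < int (length w + P)" using 5 lw by linarith+
          then show ?thesis unfolding category_def by (simp only: if_True if_False refl)
        qed
        ultimately show ?thesis unfolding r by simp
      qed
    next
      case False
      define j where "j = i - (2 * U + length w + P + 1)"
      have j: "i = 2 * U + length w + P + 1 + j" "j < 2" using False i by (auto simp: j_def)
      have "row w P U T 0 ! i = [1, 1] ! j" unfolding row_def j(1) using nth_append_length_plus[of "map (%i. category w P T 0 (int i - int U)) [0..<2 * U + length w + P + 1]" "[1, 1]" j] by simp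
      moreover have "first_word w P U ! i = [1, 1] ! j"
      proof -
        define A where "A = replicate U 5 @ (if hd w then 9 else 8) # map (%b. if b then 7 else 6) (tl w) @ replicate P 10 @ replicate U 5 @ [5::nat]"
        have lA: "length A = 2 * U + length w + P + 1" using lw by (simp add: A_def)
        have fw: "first_word w P U = A @ [1, 1]" by (simp add: first_word_def A_def)
        show ?thesis unfolding j(1) fw lA[symmetric] by (rule nth_append_length_plus)
      qed
      ultimately show ?thesis by simp
    qed
  qed
  have later: "row w P U T t = later_word (length x) P U a b"
    if ab: "\<And>d. category w P T t d = (if d = 0 then b else a)" for t a b
  proof -
    have "map (%i. category w P T t (int i - int U)) [0..<2 * U + length w + P + 1] = replicate U a @ [b] @ replicate (U + length w + P) a"
      by (rule nth_equalityI) (auto simp: ab nth_append nth_Cons' simp del: upt_Suc)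
    moreover have "replicate (U + length w + P) a = replicate (2 * length x) a @ [a] @ replicate P a @ replicate U a @ [a]"
    proof -
      have "replicate (2 * length x + (1 + (P + (U + 1)))) a = replicate (2 * length x) a @ [a] @ replicate P a @ replicate U a @ [a]"
        by (simp only: replicate_add) simp
      moreover have "U + length w + P = 2 * length x + (1 + (P + (U + 1)))" using lw by simp
      ultimately show ?thesis by (simp only:)
    qed
    ultimately show ?thesis by (simp add: row_def later_word_def)
  qed
  have mid: "row w P U T t = later_word (length x) P U 2 3" if "0 < t" "t < T" for t
    by (rule later) (use that in \<open>simp add: category_def\<close>)
  have last: "row w P U T T = later_word (length x) P U 4 4"
    by (rule later) (simp add: category_def T_def)
  have "concat (map (row w P U T) [0..<Suc n]) = first_word w P U @ repeat n (later_word (length x) P U 2 3)" if "n < T" for n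
    using that
  proof (induction n)
    case 0
    then show ?case by (simp add: first)
  next
    case (Suc n)
    have c: "repeat n xs @ xs = xs @ repeat n xs" for n and xs :: "nat list" by (induction n) simp_all
    have "concat (map (row w P U T) [0..<Suc n]) = first_word w P U @ repeat n (later_word (length x) P U 2 3)" using Suc by simp
    moreover have "[0..<Suc (Suc n)] = [0..<Suc n] @ [Suc n]" by simp
    ultimately show ?case using mid[of "Suc n"] Suc.prems c
      by (simp only: map_append concat_append list.map concat.simps append_Nil2 append_assoc repeat zero_less_Suc)
  qed
  from this[of T'] have "concat (map (row w P U T) [0..<T]) = first_word w P U @ repeat T' (later_word (length x) P U 2 3)" by (simp add: T_def)
  moreover have "[0..<Suc T] = [0..<T] @ [T]" by simp
  ultimately show ?thesis using last unfolding category_word_def w_def[symmetric]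
    by (simp only: map_append concat_append list.map concat.simps append_Nil2 append_assoc)
qed

lemma reduction_correct:
  fixes x :: "bool list" and asP asT :: "nat list"
  defines "P \<equiv> horner asP (length x)" and "T \<equiv> horner asT (length x) + 1"
  obtains I K' where "sem (reduction_prog asP asT width coded) (input_store x) 0 = rev (map bit_letter (encode_pair encode_instance encode_rat (I, K')))"
    "I \<in> spiral_instances"
    "(\<exists>t. is_arg_min (spiral_tree_length I) (spiral_tree_for I) t & spiral_tree_length I t <= of_rat K') \<longleftrightarrow>
      (\<exists>u. length u <= P & fst (snd (conf (pair_words x u) T) ! 0) 0 = 2)"
proof -
  define U where "U = 2 * horner asT (length x) + 2"
  define w where "w = pair_words x []"
  have lw: "length w = 2 * length x + 2" by (simp add: w_def length_pair_words)
  have w0: "w ~= []" using lw by auto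
  define cs where "cs = category_word x P (horner asT (length x)) U"
  have cs: "cs = concat (map (row w P U T) [0..<Suc T])"
    unfolding cs_def U_def T_def w_def by (rule category_word_rows)
  define L where "L = 2 * U + length w + P + 3"
  define z where "z = tokens L (length cs)"
  have z: "z = [2, 3, 4] @ replicate (2 * U + (2 * length x + 2) + P) 1 @ [5, 6, 7] @ replicate (length cs) 1"
    unfolding z_def tokens_def L_def lw by simp
  have z0: "z ~= []" by (simp add: z)
  define ls where "ls = based_clauses coded cs"
  define bs where "bs = picture_word width coded z cs"
  have pic: "bs = grid_picture (26 * (length z * width) + 2) (12 * length ls + 2) (layout (length z * width) (lit_of width z ls))"
    unfolding bs_def ls_def by (rule picture_layout[OF z0 width_pos])
  obtain ps px py c where sc: "fold scan_step bs ([], 0, 0, 0) = (ps, px, py, c)" by (metis prod_cases4)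
  note dec = grid_decision[OF sc[unfolded pic], folded pic]
  have "sem (reduction_prog asP asT width coded) (input_store x) 0 = rev (map bit_letter (instance_word (14 * length bs) ps c))"
    unfolding bs_def z cs_def U_def P_def
    by (rule sem_reduction[OF sc[unfolded bs_def z cs_def U_def P_def]])
  also have "instance_word (14 * length bs) ps c = encode_pair encode_instance encode_rat (far_instance (14 * length bs) ps, far_bound (14 * length bs) c)"
    by (rule encode_far[symmetric]) (use dec(2,3) in auto)
  finally have 1: "sem (reduction_prog asP asT width coded) (input_store x) 0 =
    rev (map bit_letter (encode_pair encode_instance encode_rat (far_instance (14 * length bs) ps, far_bound (14 * length bs) c)))" .
  have 2: "far_instance (14 * length bs) ps \<in> spiral_instances"
    using pi_gt_zero by (simp add: spiral_instances_def angle_def far_instance_def of_rat_divide)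
  have "(\<exists>H V. solves (26 * (length z * width) + 2) (12 * length ls + 2) (layout (length z * width) (lit_of width z ls)) H V) \<longleftrightarrow>
    cnf_sat (length z * width) (length ls) (lit_of width z ls)"
    using layout_sound layout_complete by metis
  also have "\<dots> \<longleftrightarrow> (\<exists>u. length u <= P & fst (snd (conf (w @ u) T) ! 0) 0 = 2)"
    unfolding z_def ls_def cs L_def by (rule formula_correct[OF w0]) (simp_all add: T_def U_def)
  also have "\<dots> \<longleftrightarrow> (\<exists>u. length u <= P & fst (snd (conf (pair_words x u) T) ! 0) 0 = 2)"
    by (simp add: w_def pair_words_def)
  finally show ?thesis using that[OF 1 2] dec(1) by blast
qed

end

lemma spiral_decision_hard:
  assumes A: "A \<in> class_NP"
  shows "poly_reducible A (decision_problem encode_instance spiral_instances (%I. is_arg_min (spiral_tree_length I) (spiral_tree_for I)) spiral_tree_length)"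
proof -
  obtain V p where V: "V \<in> class_P" and Ap: "\<And>x. x \<in> A \<longleftrightarrow> (\<exists>u. length u <= poly p (length x) & pair_words x u \<in> V)"
    using A unfolding class_NP_def by blast
  obtain M q where M: "wf_tm M" and q: "\<And>y. tm_outputs_within M (poly q (length y)) y [y \<in> V]"
    using V unfolding class_P_def poly_time_def by blast
  interpret tb: tableau "num_tapes M + 1" "num_syms M" "num_states M" "marked M" by (rule marked_tableau[OF M])
  obtain asP where asP: "\<And>n. poly p n = horner asP n" using horner_poly[of p] by blast
  \<comment> \<open>The verifier runs on \<open>pair_words x u\<close>, whose length is at most
    \<open>2 + 2 * n + poly p n\<close> for an input of length \<open>n\<close>.\<close>
  obtain asT where asT: "\<And>n. poly (pcompose q ([:2, 2:] + p)) n = horner asT n" using horner_poly[of "pcompose q ([:2, 2:] + p)"] by blast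
  let ?prog = "reduction_prog asP asT tb.width tb.coded"
  let ?L = "decision_problem encode_instance spiral_instances (%I. is_arg_min (spiral_tree_length I) (spiral_tree_for I)) spiral_tree_length"
  have ex: "\<exists>y. sem ?prog (input_store x) 0 = rev (map bit_letter y) & (x \<in> A \<longleftrightarrow> y \<in> ?L)" for x
  proof -
    obtain I K' where I: "sem ?prog (input_store x) 0 = rev (map bit_letter (encode_pair encode_instance encode_rat (I, K')))"
      "I \<in> spiral_instances"
      "(\<exists>t. is_arg_min (spiral_tree_length I) (spiral_tree_for I) t & spiral_tree_length I t <= of_rat K') \<longleftrightarrow>
        (\<exists>u. length u <= horner asP (length x) & fst (snd (tb.conf (pair_words x u) (horner asT (length x) + 1)) ! 0) 0 = 2)"
      using tb.reduction_correct[of asP asT x] by blast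
    have "fst (snd (tb.conf (pair_words x u) (horner asT (length x) + 1)) ! 0) 0 = 2 \<longleftrightarrow> pair_words x u \<in> V" if "length u <= horner asP (length x)" for u
    proof (rule marked_accepts[OF M q])
      have "poly q (length (pair_words x u)) <= poly q (2 + 2 * length x + poly p (length x))"
        by (rule poly_nat_mono) (use that in \<open>simp add: length_pair_words asP\<close>)
      also have "\<dots> = horner asT (length x)" by (simp add: poly_pcompose mult.commute flip: asT)
      finally show "poly q (length (pair_words x u)) <= horner asT (length x) + 1" by simp
    qed
    then have "(\<exists>u. length u <= horner asP (length x) & fst (snd (tb.conf (pair_words x u) (horner asT (length x) + 1)) ! 0) 0 = 2) \<longleftrightarrow> x \<in> A"
      unfolding Ap asP by blast
    then show ?thesis using I by (intro exI[of _ "encode_pair encode_instance encode_rat (I, K')"]) (simp add: decision_problem_iff)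
  qed
  then obtain f where f: "\<And>x. sem ?prog (input_store x) 0 = rev (map bit_letter (f x))" "\<And>x. x \<in> A \<longleftrightarrow> f x \<in> ?L" by metis
  obtain k where "k \<ge> 1" "poly_prog k ?prog" using poly_prog_reduction by blast
  then have "poly_time f" using f(1) by (intro poly_time_prog[of k 16 ?prog]) (auto simp: poly_prog_def)
  then show ?thesis unfolding poly_reducible_def using f(2) by blast
qed

theorem theorem4:
  shows "NP_hard_minimisation encode_instance spiral_instances spiral_tree_for spiral_tree_length"
  unfolding NP_hard_minimisation_def NP_hard_def using spiral_decision_hard by blast

end
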